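(* The map $F_k\mapsto g_{(k)}=\tilde g_{(k)}$ ($k\ge1$) is (extends to) a surjective Hopf algebra morphism from $\mathfrak M\mathrm{NSym}$ to $\mathfrak M\mathrm{Sym}$ which sends $\tilde R_\alpha$ to $\tilde g_{r_\alpha}$ for each composition $\alpha$. Thus, $\mathfrak M\mathrm{Sym}$ is the commutative image of $\mathfrak M\mathrm{NSym}$.
   Context: Hopf algebra $\mathfrak M\mathrm{MR}$: a set composition of a finite set $S$ of positive integers is a word $w_1\cdots w_k$ of nonempty disjoint sets with union $S$. An $\mathfrak M$-permutation of $[n]$ is a set composition of $[n]$ with no $w_i$ containing two consecutive integers; $S^{\mathfrak M}_n$ is the set of these, $S^{\mathfrak M}_0=\{\emptyset\}$, $S^{\mathfrak M}_\infty=\bigcup_nS^{\mathfrak M}_n$. $\mathfrak M\mathrm{MR}=\bigoplus_{w\in S^{\mathfrak M}_\infty}\mathbb Z w$. For a set composition $w$, $\mathrm{st}(w)\in S^{\mathfrak M}_\infty$ is obtained by repeatedly (R1) deleting $i+1$ if $i,i+1$ lie in the same $w_j$, (R2) reducing all letters larger than $i$ by $1$ if the positive integer $i$ is not present. $w|_T$ is obtained by intersecting each $w_i$ with $T$ and removing empty sets. For $w\in S^{\mathfrak M}_m,u\in S^{\mathfrak M}_n$, $w\bullet u=\sum v$ over all $v\in S^{\mathfrak M}_{m+n}$ with $v|_{[m]}=w$, $\mathrm{st}(v|_{[m+1,m+n]})=u$, and all $v\in S^{\mathfrak M}_{m+n-1}$ with $v|_{[m]}=w$, $\mathrm{st}(v|_{[m,m+n-1]})=u$.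 The coproduct is $\vartriangle w=\sum_{[u,v]=w}\mathrm{st}(u)\otimes\mathrm{st}(v)$ over all ways to write $w$ as a concatenation of two (possibly empty) set compositions. Unit $1\mapsto\emptyset$, counit the coefficient of $\emptyset$. $\mathfrak M\mathrm{NSym}$: for a composition $\alpha=(\alpha_1,\dots,\alpha_k)$ of $n$, $D(\alpha)=\{\alpha_1,\alpha_1+\alpha_2,\dots,\alpha_1+\cdots+\alpha_{k-1}\}\subset[n-1]$. For $w=w_1\cdots w_k\in S^{\mathfrak M}_n$ let $w^{-1}$ be the word of length $n$ whose $i$-th letter is the index $j$ with $i\in w_j$; $w$ has type $\alpha$ if $\{i\in[n-1]:(w^{-1})_i>(w^{-1})_{i+1}\}=D(\alpha)$. $\tilde R_\alpha$ is the sum of all $w\in S^{\mathfrak M}_n$ of type $\alpha$. $\mathfrak M\mathrm{NSym}\subset\mathfrak M\mathrm{MR}$ is the span of all $\tilde R_\alpha$; it is a Hopf subalgebra, freely generated as an algebra over $\mathbb Z$ by the elements $F_k=\tilde R_{(k)}=[1,2,\dots,k]$, $k\ge1$. $\mathfrak M\mathrm{Sym}$: a reverse plane partition $T$ of skew shape $\lambda/\mu$ (English notation) is a filling with positive integers weakly increasing along rows and down columns; $x^T=\prod_i x_i^{T(i)}$ with $T(i)$ the number of columns of $T$ containing an entry $i$; $g_{\lambda/\mu}=\sum_T x^T$ over all reverse plane partitions of shape $\lambda/\mu$; and $\tilde g_{\lambda/\mu}(x_1,x_2,\dots)=(-1)^{|\lambda/\mu|}g_{\lambda/\mu}(-x_1,-x_2,\dots)$.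 $\mathfrak M\mathrm{Sym}=\bigoplus_\lambda\mathbb Z g_\lambda$, which equals the ring $\mathrm{Sym}$ of symmetric functions, with its usual Hopf algebra structure. For a composition $\alpha=(\alpha_1,\dots,\alpha_k)$, $r_\alpha$ is the ribbon skew shape (connected, containing no $2\times2$ square) with $\alpha_k$ boxes in its first (top) row, $\alpha_{k-1}$ boxes in its second row, and so on. *)

theory Defs
  imports "HOL-Algebra.Algebra" "HOL-Library.Poly_Mapping"
begin

section \<open>Bialgebras of integer-valued functions\<close>

text \<open>
  All modules in play are additive groups of functions \<open>X \<Rightarrow> int\<close>: formal linear combinations
  of basis elements \<open>x \<in> X\<close>, or power series with monomials \<open>x \<in> X\<close>.  For such a group \<open>A\<close>
  the canonical map from the tensor square of \<open>A\<close> over the integers to \<open>X \<times> X \<Rightarrow> int\<close> is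
  injective (\<open>A\<close> is torsion-free), so the tensor square is modelled by its image, the
  integer span of the functions \<open>tens a b\<close>.
\<close>

definition zspan :: "('x \<Rightarrow> int) set \<Rightarrow> ('x \<Rightarrow> int) set" where
  "zspan S = {(\<lambda>x. \<Sum>s\<in>F. c s * s x) | F c. finite F \<and> F \<subseteq> S}"

definition tens :: "('x \<Rightarrow> int) \<Rightarrow> ('x \<Rightarrow> int) \<Rightarrow> ('x \<times> 'x \<Rightarrow> int)" where
  "tens a b = (\<lambda>(x, y). a x * b y)"

definition tensor_square :: "('x \<Rightarrow> int) set \<Rightarrow> ('x \<times> 'x \<Rightarrow> int) set" where
  "tensor_square A = zspan {tens a b | a b. a \<in> A \<and> b \<in> A}"

record 'x bialgebra = "('x \<Rightarrow> int) ring" +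
  comult :: "('x \<Rightarrow> int) \<Rightarrow> ('x \<times> 'x \<Rightarrow> int)"
  counit :: "('x \<Rightarrow> int) \<Rightarrow> int"

text \<open>
  \<open>is_tensor_map A \<phi> \<Phi>\<close>: on the tensor square of \<open>A\<close>, the map \<open>\<Phi>\<close> is \<open>\<phi> \<otimes> \<phi>\<close>.
\<close>

definition is_tensor_map ::
  "('x \<Rightarrow> int) set \<Rightarrow> (('x \<Rightarrow> int) \<Rightarrow> ('y \<Rightarrow> int)) \<Rightarrow> (('x \<times> 'x \<Rightarrow> int) \<Rightarrow> ('y \<times> 'y \<Rightarrow> int)) \<Rightarrow> bool"
where
  "is_tensor_map A \<phi> \<Phi> \<longleftrightarrow>
     (\<forall>s\<in>tensor_square A. \<forall>t\<in>tensor_square A. \<Phi> (\<lambda>p. s p + t p) = (\<lambda>q. \<Phi> s q + \<Phi> t q)) \<and>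
     (\<forall>a\<in>A. \<forall>b\<in>A. \<Phi> (tens a b) = tens (\<phi> a) (\<phi> b))"

definition coalgebra_hom ::
  "('x, 'm) bialgebra_scheme \<Rightarrow> ('y, 'n) bialgebra_scheme \<Rightarrow> (('x \<Rightarrow> int) \<Rightarrow> ('y \<Rightarrow> int)) \<Rightarrow> bool"
where
  "coalgebra_hom H K \<phi> \<longleftrightarrow>
     (\<exists>\<Phi>. is_tensor_map (carrier H) \<phi> \<Phi> \<and>
        (\<forall>x\<in>carrier H. comult H x \<in> tensor_square (carrier H) \<and>
                        comult K (\<phi> x) = \<Phi> (comult H x))) \<and>
     (\<forall>x\<in>carrier H. counit K (\<phi> x) = counit H x)"

text \<open>
  A morphism of Hopf algebras is a morphism of the underlying bialgebras; compatibility with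
  the antipodes is then automatic.
\<close>

definition hopf_hom ::
  "('x, 'm) bialgebra_scheme \<Rightarrow> ('y, 'n) bialgebra_scheme \<Rightarrow> (('x \<Rightarrow> int) \<Rightarrow> ('y \<Rightarrow> int)) \<Rightarrow> bool"
where
  "hopf_hom H K \<phi> \<longleftrightarrow> ring_hom_ring H K \<phi> \<and> coalgebra_hom H K \<phi>"

definition commutator_ideal :: "('a, 'm) ring_scheme \<Rightarrow> 'a set" where
  "commutator_ideal R =
     genideal R {(x \<otimes>\<^bsub>R\<^esub> y) \<ominus>\<^bsub>R\<^esub> (y \<otimes>\<^bsub>R\<^esub> x) | x y. x \<in> carrier R \<and> y \<in> carrier R}"

definition basis_elem :: "'x \<Rightarrow> ('x \<Rightarrow> int)" where
  "basis_elem x = (\<lambda>y. if y = x then 1 else 0)"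


section \<open>Set compositions and the Hopf algebra \<open>\<MM>MR\<close>\<close>

definition set_composition :: "nat set \<Rightarrow> nat set list \<Rightarrow> bool" where
  "set_composition S w \<longleftrightarrow>
     finite S \<and> 0 \<notin> S \<and> {} \<notin> set w \<and> \<Union>(set w) = S \<and>
     (\<forall>i<length w. \<forall>j<length w. i \<noteq> j \<longrightarrow> w ! i \<inter> w ! j = {})"

definition M_perms :: "nat \<Rightarrow> nat set list set" where
  "M_perms n =
     {w. set_composition {1..n} w \<and> (\<forall>A\<in>set w. \<forall>i. \<not> (i \<in> A \<and> Suc i \<in> A))}"

definition all_M_perms :: "nat set list set" where
  "all_M_perms = (\<Union>n. M_perms n)"

inductive st_step :: "nat set list \<Rightarrow> nat set list \<Rightarrow> bool" where
  R1: "j < length w \<Longrightarrow> i \<in> w ! j \<Longrightarrow> Suc i \<in> w ! j \<Longrightarrow> st_step w (w[j := w ! j - {Suc i}])"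
| R2: "0 < i \<Longrightarrow> i \<notin> \<Union>(set w) \<Longrightarrow> st_step w (map ((`) (\<lambda>x. if x > i then x - 1 else x)) w)"

definition st :: "nat set list \<Rightarrow> nat set list" where
  "st w = (THE u. st_step\<^sup>*\<^sup>* w u \<and> u \<in> all_M_perms)"

definition restrict_word :: "nat set list \<Rightarrow> nat set \<Rightarrow> nat set list" where
  "restrict_word w T = filter (\<lambda>A. A \<noteq> {}) (map (\<lambda>A. A \<inter> T) w)"

text \<open>
  The set of words occurring (each with coefficient one) in the product of \<open>w\<close> and \<open>u\<close>.  The
  second family is indexed by \<open>N = m + n - 1\<close>, so it is empty for \<open>m = n = 0\<close>.
\<close>

definition product_words :: "nat set list \<Rightarrow> nat set list \<Rightarrow> nat set list set" where
  "product_words w u = {v. \<exists>m n. w \<in> M_perms m \<and> u \<in> M_perms n \<and>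
     ((v \<in> M_perms (m + n) \<and>
         restrict_word v {1..m} = w \<and> st (restrict_word v {m+1..m+n}) = u) \<or>
      (\<exists>N. Suc N = m + n \<and> v \<in> M_perms N \<and>
         restrict_word v {1..m} = w \<and> st (restrict_word v {m..N}) = u))}"

definition MMR :: "nat set list bialgebra" where
  "MMR =
    \<lparr> carrier = {f. finite {w. f w \<noteq> 0} \<and> {w. f w \<noteq> 0} \<subseteq> all_M_perms},
      monoid.mult = (\<lambda>f g v. \<Sum>w | f w \<noteq> 0. \<Sum>u | g u \<noteq> 0.
                 f w * g u * (if v \<in> product_words w u then 1 else 0)),
      monoid.one = basis_elem [],
      ring.zero = (\<lambda>_. 0),
      ring.add = (\<lambda>f g v. f v + g v),
      comult = (\<lambda>f (a, b). \<Sum>w | f w \<noteq> 0.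
                 f w * int (card {(u, v). u @ v = w \<and> st u = a \<and> st v = b})),
      counit = (\<lambda>f. f []) \<rparr>"


section \<open>The Hopf subalgebra \<open>\<MM>NSym\<close>\<close>

definition is_composition :: "nat list \<Rightarrow> bool" where
  "is_composition \<alpha> \<longleftrightarrow> 0 \<notin> set \<alpha>"

definition descent_set :: "nat list \<Rightarrow> nat set" where
  "descent_set \<alpha> = {sum_list (take i \<alpha>) | i. 1 \<le> i \<and> i < length \<alpha>}"

definition word_inverse :: "nat set list \<Rightarrow> nat \<Rightarrow> nat" where
  "word_inverse w i = (THE j. j < length w \<and> i \<in> w ! j)"

definition has_type :: "nat set list \<Rightarrow> nat list \<Rightarrow> bool" where
  "has_type w \<alpha> \<longleftrightarrow>
     w \<in> M_perms (sum_list \<alpha>) \<and>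
     {i. 1 \<le> i \<and> i < sum_list \<alpha> \<and> word_inverse w i > word_inverse w (i + 1)} = descent_set \<alpha>"

definition R_tilde :: "nat list \<Rightarrow> (nat set list \<Rightarrow> int)" where
  "R_tilde \<alpha> = (\<lambda>w. if has_type w \<alpha> then 1 else 0)"

definition F_gen :: "nat \<Rightarrow> (nat set list \<Rightarrow> int)" where
  "F_gen k = R_tilde [k]"

definition MNSym :: "nat set list bialgebra" where
  "MNSym = MMR \<lparr> carrier := zspan {R_tilde \<alpha> | \<alpha>. is_composition \<alpha>} \<rparr>"


section \<open>Dual stable Grothendieck polynomials and \<open>\<MM>Sym\<close>\<close>

text \<open>
  A power series in \<open>x\<^sub>1, x\<^sub>2, \<dots>\<close> is its coefficient function; in a monomial, index \<open>k\<close> holds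
  the exponent of the variable \<open>x\<^bsub>k+1\<^esub>\<close>.
\<close>

type_synonym monomial = "nat \<Rightarrow>\<^sub>0 nat"

type_synonym series = "monomial \<Rightarrow> int"

definition is_partition :: "nat list \<Rightarrow> bool" where
  "is_partition lam \<longleftrightarrow> sorted_wrt (\<ge>) lam \<and> 0 \<notin> set lam"

text \<open>Cells are pairs (row, column), both counted from 0, with row 0 on top.\<close>

definition diagram :: "nat list \<Rightarrow> (nat \<times> nat) set" where
  "diagram lam = {(r, c). r < length lam \<and> c < lam ! r}"

definition skew_diagram :: "nat list \<Rightarrow> nat list \<Rightarrow> (nat \<times> nat) set" where
  "skew_diagram lam mu = diagram lam - diagram mu"

definition reverse_plane_partition :: "(nat \<times> nat) set \<Rightarrow> (nat \<times> nat \<Rightarrow> nat) \<Rightarrow> bool" where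
  "reverse_plane_partition D T \<longleftrightarrow>
     (\<forall>p\<in>D. T p > 0) \<and> (\<forall>p. p \<notin> D \<longrightarrow> T p = 0) \<and>
     (\<forall>r c c'. (r, c) \<in> D \<and> (r, c') \<in> D \<and> c \<le> c' \<longrightarrow> T (r, c) \<le> T (r, c')) \<and>
     (\<forall>r r' c. (r, c) \<in> D \<and> (r', c) \<in> D \<and> r \<le> r' \<longrightarrow> T (r, c) \<le> T (r', c))"

definition has_weight :: "(nat \<times> nat) set \<Rightarrow> (nat \<times> nat \<Rightarrow> nat) \<Rightarrow> monomial \<Rightarrow> bool" where
  "has_weight D T m \<longleftrightarrow>
     (\<forall>k. Poly_Mapping.lookup m k = card {c. \<exists>r. (r, c) \<in> D \<and> T (r, c) = Suc k})"

definition dual_g :: "(nat \<times> nat) set \<Rightarrow> series" where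
  "dual_g D = (\<lambda>m. int (card {T. reverse_plane_partition D T \<and> has_weight D T m}))"

definition monomial_degree :: "monomial \<Rightarrow> nat" where
  "monomial_degree m = (\<Sum>k\<in>Poly_Mapping.keys m. Poly_Mapping.lookup m k)"

definition dual_g_tilde :: "(nat \<times> nat) set \<Rightarrow> series" where
  "dual_g_tilde D = (\<lambda>m. (-1) ^ card D * ((-1) ^ monomial_degree m * dual_g D m))"

text \<open>
  The coproduct of a symmetric function \<open>f\<close> is \<open>f(x, y)\<close>, i.e. \<open>f\<close> in the variables
  \<open>x\<^sub>1, y\<^sub>1, x\<^sub>2, y\<^sub>2, \<dots>\<close>, expanded in the monomials \<open>x\<^sup>a y\<^sup>b\<close>.
\<close>

lift_definition interleave :: "monomial \<Rightarrow> monomial \<Rightarrow> monomial" is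
  "\<lambda>a b k. if even k then a (k div 2) else b (k div 2)"
proof -
  fix a b :: "nat \<Rightarrow> nat"
  assume "finite {k. a k \<noteq> 0}" "finite {k. b k \<noteq> 0}"
  then have "finite ((\<lambda>k. 2 * k) ` {k. a k \<noteq> 0} \<union> (\<lambda>k. 2 * k + 1) ` {k. b k \<noteq> 0})"
    by simp
  moreover have "{k. (if even k then a (k div 2) else b (k div 2)) \<noteq> 0} \<subseteq>
      (\<lambda>k. 2 * k) ` {k. a k \<noteq> 0} \<union> (\<lambda>k. 2 * k + 1) ` {k. b k \<noteq> 0}"
  proof
    fix k assume "k \<in> {k. (if even k then a (k div 2) else b (k div 2)) \<noteq> 0}"
    then show "k \<in> (\<lambda>k. 2 * k) ` {k. a k \<noteq> 0} \<union> (\<lambda>k. 2 * k + 1) ` {k. b k \<noteq> 0}"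
      by (cases "even k") (auto elim!: evenE oddE)
  qed
  ultimately show "finite {k. (if even k then a (k div 2) else b (k div 2)) \<noteq> 0}"
    by (rule finite_subset[rotated])
qed

definition MSym :: "monomial bialgebra" where
  "MSym =
    \<lparr> carrier = zspan {dual_g (diagram lam) | lam. is_partition lam},
      monoid.mult = (\<lambda>f g m. \<Sum>(a, b) | a + b = m. f a * g b),
      monoid.one = basis_elem 0,
      ring.zero = (\<lambda>_. 0),
      ring.add = (\<lambda>f g m. f m + g m),
      comult = (\<lambda>f (a, b). f (interleave a b)),
      counit = (\<lambda>f. f 0) \<rparr>"

text \<open>
  The ribbon of \<open>\<alpha>\<close>: with the parts listed from the top row down (\<open>rev \<alpha>\<close>), the last box of
  row \<open>r + 1\<close> lies directly below the first box of row \<open>r\<close>, and the bottom row starts in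
  column 0.  So row \<open>r\<close> of the inner shape has length \<open>\<Sum>\<^bsub>i > r\<^esub> (part i - 1)\<close>.
\<close>

definition ribbon_inner :: "nat list \<Rightarrow> nat list" where
  "ribbon_inner \<alpha> =
     map (\<lambda>r. \<Sum>a\<leftarrow>drop (Suc r) (rev \<alpha>). a - 1) [0..<length \<alpha>]"

definition ribbon_outer :: "nat list \<Rightarrow> nat list" where
  "ribbon_outer \<alpha> = map2 (+) (ribbon_inner \<alpha>) (rev \<alpha>)"

definition ribbon :: "nat list \<Rightarrow> (nat \<times> nat) set" where
  "ribbon \<alpha> = skew_diagram (ribbon_outer \<alpha>) (ribbon_inner \<alpha>)"

end

theory Submission
  imports Defs "HOL-Computational_Algebra.Polynomial"
begin


section \<open>Modules of integer-valued functions\<close>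

section \<open>Integer spans and pointwise rings\<close>

text \<open>Both algebras are studied through words. The inverse word of an M-permutation is a word
  without equal neighbours, determined up to increasing relabelling of its letters
  (\<open>word_perm\<close>), and standardizing a restriction amounts to contracting equal
  neighbours in a subword (\<open>st_blocks\<close>). Such words form a monoid under concatenation
  followed by contraction at the seam, the quotient of the free monoid by the relations xx = x. The
  product of \<open>MMR\<close> is convolution over this monoid (\<open>product_words_iff\<close>,
  \<open>MMR_mult_word_perm\<close>), hence associative, and the type of an M-permutation records
  the length and the descents of its word.

  The heart of the argument is that one product rule holds on both sides. A word that factors into a
  word of type (\<alpha>, j) and an increasing word of length k has a descent at the seam, or has
  none, or its two factors share a letter. So \<open>R_tilde\<close> of (\<alpha>, j) times F_k is
  the sum of the \<open>R_tilde\<close> of (\<alpha>, j, k), of (\<alpha>, j + k) and of (\<alpha>,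
  j + k - 1): this is \<open>R_tilde_mult_F_gen\<close>. A row of length k can likewise be joined to
  the top row of a ribbon filling or placed above it, and the fillings with equal entries in the
  column common to both rows correspond to a joined row of length j + k - 1
  (\<open>filling_count_rec\<close>). The signs in \<open>dual_g_tilde\<close> turn this into the
  same three-term rule (\<open>dual_g_tilde_ribbon_rec\<close>), where g of a single row is the
  complete homogeneous function h_k (\<open>filling_count_row\<close>). Hence the linear map
  \<open>ribbon_map\<close>, which sends each \<open>R_tilde\<close> to the
  \<open>dual_g_tilde\<close> of its ribbon, respects multiplication by every F_k. Solved for its
  first term, the rule also shows by induction on the number of parts that the F_k generate
  (\<open>W_induct_F\<close>). So \<open>ribbon_map\<close> is a ring homomorphism
  (\<open>ribbon_map_mult\<close>), and it is the only one with the given values on the F_k.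

  Both coproducts are multiplicative (\<open>comult_mult_word_perm\<close>,
  \<open>comult_MSym_conv\<close>), so they need to be compared only on F_k and h_k, where they are
  the sums of F_i \<otimes> F_(k-i) and of h_i \<otimes> h_(k-i) (\<open>comult_compatible\<close>).

  The rest is triangularity with respect to the lexicographic order of monomials. The g of a
  partition \<lambda> is symmetric (\<open>dual_g_swap\<close>) with leading monomial x^\<lambda>
  (\<open>leading_dual_g\<close>), so \<open>MSym\<close> consists of all symmetric functions
  (\<open>carrier_MSym\<close>). Surjectivity and the kernel use the second generating family E_n,
  the \<open>R_tilde\<close> of (1, ..., 1), whose images have leading monomial x_1 ... x_n. The
  leading monomials of the images of weakly increasing products of the E_n are distinct and exhaust
  the dominant monomials. Therefore \<open>ribbon_map\<close> is onto
  (\<open>ribbon_map_surj\<close>). Modulo commutators every element is a combination of such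
  products, and their images are linearly independent, so the kernel is exactly the commutator ideal
  (\<open>kernel_ribbon_map\<close>).\<close>

lemma zspanI: "finite F \<Longrightarrow> F \<subseteq> S \<Longrightarrow> (\<lambda>x. \<Sum>s\<in>F. c s * s x) \<in> zspan S"
  unfolding zspan_def by blast

lemma zspan_zero: "(\<lambda>_. 0) \<in> zspan S"
  using zspanI[of "{}"] by simp

lemma zspan_scale: "s \<in> S \<Longrightarrow> (\<lambda>x. c * s x) \<in> zspan S"
  using zspanI[of "{s}" S "\<lambda>_. c"] by simp

lemma zspan_base: "s \<in> S \<Longrightarrow> s \<in> zspan S"
  using zspan_scale[of s S 1] by simp

lemma zspan_add:
  assumes "f \<in> zspan S" "g \<in> zspan S"
  shows "(\<lambda>x. f x + g x) \<in> zspan S"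
proof -
  obtain F c where F: "f = (\<lambda>x. \<Sum>s\<in>F. c s * s x)" "finite F" "F \<subseteq> S"
    using assms(1) unfolding zspan_def by blast
  obtain G d where G: "g = (\<lambda>x. \<Sum>s\<in>G. d s * s x)" "finite G" "G \<subseteq> S"
    using assms(2) unfolding zspan_def by blast
  define e where "e s = (if s \<in> F then c s else 0) + (if s \<in> G then d s else 0)" for s
  have 1: "(\<Sum>s\<in>F. c s * s x) = (\<Sum>s\<in>F \<union> G. (if s \<in> F then c s else 0) * s x)" for x
    using F(2) G(2) by (intro sum.mono_neutral_cong_left) auto
  have 2: "(\<Sum>s\<in>G. d s * s x) = (\<Sum>s\<in>F \<union> G. (if s \<in> G then d s else 0) * s x)" for x
    using F(2) G(2) by (intro sum.mono_neutral_cong_left) auto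
  have "(\<lambda>x. f x + g x) = (\<lambda>x. \<Sum>s\<in>F \<union> G. e s * s x)"
    unfolding F(1) G(1) 1 2 e_def by (simp add: sum.distrib distrib_right)
  with zspanI[of "F \<union> G" S e] F G show ?thesis by simp
qed

text \<open>The induction rule for spans: an element of a span is reached from zero by adding one
  multiple of a generator at a time.\<close>

lemma zspan_minimal:
  assumes "f \<in> zspan S" "(\<lambda>_. 0) \<in> A"
    and "\<And>s a c. s \<in> S \<Longrightarrow> a \<in> A \<Longrightarrow> (\<lambda>x. c * s x + a x) \<in> A"
  shows "f \<in> A"
proof -
  obtain F c where F: "f = (\<lambda>x. \<Sum>s\<in>F. c s * s x)" "finite F" "F \<subseteq> S"
    using assms(1) unfolding zspan_def by blast
  have "(\<lambda>x. \<Sum>s\<in>F. c s * s x) \<in> A"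
    using F(2,3) by (induction F) (auto simp: assms(2,3))
  with F(1) show ?thesis by simp
qed

definition zmodule :: "('x \<Rightarrow> int) set \<Rightarrow> bool" where
  "zmodule A \<longleftrightarrow> (\<lambda>_. 0) \<in> A \<and> (\<forall>f\<in>A. \<forall>g\<in>A. (\<lambda>x. f x + g x) \<in> A) \<and> (\<forall>f\<in>A. \<forall>c. (\<lambda>x. c * f x) \<in> A)"

lemma zmoduleI:
  "(\<lambda>_. 0) \<in> A \<Longrightarrow> (\<And>f g. f \<in> A \<Longrightarrow> g \<in> A \<Longrightarrow> (\<lambda>x. f x + g x) \<in> A) \<Longrightarrow>
   (\<And>f c. f \<in> A \<Longrightarrow> (\<lambda>x. c * f x) \<in> A) \<Longrightarrow> zmodule A"
  by (auto simp: zmodule_def)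

lemma zmodule_zero: "zmodule A \<Longrightarrow> (\<lambda>_. 0) \<in> A"
  and zmodule_add: "zmodule A \<Longrightarrow> f \<in> A \<Longrightarrow> g \<in> A \<Longrightarrow> (\<lambda>x. f x + g x) \<in> A"
  and zmodule_scale: "zmodule A \<Longrightarrow> f \<in> A \<Longrightarrow> (\<lambda>x. c * f x) \<in> A"
  by (auto simp: zmodule_def)

lemma zmodule_uminus: "zmodule A \<Longrightarrow> f \<in> A \<Longrightarrow> (\<lambda>x. - f x) \<in> A"
  using zmodule_scale[of A f "-1"] by simp

lemma zmodule_diff: "zmodule A \<Longrightarrow> f \<in> A \<Longrightarrow> g \<in> A \<Longrightarrow> (\<lambda>x. f x - g x) \<in> A"
  using zmodule_add[of A f "\<lambda>x. - g x"] zmodule_uminus[of A g] by simp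

lemma zspan_mult:
  assumes "f \<in> zspan S"
  shows "(\<lambda>x. c * f x) \<in> zspan S"
proof -
  obtain F d where F: "f = (\<lambda>x. \<Sum>s\<in>F. d s * s x)" "finite F" "F \<subseteq> S"
    using assms unfolding zspan_def by blast
  have "(\<lambda>x. c * f x) = (\<lambda>x. \<Sum>s\<in>F. (c * d s) * s x)"
    unfolding F(1) by (simp add: sum_distrib_left mult.assoc)
  with zspanI[of F S "\<lambda>s. c * d s"] F show ?thesis by simp
qed

lemma zmodule_zspan: "zmodule (zspan S)"
  unfolding zmodule_def by (intro conjI ballI allI zspan_zero zspan_add zspan_mult)

lemma zspan_subset:
  assumes "zmodule A" "S \<subseteq> A"
  shows "zspan S \<subseteq> A"
proof
  fix f assume "f \<in> zspan S"
  then show "f \<in> A"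
  proof (rule zspan_minimal[OF _ zmodule_zero[OF assms(1)]])
    show "(\<lambda>x. c * s x + a x) \<in> A" if "s \<in> S" "a \<in> A" for s a c
      using assms(2) that by (intro zmodule_add[OF assms(1)] zmodule_scale[OF assms(1)]) auto
  qed
qed

lemma zmodule_sum:
  assumes "zmodule A" "finite I" "\<And>i. i \<in> I \<Longrightarrow> f i \<in> A"
  shows "(\<lambda>x. \<Sum>i\<in>I. f i x) \<in> A"
  using assms(2,3)
proof (induction I)
  case (insert i I)
  then show ?case using zmodule_add[OF assms(1), of "f i" "\<lambda>x. \<Sum>i\<in>I. f i x"] by simp
qed (simp add: zmodule_zero[OF assms(1)])

lemma pointwise_abelian_group:
  fixes R :: "('x \<Rightarrow> int, 'm) ring_scheme"
  assumes "zmodule (carrier R)" "ring.zero R = (\<lambda>_. 0)" "ring.add R = (\<lambda>f g x. f x + g x)"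
  shows "abelian_group R"
proof (rule abelian_groupI)
  fix f assume "f \<in> carrier R"
  then have "(\<lambda>x. - f x) \<in> carrier R" by (rule zmodule_uminus[OF assms(1)])
  then show "\<exists>g\<in>carrier R. g \<oplus>\<^bsub>R\<^esub> f = \<zero>\<^bsub>R\<^esub>"
    unfolding assms(2,3) by (intro bexI) auto
next
  show "\<zero>\<^bsub>R\<^esub> \<in> carrier R"
    unfolding assms(2) by (rule zmodule_zero[OF assms(1)])
  show "f \<oplus>\<^bsub>R\<^esub> g \<in> carrier R" if "f \<in> carrier R" "g \<in> carrier R" for f g
    unfolding assms(3) by (rule zmodule_add[OF assms(1) that])
qed (simp_all add: assms(2,3) ac_simps)

lemma pointwise_a_inv:
  fixes R :: "('x \<Rightarrow> int, 'm) ring_scheme"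
  assumes "zmodule (carrier R)" "ring.zero R = (\<lambda>_. 0)" "ring.add R = (\<lambda>f g x. f x + g x)" "f \<in> carrier R"
  shows "\<ominus>\<^bsub>R\<^esub> f = (\<lambda>x. - f x)"
proof -
  interpret abelian_group R by (rule pointwise_abelian_group) fact+
  show ?thesis
  proof (rule minus_equality)
    show "(\<lambda>x. - f x) \<oplus>\<^bsub>R\<^esub> f = \<zero>\<^bsub>R\<^esub>"
      by (simp add: assms(2,3))
  qed (use assms(4) zmodule_uminus[OF assms(1,4)] in auto)
qed

lemma pointwise_minus:
  fixes R :: "('x \<Rightarrow> int, 'm) ring_scheme"
  assumes "zmodule (carrier R)" "ring.zero R = (\<lambda>_. 0)" "ring.add R = (\<lambda>f g x. f x + g x)"
    "f \<in> carrier R" "g \<in> carrier R"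
  shows "f \<ominus>\<^bsub>R\<^esub> g = (\<lambda>x. f x - g x)"
  using pointwise_a_inv[OF assms(1-3,5)] by (simp add: a_minus_def assms(3))

section \<open>Convolution algebras of monoids\<close>

section \<open>Convolution over monoids with finitely many factorizations\<close>

text \<open>Both algebras are convolution algebras of such monoids: power series over the monomials,
  and \<open>MMR\<close> over the words without equal neighbours. Finitely many factorizations make
  convolution a finite sum for arbitrary functions.\<close>

locale fin_monoid =
  fixes M :: "'a set" and mul :: "'a \<Rightarrow> 'a \<Rightarrow> 'a" and e :: 'a
  assumes mul_closed: "a \<in> M \<Longrightarrow> b \<in> M \<Longrightarrow> mul a b \<in> M"
    and e_closed: "e \<in> M"
    and mul_assoc: "a \<in> M \<Longrightarrow> b \<in> M \<Longrightarrow> c \<in> M \<Longrightarrow> mul (mul a b) c = mul a (mul b c)"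
    and mul_e: "a \<in> M \<Longrightarrow> mul a e = a"
    and e_mul: "a \<in> M \<Longrightarrow> mul e a = a"
    and finite_factors: "m \<in> M \<Longrightarrow> finite {(a, b). a \<in> M \<and> b \<in> M \<and> mul a b = m}"
begin

definition factors :: "'a \<Rightarrow> ('a \<times> 'a) set" where
  "factors m = {(a, b). a \<in> M \<and> b \<in> M \<and> mul a b = m}"

lemma finite_factors': "m \<in> M \<Longrightarrow> finite (factors m)"
  using finite_factors by (simp add: factors_def)

definition conv :: "('a \<Rightarrow> int) \<Rightarrow> ('a \<Rightarrow> int) \<Rightarrow> 'a \<Rightarrow> int" where
  "conv f g m = (\<Sum>(a, b)\<in>factors m. f a * g b)"

lemma factors_closed: "x \<in> factors m \<Longrightarrow> fst x \<in> M" "x \<in> factors m \<Longrightarrow> snd x \<in> M"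
  by (auto simp: factors_def)

lemma conv_cong:
  "(\<And>a. a \<in> M \<Longrightarrow> f a = f' a) \<Longrightarrow> (\<And>a. a \<in> M \<Longrightarrow> g a = g' a) \<Longrightarrow> conv f g m = conv f' g' m"
  unfolding conv_def by (rule sum.cong) (auto simp: factors_def)

text \<open>Both sides sum over the triples with product \<open>m\<close>; the reindexing moves the
  bracket from the first two factors to the last two.\<close>

lemma conv_assoc:
  assumes m: "m \<in> M"
  shows "conv (conv f g) h m = conv f (conv g h) m"
proof -
  have "conv (conv f g) h m = (\<Sum>(p, c)\<in>factors m. \<Sum>(a, b)\<in>factors p. f a * g b * h c)"
    unfolding conv_def by (simp add: sum_distrib_right case_prod_beta)
  also have "\<dots> = (\<Sum>x\<in>factors m. \<Sum>y\<in>factors (fst x). f (fst y) * g (snd y) * h (snd x))"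
    by (simp add: case_prod_beta)
  also have "\<dots> = (\<Sum>z\<in>(SIGMA x:factors m. factors (fst x)).
        f (fst (snd z)) * g (snd (snd z)) * h (snd (fst z)))"
    by (subst sum.Sigma) (auto simp: m finite_factors' factors_closed case_prod_beta)
  also have "\<dots> = (\<Sum>z\<in>(SIGMA x:factors m. factors (snd x)).
        f (fst (fst z)) * g (fst (snd z)) * h (snd (snd z)))"
    by (rule sum.reindex_bij_witness[where
        i = "\<lambda>((a, q), (b, c)). ((mul a b, c), (a, b))" and
        j = "\<lambda>((p, c), (a, b)). ((a, mul b c), (b, c))"])
      (clarsimp simp: factors_def mul_assoc mul_closed)+
  also have "\<dots> = (\<Sum>x\<in>factors m. \<Sum>y\<in>factors (snd x). f (fst x) * g (fst y) * h (snd y))"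
    by (subst sum.Sigma) (auto simp: m finite_factors' factors_closed case_prod_beta)
  also have "\<dots> = (\<Sum>(a, q)\<in>factors m. \<Sum>(b, c)\<in>factors q. f a * g b * h c)"
    by (simp add: case_prod_beta)
  also have "\<dots> = conv f (conv g h) m"
    unfolding conv_def by (simp add: sum_distrib_left case_prod_beta mult.assoc)
  finally show ?thesis .
qed

lemma conv_one_right:
  assumes m: "m \<in> M"
  shows "conv f (\<lambda>a. if a = e then 1 else 0) m = f m"
proof -
  have "conv f (\<lambda>a. if a = e then 1 else 0) m = (\<Sum>x\<in>{(m, e)}. f (fst x))"
    unfolding conv_def
  proof (rule sum.mono_neutral_cong_right[OF finite_factors'[OF m]])
    show "{(m, e)} \<subseteq> factors m"
      unfolding factors_def using m e_closed mul_e[OF m] by simp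
    show "\<forall>x\<in>factors m - {(m, e)}. (case x of (a, b) \<Rightarrow> f a * (if b = e then 1 else 0)) = 0"
    proof (rule ballI, rule prod.exhaust)
      fix x a b assume x: "x \<in> factors m - {(m, e)}" "x = (a, b)"
      then have "b \<noteq> e" unfolding factors_def using mul_e by auto
      with x(2) show "(case x of (a, b) \<Rightarrow> f a * (if b = e then 1 else 0)) = 0" by simp
    qed
  qed auto
  then show ?thesis by simp
qed

lemma conv_one_left:
  assumes m: "m \<in> M"
  shows "conv (\<lambda>a. if a = e then 1 else 0) f m = f m"
proof -
  have "conv (\<lambda>a. if a = e then 1 else 0) f m = (\<Sum>x\<in>{(e, m)}. f (snd x))"
    unfolding conv_def
  proof (rule sum.mono_neutral_cong_right[OF finite_factors'[OF m]])
    show "{(e, m)} \<subseteq> factors m"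
      unfolding factors_def using m e_closed e_mul[OF m] by simp
    show "\<forall>x\<in>factors m - {(e, m)}. (case x of (a, b) \<Rightarrow> (if a = e then 1 else 0) * f b) = 0"
    proof (rule ballI, rule prod.exhaust)
      fix x a b assume x: "x \<in> factors m - {(e, m)}" "x = (a, b)"
      then have "a \<noteq> e" unfolding factors_def using e_mul by auto
      with x(2) show "(case x of (a, b) \<Rightarrow> (if a = e then 1 else 0) * f b) = 0" by simp
    qed
  qed auto
  then show ?thesis by simp
qed

lemma conv_add_right: "conv f (\<lambda>x. g x + h x) m = conv f g m + conv f h m"
  unfolding conv_def by (simp add: distrib_left sum.distrib case_prod_beta)

lemma conv_add_left: "conv (\<lambda>x. g x + h x) f m = conv g f m + conv h f m"
  unfolding conv_def by (simp add: distrib_right sum.distrib case_prod_beta)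

lemma conv_scale_right: "conv f (\<lambda>x. c * g x) m = c * conv f g m"
  unfolding conv_def by (simp add: sum_distrib_left case_prod_beta mult.left_commute)

lemma conv_scale_left: "conv (\<lambda>x. c * g x) f m = c * conv g f m"
  unfolding conv_def by (simp add: sum_distrib_left case_prod_beta mult.assoc)

lemma conv_zero [simp]: "conv f (\<lambda>_. 0) = (\<lambda>_. 0)" "conv (\<lambda>_. 0) f = (\<lambda>_. 0)"
  by (auto simp: conv_def fun_eq_iff)

lemma conv_commute:
  assumes "\<And>a b. a \<in> M \<Longrightarrow> b \<in> M \<Longrightarrow> mul a b = mul b a"
  shows "conv f g m = conv g f m"
  unfolding conv_def
  by (rule sum.reindex_bij_witness[where i = "\<lambda>(a, b). (b, a)" and j = "\<lambda>(a, b). (b, a)"])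
    (auto simp: factors_def assms)

end

section \<open>Monomials and power series\<close>

section \<open>Power series in countably many variables\<close>

abbreviation expo :: "monomial \<Rightarrow> nat \<Rightarrow> nat" where
  "expo \<equiv> Poly_Mapping.lookup"

abbreviation mkeys :: "monomial \<Rightarrow> nat set" where
  "mkeys \<equiv> Poly_Mapping.keys"

lemma finite_dominated: "finite {a :: monomial. \<forall>k. expo a k \<le> expo m k}"
proof -
  have "expo ` {a. \<forall>k. expo a k \<le> expo m k} \<subseteq>
      {f. \<forall>x. (x \<in> mkeys m \<longrightarrow> f x \<in> {..Max (expo m ` mkeys m)}) \<and> (x \<notin> mkeys m \<longrightarrow> f x = 0)}"
  proof (rule image_subsetI, clarsimp, intro allI conjI impI)
    fix a x
    assume a: "\<forall>k. expo a k \<le> expo m k"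
    show "expo a x \<le> Max (expo m ` mkeys m)" if "x \<in> mkeys m"
      using a that by (meson Max_ge finite_imageI finite_keys image_eqI order_trans)
    show "expo a x = 0" if "x \<notin> mkeys m"
      using a that by (metis in_keys_iff le_zero_eq)
  qed
  moreover have "finite \<dots>"
    by (rule finite_set_of_finite_funs) auto
  ultimately have "finite (expo ` {a :: monomial. \<forall>k. expo a k \<le> expo m k})"
    by (rule finite_subset)
  then show ?thesis
    by (rule finite_imageD) (auto intro: inj_onI poly_mapping_eqI)
qed

lemma finite_monomial_factors: "finite {(a, b). a + b = (m :: monomial)}"
proof (rule finite_subset)
  show "{(a, b). a + b = m} \<subseteq> {a. \<forall>k. expo a k \<le> expo m k} \<times> {a. \<forall>k. expo a k \<le> expo m k}"
    by (auto simp: lookup_add)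
qed (auto simp: finite_dominated)

interpretation monomials: fin_monoid "UNIV :: monomial set" "(+)" 0
  by unfold_locales (auto simp: add.assoc finite_monomial_factors)

lemma mult_MSym: "monoid.mult MSym = monomials.conv"
  by (auto simp: MSym_def monomials.conv_def monomials.factors_def fun_eq_iff)

lemma MSym_simps [simp]:
  "ring.zero MSym = (\<lambda>_. 0)" "ring.add MSym = (\<lambda>f g m. f m + g m)" "monoid.one MSym = basis_elem 0"
  "comult MSym f (a, b) = f (interleave a b)" "counit MSym f = f 0"
  by (simp_all add: MSym_def)

lemma conv_monomials_commute: "monomials.conv f g = monomials.conv g f"
  by (intro ext monomials.conv_commute) (simp add: add.commute)

lemma monomial_degree_superset:
  "finite A \<Longrightarrow> mkeys m \<subseteq> A \<Longrightarrow> monomial_degree m = (\<Sum>k\<in>A. expo m k)"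
  unfolding monomial_degree_def by (rule sum.mono_neutral_left) (auto simp: in_keys_iff)

lemma monomial_degree_add [simp]: "monomial_degree (a + b) = monomial_degree a + monomial_degree b"
  using monomial_degree_superset[of "mkeys a \<union> mkeys b" "a + b"] keys_add[of a b]
    monomial_degree_superset[of "mkeys a \<union> mkeys b" a] monomial_degree_superset[of "mkeys a \<union> mkeys b" b]
  by (simp add: lookup_add sum.distrib)

lemma monomial_degree_0 [simp]: "monomial_degree 0 = 0"
  by (simp add: monomial_degree_def)

lemma monomial_degree_single [simp]: "monomial_degree (Poly_Mapping.single k n) = n"
  by (cases "n = 0") (simp_all add: monomial_degree_def)

lemma monomial_degree_eq_0 [simp]: "monomial_degree m = 0 \<longleftrightarrow> m = 0"
  by (auto simp: monomial_degree_def in_keys_iff poly_mapping_eq_iff fun_eq_iff)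

lemma interleave_add: "interleave (a + a') (b + b') = interleave a b + interleave a' b'"
  by (rule poly_mapping_eqI) (simp add: interleave.rep_eq lookup_add)

lemma interleave_inj: "interleave a b = interleave a' b' \<longleftrightarrow> a = a' \<and> b = b'"
proof
  assume eq: "interleave a b = interleave a' b'"
  have "expo a k = expo a' k" "expo b k = expo b' k" for k
    using arg_cong[OF eq, of "\<lambda>m. expo m (2 * k)"] arg_cong[OF eq, of "\<lambda>m. expo m (2 * k + 1)"]
    by (simp_all add: interleave.rep_eq)
  then show "a = a' \<and> b = b'" by (auto intro: poly_mapping_eqI)
qed auto

text \<open>The components of the inverse of \<open>interleave\<close>: \<open>r = 0\<close>
  recovers the exponents of the x variables, \<open>r = 1\<close> those of the y variables.\<close>

lift_definition deinterleave :: "nat \<Rightarrow> monomial \<Rightarrow> monomial" is "\<lambda>r m k. m (2 * k + r)"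
proof -
  fix r and m :: "nat \<Rightarrow> nat"
  assume "finite {k. m k \<noteq> 0}"
  then show "finite {k. m (2 * k + r) \<noteq> 0}"
    by (rule finite_subset[OF _ finite_vimageI[of _ "\<lambda>k. 2 * k + r"], rotated])
      (auto intro: injI)
qed

lemma interleave_deinterleave: "interleave (deinterleave 0 m) (deinterleave 1 m) = m"
proof (rule poly_mapping_eqI)
  fix k :: nat
  show "expo (interleave (deinterleave 0 m) (deinterleave 1 m)) k = expo m k"
    by (cases "even k") (simp_all add: interleave.rep_eq deinterleave.rep_eq)
qed

lemma monomial_degree_interleave:
  "monomial_degree (interleave a b) = monomial_degree a + monomial_degree b"
proof -
  have "interleave a b = interleave a 0 + interleave 0 b"
    by (simp flip: interleave_add)
  moreover have "monomial_degree (interleave a 0) = monomial_degree a"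
    unfolding monomial_degree_def
    by (rule sum.reindex_bij_witness[where i = "\<lambda>k. 2 * k" and j = "\<lambda>k. k div 2"])
      (auto simp: interleave.rep_eq in_keys_iff split: if_splits)
  moreover have "monomial_degree (interleave 0 b) = monomial_degree b"
    unfolding monomial_degree_def
    by (rule sum.reindex_bij_witness[where i = "\<lambda>k. 2 * k + 1" and j = "\<lambda>k. k div 2"])
      (auto simp: interleave.rep_eq in_keys_iff split: if_splits)
  ultimately show ?thesis by simp
qed


section \<open>Symmetry of g of a partition, by counting intermediate partitions\<close>

section \<open>Symmetry of dual stable Grothendieck polynomials\<close>

text \<open>
  Column heights are listed from the last (shortest) column to the first.  The sum runs over
  the intermediate partitions between the inner and the outer one; a column contributes \<open>x\<close> if
  it gains boxes in the first step and \<open>y\<close> if it gains boxes in the second step.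
\<close>

fun two_step :: "'a::comm_ring_1 \<Rightarrow> 'a \<Rightarrow> nat \<Rightarrow> nat list \<Rightarrow> nat list \<Rightarrow> 'a" where
  "two_step x y lo (a # as) (c # cs) =
     (\<Sum>b\<in>{max lo a..c}. (if a < b then x else 1) * (if b < c then y else 1) * two_step x y b as cs)"
| "two_step x y lo _ _ = 1"

lemma two_step_mono_lo:
  assumes "lo \<le> a"
  shows "two_step x y lo (a # as) cs = two_step x y 0 (a # as) cs"
  using assms by (cases cs) (simp_all add: max_def)

text \<open>The weight of one column of inner height \<open>A\<close> and outer height
  \<open>E\<close> when its intermediate height \<open>b\<close> is capped by the height
  \<open>\<beta>\<close> of the next column: \<open>b = A\<close> gives y, \<open>b = E\<close>
  gives x, every height strictly between gives xy. The result is symmetric in x and y unless the cap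
  cuts the range short.\<close>

lemma sum_step:
  fixes x y :: "'a::comm_ring_1"
  assumes "A < E" "A \<le> \<beta>"
  shows "(\<Sum>b\<in>{A..min \<beta> E}. (if A < b then x else 1) * (if b < E then y else 1)) =
    (if E \<le> \<beta> then x + y + of_nat (E - A - 1) * (x * y) else y + of_nat (\<beta> - A) * (x * y))"
proof (cases "E \<le> \<beta>")
  case True
  have "{A..min \<beta> E} = insert A (insert E {A<..<E})"
    using assms True by auto
  then have "(\<Sum>b\<in>{A..min \<beta> E}. (if A < b then x else 1) * (if b < E then y else 1)) =
      y + x + (\<Sum>b\<in>{A<..<E}. (if A < b then x else 1) * (if b < E then y else 1))"
    using assms by simp
  also have "(\<Sum>b\<in>{A<..<E}. (if A < b then x else 1) * (if b < E then y else 1)) =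
      (\<Sum>b\<in>{A<..<E}. x * y)"
    by (rule sum.cong) auto
  finally show ?thesis using True by simp
next
  case False
  have "{A..min \<beta> E} = insert A {A<..\<beta>}"
    using assms False by auto
  then have "(\<Sum>b\<in>{A..min \<beta> E}. (if A < b then x else 1) * (if b < E then y else 1)) =
      y + (\<Sum>b\<in>{A<..\<beta>}. (if A < b then x else 1) * (if b < E then y else 1))"
    using assms by simp
  also have "(\<Sum>b\<in>{A<..\<beta>}. (if A < b then x else 1) * (if b < E then y else 1)) =
      (\<Sum>b\<in>{A<..\<beta>}. x * y)"
    by (rule sum.cong) (use False in auto)
  finally show ?thesis using False by simp
qed

text \<open>Splits off the shortest column. Without interaction between columns it would contribute
  the symmetric factor of \<open>sum_step\<close>; the correction for the missing pairs turns out to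
  be xy times the same sums for one column fewer, with the outer height \<open>C\<close> replaced by
  each \<open>d < E\<close>. All coefficients are symmetric, which is what the induction in
  \<open>two_step_sym\<close> needs.\<close>

lemma two_step_Cons:
  fixes x y :: "'a::comm_ring_1"
  assumes "A < E" "A \<le> A'" "E \<le> C"
  shows "two_step x y 0 (A # A' # as) (E # C # cs) =
    (x + y + of_nat (E - A - 1) * (x * y)) * two_step x y 0 (A' # as) (C # cs)
      - x * y * (\<Sum>d<E. two_step x y 0 (A' # as) (d # cs))"
proof -
  define Y where "Y \<beta> = (if A' < \<beta> then x else 1) * two_step x y \<beta> as cs" for \<beta>
  define S where "S b = (if A < b then x else 1) * (if b < E then y else 1)" for b
  have W: "two_step x y lo (A' # as) (d # cs) = (\<Sum>\<beta>\<in>{max lo A'..d}. (if \<beta> < d then y else 1) * Y \<beta>)"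
    for lo d
    by (auto simp: Y_def intro!: sum.cong)
  have "two_step x y 0 (A # A' # as) (E # C # cs) =
      (\<Sum>b\<in>{A..E}. S b * (\<Sum>\<beta>\<in>{max b A'..C}. (if \<beta> < C then y else 1) * Y \<beta>))"
    by (simp add: W[symmetric] S_def del: two_step.simps(1)) (subst two_step.simps, simp)
  also have "\<dots> = (\<Sum>b\<in>{A..E}. \<Sum>\<beta>\<in>{A'..C}. if b \<le> \<beta> then S b * ((if \<beta> < C then y else 1) * Y \<beta>) else 0)"
    by (rule sum.cong, simp, subst sum_distrib_left, rule sum.mono_neutral_cong_left) auto
  also have "\<dots> = (\<Sum>\<beta>\<in>{A'..C}. \<Sum>b\<in>{A..E}. if b \<le> \<beta> then S b * ((if \<beta> < C then y else 1) * Y \<beta>) else 0)"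
    by (rule sum.swap)
  also have "\<dots> = (\<Sum>\<beta>\<in>{A'..C}. (if \<beta> < C then y else 1) * Y \<beta> * (\<Sum>b\<in>{A..min \<beta> E}. S b))"
    by (rule sum.cong, simp, subst sum_distrib_left, rule sum.mono_neutral_cong_right) (auto simp: ac_simps)
  \<comment> \<open>The capped column sum is the uncapped, symmetric one minus the contribution of
    the heights \<open>b\<close> above \<open>\<beta>\<close>: x for \<open>b = E\<close>, and xy
    for each of the others.\<close>
  also have "\<dots> = (\<Sum>\<beta>\<in>{A'..C}. (if \<beta> < C then y else 1) * Y \<beta> *
      ((x + y + of_nat (E - A - 1) * (x * y)) -
       (if \<beta> < E then x + of_nat (E - 1 - \<beta>) * (x * y) else 0)))"
  proof (rule sum.cong[OF refl])
    fix \<beta> assume "\<beta> \<in> {A'..C}"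
    then have "A \<le> \<beta>" using assms by auto
    have *: "of_nat (E - A - 1) = (of_nat (E - 1 - \<beta>) + of_nat (\<beta> - A) :: 'a)" if "\<beta> < E"
      using that \<open>A \<le> \<beta>\<close> by (simp flip: of_nat_add)
    have "(\<Sum>b\<in>{A..min \<beta> E}. S b) = x + y + of_nat (E - A - 1) * (x * y) -
       (if \<beta> < E then x + of_nat (E - 1 - \<beta>) * (x * y) else 0)"
      unfolding S_def sum_step[OF assms(1) \<open>A \<le> \<beta>\<close>]
      using * by (cases "\<beta> < E") (simp_all only: distrib_right if_True if_False not_le, simp_all)
    then show "(if \<beta> < C then y else 1) * Y \<beta> * (\<Sum>b\<in>{A..min \<beta> E}. S b) = (if \<beta> < C then y else 1) * Y \<beta> *
      ((x + y + of_nat (E - A - 1) * (x * y)) -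
       (if \<beta> < E then x + of_nat (E - 1 - \<beta>) * (x * y) else 0))" by simp
  qed
  also have "\<dots> = (x + y + of_nat (E - A - 1) * (x * y)) * (\<Sum>\<beta>\<in>{A'..C}. (if \<beta> < C then y else 1) * Y \<beta>) -
      (\<Sum>\<beta>\<in>{A'..C}. (if \<beta> < C then y else 1) * Y \<beta> * (if \<beta> < E then x + of_nat (E - 1 - \<beta>) * (x * y) else 0))"
    by (simp add: right_diff_distrib sum_subtractf sum_distrib_left mult.commute)
  \<comment> \<open>Only \<open>\<beta> < E \<le> C\<close> remains, so the second column gains
    boxes in the second step, and its factor y completes x to xy.\<close>
  also have "(\<Sum>\<beta>\<in>{A'..C}. (if \<beta> < C then y else 1) * Y \<beta> * (if \<beta> < E then x + of_nat (E - 1 - \<beta>) * (x * y) else 0)) =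
      (\<Sum>\<beta>\<in>{A'..<E}. x * y * ((1 + of_nat (E - 1 - \<beta>) * y) * Y \<beta>))"
    by (rule sum.mono_neutral_cong_right) (use assms in \<open>auto simp: algebra_simps\<close>)
  \<comment> \<open>\<open>1 + (E - 1 - \<beta>) * y\<close> is the sum over \<open>d\<close> in
    \<open>{\<beta>..<E}\<close> of the second-step factor of a column of outer height
    \<open>d\<close>; exchanging the sums then produces instances of
    \<open>two_step\<close>.\<close>
  also have "\<dots> = x * y * (\<Sum>\<beta>\<in>{A'..<E}. (\<Sum>d\<in>{\<beta>..<E}. (if \<beta> < d then y else 1) * Y \<beta>))"
    unfolding sum_distrib_left
  proof (rule sum.cong[OF refl])
    fix \<beta> assume "\<beta> \<in> {A'..<E}"
    then have "{\<beta>..<E} = insert \<beta> {\<beta><..<E}" by auto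
    then have "(\<Sum>d\<in>{\<beta>..<E}. x * y * ((if \<beta> < d then y else 1) * Y \<beta>)) =
        x * y * Y \<beta> + (\<Sum>d\<in>{\<beta><..<E}. x * y * ((if \<beta> < d then y else 1) * Y \<beta>))"
      by simp
    also have "(\<Sum>d\<in>{\<beta><..<E}. x * y * ((if \<beta> < d then y else 1) * Y \<beta>)) = (\<Sum>d\<in>{\<beta><..<E}. x * y * (y * Y \<beta>))"
      by (rule sum.cong) auto
    finally show "x * y * ((1 + of_nat (E - 1 - \<beta>) * y) * Y \<beta>) = (\<Sum>d\<in>{\<beta>..<E}. x * y * ((if \<beta> < d then y else 1) * Y \<beta>))"
      by (simp add: algebra_simps)
  qed
  also have "(\<Sum>\<beta>\<in>{A'..<E}. (\<Sum>d\<in>{\<beta>..<E}. (if \<beta> < d then y else 1) * Y \<beta>)) =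
      (\<Sum>\<beta>\<in>{..<E}. \<Sum>d\<in>{..<E}. if A' \<le> \<beta> \<and> \<beta> \<le> d then (if \<beta> < d then y else 1) * Y \<beta> else 0)"
    by (rule sum.mono_neutral_cong_left; (auto intro!: sum.mono_neutral_cong_left)?)
  also have "\<dots> = (\<Sum>d\<in>{..<E}. \<Sum>\<beta>\<in>{..<E}. if A' \<le> \<beta> \<and> \<beta> \<le> d then (if \<beta> < d then y else 1) * Y \<beta> else 0)"
    by (rule sum.swap)
  also have "\<dots> = (\<Sum>d<E. two_step x y 0 (A' # as) (d # cs))"
    unfolding W by (rule sum.cong[OF refl], rule sum.mono_neutral_cong_right) auto
  finally show ?thesis
    unfolding W[of 0 C] by simp
qed

text \<open>Induction on the number of columns. If \<open>E < A\<close> the sum is empty, if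
  \<open>E = A\<close> the first column stays fixed, and otherwise \<open>two_step_Cons\<close>
  expresses the sum by symmetric coefficients and shorter instances.\<close>

lemma two_step_sym:
  fixes x y :: "'a::comm_ring_1"
  assumes "sorted as" "sorted cs" "length as = length cs"
  shows "two_step x y 0 as cs = two_step y x 0 as cs"
  using assms
proof (induction "length as" arbitrary: as cs)
  case (Suc n)
  obtain A as' E cs' where [simp]: "as = A # as'" "cs = E # cs'"
    using Suc.hyps(2) Suc.prems by (metis length_Suc_conv)
  consider "E < A" | "E = A" | "A < E" by linarith
  then show ?case
  proof cases
    case 2
    have "two_step x y A as' cs' = two_step x y 0 as' cs'" for x y :: 'a
    proof (cases as')
      case (Cons A' as)
      then have "A \<le> A'" using Suc.prems by simp
      from two_step_mono_lo[OF this] show ?thesis unfolding Cons .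
    qed simp
    with 2 Suc.hyps(1)[of as' cs'] Suc.hyps(2) Suc.prems show ?thesis by simp
  next
    case 3
    show ?thesis
    proof (cases as')
      case Nil
      then have "cs' = []" using Suc.prems by simp
      with Nil sum_step[OF 3, of E x y] sum_step[OF 3, of E y x] 3 show ?thesis
        by (simp add: mult.commute add.commute)
    next
      case (Cons A' as'')
      moreover from this obtain C cs'' where "cs' = C # cs''"
        using Suc.prems by (cases cs') auto
      ultimately have eq: "as = A # A' # as''" "cs = E # C # cs''" by simp_all
      have le: "A \<le> A'" "E \<le> C" using Suc.prems unfolding eq by simp_all
      have IH: "two_step x y 0 (A' # as'') (d # cs'') = two_step y x 0 (A' # as'') (d # cs'')"
        if "d \<le> C" for d
        using Suc.hyps(2) Suc.prems that unfolding eq by (intro Suc.hyps(1)) auto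
      have "(\<Sum>d<E. two_step x y 0 (A' # as'') (d # cs'')) = (\<Sum>d<E. two_step y x 0 (A' # as'') (d # cs''))"
        by (rule sum.cong[OF refl], rule IH) (use le in auto)
      then show ?thesis
        unfolding eq two_step_Cons[OF 3 le] IH[OF order_refl] by (simp add: ac_simps)
    qed
  qed simp
qed simp


definition steps :: "nat list \<Rightarrow> nat list \<Rightarrow> nat" where
  "steps as bs = length (filter (\<lambda>(a, b). a < b) (zip as bs))"

lemma steps_simps [simp]:
  "steps [] bs = 0" "steps as [] = 0" "steps (a # as) (b # bs) = (if a < b then 1 else 0) + steps as bs"
  by (simp_all add: steps_def)

definition intermediate :: "nat \<Rightarrow> nat list \<Rightarrow> nat list \<Rightarrow> nat list set" where
  "intermediate lo as cs = {bs. sorted (lo # bs) \<and> list_all2 (\<le>) as bs \<and> list_all2 (\<le>) bs cs}"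

lemma intermediate_Nil: "intermediate lo [] [] = {[]}"
  by (auto simp: intermediate_def)

lemma intermediate_Cons:
  "intermediate lo (a # as) (c # cs) = (\<Union>b\<in>{max lo a..c}. (#) b ` intermediate b as cs)"
  by (fastforce simp: intermediate_def list_all2_Cons1 image_iff)

lemma finite_intermediate: "finite (intermediate lo as cs)"
proof (rule finite_subset)
  show "intermediate lo as cs \<subseteq> {bs. set bs \<subseteq> {..Max (insert 0 (set cs))} \<and> length bs = length cs}"
    by (auto simp: intermediate_def list_all2_conv_all_nth in_set_conv_nth)
      (meson List.finite_set Max_ge finite_insert insertI2 le_trans nth_mem)
qed (simp add: finite_lists_length_eq)

lemma two_step_eq:
  fixes x y :: "'a::comm_ring_1"
  assumes "length as = length cs"
  shows "two_step x y lo as cs = (\<Sum>bs\<in>intermediate lo as cs. x ^ steps as bs * y ^ steps bs cs)"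
  using assms
proof (induction as cs arbitrary: lo rule: list_induct2)
  case (Cons a as c cs)
  have "(\<Sum>bs\<in>intermediate lo (a # as) (c # cs). x ^ steps (a # as) bs * y ^ steps bs (c # cs)) =
     (\<Sum>b\<in>{max lo a..c}. \<Sum>bs\<in>(#) b ` intermediate b as cs. x ^ steps (a # as) bs * y ^ steps bs (c # cs))"
    unfolding intermediate_Cons by (rule sum.UNION_disjoint) (auto simp: finite_intermediate)
  also have "\<dots> = (\<Sum>b\<in>{max lo a..c}. (if a < b then x else 1) * (if b < c then y else 1) * two_step x y b as cs)"
    by (rule sum.cong[OF refl], subst sum.reindex)
      (auto simp: Cons.IH sum_distrib_left power_add ac_simps)
  finally show ?case by simp
qed (simp add: intermediate_Nil)

text \<open>Coefficient extraction from \<open>two_step_sym\<close> at two independent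
  indeterminates: x is the variable of the inner polynomial ring, y that of the outer one.\<close>

lemma card_intermediate_sym:
  assumes "sorted as" "sorted cs" "length as = length cs"
  shows "card {bs \<in> intermediate 0 as cs. steps as bs = p \<and> steps bs cs = q} =
    card {bs \<in> intermediate 0 as cs. steps as bs = q \<and> steps bs cs = p}"
proof -
  define x y :: "int poly poly" where "x = [:[:0, 1:]:]" and "y = [:0, 1:]"
  have "x ^ i = [:monom 1 i:]" "y ^ i = monom 1 i" for i
    by (simp_all add: x_def y_def poly_const_pow monom_altdef)
  then have xy: "x ^ i * y ^ j = monom (monom 1 i) j" "y ^ j * x ^ i = monom (monom 1 i) j" for i j
    by (simp_all add: smult_monom mult.commute)
  have int_card: "int (card {bs \<in> intermediate 0 as cs. Q bs}) = (\<Sum>bs\<in>intermediate 0 as cs. if Q bs then 1 else 0)"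
    for Q by (simp add: sum.inter_filter[OF finite_intermediate, symmetric])
  have 1: "coeff (coeff (two_step x y 0 as cs) q) p =
      int (card {bs \<in> intermediate 0 as cs. steps as bs = p \<and> steps bs cs = q})"
    unfolding two_step_eq[OF assms(3)] xy int_card coeff_sum
    by (rule sum.cong) auto
  have 2: "coeff (coeff (two_step y x 0 as cs) q) p =
      int (card {bs \<in> intermediate 0 as cs. steps as bs = q \<and> steps bs cs = p})"
    unfolding two_step_eq[OF assms(3)] xy int_card coeff_sum
    by (rule sum.cong) auto
  show ?thesis
    using 1 2 two_step_sym[OF assms, of x y] by simp
qed


lift_definition adj_swap :: "nat \<Rightarrow> monomial \<Rightarrow> monomial" is
  "\<lambda>k m i. m (if i = k then Suc k else if i = Suc k then k else i)"
proof -
  fix k and m :: "nat \<Rightarrow> nat"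
  assume "finite {i. m i \<noteq> 0}"
  then have "finite (insert k (insert (Suc k) {i. m i \<noteq> 0}))" by simp
  then show "finite {i. m (if i = k then Suc k else if i = Suc k then k else i) \<noteq> 0}"
    by (rule finite_subset[rotated]) auto
qed

lemma expo_adj_swap:
  "expo (adj_swap k m) i = expo m (if i = k then Suc k else if i = Suc k then k else i)"
  by (simp add: adj_swap.rep_eq)

definition young :: "(nat \<times> nat) set \<Rightarrow> bool" where
  "young D \<longleftrightarrow> finite D \<and> (\<forall>r c r' c'. (r, c) \<in> D \<longrightarrow> r' \<le> r \<longrightarrow> c' \<le> c \<longrightarrow> (r', c') \<in> D)"

lemma youngD: "young D \<Longrightarrow> (r, c) \<in> D \<Longrightarrow> r' \<le> r \<Longrightarrow> c' \<le> c \<Longrightarrow> (r', c') \<in> D"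
  by (auto simp: young_def)

lemma young_finite: "young D \<Longrightarrow> finite D"
  by (auto simp: young_def)

lemma finite_diagram: "finite (diagram lam)"
proof (rule finite_subset)
  show "diagram lam \<subseteq> (SIGMA r:{..<length lam}. {..<lam ! r})"
    by (auto simp: diagram_def)
qed auto

lemma young_diagram:
  assumes "is_partition lam"
  shows "young (diagram lam)"
  unfolding young_def
proof (intro conjI allI impI)
  fix r c r' c' assume *: "(r, c) \<in> diagram lam" "r' \<le> r" "c' \<le> c"
  have "lam ! r \<le> lam ! r'"
    using assms * sorted_wrt_nth_less[of "(\<ge>)" lam r' r]
    by (cases "r' = r") (auto simp: is_partition_def diagram_def)
  with * show "(r', c') \<in> diagram lam" by (auto simp: diagram_def)
qed (rule finite_diagram)

lemma rppD:
  assumes "reverse_plane_partition D T"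
  shows "p \<in> D \<Longrightarrow> 0 < T p" "p \<notin> D \<Longrightarrow> T p = 0"
    "(r, c) \<in> D \<Longrightarrow> (r, c') \<in> D \<Longrightarrow> c \<le> c' \<Longrightarrow> T (r, c) \<le> T (r, c')"
    "(r, c) \<in> D \<Longrightarrow> (r', c) \<in> D \<Longrightarrow> r \<le> r' \<Longrightarrow> T (r, c) \<le> T (r', c)"
  using assms unfolding reverse_plane_partition_def by blast+

lemma finite_columns:
  assumes "finite D"
  shows "finite {c. \<exists>r. (r, c) \<in> D \<and> P r c}"
proof (rule finite_subset)
  show "{c. \<exists>r. (r, c) \<in> D \<and> P r c} \<subseteq> snd ` D"
    by (auto intro: rev_image_eqI)
qed (simp add: assms)

text \<open>Every entry shows up in the weight through its column, so the weight \<open>m\<close>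
  leaves only finitely many values for each cell.\<close>

lemma finite_rpp:
  assumes "finite D"
  shows "finite {T. reverse_plane_partition D T \<and> has_weight D T m}"
proof (rule finite_subset)
  show "{T. reverse_plane_partition D T \<and> has_weight D T m} \<subseteq>
    {T. \<forall>p. (p \<in> D \<longrightarrow> T p \<in> Suc ` mkeys m) \<and> (p \<notin> D \<longrightarrow> T p = 0)}"
  proof (rule subsetI, unfold mem_Collect_eq, elim conjE, intro allI conjI impI)
    fix T p
    assume T: "reverse_plane_partition D T" "has_weight D T m"
    show "T p = 0" if "p \<notin> D" using rppD(2)[OF T(1) that] .
    show "T p \<in> Suc ` mkeys m" if pD: "p \<in> D"
    proof -
      obtain r c where p: "p = (r, c)" by fastforce
      obtain k where k: "T p = Suc k"
        using rppD(1)[OF T(1) pD] gr0_implies_Suc by blast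
      have "c \<in> {c. \<exists>r. (r, c) \<in> D \<and> T (r, c) = Suc k}" using k pD p by blast
      then have "card {c. \<exists>r. (r, c) \<in> D \<and> T (r, c) = Suc k} > 0"
        using finite_columns[OF assms, of "\<lambda>r c. T (r, c) = Suc k"] unfolding card_gt_0_iff by blast
      with T(2) k show ?thesis by (auto simp: has_weight_def in_keys_iff)
    qed
  qed
qed (rule finite_set_of_finite_funs, use assms in auto)

lemma initial_segment:
  assumes "finite S" "\<And>r r'. r \<in> S \<Longrightarrow> r' \<le> r \<Longrightarrow> r' \<in> S"
  shows "S = {..<card S}"
proof -
  define n where "n = (LEAST n. n \<notin> S)"
  have "n \<notin> S"
    unfolding n_def using ex_new_if_finite[OF infinite_UNIV_nat assms(1)] by (rule LeastI_ex)
  moreover have "r \<in> S" if "r < n" for r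
    using that not_less_Least unfolding n_def by blast
  ultimately have "S = {..<n}"
    using assms(2) by (auto simp: not_le[symmetric])
  then show ?thesis by simp
qed

text \<open>A reverse plane partition of straight shape is a chain of Young diagrams, the cells with
  entries at most \<open>v\<close>; these are the column heights of that chain. A column contains
  the entry \<open>Suc v\<close> exactly if it grows from step \<open>v\<close> to step
  \<open>Suc v\<close>.\<close>

definition heights :: "(nat \<times> nat) set \<Rightarrow> (nat \<times> nat \<Rightarrow> nat) \<Rightarrow> nat \<Rightarrow> nat \<Rightarrow> nat" where
  "heights D T v j = card {r. (r, j) \<in> D \<and> T (r, j) \<le> v}"

lemma heights_iff:
  assumes "young D" "reverse_plane_partition D T"
  shows "(r, j) \<in> D \<and> T (r, j) \<le> v \<longleftrightarrow> r < heights D T v j"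
proof -
  have "finite {r. (r, j) \<in> D \<and> T (r, j) \<le> v}"
    by (rule finite_subset[OF _ finite_imageI[OF young_finite[OF assms(1)], of fst]])
      (auto intro: rev_image_eqI)
  then have "{r. (r, j) \<in> D \<and> T (r, j) \<le> v} = {..<heights D T v j}"
    unfolding heights_def
  proof (rule initial_segment)
    fix r r' assume "r \<in> {r. (r, j) \<in> D \<and> T (r, j) \<le> v}" "r' \<le> r"
    then show "r' \<in> {r. (r, j) \<in> D \<and> T (r, j) \<le> v}"
      using youngD[OF assms(1), of r j r' j] rppD(4)[OF assms(2), of r' j r] by auto
  qed
  then show ?thesis by auto
qed

lemma heights_antimono:
  assumes "young D" "reverse_plane_partition D T" "j \<le> j'"
  shows "heights D T v j' \<le> heights D T v j"
proof -
  have "r < heights D T v j" if "r < heights D T v j'" for r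
    using that youngD[OF assms(1), of r j' r j] rppD(3)[OF assms(2), of r j j'] assms(3)
    unfolding heights_iff[OF assms(1,2), symmetric] by auto
  then show ?thesis by (meson not_le less_irrefl)
qed

lemma heights_mono:
  assumes "young D" "reverse_plane_partition D T" "v \<le> v'"
  shows "heights D T v j \<le> heights D T v' j"
proof -
  have "r < heights D T v' j" if "r < heights D T v j" for r
    using that assms(3) unfolding heights_iff[OF assms(1,2), symmetric] by auto
  then show ?thesis by (meson not_le less_irrefl)
qed

lemma column_contains_iff:
  assumes "young D" "reverse_plane_partition D T"
  shows "(\<exists>r. (r, j) \<in> D \<and> T (r, j) = Suc v) \<longleftrightarrow> heights D T v j < heights D T (Suc v) j"
proof
  assume "\<exists>r. (r, j) \<in> D \<and> T (r, j) = Suc v"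
  then obtain r where "(r, j) \<in> D" "T (r, j) = Suc v" by blast
  then show "heights D T v j < heights D T (Suc v) j"
    using heights_iff[OF assms, of r j v] heights_iff[OF assms, of r j "Suc v"] by auto
next
  assume "heights D T v j < heights D T (Suc v) j"
  then show "\<exists>r. (r, j) \<in> D \<and> T (r, j) = Suc v"
    using heights_iff[OF assms, of "heights D T v j" j v] heights_iff[OF assms, of "heights D T v j" j "Suc v"]
    by (intro exI[of _ "heights D T v j"]) auto
qed

text \<open>Columns run from the last to the first so that the lists are weakly increasing, the
  order expected by \<open>two_step\<close>; \<open>n\<close> bounds the number of columns.\<close>

definition height_list :: "nat \<Rightarrow> (nat \<times> nat) set \<Rightarrow> (nat \<times> nat \<Rightarrow> nat) \<Rightarrow> nat \<Rightarrow> nat list" where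
  "height_list n D T v = map (\<lambda>i. heights D T v (n - Suc i)) [0..<n]"

lemma length_height_list [simp]: "length (height_list n D T v) = n"
  by (simp add: height_list_def)

lemma nth_height_list [simp]: "i < n \<Longrightarrow> height_list n D T v ! i = heights D T v (n - Suc i)"
  by (simp add: height_list_def)

lemma sorted_height_list:
  assumes "young D" "reverse_plane_partition D T"
  shows "sorted (height_list n D T v)"
  unfolding sorted_iff_nth_mono by (auto intro: heights_antimono[OF assms])

lemma steps_eq_card:
  assumes "length as = n" "length bs = n"
  shows "steps as bs = card {j. j < n \<and> as ! (n - Suc j) < bs ! (n - Suc j)}"
proof -
  have "steps as bs = card {i. i < n \<and> as ! i < bs ! i}"
    unfolding steps_def length_filter_conv_card
    by (rule arg_cong[where f = card]) (use assms in auto)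
  also have "\<dots> = card {j. j < n \<and> as ! (n - Suc j) < bs ! (n - Suc j)}"
    by (rule bij_betw_same_card[of "\<lambda>i. n - Suc i"], rule bij_betw_byWitness[where f' = "\<lambda>i. n - Suc i"])
      auto
  finally show ?thesis .
qed

lemma steps_height_list:
  assumes "young D" "reverse_plane_partition D T" "\<And>r c. (r, c) \<in> D \<Longrightarrow> c < n"
  shows "card {c. \<exists>r. (r, c) \<in> D \<and> T (r, c) = Suc v} =
    steps (height_list n D T v) (height_list n D T (Suc v))"
proof -
  have "{c. \<exists>r. (r, c) \<in> D \<and> T (r, c) = Suc v} =
      {j. j < n \<and> heights D T v j < heights D T (Suc v) j}"
    unfolding column_contains_iff[OF assms(1,2), symmetric] using assms(3) by blast
  also have "\<dots> = {j. j < n \<and> height_list n D T v ! (n - Suc j) < height_list n D T (Suc v) ! (n - Suc j)}"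
    by (auto simp: Suc_diff_Suc)
  finally show ?thesis by (subst steps_eq_card[of _ n]) simp_all
qed


text \<open>Identifies the two values that belong to the exponents with index \<open>k\<close> and
  \<open>Suc k\<close>; in terms of chains of diagrams it forgets the member between them.\<close>

definition collapse :: "nat \<Rightarrow> (nat \<times> nat \<Rightarrow> nat) \<Rightarrow> nat \<times> nat \<Rightarrow> nat" where
  "collapse k T p = (if T p = Suc (Suc k) then Suc k else T p)"

lemma rpp_collapse:
  assumes "reverse_plane_partition D T"
  shows "reverse_plane_partition D (collapse k T)"
proof -
  have mono: "collapse k T p \<le> collapse k T q" if "T p \<le> T q" for p q
    using that by (auto simp: collapse_def)
  show ?thesis
    using assms unfolding reverse_plane_partition_def
    by (auto intro: mono) (auto simp: collapse_def)
qed

text \<open>Reinserts the forgotten diagram with column heights \<open>bs\<close>: cells with the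
  merged value keep the smaller value inside it and get the larger one outside.\<close>

definition expand :: "nat \<Rightarrow> nat \<Rightarrow> (nat \<times> nat \<Rightarrow> nat) \<Rightarrow> nat list \<Rightarrow> nat \<times> nat \<Rightarrow> nat" where
  "expand n k U bs = (\<lambda>(r, j). if U (r, j) = Suc k \<and> bs ! (n - Suc j) \<le> r then Suc (Suc k) else U (r, j))"

text \<open>A member of the fibre is the same as a choice of the forgotten diagram, which may be any
  partition between its two neighbours in the chain of \<open>U\<close>.\<close>

lemma card_fiber:
  assumes D: "young D" "\<And>r c. (r, c) \<in> D \<Longrightarrow> c < n"
    and U: "reverse_plane_partition D U" "\<And>p. U p \<noteq> Suc (Suc k)"
  shows "card {T. reverse_plane_partition D T \<and> collapse k T = U \<and> Q (height_list n D T (Suc k))} =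
    card {bs \<in> intermediate 0 (height_list n D U k) (height_list n D U (Suc k)). Q bs}"
proof (rule bij_betw_same_card)
  let ?as = "height_list n D U k" and ?cs = "height_list n D U (Suc k)"
  let ?f = "\<lambda>T. height_list n D T (Suc k)" and ?g = "expand n k U"
  show "bij_betw ?f {T. reverse_plane_partition D T \<and> collapse k T = U \<and> Q (?f T)}
      {bs \<in> intermediate 0 ?as ?cs. Q bs}"
  proof (rule bij_betw_byWitness[where f' = ?g])
    show inv1: "\<forall>T\<in>{T. reverse_plane_partition D T \<and> collapse k T = U \<and> Q (?f T)}. ?g (?f T) = T"
    proof (intro ballI ext, unfold mem_Collect_eq, elim conjE)
      fix T and p :: "nat \<times> nat" assume T: "reverse_plane_partition D T" "collapse k T = U"
      obtain r j where p: "p = (r, j)" by fastforce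
      show "?g (?f T) p = T p"
      proof (cases "p \<in> D")
        case True
        then have "j < n" using D(2) p by blast
        then have nth: "?f T ! (n - Suc j) = heights D T (Suc k) j"
          by (simp add: Suc_diff_Suc)
        show ?thesis
          using heights_iff[OF D(1) T(1), of r j "Suc k"] True
          unfolding p expand_def split nth T(2)[symmetric] collapse_def by auto
      next
        case False
        then show ?thesis
          using rppD(2)[OF T(1) False] rppD(2)[OF U(1) False] by (simp add: expand_def p)
      qed
    qed
    have fib: "heights D T k j = heights D U k j" "heights D T (Suc (Suc k)) j = heights D U (Suc k) j"
      if "collapse k T = U" for T j
      unfolding heights_def that[symmetric] collapse_def
      by (rule arg_cong[where f = card], force)+
    show "?f ` {T. reverse_plane_partition D T \<and> collapse k T = U \<and> Q (?f T)} \<subseteq> {bs \<in> intermediate 0 ?as ?cs. Q bs}"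
    proof (rule image_subsetI, unfold mem_Collect_eq, elim conjE, intro conjI)
      fix T assume T: "reverse_plane_partition D T" "collapse k T = U"
      show "?f T \<in> intermediate 0 ?as ?cs"
        unfolding intermediate_def
        by (auto simp: sorted_height_list[OF D(1) T(1)] list_all2_conv_all_nth
            simp flip: fib[OF T(2)] intro!: heights_mono[OF D(1) T(1)])
    qed
    have g: "reverse_plane_partition D (?g bs)" "collapse k (?g bs) = U" "?f (?g bs) = bs"
      if bs: "bs \<in> intermediate 0 ?as ?cs" for bs
    proof -
      have la: "list_all2 (\<le>) ?as bs" "list_all2 (\<le>) bs ?cs" and srt: "sorted bs"
        using bs by (simp_all add: intermediate_def)
      have len: "length bs = n"
        using list_all2_lengthD[OF la(1)] by simp
      have bounds: "heights D U k j \<le> bs ! (n - Suc j)" "bs ! (n - Suc j) \<le> heights D U (Suc k) j"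
        if "j < n" for j
        using list_all2_nthD[OF la(1), of "n - Suc j"] list_all2_nthD[OF la(2), of "n - Suc j"] that len
        by (simp_all add: Suc_diff_Suc)
      have anti: "bs ! (n - Suc j') \<le> bs ! (n - Suc j)" if "j \<le> j'" "j' < n" for j j'
        using srt that len by (intro sorted_nth_mono) auto
      show rpp: "reverse_plane_partition D (?g bs)"
        unfolding reverse_plane_partition_def
      proof (intro conjI allI impI ballI)
        fix p assume "p \<in> D" then show "0 < ?g bs p"
          using rppD(1)[OF U(1)] by (cases p) (auto simp: expand_def)
      next
        fix p assume "p \<notin> D" then show "?g bs p = 0"
          using rppD(2)[OF U(1)] by (cases p) (auto simp: expand_def)
      next
        fix r c c' assume *: "(r, c) \<in> D \<and> (r, c') \<in> D \<and> c \<le> c'"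
        then have "U (r, c) \<le> U (r, c')" "bs ! (n - Suc c') \<le> bs ! (n - Suc c)"
          using rppD(3)[OF U(1)] anti D(2) by blast+
        then show "?g bs (r, c) \<le> ?g bs (r, c')"
          using U(2)[of "(r, c')"] by (auto simp: expand_def)
      next
        fix r r' c assume *: "(r, c) \<in> D \<and> (r', c) \<in> D \<and> r \<le> r'"
        then have "U (r, c) \<le> U (r', c)"
          using rppD(4)[OF U(1)] by blast
        then show "?g bs (r, c) \<le> ?g bs (r', c)"
          using U(2)[of "(r', c)"] * by (auto simp: expand_def)
      qed
      show "collapse k (?g bs) = U"
        using U(2) by (auto simp: collapse_def expand_def fun_eq_iff)
      show "?f (?g bs) = bs"
      proof (rule nth_equalityI)
        fix i assume "i < length (?f (?g bs))"
        then have i: "i < n" by simp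
        define j where "j = n - Suc i"
        have j: "j < n" "n - Suc j = i" using i by (auto simp: j_def)
        have "r < heights D (?g bs) (Suc k) j \<longleftrightarrow> r < bs ! i" for r
          using heights_iff[OF D(1) U(1), of r j k] heights_iff[OF D(1) U(1), of r j "Suc k"]
            bounds[OF j(1)] U(2)[of "(r, j)"]
          unfolding heights_iff[OF D(1) rpp, symmetric] j(2)
          by (auto simp: expand_def j(2) split: if_splits)
        then have "heights D (?g bs) (Suc k) j = bs ! i"
          by (metis less_irrefl linorder_neqE_nat)
        then show "?f (?g bs) ! i = bs ! i" using i by (simp add: j_def)
      qed (simp add: len)
    qed
    show "\<forall>bs\<in>{bs \<in> intermediate 0 ?as ?cs. Q bs}. ?f (?g bs) = bs"
      using g(3) by blast
    show "?g ` {bs \<in> intermediate 0 ?as ?cs. Q bs} \<subseteq> {T. reverse_plane_partition D T \<and> collapse k T = U \<and> Q (?f T)}"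
      using g by (simp add: image_subset_iff)
  qed
qed

text \<open>The fillings are grouped by their collapse. Within a fibre the two exponents in question
  are the numbers of columns that grow in the first and in the second of two consecutive steps, so
  \<open>card_intermediate_sym\<close> exchanges them; all other exponents are constant on the
  fibre.\<close>

lemma dual_g_swap:
  assumes "young D"
  shows "dual_g D (adj_swap k m) = dual_g D m"
proof -
  note fin = young_finite[OF assms]
  obtain n where n: "\<And>r c. (r, c) \<in> D \<Longrightarrow> c < n"
  proof -
    have "finite (snd ` D)" using fin by simp
    then obtain n where "\<forall>c\<in>snd ` D. c < n"
      using finite_nat_set_iff_bounded by blast
    then show ?thesis using that by force
  qed
  define S where "S m = {T. reverse_plane_partition D T \<and> has_weight D T m}" for m
  \<comment> \<open>A common index set for the fibres of both weights.\<close>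
  define A where "A = collapse k ` (S m \<union> S (adj_swap k m))"
  have finS: "finite (S m)" for m
    unfolding S_def by (rule finite_rpp[OF fin])
  then have finA: "finite A" by (simp add: A_def)
  have card: "card (S m') = (\<Sum>U\<in>A. card {T \<in> S m'. collapse k T = U})" if "m' \<in> {m, adj_swap k m}" for m'
  proof -
    have "collapse k ` S m' \<subseteq> A" using that by (auto simp: A_def)
    from sum.group[OF finS[of m'] finA this, of "\<lambda>_. 1 :: nat"] show ?thesis by simp
  qed
  have "card {T \<in> S m. collapse k T = U} = card {T \<in> S (adj_swap k m). collapse k T = U}" if "U \<in> A" for U
  proof -
    have U: "reverse_plane_partition D U" "\<And>p. U p \<noteq> Suc (Suc k)"
      using that by (auto simp: A_def S_def rpp_collapse collapse_def split: if_splits)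
    let ?as = "height_list n D U k" and ?cs = "height_list n D U (Suc k)"
    define other where "other m' \<longleftrightarrow> (\<forall>v. v \<noteq> k \<and> v \<noteq> Suc k \<longrightarrow>
        expo m' v = card {c. \<exists>r. (r, c) \<in> D \<and> U (r, c) = Suc v})" for m'
    have wt: "has_weight D T m' \<longleftrightarrow> other m' \<and>
        steps ?as (height_list n D T (Suc k)) = expo m' k \<and> steps (height_list n D T (Suc k)) ?cs = expo m' (Suc k)"
      if T: "reverse_plane_partition D T" "collapse k T = U" for T m'
    proof -
      have hl: "height_list n D T k = ?as" "height_list n D T (Suc (Suc k)) = ?cs"
        unfolding height_list_def heights_def T(2)[symmetric] collapse_def
        by (auto intro!: arg_cong[where f = card])
      have eq: "{c. \<exists>r. (r, c) \<in> D \<and> T (r, c) = Suc v} = {c. \<exists>r. (r, c) \<in> D \<and> U (r, c) = Suc v}"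
        if "v \<noteq> k" "v \<noteq> Suc k" for v
      proof -
        have "T p = Suc v \<longleftrightarrow> U p = Suc v" for p
          using that by (auto simp: T(2)[symmetric] collapse_def)
        then show ?thesis by simp
      qed
      have s1: "card {c. \<exists>r. (r, c) \<in> D \<and> T (r, c) = Suc k} = steps ?as (height_list n D T (Suc k))"
        using steps_height_list[where n = n and v = k, OF assms T(1) n] by (simp add: hl)
      have s2: "card {c. \<exists>r. (r, c) \<in> D \<and> T (r, c) = Suc (Suc k)} = steps (height_list n D T (Suc k)) ?cs"
        using steps_height_list[where n = n and v = "Suc k", OF assms T(1) n] by (simp add: hl)
      have oth: "(\<forall>v. v \<noteq> k \<and> v \<noteq> Suc k \<longrightarrow>
          expo m' v = card {c. \<exists>r. (r, c) \<in> D \<and> T (r, c) = Suc v}) \<longleftrightarrow> other m'"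
        unfolding other_def by (intro all_cong1 imp_cong refl) (simp add: eq)
      have split3: "(\<forall>v. P v) \<longleftrightarrow> (\<forall>v. v \<noteq> k \<and> v \<noteq> Suc k \<longrightarrow> P v) \<and> P k \<and> P (Suc k)" for P
        by metis
      have "has_weight D T m' \<longleftrightarrow> (\<forall>v. v \<noteq> k \<and> v \<noteq> Suc k \<longrightarrow>
            expo m' v = card {c. \<exists>r. (r, c) \<in> D \<and> T (r, c) = Suc v}) \<and>
          expo m' k = card {c. \<exists>r. (r, c) \<in> D \<and> T (r, c) = Suc k} \<and>
          expo m' (Suc k) = card {c. \<exists>r. (r, c) \<in> D \<and> T (r, c) = Suc (Suc k)}"
        unfolding has_weight_def by (rule split3)
      also have "\<dots> \<longleftrightarrow> other m' \<and> expo m' k = steps ?as (height_list n D T (Suc k)) \<and>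
          expo m' (Suc k) = steps (height_list n D T (Suc k)) ?cs"
        unfolding oth s1 s2 by (rule refl)
      finally show ?thesis by auto
    qed
    have c: "card {T \<in> S m'. collapse k T = U} =
        card {bs \<in> intermediate 0 ?as ?cs. other m' \<and> steps ?as bs = expo m' k \<and> steps bs ?cs = expo m' (Suc k)}"
      for m'
    proof -
      have "{T \<in> S m'. collapse k T = U} = {T. reverse_plane_partition D T \<and> collapse k T = U \<and>
         (other m' \<and> steps ?as (height_list n D T (Suc k)) = expo m' k \<and> steps (height_list n D T (Suc k)) ?cs = expo m' (Suc k))}"
        unfolding S_def using wt by blast
      then show ?thesis
        using card_fiber[OF assms n U, where Q = "\<lambda>bs. other m' \<and> steps ?as bs = expo m' k \<and> steps bs ?cs = expo m' (Suc k)"]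
        by simp
    qed
    have "other (adj_swap k m) \<longleftrightarrow> other m"
      by (auto simp: other_def expo_adj_swap)
    then show ?thesis
      unfolding c using card_intermediate_sym[of ?as ?cs "expo m k" "expo m (Suc k)"]
        sorted_height_list[OF assms U(1)]
      by (cases "other m") (simp_all add: expo_adj_swap)
  qed
  then have "card (S m) = card (S (adj_swap k m))"
    unfolding card[of m, simplified] card[of "adj_swap k m", simplified] by (intro sum.cong) auto
  then show ?thesis by (simp add: dual_g_def S_def)
qed


section \<open>Symmetric functions and elimination of leading monomials\<close>

section \<open>Symmetric functions and leading terms\<close>

text \<open>Adjacent transpositions generate the finitary permutations of the variables, so
  invariance under them is symmetry; the degree bound separates symmetric functions from symmetric
  power series.\<close>

definition symmetric_functions :: "series set" where
  "symmetric_functions =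
     {f. (\<forall>k m. f (adj_swap k m) = f m) \<and> (\<exists>N. \<forall>m. f m \<noteq> 0 \<longrightarrow> monomial_degree m \<le> N)}"

lemma symmetric_functionsI:
  "(\<And>k m. f (adj_swap k m) = f m) \<Longrightarrow> (\<And>m. f m \<noteq> 0 \<Longrightarrow> monomial_degree m \<le> N) \<Longrightarrow>
    f \<in> symmetric_functions"
  unfolding symmetric_functions_def by blast

lemma symmetric_functions_swap: "f \<in> symmetric_functions \<Longrightarrow> f (adj_swap k m) = f m"
  unfolding symmetric_functions_def by blast

lemma symmetric_functions_bound:
  "f \<in> symmetric_functions \<Longrightarrow> \<exists>N. \<forall>m. f m \<noteq> 0 \<longrightarrow> monomial_degree m \<le> N"
  unfolding symmetric_functions_def by simp

lemma adj_swap_involution [simp]: "adj_swap k (adj_swap k m) = m"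
  by (rule poly_mapping_eqI) (simp add: expo_adj_swap)

lemma adj_swap_add: "adj_swap k (a + b) = adj_swap k a + adj_swap k b"
  by (rule poly_mapping_eqI) (simp add: expo_adj_swap lookup_add)

lemma monomial_degree_adj_swap [simp]: "monomial_degree (adj_swap k m) = monomial_degree m"
  unfolding monomial_degree_def
  by (rule sum.reindex_bij_witness[where i = "\<lambda>i. if i = k then Suc k else if i = Suc k then k else i"
        and j = "\<lambda>i. if i = k then Suc k else if i = Suc k then k else i"])
    (auto simp: expo_adj_swap in_keys_iff)

lemma zmodule_symmetric_functions: "zmodule symmetric_functions"
  unfolding zmodule_def
proof (intro conjI ballI allI)
  show "(\<lambda>_. 0) \<in> symmetric_functions"
    by (rule symmetric_functionsI) auto
next
  fix f g assume f: "f \<in> symmetric_functions" and g: "g \<in> symmetric_functions"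
  obtain N where "\<forall>m. f m \<noteq> 0 \<longrightarrow> monomial_degree m \<le> N"
    using symmetric_functions_bound[OF f] ..
  note N = this[rule_format]
  obtain M where "\<forall>m. g m \<noteq> 0 \<longrightarrow> monomial_degree m \<le> M"
    using symmetric_functions_bound[OF g] ..
  note M = this[rule_format]
  show "(\<lambda>x. f x + g x) \<in> symmetric_functions"
  proof (rule symmetric_functionsI[where N = "max N M"])
    fix m assume "f m + g m \<noteq> 0"
    then have "f m \<noteq> 0 \<or> g m \<noteq> 0" by auto
    then show "monomial_degree m \<le> max N M" using N M le_max_iff_disj by blast
  qed (simp add: symmetric_functions_swap f g)
next
  fix f c assume f: "f \<in> symmetric_functions"
  obtain N where "\<forall>m. f m \<noteq> 0 \<longrightarrow> monomial_degree m \<le> N"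
    using symmetric_functions_bound[OF f] ..
  note N = this[rule_format]
  show "(\<lambda>x. c * f x) \<in> symmetric_functions"
    by (rule symmetric_functionsI[where N = N]) (auto simp: symmetric_functions_swap f N)
qed

lemma conv_nonzero:
  assumes "monomials.conv f g m \<noteq> 0"
  obtains a b where "a + b = m" "f a \<noteq> 0" "g b \<noteq> 0"
proof -
  obtain x where "x \<in> monomials.factors m" "(case x of (a, b) \<Rightarrow> f a * g b) \<noteq> 0"
    using assms unfolding monomials.conv_def by (rule sum.not_neutral_contains_not_neutral)
  then show ?thesis
    using that by (auto simp: monomials.factors_def split: prod.splits)
qed

lemma symmetric_functions_conv:
  assumes "f \<in> symmetric_functions" "g \<in> symmetric_functions"
  shows "monomials.conv f g \<in> symmetric_functions"
proof -
  obtain N where "\<forall>m. f m \<noteq> 0 \<longrightarrow> monomial_degree m \<le> N"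
    using symmetric_functions_bound[OF assms(1)] ..
  note N = this[rule_format]
  obtain M where "\<forall>m. g m \<noteq> 0 \<longrightarrow> monomial_degree m \<le> M"
    using symmetric_functions_bound[OF assms(2)] ..
  note M = this[rule_format]
  show ?thesis
  proof (rule symmetric_functionsI[where N = "N + M"])
    fix k m
    show "monomials.conv f g (adj_swap k m) = monomials.conv f g m"
      unfolding monomials.conv_def monomials.factors_def
      by (rule sum.reindex_bij_witness[where i = "\<lambda>(a, b). (adj_swap k a, adj_swap k b)"
            and j = "\<lambda>(a, b). (adj_swap k a, adj_swap k b)"])
        (auto simp: symmetric_functions_swap assms simp flip: adj_swap_add)
  next
    fix m assume "monomials.conv f g m \<noteq> 0"
    then obtain a b where "a + b = m" "f a \<noteq> 0" "g b \<noteq> 0" by (rule conv_nonzero)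
    with N[of a] M[of b] show "monomial_degree m \<le> N + M"
      by (auto simp flip: \<open>a + b = m\<close>)
  qed
qed

lemma symmetric_functions_one: "basis_elem 0 \<in> symmetric_functions"
proof (rule symmetric_functionsI[where N = 0])
  have "adj_swap k m = 0 \<longleftrightarrow> m = 0" for k m
  proof -
    have "adj_swap k 0 = 0" for k by (rule poly_mapping_eqI) (simp add: expo_adj_swap)
    then show ?thesis by (metis adj_swap_involution)
  qed
  then show "basis_elem 0 (adj_swap k m) = basis_elem 0 m" for k m
    by (simp add: basis_elem_def)
qed (auto simp: basis_elem_def split: if_splits)

text \<open>Monomials are compared lexicographically, the exponent of \<open>x\<^sub>1\<close> counting first.\<close>

definition leading :: "series \<Rightarrow> monomial \<Rightarrow> bool" where
  "leading f m \<longleftrightarrow> f m = 1 \<and> (\<forall>m'. f m' \<noteq> 0 \<longrightarrow> m' \<le> m \<and> monomial_degree m' \<le> monomial_degree m)"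

text \<open>The lexicographic order is compatible with addition, so the exponent
  \<open>a + b\<close> arises from the two supports only as the sum of the two leading
  exponents.\<close>

lemma leading_conv:
  assumes "leading f a" "leading g b"
  shows "leading (monomials.conv f g) (a + b)"
  unfolding leading_def
proof (intro conjI allI impI)
  have "monomials.conv f g (a + b) = (\<Sum>(p, q)\<in>{(a, b)}. f p * g q)"
    unfolding monomials.conv_def
  proof (rule sum.mono_neutral_right[OF monomials.finite_factors'])
    show "\<forall>x\<in>monomials.factors (a + b) - {(a, b)}. (case x of (p, q) \<Rightarrow> f p * g q) = 0"
    proof (rule ballI, rule ccontr)
      fix x assume x: "x \<in> monomials.factors (a + b) - {(a, b)}" "(case x of (p, q) \<Rightarrow> f p * g q) \<noteq> 0"
      obtain p q where pq: "x = (p, q)" by fastforce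
      have "p \<le> a" "q \<le> b" "p + q = a + b"
        using x assms unfolding pq leading_def monomials.factors_def by auto
      then have "p = a" "q = b"
        using add_less_le_mono[of p a q b] add_le_less_mono[of p a q b] by (auto simp: order.order_iff_strict)
      with x pq show False by simp
    qed
  qed (auto simp: monomials.factors_def)
  then show "monomials.conv f g (a + b) = 1"
    using assms by (simp add: leading_def)
next
  fix m' assume "monomials.conv f g m' \<noteq> 0"
  then obtain p q where "p + q = m'" "f p \<noteq> 0" "g q \<noteq> 0" by (rule conv_nonzero)
  with assms show "m' \<le> a + b" "monomial_degree m' \<le> monomial_degree (a + b)"
    unfolding leading_def by (auto intro!: add_mono)
qed

lemma leading_one: "leading (basis_elem 0) 0"
  by (simp add: leading_def basis_elem_def)

lemma monomial_less_iff:
  "(a :: monomial) < b \<longleftrightarrow> (\<exists>k. expo a k < expo b k \<and> (\<forall>j<k. expo a j = expo b j))"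
  by (simp add: less_poly_mapping.rep_eq less_fun_def)

definition dominant :: "monomial \<Rightarrow> bool" where
  "dominant m \<longleftrightarrow> (\<forall>i. expo m (Suc i) \<le> expo m i)"

lemma dominant_mono: "dominant m \<Longrightarrow> i \<le> j \<Longrightarrow> expo m j \<le> expo m i"
  unfolding dominant_def by (rule lift_Suc_antimono_le[of "expo m"]) auto

lemma finite_monomials: "finite {m. mkeys m \<subseteq> {..<M} \<and> monomial_degree m \<le> N}"
proof (rule finite_subset[OF _ finite_dominated])
  show "{m. mkeys m \<subseteq> {..<M} \<and> monomial_degree m \<le> N} \<subseteq>
    {m. \<forall>k. expo m k \<le> expo (\<Sum>i<M. Poly_Mapping.single i N) k}"
  proof (rule subsetI, unfold mem_Collect_eq, rule allI)
    fix m k assume m: "mkeys m \<subseteq> {..<M} \<and> monomial_degree m \<le> N"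
    show "expo m k \<le> expo (\<Sum>i<M. Poly_Mapping.single i N) k"
    proof (cases "k \<in> mkeys m")
      case True
      then have "expo m k \<le> monomial_degree m"
        unfolding monomial_degree_def by (intro member_le_sum) auto
      moreover have "expo (\<Sum>i<M. Poly_Mapping.single i N) k = N"
        using True m by (auto simp: lookup_sum lookup_single when_def)
      ultimately show ?thesis using m by simp
    qed (simp add: in_keys_iff)
  qed
qed

text \<open>All variables before an occurring one occur too, so a dominant monomial of degree d
  involves only the first d variables. In particular there are finitely many dominant monomials of
  bounded degree.\<close>

lemma dominant_keys:
  assumes "dominant m"
  shows "mkeys m \<subseteq> {..<monomial_degree m}"
proof
  fix i assume "i \<in> mkeys m"
  then have pos: "0 < expo m j" if "j \<le> i" for j
    using dominant_mono[OF assms that] by (auto simp: in_keys_iff)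
  then have "{..i} \<subseteq> mkeys m" by (force simp: in_keys_iff)
  then have "(\<Sum>j\<le>i. expo m j) \<le> monomial_degree m"
    unfolding monomial_degree_def by (intro sum_mono2) auto
  moreover have "(\<Sum>j\<le>i. 1) \<le> (\<Sum>j\<le>i. expo m j)"
    by (rule sum_mono) (use pos in \<open>simp add: Suc_leI\<close>)
  ultimately show "i \<in> {..<monomial_degree m}" by simp
qed

lemma finite_dominant: "finite {m. dominant m \<and> monomial_degree m \<le> N}"
  by (rule finite_subset[OF _ finite_monomials[of N N]]) (use dominant_keys in fastforce)

text \<open>The lexicographically largest monomial of the support is dominant: otherwise swapping
  two neighbouring exponents in the wrong order would give a larger one with the same
  coefficient.\<close>

lemma exists_dominant:
  assumes f: "f \<in> symmetric_functions" and "f m \<noteq> 0"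
  obtains m' where "dominant m'" "f m' \<noteq> 0"
proof -
  \<comment> \<open>Restricting to the first \<open>M\<close> variables keeps the set finite; the
    swap used below moves a larger exponent to an earlier variable and so stays inside.\<close>
  define M where "M = Suc (Max (insert 0 (mkeys m)))"
  define S where "S = {m'. mkeys m' \<subseteq> {..<M} \<and> monomial_degree m' \<le> monomial_degree m} \<inter> {m'. f m' \<noteq> 0}"
  have fin: "finite S" unfolding S_def using finite_monomials by blast
  have "m \<in> S" using assms(2) by (auto simp: S_def M_def less_Suc_eq_le)
  then have Max: "Max S \<in> S" using fin Max_in by blast
  have "dominant (Max S)"
  proof (rule ccontr)
    assume "\<not> dominant (Max S)"
    then obtain k where k: "expo (Max S) k < expo (Max S) (Suc k)"
      by (auto simp: dominant_def not_le)
    then have "Max S < adj_swap k (Max S)"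
      unfolding monomial_less_iff by (intro exI[of _ k]) (auto simp: expo_adj_swap)
    moreover have "mkeys (adj_swap k (Max S)) \<subseteq> {..<M}"
    proof
      fix i assume i: "i \<in> mkeys (adj_swap k (Max S))"
      have sub: "mkeys (Max S) \<subseteq> {..<M}" using Max by (simp add: S_def)
      have "Suc k \<in> mkeys (Max S)" using k by (simp add: in_keys_iff)
      with sub have "k < M" by auto
      show "i \<in> {..<M}"
      proof (cases "i = k")
        case False
        then have "i \<in> mkeys (Max S) \<or> i = Suc k" using i by (auto simp: in_keys_iff expo_adj_swap)
        with sub \<open>Suc k \<in> mkeys (Max S)\<close> show ?thesis by blast
      qed (simp add: \<open>k < M\<close>)
    qed
    then have "adj_swap k (Max S) \<in> S"
      using Max by (simp add: S_def symmetric_functions_swap[OF f])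
    ultimately show False
      using Max_ge[OF fin] by (simp add: not_less[symmetric])
  qed
  with Max that show ?thesis by (auto simp: S_def)
qed

text \<open>Elimination of leading terms. \<open>S\<close> is a downward closed, finite set of
  dominant monomials containing the dominant support of \<open>f\<close>. Subtracting the right
  multiple of an element whose leading monomial is the largest member of \<open>S\<close> removes
  that member; the degree clause in \<open>leading\<close> keeps the degree bound, so no new
  dominant monomial enters from outside. When \<open>S\<close> is empty,
  \<open>exists_dominant\<close> leaves only zero.\<close>

lemma symmetric_functions_subset:
  assumes A: "zmodule A" "A \<subseteq> symmetric_functions"
    and lead: "\<And>m. dominant m \<Longrightarrow> \<exists>b\<in>A. leading b m"
  shows "symmetric_functions \<subseteq> A"
proof
  fix f assume f: "f \<in> symmetric_functions"
  obtain N where "\<forall>m. f m \<noteq> 0 \<longrightarrow> monomial_degree m \<le> N"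
    using symmetric_functions_bound[OF f] ..
  note N = this[rule_format]
  define Dom where "Dom = {m. dominant m \<and> monomial_degree m \<le> N}"
  have "f \<in> A"
    if "finite S" "S \<subseteq> Dom" "\<And>m s. m \<in> Dom \<Longrightarrow> s \<in> S \<Longrightarrow> m \<le> s \<Longrightarrow> m \<in> S"
      "f \<in> symmetric_functions" "\<And>m. f m \<noteq> 0 \<Longrightarrow> monomial_degree m \<le> N" "\<And>m. dominant m \<Longrightarrow> f m \<noteq> 0 \<Longrightarrow> m \<in> S"
    for S f
    using that
  proof (induction S arbitrary: f rule: finite_linorder_max_induct)
    case empty
    have "f m = 0" for m
      using exists_dominant[OF empty.prems(3), of m] empty.prems(5) by blast
    then have "f = (\<lambda>_. 0)" by blast
    with zmodule_zero[OF A(1)] show ?case by simp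
  next
    case (insert b S)
    have b: "dominant b" "monomial_degree b \<le> N"
      using insert.prems(1) by (auto simp: Dom_def)
    obtain l where l: "l \<in> A" "leading l b" using lead[OF b(1)] by blast
    define g where "g m = f m - f b * l m" for m
    have g': "g = (\<lambda>m. f m - f b * l m)" by (simp add: g_def fun_eq_iff)
    have gnz: "f m \<noteq> 0 \<or> l m \<noteq> 0" if "g m \<noteq> 0" for m using that by (auto simp: g_def)
    have "g \<in> A"
    proof (rule insert.IH)
      show "S \<subseteq> Dom" using insert.prems(1) by simp
      show "m \<in> S" if "m \<in> Dom" "s \<in> S" "m \<le> s" for m s
        using insert.prems(2)[OF that(1) _ that(3)] insert.hyps(2) that by fastforce
      show "g \<in> symmetric_functions"
        unfolding g' using A(2) l(1) insert.prems(3)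
        by (intro zmodule_diff[OF zmodule_symmetric_functions] zmodule_scale[OF zmodule_symmetric_functions]) auto
      show deg: "monomial_degree m \<le> N" if "g m \<noteq> 0" for m
        using gnz[OF that] insert.prems(4) l(2) b(2) unfolding leading_def by (meson le_trans)
      show "m \<in> S" if m: "dominant m" "g m \<noteq> 0" for m
      proof -
        have "m \<noteq> b" using m(2) l(2) by (auto simp: g_def leading_def)
        have "m \<in> insert b S"
        proof (cases "f m = 0")
          case True
          then have "m \<le> b" using gnz[OF m(2)] l(2) by (auto simp: leading_def)
          moreover have "m \<in> Dom" using deg[OF m(2)] m(1) by (simp add: Dom_def)
          ultimately show ?thesis using insert.prems(2) by blast
        qed (use insert.prems(5) m in blast)
        with \<open>m \<noteq> b\<close> show ?thesis by simp
      qed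
    qed
    then have "(\<lambda>m. g m + f b * l m) \<in> A"
      by (intro zmodule_add[OF A(1)] zmodule_scale[OF A(1)] l(1))
    then show ?case by (simp add: g_def)
  qed
  from this[of Dom f] finite_dominant[of N] f N show "f \<in> A"
    by (auto simp: Dom_def)
qed

text \<open>Distinct leading monomials imply linear independence: at the largest of them only one
  summand is nonzero.\<close>

lemma leading_sum_nonzero:
  assumes "finite I" "I \<noteq> {}" "inj_on L I" "\<And>i. i \<in> I \<Longrightarrow> c i \<noteq> 0" "\<And>i. i \<in> I \<Longrightarrow> leading (f i) (L i)"
  shows "\<exists>m. (\<Sum>i\<in>I. c i * f i m) \<noteq> 0"
proof -
  have "Max (L ` I) \<in> L ` I" using assms(1,2) by (intro Max_in) auto
  then obtain i where i: "i \<in> I" "L i = Max (L ` I)" by auto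
  have "c j * f j (L i) = (if j = i then c i else 0)" if "j \<in> I" for j
  proof (cases "j = i")
    case False
    have "L j \<le> L i" unfolding i(2) using assms(1) that by (intro Max_ge) auto
    moreover have "L j \<noteq> L i" using False assms(3) that i(1) by (auto dest: inj_onD)
    ultimately have "f j (L i) = 0"
      using assms(5)[OF that] unfolding leading_def by (meson leD order_le_imp_less_or_eq)
    with False show ?thesis by simp
  qed (use assms(5)[OF i(1)] in \<open>simp add: leading_def\<close>)
  then have "(\<Sum>j\<in>I. c j * f j (L i)) = (\<Sum>j\<in>I. if j = i then c i else 0)"
    by (intro sum.cong) auto
  also have "\<dots> = c i" using assms(1) i(1) by simp
  finally show ?thesis using assms(4)[OF i(1)] by auto
qed


section \<open>Leading monomials of g of a partition, and the carrier of \<open>MSym\<close>\<close>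

definition elementary_monomial :: "nat \<Rightarrow> monomial" where
  "elementary_monomial n = (\<Sum>i<n. Poly_Mapping.single i 1)"

lemma expo_elementary_monomial: "expo (elementary_monomial n) i = (if i < n then 1 else 0)"
  by (simp add: elementary_monomial_def lookup_sum lookup_single when_def)

lemma monomial_degree_sum: "finite I \<Longrightarrow> monomial_degree (\<Sum>i\<in>I. f i) = (\<Sum>i\<in>I. monomial_degree (f i))"
  by (induction I rule: finite_induct) auto

lemma monomial_degree_elementary [simp]: "monomial_degree (elementary_monomial n) = n"
  by (simp add: elementary_monomial_def monomial_degree_sum)

text \<open>A squarefree monomial that beats x_1 ... x_n must agree with it in the first n variables
  and contain a further one, so its degree exceeds n.\<close>

lemma le_elementary_monomial:
  assumes "\<And>i. expo p i \<le> 1" "monomial_degree p \<le> n"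
  shows "p \<le> elementary_monomial n"
proof (rule ccontr)
  assume "\<not> p \<le> elementary_monomial n"
  then have "elementary_monomial n < p" by simp
  then obtain k where k: "expo (elementary_monomial n) k < expo p k"
      "\<And>j. j < k \<Longrightarrow> expo (elementary_monomial n) j = expo p j"
    unfolding monomial_less_iff by blast
  then have kn: "n \<le> k" "expo p k = 1"
    using assms(1)[of k] by (auto simp: expo_elementary_monomial split: if_splits)
  have "expo p j = 1" if "j < n" for j
    using k(2)[of j] that kn(1) by (simp add: expo_elementary_monomial)
  then have "(\<Sum>j\<in>insert k {..<n}. expo p j) = Suc n"
    using kn by simp
  moreover have "(\<Sum>j\<in>insert k {..<n}. expo p j) \<le> monomial_degree p"
    by (subst monomial_degree_superset[of "mkeys p \<union> insert k {..<n}"]) (auto intro!: sum_mono2)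
  ultimately show False using assms(2) by simp
qed

definition partition_monomial :: "nat list \<Rightarrow> monomial" where
  "partition_monomial lam = (\<Sum>i<length lam. Poly_Mapping.single i (lam ! i))"

lemma expo_partition_monomial: "expo (partition_monomial lam) i = (if i < length lam then lam ! i else 0)"
  by (simp add: partition_monomial_def lookup_sum lookup_single when_def)

lemma dominant_partition:
  assumes "dominant m"
  obtains lam where "is_partition lam" "m = partition_monomial lam"
proof -
  have "mkeys m = {..<card (mkeys m)}"
  proof (rule initial_segment)
    fix r r' assume "r \<in> mkeys m" "r' \<le> r"
    then show "r' \<in> mkeys m" using dominant_mono[OF assms, of r' r] by (auto simp: in_keys_iff)
  qed simp
  then obtain n where n: "mkeys m = {..<n}" by blast
  have nz: "expo m i \<noteq> 0 \<longleftrightarrow> i < n" for i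
    using in_keys_iff[of i m] unfolding n by simp
  let ?lam = "map (expo m) [0..<n]"
  have "0 \<notin> set ?lam"
  proof
    assume "0 \<in> set ?lam"
    then obtain i where "i < n" "expo m i = 0" by auto
    with nz[of i] show False by simp
  qed
  then have "is_partition ?lam"
    using dominant_mono[OF assms] by (simp add: is_partition_def sorted_wrt_iff_nth_less)
  moreover have "m = partition_monomial ?lam"
    by (rule poly_mapping_eqI) (simp add: expo_partition_monomial, use nz in blast)
  ultimately show ?thesis by (rule that)
qed

text \<open>The weight of a filling is the product over its columns of the squarefree monomials of
  the entries occurring there. For a column of length \<open>len c\<close> that monomial is at most
  x_1 ... x_(len c), and the product of these bounds is x^\<lambda>. Equality forces every column to
  read 1, 2, 3, ..., so exactly one filling attains it.\<close>

lemma leading_dual_g: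
  assumes lam: "is_partition lam"
  shows "leading (dual_g (diagram lam)) (partition_monomial lam)"
proof -
  let ?D = "diagram lam"
  note fin = finite_diagram[of lam] and yD = young_diagram[OF lam]
  define n where "n = Max (insert 0 (set lam))"
  have n: "c < n" if "(r, c) \<in> ?D" for r c
  proof -
    have "c < lam ! r" "lam ! r \<in> set lam" using that by (auto simp: diagram_def)
    then show ?thesis unfolding n_def by (meson List.finite_set Max_ge finite_insert insertI2 less_le_trans)
  qed
  define len where "len c = card {r. (r, c) \<in> ?D}" for c
  have finc: "finite {r. (r, c) \<in> ?D}" for c
    by (rule finite_subset[of _ "{..<length lam}"]) (auto simp: diagram_def)
  have len: "(r, c) \<in> ?D \<longleftrightarrow> r < len c" for r c
  proof -
    have "{r. (r, c) \<in> ?D} = {..<len c}"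
      unfolding len_def by (rule initial_segment[OF finc]) (use youngD[OF yD] in blast)
    then show ?thesis by blast
  qed
  define col where "col T c = (\<Sum>v\<in>{v. \<exists>r. (r, c) \<in> ?D \<and> T (r, c) = Suc v}. Poly_Mapping.single v (1::nat))"
    for T :: "nat \<times> nat \<Rightarrow> nat" and c
  have finv: "finite {v. \<exists>r. (r, c) \<in> ?D \<and> T (r, c) = Suc v}" for T :: "nat \<times> nat \<Rightarrow> nat" and c
    by (rule finite_subset[OF _ finite_imageI[OF finc[of c], of "\<lambda>r. T (r, c) - 1"]])
      (auto intro: rev_image_eqI)
  have expo_col: "expo (col T c) v = (if \<exists>r. (r, c) \<in> ?D \<and> T (r, c) = Suc v then 1 else 0)" for T c v
    using finv[of c T] by (auto simp: col_def lookup_sum lookup_single when_def)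
  have deg_col: "monomial_degree (col T c) \<le> len c" for T c
  proof -
    have "monomial_degree (col T c) = card {v. \<exists>r. (r, c) \<in> ?D \<and> T (r, c) = Suc v}"
      using finv[of c T] by (simp add: col_def monomial_degree_sum)
    also have "\<dots> \<le> card ((\<lambda>r. T (r, c) - 1) ` {r. (r, c) \<in> ?D})"
      by (rule card_mono[OF finite_imageI[OF finc]]) (auto intro: rev_image_eqI)
    also have "\<dots> \<le> len c"
      unfolding len_def by (rule card_image_le[OF finc])
    finally show ?thesis .
  qed
  have col_le: "col T c \<le> elementary_monomial (len c)" for T c
    by (rule le_elementary_monomial[OF _ deg_col]) (simp add: expo_col)
  have lam_eq: "partition_monomial lam = (\<Sum>c<n. elementary_monomial (len c))"
  proof (rule poly_mapping_eqI)
    fix i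
    have "expo (\<Sum>c<n. elementary_monomial (len c)) i = card {c. (i, c) \<in> ?D}"
      using n by (auto simp: lookup_sum expo_elementary_monomial len[symmetric] sum.If_cases intro!: arg_cong[where f = card])
    also have "{c. (i, c) \<in> ?D} = (if i < length lam then {..<lam ! i} else {})"
      by (auto simp: diagram_def)
    finally show "expo (partition_monomial lam) i = expo (\<Sum>c<n. elementary_monomial (len c)) i"
      by (simp add: expo_partition_monomial)
  qed
  have wt: "m = (\<Sum>c<n. col T c)" if "has_weight ?D T m" for T m
  proof (rule poly_mapping_eqI)
    fix v
    have "expo (\<Sum>c<n. col T c) v = card {c. \<exists>r. (r, c) \<in> ?D \<and> T (r, c) = Suc v}"
      using n by (auto simp: lookup_sum expo_col sum.If_cases intro!: arg_cong[where f = card])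
    with that show "expo m v = expo (\<Sum>c<n. col T c) v" by (simp add: has_weight_def)
  qed
  define T0 where "T0 = (\<lambda>(r, c). if (r, c) \<in> ?D then Suc r else 0)"
  have T0: "reverse_plane_partition ?D T0"
    by (auto simp: reverse_plane_partition_def T0_def)
  have wt0: "has_weight ?D T0 (partition_monomial lam)"
    unfolding has_weight_def
  proof
    fix v
    have "{c. \<exists>r. (r, c) \<in> ?D \<and> T0 (r, c) = Suc v} = (if v < length lam then {..<lam ! v} else {})"
      by (auto simp: T0_def diagram_def split: if_splits)
    then show "expo (partition_monomial lam) v = card {c. \<exists>r. (r, c) \<in> ?D \<and> T0 (r, c) = Suc v}"
      by (simp add: expo_partition_monomial)
  qed
  have uniq: "T = T0" if T: "reverse_plane_partition ?D T" "has_weight ?D T (partition_monomial lam)" for T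
  proof
    fix p :: "nat \<times> nat"
    obtain r c where p: "p = (r, c)" by fastforce
    show "T p = T0 p"
    proof (cases "p \<in> ?D")
      case True
      then have c: "c < n" "r < len c" using n len p by auto
      have "(\<Sum>c<n. col T c) = (\<Sum>c<n. elementary_monomial (len c))"
        using wt[OF T(2)] lam_eq by simp
      \<comment> \<open>Termwise bounds whose sums agree are all attained.\<close>
      then have "col T c = elementary_monomial (len c)"
        by (rule sum_mono_inv) (use c col_le in auto)
      then have "expo (col T c) v = expo (elementary_monomial (len c)) v" for v by simp
      then have cont: "(\<exists>r. r < len c \<and> T (r, c) = Suc v) \<longleftrightarrow> v < len c" for v
        unfolding expo_col expo_elementary_monomial len by (metis zero_neq_one)
      let ?l = "map (\<lambda>r. T (r, c) - 1) [0..<len c]"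
      have pos: "0 < T (r, c)" if "r < len c" for r
        using rppD(1)[OF T(1), of "(r, c)"] that len by blast
      have set: "set ?l = set [0..<len c]"
      proof (rule Set.set_eqI)
        fix v
        have "v \<in> set ?l \<longleftrightarrow> (\<exists>r. r < len c \<and> v = T (r, c) - 1)" by auto
        also have "\<dots> \<longleftrightarrow> (\<exists>r. r < len c \<and> T (r, c) = Suc v)"
        proof (intro ex_cong1 conj_cong refl)
          fix r assume "r < len c"
          from pos[OF this] show "v = T (r, c) - 1 \<longleftrightarrow> T (r, c) = Suc v" by auto
        qed
        finally show "v \<in> set ?l \<longleftrightarrow> v \<in> set [0..<len c]" using cont by auto
      qed
      moreover have "distinct ?l"
        by (intro card_distinct) (simp only: set, simp)
      moreover have "sorted ?l"
        unfolding sorted_iff_nth_mono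
        using rppD(4)[OF T(1)] len by (auto intro!: diff_le_mono)
      ultimately have "?l = [0..<len c]"
        by (intro sorted_distinct_set_unique) auto
      then have "?l ! r = r" using c(2) by simp
      then have "T (r, c) = Suc r" using c(2) pos[of r] by simp
      then show ?thesis using True by (simp add: T0_def p)
    qed (use rppD(2)[OF T(1)] in \<open>simp add: T0_def p\<close>)
  qed
  show ?thesis
    unfolding leading_def
  proof (intro conjI allI impI)
    have "{T. reverse_plane_partition ?D T \<and> has_weight ?D T (partition_monomial lam)} = {T0}"
      using uniq T0 wt0 by blast
    then show "dual_g ?D (partition_monomial lam) = 1" by (simp add: dual_g_def)
  next
    fix m assume "dual_g ?D m \<noteq> 0"
    then have "{T. reverse_plane_partition ?D T \<and> has_weight ?D T m} \<noteq> {}"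
      unfolding dual_g_def by (metis card.empty of_nat_0)
    then obtain T where "has_weight ?D T m" by blast
    from wt[OF this] have m: "m = (\<Sum>c<n. col T c)" .
    show "m \<le> partition_monomial lam"
      unfolding m lam_eq by (rule sum_mono) (rule col_le)
    show "monomial_degree m \<le> monomial_degree (partition_monomial lam)"
      unfolding m lam_eq by (simp add: monomial_degree_sum sum_mono deg_col)
  qed
qed

lemma dual_g_diagram_symmetric:
  assumes "is_partition lam"
  shows "dual_g (diagram lam) \<in> symmetric_functions"
  using leading_dual_g[OF assms] unfolding leading_def
  by (intro symmetric_functionsI dual_g_swap young_diagram assms) blast

text \<open>The g of partitions are symmetric and their leading monomials are all the dominant ones,
  so elimination applies. Closure of \<open>MSym\<close> under products is then inherited from
  symmetric functions.\<close>

lemma carrier_MSym: "carrier MSym = symmetric_functions"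
proof -
  let ?S = "{dual_g (diagram lam) | lam. is_partition lam}"
  have "zspan ?S \<subseteq> symmetric_functions"
    by (rule zspan_subset[OF zmodule_symmetric_functions]) (auto simp: dual_g_diagram_symmetric)
  moreover from this have "symmetric_functions \<subseteq> zspan ?S"
  proof (rule symmetric_functions_subset[OF zmodule_zspan])
    fix m assume "dominant m"
    then obtain lam where "is_partition lam" "m = partition_monomial lam"
      by (rule dominant_partition)
    then show "\<exists>b\<in>zspan ?S. leading b m"
      using leading_dual_g[of lam] zspan_base[of "dual_g (diagram lam)" ?S] by blast
  qed
  ultimately show ?thesis by (simp add: MSym_def)
qed

lemma zmodule_MSym: "zmodule (carrier MSym)"
  unfolding carrier_MSym by (rule zmodule_symmetric_functions)

lemma conv_one_monomials: "monomials.conv f (basis_elem 0) = f" "monomials.conv (basis_elem 0) f = f"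
  by (auto simp: basis_elem_def monomials.conv_one_right monomials.conv_one_left fun_eq_iff)

lemma cring_MSym: "cring MSym"
proof (rule cringI)
  show "abelian_group MSym"
    by (rule pointwise_abelian_group[OF zmodule_MSym]) simp_all
  show "comm_monoid MSym"
  proof (rule comm_monoidI)
    show "x \<otimes>\<^bsub>MSym\<^esub> y \<otimes>\<^bsub>MSym\<^esub> z = x \<otimes>\<^bsub>MSym\<^esub> (y \<otimes>\<^bsub>MSym\<^esub> z)" for x y z
      unfolding mult_MSym by (intro ext monomials.conv_assoc) simp
    show "x \<otimes>\<^bsub>MSym\<^esub> y = y \<otimes>\<^bsub>MSym\<^esub> x" for x y
      unfolding mult_MSym by (rule conv_monomials_commute)
  qed (simp_all add: carrier_MSym mult_MSym symmetric_functions_conv symmetric_functions_one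
        conv_one_monomials)
  show "(x \<oplus>\<^bsub>MSym\<^esub> y) \<otimes>\<^bsub>MSym\<^esub> z = x \<otimes>\<^bsub>MSym\<^esub> z \<oplus>\<^bsub>MSym\<^esub> y \<otimes>\<^bsub>MSym\<^esub> z" for x y z
    unfolding mult_MSym MSym_simps by (intro ext monomials.conv_add_left)
qed


section \<open>Ribbon fillings as lists of rows, and their product rule\<close>

section \<open>Ribbons\<close>

text \<open>
  A reverse plane partition of a ribbon is encoded by the list of its rows, from the top row
  down, with entries lowered by one so that they are variable indices.  The parts \<open>ks\<close> are
  listed from the top row down as well, so the shape is \<open>ribbon (rev ks)\<close>.
\<close>

definition row_monomial :: "nat list \<Rightarrow> monomial" where
  "row_monomial \<rho> = (\<Sum>v\<leftarrow>\<rho>. Poly_Mapping.single v 1)"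

lemma row_monomial_simps [simp]:
  "row_monomial [] = 0" "row_monomial (v # \<rho>) = Poly_Mapping.single v 1 + row_monomial \<rho>"
  "row_monomial (\<rho> @ \<sigma>) = row_monomial \<rho> + row_monomial \<sigma>"
  by (simp_all add: row_monomial_def)

lemma expo_row_monomial: "expo (row_monomial \<rho>) v = count_list \<rho> v"
  by (induction \<rho>) (auto simp: lookup_add lookup_single when_def)

lemma monomial_degree_row [simp]: "monomial_degree (row_monomial \<rho>) = length \<rho>"
  by (induction \<rho>) auto

fun fillings :: "nat list \<Rightarrow> nat list list set" where
  "fillings [] = {[]}"
| "fillings (k # ks) = {\<rho> # R | \<rho> R. R \<in> fillings ks \<and> length \<rho> = k \<and> sorted \<rho> \<and>
      (R \<noteq> [] \<longrightarrow> hd \<rho> \<le> last (hd R))}"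

text \<open>
  The first entry of a row lies above the last entry of the next row, in the same column, and
  does not contribute if the two agree.
\<close>

fun filling_weight :: "nat list list \<Rightarrow> monomial" where
  "filling_weight [] = 0"
| "filling_weight (\<rho> # R) =
     (if R \<noteq> [] \<and> hd \<rho> = last (hd R) then row_monomial (tl \<rho>) else row_monomial \<rho>) + filling_weight R"

lemma fillings_Cons_iff: "\<rho> # R \<in> fillings (k # ks) \<longleftrightarrow>
    R \<in> fillings ks \<and> length \<rho> = k \<and> sorted \<rho> \<and> (R \<noteq> [] \<longrightarrow> hd \<rho> \<le> last (hd R))"
  by simp

lemma filling_weight_append:
  assumes "\<rho> \<noteq> []"
  shows "filling_weight ((\<rho> @ \<tau>) # R) = filling_weight (\<rho> # R) + row_monomial \<tau>"
  using assms by (simp add: ac_simps)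

text \<open>Equal entries in the common column of two rows count once, so joining the rows and
  keeping the shared entry once preserves the weight. This is the source of the parts
  \<open>j + k - 1\<close>.\<close>

lemma filling_weight_equal:
  assumes "\<rho> \<noteq> []"
  shows "filling_weight ((last \<rho> # \<tau>) # \<rho> # R) = filling_weight ((\<rho> @ \<tau>) # R)"
  unfolding filling_weight_append[OF assms] by (subst filling_weight.simps) (simp add: ac_simps del: filling_weight.simps)

lemma fillings_length: "R \<in> fillings ks \<Longrightarrow> map length R = ks"
proof (induction ks arbitrary: R)
  case (Cons k ks)
  then obtain \<rho> R' where "R = \<rho> # R'" "R' \<in> fillings ks" "length \<rho> = k" by auto
  with Cons.IH[of R'] show ?case by simp
qed simp

lemma fillings_nonempty: "R \<in> fillings ks \<Longrightarrow> R = [] \<longleftrightarrow> ks = []"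
  by (cases ks) auto

text \<open>An entry omitted from the weight of its row equals an entry of the next row, so it is
  recorded there or further down.\<close>

lemma letters_subset_keys:
  assumes "R \<in> fillings ks" "0 \<notin> set ks"
  shows "(\<Union>\<rho>\<in>set R. set \<rho>) \<subseteq> mkeys (filling_weight R)"
  using assms
proof (induction ks arbitrary: R)
  case (Cons k ks)
  then obtain \<rho> R' where R: "R = \<rho> # R'" "R' \<in> fillings ks" "length \<rho> = k" by auto
  have IH: "(\<Union>\<rho>\<in>set R'. set \<rho>) \<subseteq> mkeys (filling_weight R')"
    using Cons R by simp
  have row: "set \<sigma> \<subseteq> mkeys (row_monomial \<sigma>)" for \<sigma>
    by (auto simp: in_keys_iff expo_row_monomial count_list_0_iff)
  have add: "mkeys (a + b) = mkeys a \<union> mkeys b" for a b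
    by (auto simp: in_keys_iff lookup_add)
  have "\<rho> \<noteq> []" using R Cons.prems by auto
  show ?case
  proof (cases "R' \<noteq> [] \<and> hd \<rho> = last (hd R')")
    case True
    have "length (hd R') \<in> set ks"
      using True fillings_length[OF R(2)] by (cases R') auto
    then have "hd R' \<noteq> []" using Cons.prems by auto
    then have "hd \<rho> \<in> (\<Union>\<rho>\<in>set R'. set \<rho>)" using True by (auto intro!: bexI[of _ "hd R'"])
    moreover have "set \<rho> = insert (hd \<rho>) (set (tl \<rho>))" using \<open>\<rho> \<noteq> []\<close> by (cases \<rho>) auto
    ultimately show ?thesis
      using True IH row[of "tl \<rho>"] by (auto simp: R(1) add)
  next
    case False
    have "filling_weight R = row_monomial \<rho> + filling_weight R'"
      unfolding R(1) filling_weight.simps using False by (simp only: if_False)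
    with IH row[of \<rho>] show ?thesis by (auto simp: R(1) add)
  qed
qed simp

lemma finite_fillings:
  assumes "0 \<notin> set ks"
  shows "finite {R \<in> fillings ks. filling_weight R = m}"
proof (rule finite_subset)
  let ?L = "{\<rho>. set \<rho> \<subseteq> mkeys m \<and> length \<rho> \<le> sum_list ks}"
  show "{R \<in> fillings ks. filling_weight R = m} \<subseteq> {R. set R \<subseteq> ?L \<and> length R = length ks}"
  proof (rule subsetI, unfold mem_Collect_eq, elim conjE, intro conjI subsetI)
    fix R assume R: "R \<in> fillings ks" "filling_weight R = m"
    note len = fillings_length[OF R(1)]
    show "length R = length ks" using arg_cong[OF len, of length] by simp
    fix \<rho> assume \<rho>: "\<rho> \<in> set R"
    then have "length \<rho> \<in> set ks" using len by auto
    then have "length \<rho> \<le> sum_list ks" by (intro member_le_sum_list) auto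
    moreover have "set \<rho> \<subseteq> mkeys m"
      using letters_subset_keys[OF R(1) assms] \<rho> R(2) by blast
    ultimately show "\<rho> \<in> ?L" by simp
  qed
  show "finite {R. set R \<subseteq> ?L \<and> length R = length ks}"
    by (intro finite_lists_length_eq finite_lists_length_le finite_keys)
qed

definition filling_count :: "nat list \<Rightarrow> series" where
  "filling_count ks m = int (card {R \<in> fillings ks. filling_weight R = m})"

lemma sorted_append_last_hd:
  fixes xs ys :: "nat list"
  assumes "sorted xs" "sorted ys" "xs \<noteq> []" "ys \<noteq> []" "last xs \<le> hd ys"
  shows "sorted (xs @ ys)"
proof -
  obtain us u where "xs = us @ [u]" using assms(3) by (metis append_butlast_last_id)
  moreover obtain v vs where "ys = v # vs" using assms(4) by (cases ys) auto
  ultimately show ?thesis using assms(1,2,5) by (fastforce simp: sorted_append)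
qed

text \<open>Take a filling with top row \<open>\<rho>\<close> of length \<open>j\<close> and a
  separate increasing row \<open>\<tau>\<close> of length \<open>k\<close>. If
  \<open>last \<rho> \<le> hd \<tau>\<close>, the rows join to one of length \<open>j + k\<close>.
  Otherwise \<open>\<tau>\<close> can be placed on top, which yields the fillings with strict
  inequality in the common column (\<open>?Y1\<close>). Those with equality there
  (\<open>?Y2\<close>) are missing; they merge to a top row of length \<open>j + k - 1\<close>, the
  second term on the left.\<close>

lemma filling_count_rec:
  assumes "0 \<notin> set ks" "0 < j" "0 < k"
  shows "monomials.conv (filling_count (j # ks)) (filling_count [k]) m + filling_count ((j + k - 1) # ks) m =
    filling_count ((j + k) # ks) m + filling_count (k # j # ks) m"
proof -
  define Z where "Z = {(S, \<tau>). S \<in> fillings (j # ks) \<and> length \<tau> = k \<and> sorted \<tau> \<and>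
    filling_weight S + row_monomial \<tau> = m}"
  define Y where "Y = {R \<in> fillings (k # j # ks). filling_weight R = m}"
  define A where "A a = {R \<in> fillings (j # ks). filling_weight R = a}" for a
  define B where "B b = {R \<in> fillings [k]. filling_weight R = b}" for b
  have fin: "finite (A a)" "finite (B b)" "finite Y" for a b
    unfolding A_def B_def Y_def by (rule finite_fillings; use assms in simp)+
  have Z_eq: "bij_betw (\<lambda>(S, R). (S, hd R)) (\<Union>x\<in>monomials.factors m. A (fst x) \<times> B (snd x)) Z"
    by (rule bij_betw_byWitness[where f' = "\<lambda>(S, \<tau>). (S, [\<tau>])"])
      (auto simp: A_def B_def Z_def monomials.factors_def)
  have fU: "finite (\<Union>x\<in>monomials.factors m. A (fst x) \<times> B (snd x))"
    using fin monomials.finite_factors'[of m] by auto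
  have finZ: "finite Z" using bij_betw_finite[OF Z_eq] fU by simp
  have "int (card Z) = int (card (\<Union>x\<in>monomials.factors m. A (fst x) \<times> B (snd x)))"
    using bij_betw_same_card[OF Z_eq] by simp
  also have "\<dots> = int (\<Sum>x\<in>monomials.factors m. card (A (fst x) \<times> B (snd x)))"
  proof (subst card_UN_disjoint)
    show "finite (monomials.factors m)" by (simp add: monomials.finite_factors')
    show "\<forall>i\<in>monomials.factors m. finite (A (fst i) \<times> B (snd i))" using fin by simp
    show "\<forall>i\<in>monomials.factors m. \<forall>j\<in>monomials.factors m. i \<noteq> j \<longrightarrow>
        A (fst i) \<times> B (snd i) \<inter> A (fst j) \<times> B (snd j) = {}"
      by (auto simp: A_def B_def)
  qed simp
  also have "\<dots> = monomials.conv (filling_count (j # ks)) (filling_count [k]) m"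
    by (simp add: monomials.conv_def filling_count_def A_def B_def case_prod_beta card_cartesian_product)
  finally have cZ: "monomials.conv (filling_count (j # ks)) (filling_count [k]) m = int (card Z)" ..

  let ?Z1 = "{(S, \<tau>) \<in> Z. last (hd S) \<le> hd \<tau>}" and ?Z2 = "{(S, \<tau>) \<in> Z. hd \<tau> < last (hd S)}"
  let ?Y1 = "{R \<in> Y. hd (hd R) < last (hd (tl R))}" and ?Y2 = "{R \<in> Y. hd (hd R) = last (hd (tl R))}"
  have "Z = ?Z1 \<union> ?Z2" by auto
  then have cardZ: "card Z = card ?Z1 + card ?Z2"
    using card_Un_disjoint[of ?Z1 ?Z2] finZ by (metis (no_types, lifting) Un_infinite disjoint_iff finite_Un
        mem_Collect_eq not_le case_prodE case_prodD)
  have cardY: "card Y = card ?Y1 + card ?Y2"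
  proof -
    have "hd (hd R) \<le> last (hd (tl R))" if "R \<in> Y" for R using that by (auto simp: Y_def)
    then have "Y = ?Y1 \<union> ?Y2" by (auto simp: order.order_iff_strict)
    moreover have "?Y1 \<inter> ?Y2 = {}" by auto
    ultimately show ?thesis using card_Un_disjoint[of ?Y1 ?Y2] fin(3) by (metis (no_types, lifting) finite_Un)
  qed
  have b1: "bij_betw (\<lambda>(S, \<tau>). (hd S @ \<tau>) # tl S) ?Z1 {R \<in> fillings ((j + k) # ks). filling_weight R = m}"
  proof (rule bij_betw_byWitness[where f' = "\<lambda>R. (take j (hd R) # tl R, drop j (hd R))"])
    show "\<forall>a\<in>?Z1. (\<lambda>R. (take j (hd R) # tl R, drop j (hd R))) ((\<lambda>(S, \<tau>). (hd S @ \<tau>) # tl S) a) = a"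
      by (auto simp: Z_def)
    show "\<forall>a\<in>{R \<in> fillings ((j + k) # ks). filling_weight R = m}.
        (\<lambda>(S, \<tau>). (hd S @ \<tau>) # tl S) ((\<lambda>R. (take j (hd R) # tl R, drop j (hd R))) a) = a"
      by auto
    show "(\<lambda>(S, \<tau>). (hd S @ \<tau>) # tl S) ` ?Z1 \<subseteq> {R \<in> fillings ((j + k) # ks). filling_weight R = m}"
    proof (rule image_subsetI)
      fix x assume "x \<in> ?Z1"
      then obtain \<rho> R \<tau> where x: "x = (\<rho> # R, \<tau>)" "R \<in> fillings ks" "length \<rho> = j" "sorted \<rho>"
        "R \<noteq> [] \<longrightarrow> hd \<rho> \<le> last (hd R)" "length \<tau> = k" "sorted \<tau>"
        "filling_weight (\<rho> # R) + row_monomial \<tau> = m" "last \<rho> \<le> hd \<tau>"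
        by (auto simp: Z_def)
      have ne: "\<rho> \<noteq> []" "\<tau> \<noteq> []" using x assms by auto
      have "sorted (\<rho> @ \<tau>)"
        using x ne by (intro sorted_append_last_hd) auto
      then show "(\<lambda>(S, \<tau>). (hd S @ \<tau>) # tl S) x \<in> {R \<in> fillings ((j + k) # ks). filling_weight R = m}"
        using x(2,3,5,6,8) ne unfolding x(1) prod.case mem_Collect_eq list.sel fillings_Cons_iff
        by (simp only: filling_weight_append length_append hd_append2 simp_thms)
    qed
    show "(\<lambda>R. (take j (hd R) # tl R, drop j (hd R))) ` {R \<in> fillings ((j + k) # ks). filling_weight R = m} \<subseteq> ?Z1"
    proof (rule image_subsetI)
      fix x assume "x \<in> {R \<in> fillings ((j + k) # ks). filling_weight R = m}"
      then obtain \<sigma> R where x: "x = \<sigma> # R" "R \<in> fillings ks" "length \<sigma> = j + k" "sorted \<sigma>"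
        "R \<noteq> [] \<longrightarrow> hd \<sigma> \<le> last (hd R)" "filling_weight (\<sigma> # R) = m" by auto
      define \<rho> \<tau> where "\<rho> = take j \<sigma>" and "\<tau> = drop j \<sigma>"
      have \<sigma>: "\<sigma> = \<rho> @ \<tau>" "length \<rho> = j" "length \<tau> = k" using x by (auto simp: \<rho>_def \<tau>_def)
      have ne: "\<rho> \<noteq> []" "\<tau> \<noteq> []" using \<sigma> assms by auto
      have "last \<rho> \<le> hd \<tau>" "sorted \<rho>" "sorted \<tau>"
        using x(4) ne unfolding \<sigma>(1) sorted_append by auto
      moreover have "filling_weight (\<rho> # R) + row_monomial \<tau> = m"
        using x(6) unfolding \<sigma>(1) filling_weight_append[OF ne(1)] .
      moreover have "R \<noteq> [] \<longrightarrow> hd \<rho> \<le> last (hd R)"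
        using x(5) ne(1) by (simp add: \<sigma>(1))
      moreover have "(\<lambda>R. (take j (hd R) # tl R, drop j (hd R))) x = (\<rho> # R, \<tau>)"
        by (simp add: x(1) \<rho>_def \<tau>_def)
      ultimately show "(\<lambda>R. (take j (hd R) # tl R, drop j (hd R))) x \<in> ?Z1"
        using x(2) \<sigma>(2,3) by (simp add: Z_def del: filling_weight.simps)
    qed
  qed
  have b2: "bij_betw (\<lambda>(S, \<tau>). \<tau> # S) ?Z2 ?Y1"
  proof (rule bij_betw_byWitness[where f' = "\<lambda>R. (tl R, hd R)"])
    show "(\<lambda>(S, \<tau>). \<tau> # S) ` ?Z2 \<subseteq> ?Y1"
      by (auto simp: Z_def Y_def ac_simps)
    show "(\<lambda>R. (tl R, hd R)) ` ?Y1 \<subseteq> ?Z2"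
      by (auto simp: Z_def Y_def ac_simps)
  qed (auto simp: Y_def)
  \<comment> \<open>The inverse cuts the merged row after \<open>j\<close> entries and repeats the
    last of these as the first entry of the upper row.\<close>
  have b3: "bij_betw (\<lambda>R. (hd (tl R) @ tl (hd R)) # tl (tl R)) ?Y2
      {R \<in> fillings ((j + k - 1) # ks). filling_weight R = m}"
  proof (rule bij_betw_byWitness[where
        f' = "\<lambda>R. (last (take j (hd R)) # drop j (hd R)) # take j (hd R) # tl R"])
    show "\<forall>R\<in>?Y2. (\<lambda>R. (last (take j (hd R)) # drop j (hd R)) # take j (hd R) # tl R)
        ((\<lambda>R. (hd (tl R) @ tl (hd R)) # tl (tl R)) R) = R"
    proof
      fix x assume "x \<in> ?Y2"
      then obtain \<tau> \<rho> R where "x = \<tau> # \<rho> # R" "length \<rho> = j" "length \<tau> = k" "hd \<tau> = last \<rho>"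
        by (auto simp: Y_def)
      then show "(\<lambda>R. (last (take j (hd R)) # drop j (hd R)) # take j (hd R) # tl R)
        ((\<lambda>R. (hd (tl R) @ tl (hd R)) # tl (tl R)) x) = x"
        using assms(3) by (cases \<tau>) auto
    qed
    show "\<forall>R\<in>{R \<in> fillings ((j + k - 1) # ks). filling_weight R = m}. (\<lambda>R. (hd (tl R) @ tl (hd R)) # tl (tl R))
       ((\<lambda>R. (last (take j (hd R)) # drop j (hd R)) # take j (hd R) # tl R) R) = R"
      by auto
    show "(\<lambda>R. (hd (tl R) @ tl (hd R)) # tl (tl R)) ` ?Y2 \<subseteq> {R \<in> fillings ((j + k - 1) # ks). filling_weight R = m}"
    proof (rule image_subsetI)
      fix x assume "x \<in> ?Y2"
      then obtain \<tau> \<rho> R where x: "x = \<tau> # \<rho> # R" "R \<in> fillings ks" "length \<rho> = j" "sorted \<rho>"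
        "R \<noteq> [] \<longrightarrow> hd \<rho> \<le> last (hd R)" "length \<tau> = k" "sorted \<tau>" "hd \<tau> = last \<rho>"
        "filling_weight (\<tau> # \<rho> # R) = m"
        by (auto simp: Y_def simp del: filling_weight.simps)
      obtain t \<tau>' where \<tau>: "\<tau> = t # \<tau>'" using x assms(3) by (cases \<tau>) auto
      have ne: "\<rho> \<noteq> []" using x assms by auto
      have "sorted (\<rho> @ \<tau>')"
        using x ne \<tau> by (cases "\<tau>' = []") (auto intro!: sorted_append_last_hd simp: neq_Nil_conv)
      moreover have "filling_weight ((\<rho> @ \<tau>') # R) = m"
        using x(8,9) filling_weight_equal[OF ne, of \<tau>' R] by (simp only: \<tau> list.sel)
      moreover have "length (\<rho> @ \<tau>') = j + k - 1" using x(3,6) \<tau> by simp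
      moreover have "R \<noteq> [] \<longrightarrow> hd (\<rho> @ \<tau>') \<le> last (hd R)" using x(5) ne by simp
      moreover have "(\<lambda>R. (hd (tl R) @ tl (hd R)) # tl (tl R)) x = (\<rho> @ \<tau>') # R"
        by (simp add: x(1) \<tau>)
      ultimately show "(\<lambda>R. (hd (tl R) @ tl (hd R)) # tl (tl R)) x \<in> {R \<in> fillings ((j + k - 1) # ks). filling_weight R = m}"
        using x(2) by (simp only: fillings_Cons_iff mem_Collect_eq simp_thms)
    qed
    show "(\<lambda>R. (last (take j (hd R)) # drop j (hd R)) # take j (hd R) # tl R) `
        {R \<in> fillings ((j + k - 1) # ks). filling_weight R = m} \<subseteq> ?Y2"
    proof (rule image_subsetI)
      fix x assume "x \<in> {R \<in> fillings ((j + k - 1) # ks). filling_weight R = m}"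
      then obtain \<sigma> R where x: "x = \<sigma> # R" "R \<in> fillings ks" "length \<sigma> = j + k - 1" "sorted \<sigma>"
        "R \<noteq> [] \<longrightarrow> hd \<sigma> \<le> last (hd R)" "filling_weight (\<sigma> # R) = m" by auto
      define \<rho> \<tau> where "\<rho> = take j \<sigma>" and "\<tau> = drop j \<sigma>"
      have \<sigma>: "\<sigma> = \<rho> @ \<tau>" "length \<rho> = j" "length \<tau> = k - 1" using x assms by (auto simp: \<rho>_def \<tau>_def)
      have ne: "\<rho> \<noteq> []" using \<sigma> assms by auto
      have "sorted (last \<rho> # \<tau>)" "sorted \<rho>"
        using x(4) ne unfolding \<sigma>(1) sorted_append by auto
      moreover have "filling_weight ((last \<rho> # \<tau>) # \<rho> # R) = m"
        using x(6) unfolding filling_weight_equal[OF ne] \<sigma>(1) .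
      moreover have "R \<noteq> [] \<longrightarrow> hd \<rho> \<le> last (hd R)"
        using x(5) ne by (simp add: \<sigma>(1))
      moreover have "(\<lambda>R. (last (take j (hd R)) # drop j (hd R)) # take j (hd R) # tl R) x = (last \<rho> # \<tau>) # \<rho> # R"
        by (simp add: x(1) \<rho>_def \<tau>_def)
      ultimately show "(\<lambda>R. (last (take j (hd R)) # drop j (hd R)) # take j (hd R) # tl R) x \<in> ?Y2"
        using x(2) \<sigma>(2,3) assms(3)
        by (simp only: Y_def mem_Collect_eq fillings_Cons_iff list.sel list.size simp_thms) simp
    qed
  qed
  have "card Z + card {R \<in> fillings ((j + k - 1) # ks). filling_weight R = m} =
     card {R \<in> fillings ((j + k) # ks). filling_weight R = m} + card Y"
    unfolding cardZ cardY bij_betw_same_card[OF b1] bij_betw_same_card[OF b2] bij_betw_same_card[OF b3] by simp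
  then show ?thesis
    unfolding cZ filling_count_def Y_def by (simp only: of_nat_add[symmetric])
qed


section \<open>From ribbon fillings to reverse plane partitions of ribbon shape\<close>

definition ribbon_offset :: "nat list \<Rightarrow> nat" where
  "ribbon_offset ks = (\<Sum>a\<leftarrow>ks. a - 1)"

lemma ribbon_inner_Cons: "ribbon_inner (rev (k # ks)) = ribbon_offset ks # ribbon_inner (rev ks)"
proof -
  have "[0..<Suc (length ks)] = 0 # map Suc [0..<length ks]"
    by (simp only: upt_conv_Cons zero_less_Suc map_Suc_upt)
  then show ?thesis
    unfolding ribbon_inner_def rev_rev_ident length_rev list.size add_Suc_right add_0_right
    by (simp add: ribbon_offset_def del: upt_Suc)
qed

lemma ribbon_outer_Cons: "ribbon_outer (rev (k # ks)) = (ribbon_offset ks + k) # ribbon_outer (rev ks)"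
  unfolding ribbon_outer_def ribbon_inner_Cons by simp

lemma diagram_Cons: "diagram (a # as) = {(0, c) | c. c < a} \<union> {(Suc r, c) | r c. (r, c) \<in> diagram as}"
proof -
  have "p \<in> diagram (a # as) \<longleftrightarrow> p \<in> {(0, c) | c. c < a} \<union> {(Suc r, c) | r c. (r, c) \<in> diagram as}" for p
    by (cases p; cases "fst p") (auto simp: diagram_def)
  then show ?thesis by blast
qed

lemma ribbon_Nil: "ribbon [] = {}"
  by (simp add: ribbon_def ribbon_outer_def ribbon_inner_def skew_diagram_def diagram_def)

lemma ribbon_Cons: "ribbon (rev (k # ks)) =
    {(0, c) | c. ribbon_offset ks \<le> c \<and> c < ribbon_offset ks + k} \<union> {(Suc r, c) | r c. (r, c) \<in> ribbon (rev ks)}"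
  unfolding ribbon_def skew_diagram_def ribbon_outer_Cons ribbon_inner_Cons diagram_Cons by auto

lemma ribbon_row_0: "(0, c) \<in> ribbon (rev (k # ks)) \<longleftrightarrow> ribbon_offset ks \<le> c \<and> c < ribbon_offset ks + k"
  and ribbon_row_Suc: "(Suc r, c) \<in> ribbon (rev (k # ks)) \<longleftrightarrow> (r, c) \<in> ribbon (rev ks)"
  unfolding ribbon_Cons by auto

lemma ribbon_offset_Cons: "ribbon_offset (k # ks) = k - 1 + ribbon_offset ks"
  by (simp add: ribbon_offset_def)

text \<open>\<open>ribbon_offset ks\<close> is the last column of the ribbon and the column in which
  a new top row would start. So a new top row meets the old ribbon in this one column only.\<close>

lemma ribbon_column_le: "0 \<notin> set ks \<Longrightarrow> (r, c) \<in> ribbon (rev ks) \<Longrightarrow> c \<le> ribbon_offset ks"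
proof (induction ks arbitrary: r)
  case (Cons k ks)
  show ?case
  proof (cases r)
    case 0
    then have "c < ribbon_offset ks + k"
      using Cons.prems(2) ribbon_row_0[of c k ks] by blast
    then show ?thesis unfolding ribbon_offset_Cons by linarith
  next
    case (Suc q)
    then have "(q, c) \<in> ribbon (rev ks)"
      using Cons.prems(2) ribbon_row_Suc[of q c k ks] by blast
    then have "c \<le> ribbon_offset ks" using Cons by simp
    then show ?thesis by (simp add: ribbon_offset_Cons)
  qed
qed (simp add: ribbon_Nil)

lemma ribbon_top_cell: "0 \<notin> set ks \<Longrightarrow> ks \<noteq> [] \<Longrightarrow> (0, ribbon_offset ks) \<in> ribbon (rev ks)"
  by (cases ks) (auto simp: ribbon_row_0 ribbon_offset_Cons simp del: rev.simps)

lemma finite_ribbon: "finite (ribbon (rev ks))"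
proof (induction ks)
  case (Cons k ks)
  have "ribbon (rev (k # ks)) \<subseteq>
      (\<lambda>c. (0, c)) ` {..<ribbon_offset ks + k} \<union> (\<lambda>(r, c). (Suc r, c)) ` ribbon (rev ks)"
    unfolding ribbon_Cons by (auto intro: rev_image_eqI)
  then show ?case by (rule finite_subset) (simp add: Cons del: rev.simps)
qed (simp add: ribbon_Nil)

lemma card_ribbon: "card (ribbon (rev ks)) = sum_list ks"
proof (induction ks)
  case (Cons k ks)
  have "ribbon (rev (k # ks)) =
      (\<lambda>c. (0, c)) ` {ribbon_offset ks..<ribbon_offset ks + k} \<union> (\<lambda>(r, c). (Suc r, c)) ` ribbon (rev ks)"
    unfolding ribbon_Cons by (auto intro: rev_image_eqI)
  also have "card \<dots> = card ((\<lambda>c. (0 :: nat, c)) ` {ribbon_offset ks..<ribbon_offset ks + k}) +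
      card ((\<lambda>(r, c). (Suc r, c)) ` ribbon (rev ks))"
    by (rule card_Un_disjoint) (auto simp: finite_ribbon)
  also have "card ((\<lambda>c. (0 :: nat, c)) ` {ribbon_offset ks..<ribbon_offset ks + k}) = k"
    by (subst card_image) (auto intro: inj_onI)
  also have "card ((\<lambda>(r, c). (Suc r, c)) ` ribbon (rev ks)) = sum_list ks"
    unfolding Cons[symmetric] by (rule card_image) (auto intro: inj_onI)
  finally show ?case by simp
qed (simp add: ribbon_Nil)

definition below_top :: "(nat \<times> nat \<Rightarrow> nat) \<Rightarrow> nat \<times> nat \<Rightarrow> nat" where
  "below_top T = (\<lambda>(r, c). T (Suc r, c))"

text \<open>Peels off the top row. The two parts share only the column
  \<open>ribbon_offset ks\<close>, and the entries below already increase down that column, so one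
  inequality with the box directly underneath expresses the whole interaction.\<close>

lemma rpp_ribbon_Cons:
  assumes "0 \<notin> set (k # ks)"
  shows "reverse_plane_partition (ribbon (rev (k # ks))) T \<longleftrightarrow>
    reverse_plane_partition (ribbon (rev ks)) (below_top T) \<and>
    (\<forall>c<k. 0 < T (0, ribbon_offset ks + c)) \<and>
    (\<forall>c. c < ribbon_offset ks \<or> ribbon_offset ks + k \<le> c \<longrightarrow> T (0, c) = 0) \<and>
    (\<forall>c c'. c \<le> c' \<longrightarrow> c' < k \<longrightarrow> T (0, ribbon_offset ks + c) \<le> T (0, ribbon_offset ks + c')) \<and>
    (ks \<noteq> [] \<longrightarrow> T (0, ribbon_offset ks) \<le> T (1, ribbon_offset ks))" (is "?L \<longleftrightarrow> ?R")
proof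
  assume L: ?L
  note r0 = ribbon_row_0[of _ k ks] and rS = ribbon_row_Suc[of _ _ k ks]
  show ?R
  proof (intro conjI allI impI)
    show "reverse_plane_partition (ribbon (rev ks)) (below_top T)"
      unfolding reverse_plane_partition_def below_top_def
    proof (intro conjI allI impI ballI)
      fix p assume "p \<in> ribbon (rev ks)"
      then show "0 < (case p of (r, c) \<Rightarrow> T (Suc r, c))" using rppD(1)[OF L] rS by (cases p) auto
    next
      fix p assume "p \<notin> ribbon (rev ks)"
      then show "(case p of (r, c) \<Rightarrow> T (Suc r, c)) = 0" using rppD(2)[OF L] rS by (cases p) auto
    next
      fix r c c' assume "(r, c) \<in> ribbon (rev ks) \<and> (r, c') \<in> ribbon (rev ks) \<and> c \<le> c'"
      then show "(case (r, c) of (r, c) \<Rightarrow> T (Suc r, c)) \<le> (case (r, c') of (r, c) \<Rightarrow> T (Suc r, c))"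
        using rppD(3)[OF L, of "Suc r" c c'] rS by simp
    next
      fix r r' c assume "(r, c) \<in> ribbon (rev ks) \<and> (r', c) \<in> ribbon (rev ks) \<and> r \<le> r'"
      then show "(case (r, c) of (r, c) \<Rightarrow> T (Suc r, c)) \<le> (case (r', c) of (r, c) \<Rightarrow> T (Suc r, c))"
        using rppD(4)[OF L, of "Suc r" c "Suc r'"] rS by simp
    qed
    show "0 < T (0, ribbon_offset ks + c)" if "c < k" for c
      using rppD(1)[OF L] r0 that by simp
    show "T (0, c) = 0" if "c < ribbon_offset ks \<or> ribbon_offset ks + k \<le> c" for c
      using rppD(2)[OF L, of "(0, c)"] r0[of c] that by auto
    show "T (0, ribbon_offset ks + c) \<le> T (0, ribbon_offset ks + c')" if "c \<le> c'" "c' < k" for c c'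
      using rppD(3)[OF L, of 0 "ribbon_offset ks + c" "ribbon_offset ks + c'"] r0 that by simp
    show "T (0, ribbon_offset ks) \<le> T (1, ribbon_offset ks)" if "ks \<noteq> []"
      using rppD(4)[OF L, of 0 "ribbon_offset ks" 1] r0[of "ribbon_offset ks"] rS[of 0 "ribbon_offset ks"]
        ribbon_top_cell[of ks] assms that by simp
  qed
next
  assume R: ?R
  then have T': "reverse_plane_partition (ribbon (rev ks)) (below_top T)"
    and outside: "\<And>c. c < ribbon_offset ks \<or> ribbon_offset ks + k \<le> c \<Longrightarrow> T (0, c) = 0" by blast+
  note r0 = ribbon_row_0[of _ k ks] and rS = ribbon_row_Suc[of _ _ k ks]
  show ?L
    unfolding reverse_plane_partition_def
  proof (intro conjI allI impI ballI)
    fix p assume p: "p \<in> ribbon (rev (k # ks))"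
    obtain r c where [simp]: "p = (r, c)" by fastforce
    show "0 < T p"
    proof (cases r)
      case 0
      then obtain d where "c = ribbon_offset ks + d" "d < k"
        using p r0 nat_le_iff_add by auto
      then show ?thesis using R 0 by simp
    next
      case (Suc r')
      then show ?thesis using p rppD(1)[OF T', of "(r', c)"] rS by (simp add: below_top_def)
    qed
  next
    fix p assume p: "p \<notin> ribbon (rev (k # ks))"
    obtain r c where [simp]: "p = (r, c)" by fastforce
    show "T p = 0"
    proof (cases r)
      case 0
      then have "c < ribbon_offset ks \<or> ribbon_offset ks + k \<le> c" using p r0[of c] by auto
      then show ?thesis using outside 0 by simp
    next
      case (Suc r')
      then show ?thesis using p rppD(2)[OF T', of "(r', c)"] rS by (simp add: below_top_def)
    qed
  next
    fix r c c'
    assume a: "(r, c) \<in> ribbon (rev (k # ks)) \<and> (r, c') \<in> ribbon (rev (k # ks)) \<and> c \<le> c'"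
    show "T (r, c) \<le> T (r, c')"
    proof (cases r)
      case 0
      then obtain d d' where d: "c = ribbon_offset ks + d" "c' = ribbon_offset ks + d'" "d' < k" "d \<le> d'"
        using a r0 nat_le_iff_add by auto
      have "T (0, ribbon_offset ks + d) \<le> T (0, ribbon_offset ks + d')"
        using R d(3,4) by blast
      then show ?thesis using 0 d by simp
    next
      case (Suc r')
      then show ?thesis using a rppD(3)[OF T', of r' c c'] rS by (simp add: below_top_def)
    qed
  next
    fix r r' c
    assume a: "(r, c) \<in> ribbon (rev (k # ks)) \<and> (r', c) \<in> ribbon (rev (k # ks)) \<and> r \<le> r'"
    show "T (r, c) \<le> T (r', c)"
    proof (cases r)
      case 0
      show ?thesis
      proof (cases r')
        case (Suc q)
        then have q: "(q, c) \<in> ribbon (rev ks)" using a rS by simp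
        then have ks: "ks \<noteq> []" by (auto simp: ribbon_Nil)
        have c: "c = ribbon_offset ks"
          using ribbon_column_le[OF _ q] assms a 0 r0[of c] by simp
        have "T (0, c) \<le> T (1, c)" using R ks c by blast
        also have "\<dots> \<le> T (r', c)"
          using rppD(4)[OF T', of 0 c q] q ribbon_top_cell[OF _ ks] assms by (simp add: below_top_def c Suc)
        finally show ?thesis using 0 by simp
      qed (simp add: 0)
    next
      case (Suc q)
      then obtain q' where "r' = Suc q'" using a by (cases r') auto
      then show ?thesis using a rppD(4)[OF T', of q c q'] rS Suc by (simp add: below_top_def)
    qed
  qed
qed

lemma rpp_ribbon_ConsD:
  assumes "0 \<notin> set (k # ks)" "reverse_plane_partition (ribbon (rev (k # ks))) T"
  shows "reverse_plane_partition (ribbon (rev ks)) (below_top T)"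
    and "c < k \<Longrightarrow> 0 < T (0, ribbon_offset ks + c)"
    and "c < ribbon_offset ks \<or> ribbon_offset ks + k \<le> c \<Longrightarrow> T (0, c) = 0"
    and "c \<le> c' \<Longrightarrow> c' < k \<Longrightarrow> T (0, ribbon_offset ks + c) \<le> T (0, ribbon_offset ks + c')"
    and "ks \<noteq> [] \<Longrightarrow> T (0, ribbon_offset ks) \<le> T (1, ribbon_offset ks)"
  using assms(2) unfolding rpp_ribbon_Cons[OF assms(1)] by (elim conjE; simp only: simp_thms)+

fun ribbon_rows :: "nat list \<Rightarrow> (nat \<times> nat \<Rightarrow> nat) \<Rightarrow> nat list list" where
  "ribbon_rows [] T = []"
| "ribbon_rows (k # ks) T = map (\<lambda>c. T (0, ribbon_offset ks + c) - 1) [0..<k] # ribbon_rows ks (below_top T)"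

fun ribbon_filling :: "nat list \<Rightarrow> nat list list \<Rightarrow> nat \<times> nat \<Rightarrow> nat" where
  "ribbon_filling (k # ks) (\<rho> # R) (0, c) =
     (if ribbon_offset ks \<le> c \<and> c < ribbon_offset ks + k then Suc (\<rho> ! (c - ribbon_offset ks)) else 0)"
| "ribbon_filling (k # ks) (\<rho> # R) (Suc r, c) = ribbon_filling ks R (r, c)"
| "ribbon_filling _ _ _ = 0"

lemma below_top_filling: "below_top (ribbon_filling (k # ks) (\<rho> # R)) = ribbon_filling ks R"
  by (auto simp: below_top_def fun_eq_iff)

lemma last_ribbon_row:
  assumes "0 \<notin> set ks" "ks \<noteq> []"
  shows "last (hd (ribbon_rows ks T)) = T (0, ribbon_offset ks) - 1"
  using assms by (cases ks) (auto simp: last_map ribbon_offset_Cons add.commute)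

lemma ribbon_rows_filling:
  assumes "0 \<notin> set ks" "reverse_plane_partition (ribbon (rev ks)) T"
  shows "ribbon_rows ks T \<in> fillings ks \<and> ribbon_filling ks (ribbon_rows ks T) = T"
  using assms
proof (induction ks arbitrary: T)
  case Nil
  have "T p = 0" for p using rppD(2)[OF Nil.prems(2), of p] by (simp add: ribbon_Nil)
  then show ?case by auto
next
  case (Cons k ks)
  note T = rpp_ribbon_ConsD[OF Cons.prems]
  let ?\<rho> = "map (\<lambda>c. T (0, ribbon_offset ks + c) - 1) [0..<k]" and ?R = "ribbon_rows ks (below_top T)"
  have k: "0 < k" "0 \<notin> set ks" using Cons.prems(1) by auto
  have IH: "?R \<in> fillings ks" "ribbon_filling ks ?R = below_top T"
    using Cons.IH[OF k(2) T(1)] by blast+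
  have "?\<rho> # ?R \<in> fillings (k # ks)"
    unfolding fillings_Cons_iff
  proof (intro conjI impI IH(1))
    show "sorted ?\<rho>"
      unfolding sorted_iff_nth_mono using T(4) by (auto intro!: diff_le_mono)
    assume "?R \<noteq> []"
    then have "ks \<noteq> []" by auto
    then show "hd ?\<rho> \<le> last (hd ?R)"
      using T(5) k by (simp add: last_ribbon_row hd_map below_top_def diff_le_mono)
  qed simp
  moreover have "ribbon_filling (k # ks) (?\<rho> # ?R) p = T p" for p
  proof -
    obtain r c where p: "p = (r, c)" by fastforce
    show ?thesis
    proof (cases r)
      case 0
      show ?thesis
      proof (cases "ribbon_offset ks \<le> c \<and> c < ribbon_offset ks + k")
        case True
        then obtain d where d: "c = ribbon_offset ks + d" "d < k" using nat_le_iff_add by auto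
        then have "0 < T (0, ribbon_offset ks + d)" using T(2) by blast
        then show ?thesis using d by (simp add: p 0)
      next
        case False
        then have "c < ribbon_offset ks \<or> ribbon_offset ks + k \<le> c" by auto
        then have "T (0, c) = 0" by (rule T(3))
        then show ?thesis using False by (simp add: p 0)
      qed
    next
      case (Suc q)
      then show ?thesis by (simp add: p IH(2)) (simp add: below_top_def)
    qed
  qed
  ultimately show ?case by (auto simp: fun_eq_iff)
qed

lemma ribbon_filling_rpp:
  assumes "0 \<notin> set ks" "R \<in> fillings ks"
  shows "reverse_plane_partition (ribbon (rev ks)) (ribbon_filling ks R) \<and> ribbon_rows ks (ribbon_filling ks R) = R"
  using assms
proof (induction ks arbitrary: R)
  case Nil
  then show ?case by (simp add: ribbon_Nil reverse_plane_partition_def)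
next
  case (Cons k ks)
  obtain \<rho> R' where R: "R = \<rho> # R'" "R' \<in> fillings ks" "length \<rho> = k" "sorted \<rho>"
    "R' \<noteq> [] \<longrightarrow> hd \<rho> \<le> last (hd R')" using Cons.prems(2) by auto
  have k: "0 < k" "0 \<notin> set ks" using Cons.prems(1) by auto
  have IH: "reverse_plane_partition (ribbon (rev ks)) (ribbon_filling ks R')"
      "ribbon_rows ks (ribbon_filling ks R') = R'"
    using Cons.IH[of R'] k R by blast+
  have row: "map (\<lambda>c. ribbon_filling (k # ks) (\<rho> # R') (0, ribbon_offset ks + c) - 1) [0..<k] = \<rho>"
    by (rule nth_equalityI) (use R(3) in auto)
  have rows: "ribbon_rows (k # ks) (ribbon_filling (k # ks) (\<rho> # R')) = \<rho> # R'"
    by (simp only: ribbon_rows.simps below_top_filling IH(2) row)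
  have "reverse_plane_partition (ribbon (rev (k # ks))) (ribbon_filling (k # ks) (\<rho> # R'))"
    unfolding rpp_ribbon_Cons[OF Cons.prems(1)] below_top_filling
  proof (intro conjI allI impI IH(1))
    assume ks: "ks \<noteq> []"
    then have "R' \<noteq> []" using fillings_nonempty[OF R(2)] by blast
    then have "hd \<rho> \<le> last (hd (ribbon_rows ks (ribbon_filling ks R')))" using R(5) IH(2) by simp
    then have "hd \<rho> \<le> ribbon_filling ks R' (0, ribbon_offset ks) - 1"
      using last_ribbon_row[OF k(2) ks] by simp
    moreover have "0 < ribbon_filling ks R' (0, ribbon_offset ks)"
      using rppD(1)[OF IH(1) ribbon_top_cell[OF k(2) ks]] .
    moreover have "hd \<rho> = \<rho> ! 0" using R(3) k by (intro hd_conv_nth) auto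
    ultimately show "ribbon_filling (k # ks) (\<rho> # R') (0, ribbon_offset ks) \<le>
        ribbon_filling (k # ks) (\<rho> # R') (1, ribbon_offset ks)"
      using k by simp
  qed (use R(3,4) in \<open>auto intro: sorted_nth_mono\<close>)
  with rows R(1) show ?case by simp
qed

text \<open>A column containing a value lies in the lower ribbon or comes from the top row; the
  shared column is counted twice exactly if the first entry of the top row equals the entry below
  it, which is when \<open>filling_weight\<close> omits that entry.\<close>

lemma has_weight_ribbon_rows:
  assumes "0 \<notin> set ks" "reverse_plane_partition (ribbon (rev ks)) T"
  shows "has_weight (ribbon (rev ks)) T (filling_weight (ribbon_rows ks T))"
  using assms
proof (induction ks arbitrary: T)
  case Nil
  show ?case by (simp add: has_weight_def ribbon_Nil)
next
  case (Cons k ks)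
  note T = rpp_ribbon_ConsD[OF Cons.prems]
  let ?\<rho> = "map (\<lambda>c. T (0, ribbon_offset ks + c) - 1) [0..<k]" and ?R = "ribbon_rows ks (below_top T)"
  have k: "0 < k" "0 \<notin> set ks" using Cons.prems(1) by auto
  note T' = T(1) and pos = T(2)
  have IH: "has_weight (ribbon (rev ks)) (below_top T) (filling_weight ?R)"
    using Cons.IH[OF k(2) T'] .
  \<comment> \<open>The number of entries of the top row whose column already counts in the lower
    ribbon.\<close>
  define e where "e = (if ks \<noteq> [] \<and> T (0, ribbon_offset ks) = T (1, ribbon_offset ks) then 1 else 0 :: nat)"
  have merge: "?R \<noteq> [] \<and> hd ?\<rho> = last (hd ?R) \<longleftrightarrow> ks \<noteq> [] \<and> T (0, ribbon_offset ks) = T (1, ribbon_offset ks)"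
  proof (cases "ks = []")
    case False
    then have "?R \<noteq> []" by (cases ks) auto
    moreover have "0 < below_top T (0, ribbon_offset ks)"
      using rppD(1)[OF T' ribbon_top_cell[OF k(2) False]] .
    moreover have "hd ?\<rho> = T (0, ribbon_offset ks) - 1" using k by (simp add: hd_map)
    ultimately show ?thesis
      using False pos[of 0] k last_ribbon_row[OF k(2) False] by (auto simp: below_top_def)
  qed simp
  have top: "row_monomial (drop e ?\<rho>) = (if ?R \<noteq> [] \<and> hd ?\<rho> = last (hd ?R) then row_monomial (tl ?\<rho>) else row_monomial ?\<rho>)"
    unfolding merge e_def by (simp add: drop_Suc)
  have fw: "filling_weight (?\<rho> # ?R) = row_monomial (drop e ?\<rho>) + filling_weight ?R"
    unfolding top by simp
  show ?case
    unfolding has_weight_def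
  proof
    fix v
    let ?A = "{c. \<exists>r. (r, c) \<in> ribbon (rev ks) \<and> below_top T (r, c) = Suc v}"
    let ?B = "{c. ribbon_offset ks \<le> c \<and> c < ribbon_offset ks + k \<and> T (0, c) = Suc v}"
    let ?B' = "{c. ribbon_offset ks + e \<le> c \<and> c < ribbon_offset ks + k \<and> T (0, c) = Suc v}"
    have eq1: "{c. \<exists>r. (r, c) \<in> ribbon (rev (k # ks)) \<and> T (r, c) = Suc v} = ?A \<union> ?B"
      unfolding ribbon_Cons below_top_def by auto
    have eq2: "?A \<union> ?B = ?A \<union> ?B'"
    proof -
      have "c \<in> ?A" if c: "c \<in> ?B" "c \<notin> ?B'" for c
      proof -
        have e: "e = 1" and cc: "c = ribbon_offset ks" using c by (auto simp: e_def split: if_splits)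
        from e have m: "ks \<noteq> [] \<and> T (0, ribbon_offset ks) = T (1, ribbon_offset ks)"
          unfolding e_def by (metis zero_neq_one)
        then have "(0, c) \<in> ribbon (rev ks)" using ribbon_top_cell[OF k(2)] cc by blast
        moreover have "below_top T (0, c) = Suc v" using m c(1) cc by (simp add: below_top_def)
        ultimately show ?thesis by blast
      qed
      then show ?thesis by auto
    qed
    \<comment> \<open>A column in both sets must be the shared one with \<open>e = 0\<close>. But
      the value \<open>v\<close> at the top and again further down forces equality with the box in
      between, hence \<open>e = 1\<close>.\<close>
    have eq3: "card (?A \<union> ?B') = card ?A + card ?B'"
    proof (rule card_Un_disjoint)
      show "finite ?A" by (rule finite_columns[OF finite_ribbon])
      show "?A \<inter> ?B' = {}"
      proof (rule ccontr)
        assume "?A \<inter> ?B' \<noteq> {}"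
        then obtain c r where c: "(r, c) \<in> ribbon (rev ks)" "below_top T (r, c) = Suc v" "c \<in> ?B'" by blast
        then have ks: "ks \<noteq> []" by (auto simp: ribbon_Nil)
        have cc: "c = ribbon_offset ks" "e = 0"
          using ribbon_column_le[OF k(2) c(1)] c(3) by auto
        have "T (0, c) \<le> T (1, c)" using T(5)[OF ks] cc by simp
        moreover have "below_top T (0, c) \<le> below_top T (r, c)"
          using rppD(4)[OF T', of 0 c r] ribbon_top_cell[OF k(2) ks] c(1) cc by simp
        ultimately have "T (0, c) = T (1, c)" using c(2,3) by (simp add: below_top_def)
        then show False using cc ks by (simp add: e_def)
      qed
    qed simp
    have cA: "card ?A = expo (filling_weight ?R) v"
      by (rule IH[unfolded has_weight_def, rule_format, symmetric])
    have cB: "card ?B' = expo (row_monomial (drop e ?\<rho>)) v"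
    proof -
      have "count_list (drop e ?\<rho>) v = length (filter ((=) v) (drop e ?\<rho>))"
        by (simp add: count_list_eq_length_filter)
      also have "\<dots> = card {i. i < length (drop e ?\<rho>) \<and> v = drop e ?\<rho> ! i}"
        by (rule length_filter_conv_card)
      also have "\<dots> = card ?B'"
      proof (rule bij_betw_same_card[where f = "\<lambda>i. ribbon_offset ks + e + i"],
          rule bij_betw_byWitness[where f' = "\<lambda>c. c - ribbon_offset ks - e"])
        have ge: "v = T (0, ribbon_offset ks + d) - 1 \<longleftrightarrow> T (0, ribbon_offset ks + d) = Suc v" if "d < k" for d
          using pos[OF that] by auto
        show "(\<lambda>i. ribbon_offset ks + e + i) ` {i. i < length (drop e ?\<rho>) \<and> v = drop e ?\<rho> ! i} \<subseteq> ?B'"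
        proof (rule image_subsetI)
          fix i assume i: "i \<in> {i. i < length (drop e ?\<rho>) \<and> v = drop e ?\<rho> ! i}"
          then have "e + i < k" by auto
          with i ge[of "e + i"] show "ribbon_offset ks + e + i \<in> ?B'" by (simp add: add.assoc)
        qed
        show "(\<lambda>c. c - ribbon_offset ks - e) ` ?B' \<subseteq> {i. i < length (drop e ?\<rho>) \<and> v = drop e ?\<rho> ! i}"
        proof (rule image_subsetI)
          fix c assume c: "c \<in> ?B'"
          define i where "i = c - ribbon_offset ks - e"
          have i: "c = ribbon_offset ks + (e + i)" "e + i < k" using c by (auto simp: i_def)
          have "v = T (0, ribbon_offset ks + (e + i)) - 1" using c ge[OF i(2)] i(1) by simp
          then have "i \<in> {i. i < length (drop e ?\<rho>) \<and> v = drop e ?\<rho> ! i}"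
            using i(2) by simp
          then show "c - ribbon_offset ks - e \<in> {i. i < length (drop e ?\<rho>) \<and> v = drop e ?\<rho> ! i}"
            unfolding i_def .
        qed
      qed auto
      finally show ?thesis by (simp only: expo_row_monomial)
    qed
    show "expo (filling_weight (ribbon_rows (k # ks) T)) v =
        card {c. \<exists>r. (r, c) \<in> ribbon (rev (k # ks)) \<and> T (r, c) = Suc v}"
      unfolding ribbon_rows.simps fw lookup_add eq1 eq2 eq3 cA cB by (rule add.commute)
  qed
qed

lemma has_weight_unique: "has_weight D T m \<Longrightarrow> has_weight D T m' \<Longrightarrow> m = m'"
  by (rule poly_mapping_eqI) (simp add: has_weight_def)

lemma dual_g_ribbon:
  assumes "0 \<notin> set ks"
  shows "dual_g (ribbon (rev ks)) = filling_count ks"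
proof
  fix m
  have "bij_betw (ribbon_rows ks) {T. reverse_plane_partition (ribbon (rev ks)) T \<and> has_weight (ribbon (rev ks)) T m}
     {R \<in> fillings ks. filling_weight R = m}"
  proof (rule bij_betw_byWitness[where f' = "ribbon_filling ks"])
    show "ribbon_rows ks ` {T. reverse_plane_partition (ribbon (rev ks)) T \<and> has_weight (ribbon (rev ks)) T m}
       \<subseteq> {R \<in> fillings ks. filling_weight R = m}"
    proof (rule image_subsetI)
      fix T assume "T \<in> {T. reverse_plane_partition (ribbon (rev ks)) T \<and> has_weight (ribbon (rev ks)) T m}"
      then have T: "reverse_plane_partition (ribbon (rev ks)) T" "has_weight (ribbon (rev ks)) T m" by auto
      show "ribbon_rows ks T \<in> {R \<in> fillings ks. filling_weight R = m}"
        using ribbon_rows_filling[OF assms T(1)] has_weight_unique[OF has_weight_ribbon_rows[OF assms T(1)] T(2)]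
        by simp
    qed
    show "ribbon_filling ks ` {R \<in> fillings ks. filling_weight R = m}
        \<subseteq> {T. reverse_plane_partition (ribbon (rev ks)) T \<and> has_weight (ribbon (rev ks)) T m}"
    proof (rule image_subsetI)
      fix R assume "R \<in> {R \<in> fillings ks. filling_weight R = m}"
      then show "ribbon_filling ks R \<in> {T. reverse_plane_partition (ribbon (rev ks)) T \<and> has_weight (ribbon (rev ks)) T m}"
        using ribbon_filling_rpp[OF assms, of R] has_weight_ribbon_rows[OF assms, of "ribbon_filling ks R"] by auto
    qed
  qed (use ribbon_rows_filling[OF assms] ribbon_filling_rpp[OF assms] in auto)
  then show "dual_g (ribbon (rev ks)) m = filling_count ks m"
    unfolding dual_g_def filling_count_def by (simp add: bij_betw_same_card)
qed

lemma diagram_eq_ribbon: "diagram [k] = ribbon [k]"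
  using ribbon_Cons[of k "[]"] by (auto simp: diagram_def ribbon_offset_def ribbon_Nil)

text \<open>A monomial is the content of exactly one sorted word, so this is the complete
  homogeneous symmetric function h_k.\<close>

lemma filling_count_row: "filling_count [k] m = (if monomial_degree m = k then 1 else 0)"
proof -
  have "{R \<in> fillings [k]. filling_weight R = m} = (\<lambda>\<rho>. [\<rho>]) ` {\<rho>. length \<rho> = k \<and> sorted \<rho> \<and> row_monomial \<rho> = m}"
    by auto
  then have "filling_count [k] m = int (card {\<rho>. length \<rho> = k \<and> sorted \<rho> \<and> row_monomial \<rho> = m})"
    unfolding filling_count_def by (simp add: card_image inj_on_def)
  moreover have "card {\<rho>. length \<rho> = k \<and> sorted \<rho> \<and> row_monomial \<rho> = m} = 1" if "monomial_degree m = k"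
  proof -
    have "\<exists>\<rho>. sorted \<rho> \<and> row_monomial \<rho> = m"
      using that
    proof (induction k arbitrary: m)
      case 0
      then show ?case by (intro exI[of _ "[]"]) simp
    next
      case (Suc k)
      then obtain v where v: "expo m v \<noteq> 0"
        by (metis monomial_degree_eq_0 nat.distinct(1) poly_mapping_eqI lookup_zero)
      define m' where "m' = m - Poly_Mapping.single v 1"
      have m: "m = Poly_Mapping.single v 1 + m'"
        by (rule poly_mapping_eqI) (use v in \<open>auto simp: m'_def lookup_add lookup_minus lookup_single when_def\<close>)
      then have "monomial_degree m' = k" using Suc.prems by simp
      then obtain \<rho> where \<rho>: "sorted \<rho>" "row_monomial \<rho> = m'" using Suc.IH by blast
      have "row_monomial (insort v \<sigma>) = Poly_Mapping.single v 1 + row_monomial \<sigma>" for \<sigma>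
        by (induction \<sigma>) (auto simp: ac_simps)
      with \<rho> m show ?case by (intro exI[of _ "insort v \<rho>"]) (simp add: sorted_insort)
    qed
    then obtain \<rho> where \<rho>: "sorted \<rho>" "row_monomial \<rho> = m" by blast
    have uniq: "\<sigma> = \<rho>" if "sorted \<sigma>" "row_monomial \<sigma> = m" for \<sigma>
    proof -
      have "count_list \<sigma> v = count_list \<rho> v" for v
        using that(2) \<rho>(2) by (simp flip: expo_row_monomial)
      then have "mset \<sigma> = mset \<rho>" by (intro multiset_eqI) (simp add: count_mset)
      then show ?thesis using that(1) \<rho>(1) properties_for_sort sorted_sort_id by metis
    qed
    have "length \<rho> = k" using \<rho>(2) that by auto
    with \<rho> have "\<rho> \<in> {\<rho>. length \<rho> = k \<and> sorted \<rho> \<and> row_monomial \<rho> = m}" by simp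
    moreover have "{\<rho>. length \<rho> = k \<and> sorted \<rho> \<and> row_monomial \<rho> = m} \<subseteq> {\<rho>}"
    proof
      fix \<sigma> assume "\<sigma> \<in> {\<rho>. length \<rho> = k \<and> sorted \<rho> \<and> row_monomial \<rho> = m}"
      then show "\<sigma> \<in> {\<rho>}" using uniq[of \<sigma>] by simp
    qed
    ultimately have "{\<rho>. length \<rho> = k \<and> sorted \<rho> \<and> row_monomial \<rho> = m} = {\<rho>}" by blast
    then show ?thesis by simp
  qed
  moreover have "card {\<rho>. length \<rho> = k \<and> sorted \<rho> \<and> row_monomial \<rho> = m} = 0" if "monomial_degree m \<noteq> k"
  proof -
    have "{\<rho>. length \<rho> = k \<and> sorted \<rho> \<and> row_monomial \<rho> = m} = {}" using that by auto
    then show ?thesis by (simp only: card.empty)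
  qed
  ultimately show ?thesis by simp
qed

lemma dual_g_row: "0 < k \<Longrightarrow> dual_g (diagram [k]) m = (if monomial_degree m = k then 1 else 0)"
  using dual_g_ribbon[of "[k]"] filling_count_row by (simp add: diagram_eq_ribbon)

text \<open>h_k is homogeneous of degree k, the size of the shape, so the two signs cancel.\<close>

lemma dual_g_tilde_row: "0 < k \<Longrightarrow> dual_g_tilde (diagram [k]) = dual_g (diagram [k])"
  using card_ribbon[of "[k]"]
  by (auto simp: dual_g_tilde_def dual_g_row diagram_eq_ribbon[symmetric] fun_eq_iff simp flip: power_add mult_2)

lemma dual_g_tilde_ribbon:
  assumes "is_composition \<alpha>"
  shows "dual_g_tilde (ribbon \<alpha>) m = (-1) ^ (sum_list \<alpha> + monomial_degree m) * filling_count (rev \<alpha>) m"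
  using dual_g_ribbon[of "rev \<alpha>"] card_ribbon[of "rev \<alpha>"] assms
  by (simp add: dual_g_tilde_def power_add mult.assoc is_composition_def)

text \<open>\<open>filling_count_rec\<close> with signs. The ribbon with last part
  \<open>j + k - 1\<close> has one box fewer, so its sign is opposite and it joins the other two
  terms; the row of length \<open>k\<close> adds \<open>k\<close> both to the size and to the degree
  and so leaves the sign alone. The last part of a composition is the top row, whence the
  reversal.\<close>

lemma dual_g_tilde_ribbon_rec:
  assumes "is_composition (\<alpha> @ [j, k])"
  shows "monomials.conv (dual_g_tilde (ribbon (\<alpha> @ [j]))) (dual_g (diagram [k])) =
    (\<lambda>m. dual_g_tilde (ribbon (\<alpha> @ [j, k])) m + dual_g_tilde (ribbon (\<alpha> @ [j + k])) m +
      dual_g_tilde (ribbon (\<alpha> @ [j + k - 1])) m)"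
proof
  fix m
  have pos: "0 < j" "0 < k" "0 \<notin> set \<alpha>" using assms by (auto simp: is_composition_def)
  let ?n = "sum_list \<alpha> + j + k"
  have comp: "is_composition (\<alpha> @ [j])" "is_composition (\<alpha> @ [j + k])" "is_composition (\<alpha> @ [j + k - 1])"
    using pos by (auto simp: is_composition_def)
  have row: "dual_g (diagram [k]) = filling_count [k]"
    using dual_g_ribbon[of "[k]"] pos by (simp add: diagram_eq_ribbon)
  have "monomials.conv (dual_g_tilde (ribbon (\<alpha> @ [j]))) (dual_g (diagram [k])) m =
      (\<Sum>(a, b)\<in>monomials.factors m. (-1) ^ (?n + monomial_degree m) * (filling_count (j # rev \<alpha>) a * filling_count [k] b))"
    unfolding monomials.conv_def row
  proof (rule sum.cong[OF refl], clarify)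
    fix a b assume "(a, b) \<in> monomials.factors m"
    then have m: "m = a + b" by (simp add: monomials.factors_def)
    show "dual_g_tilde (ribbon (\<alpha> @ [j])) a * filling_count [k] b =
        (-1) ^ (?n + monomial_degree m) * (filling_count (j # rev \<alpha>) a * filling_count [k] b)"
    proof (cases "monomial_degree b = k")
      case True
      then have "(-1 :: int) ^ (?n + monomial_degree m) = (-1) ^ (sum_list \<alpha> + j + monomial_degree a + 2 * k)"
        unfolding m monomial_degree_add by (intro arg_cong[where f = "power (-1)"]) simp
      also have "\<dots> = (-1) ^ (sum_list \<alpha> + j + monomial_degree a)" by (simp add: power_add power_mult)
      finally show ?thesis by (simp add: dual_g_tilde_ribbon[OF comp(1)])
    qed (simp add: filling_count_row)
  qed
  also have "\<dots> = (-1) ^ (?n + monomial_degree m) * monomials.conv (filling_count (j # rev \<alpha>)) (filling_count [k]) m"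
    unfolding monomials.conv_def by (simp add: sum_distrib_left case_prod_beta)
  also have "monomials.conv (filling_count (j # rev \<alpha>)) (filling_count [k]) m =
      filling_count ((j + k) # rev \<alpha>) m + filling_count (k # j # rev \<alpha>) m - filling_count ((j + k - 1) # rev \<alpha>) m"
    using filling_count_rec[of "rev \<alpha>" j k m] pos by simp
  also have "(-1) ^ (?n + monomial_degree m) * \<dots> =
      dual_g_tilde (ribbon (\<alpha> @ [j, k])) m + dual_g_tilde (ribbon (\<alpha> @ [j + k])) m +
      dual_g_tilde (ribbon (\<alpha> @ [j + k - 1])) m"
  proof -
    define n where "n = sum_list \<alpha> + (j + k - 1)"
    have n: "sum_list (\<alpha> @ [j, k]) = Suc n" "sum_list (\<alpha> @ [j + k]) = Suc n"
        "sum_list (\<alpha> @ [j + k - 1]) = n" "?n = Suc n"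
      using pos by (simp_all add: n_def)
    show ?thesis
      unfolding dual_g_tilde_ribbon[OF assms] dual_g_tilde_ribbon[OF comp(2)] dual_g_tilde_ribbon[OF comp(3)] n
      by (simp add: right_diff_distrib distrib_left)
  qed
  finally show "monomials.conv (dual_g_tilde (ribbon (\<alpha> @ [j]))) (dual_g (diagram [k])) m =
    dual_g_tilde (ribbon (\<alpha> @ [j, k])) m + dual_g_tilde (ribbon (\<alpha> @ [j + k])) m +
      dual_g_tilde (ribbon (\<alpha> @ [j + k - 1])) m" .
qed


section \<open>The monoid of words without equal neighbours\<close>

section \<open>Words without equal neighbours\<close>

text \<open>Contraction computes the normal form modulo the congruence generated by xx = x, so it
  may be applied early to a factor. Together with the mirror image this makes the product of words
  associative.\<close>

lemma remdups_adj_append_left: "remdups_adj (remdups_adj xs @ ys) = remdups_adj (xs @ ys)"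
proof (induction xs rule: remdups_adj.induct)
  case (3 x y xs)
  show ?case
  proof (cases "x = y")
    case False
    define t where "t = tl (remdups_adj (y # xs))"
    have t: "remdups_adj (y # xs) = y # t" by (simp only: t_def remdups_adj_Cons_alt)
    then have "remdups_adj (y # t @ ys) = remdups_adj (y # xs @ ys)"
      using 3(2)[OF False] by simp
    then show ?thesis using False by (simp add: t)
  qed (use 3(1) in simp)
qed simp_all

lemma remdups_adj_append_right: "remdups_adj (xs @ remdups_adj ys) = remdups_adj (xs @ ys)"
proof -
  have "remdups_adj (rev (xs @ remdups_adj ys)) = remdups_adj (rev (xs @ ys))"
    using remdups_adj_append_left[of "rev ys" "rev xs"] by simp
  then show ?thesis by (simp only: remdups_adj_rev rev_is_rev_conv)
qed

lemma remdups_adj_double: "remdups_adj (xs @ x # x # ys) = remdups_adj (xs @ x # ys)"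
  by (simp only: remdups_adj_append[of xs x "x # ys"] remdups_adj_append[of xs x ys]) simp

lemma remdups_adj_map_inj_on:
  assumes "inj_on f (set xs)"
  shows "remdups_adj (map f xs) = map f (remdups_adj xs)"
  using assms by (induction xs rule: remdups_adj.induct) (auto dest: inj_onD)

lemma remdups_adj_append_cases:
  assumes "distinct_adj a" "distinct_adj b"
  shows "remdups_adj (a @ b) = (if a \<noteq> [] \<and> b \<noteq> [] \<and> last a = hd b then a @ tl b else a @ b)"
proof (cases "a \<noteq> [] \<and> b \<noteq> [] \<and> last a = hd b")
  case True
  then obtain a' x b' where ab: "a = a' @ [x]" "b = x # b'"
    by (metis append_butlast_last_id list.exhaust_sel)
  have "distinct_adj (a @ b')"
    using assms unfolding ab by (auto simp: distinct_adj_append_iff distinct_adj_Cons)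
  moreover have "remdups_adj (a @ b) = remdups_adj (a @ b')"
    using remdups_adj_double[of a' x b'] by (simp add: ab)
  ultimately show ?thesis using True by (simp add: ab distinct_adj_altdef)
next
  case False
  then have "distinct_adj (a @ b)"
    using assms by (auto simp: distinct_adj_append_iff)
  then have "remdups_adj (a @ b) = a @ b" by (simp add: distinct_adj_altdef)
  then show ?thesis unfolding if_not_P[OF False] .
qed

text \<open>A factorization cuts \<open>c\<close> between two letters, or lets both factors share
  one letter. These two kinds match the two families of words in the product of
  \<open>MMR\<close>.\<close>

lemma remdups_adj_append_eq_iff:
  assumes "distinct_adj c"
  shows "distinct_adj a \<and> distinct_adj b \<and> remdups_adj (a @ b) = c \<longleftrightarrow>
    (\<exists>m\<le>length c. a = take m c \<and> b = drop m c) \<or>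
    (\<exists>m<length c. a = take (Suc m) c \<and> b = drop m c)" (is "?L \<longleftrightarrow> ?R")
proof
  assume L: ?L
  show ?R
  proof (cases "a \<noteq> [] \<and> b \<noteq> [] \<and> last a = hd b")
    case True
    then have c: "c = a @ tl b" using L remdups_adj_append_cases[of a b] by auto
    define m where "m = length a - 1"
    have m: "m < length c" "Suc m = length a" using True by (cases a; auto simp: m_def c)+
    have "b = last a # tl b" using True by simp
    also have "\<dots> = drop m c"
    proof -
      obtain a' x where "a = a' @ [x]" using True by (metis append_butlast_last_id)
      then show ?thesis by (simp add: c m_def)
    qed
    finally have "b = drop m c" .
    moreover have "a = take (Suc m) c" using m by (simp add: c)
    ultimately show ?thesis using m(1) by blast
  next
    case False
    then have c: "c = a @ b" using L remdups_adj_append_cases[of a b] by auto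
    then show ?thesis by (intro disjI1 exI[of _ "length a"]) simp
  qed
next
  assume ?R
  then show ?L
  proof (elim disjE exE conjE)
    fix m assume "m \<le> length c" "a = take m c" "b = drop m c"
    then have c: "c = a @ b" by simp
    then show ?L using assms by (auto simp: distinct_adj_altdef[symmetric] dest: distinct_adj_appendD1 distinct_adj_appendD2)
  next
    fix m assume m: "m < length c" "a = take (Suc m) c" "b = drop m c"
    have a: "a = take m c @ [c ! m]" and b: "b = c ! m # drop (Suc m) c"
      using m by (simp_all add: take_Suc_conv_app_nth Cons_nth_drop_Suc)
    have "remdups_adj (a @ b) = remdups_adj (take m c @ [c ! m] @ drop (Suc m) c)"
      unfolding a b using remdups_adj_double[of "take m c" "c ! m" "drop (Suc m) c"] by simp
    also have "take m c @ [c ! m] @ drop (Suc m) c = c"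
      using m(1) by (simp add: id_take_nth_drop[symmetric])
    also have "remdups_adj c = c" using assms by (simp add: distinct_adj_altdef)
    finally have "remdups_adj (a @ b) = c" .
    moreover have "distinct_adj a" "distinct_adj b"
      using assms m append_take_drop_id[of "Suc m" c] append_take_drop_id[of m c]
      by (metis distinct_adj_appendD1, metis distinct_adj_appendD2)
    ultimately show ?L by simp
  qed
qed

lemma finite_word_factors:
  assumes "distinct_adj c"
  shows "finite {(a, b). distinct_adj a \<and> distinct_adj b \<and> remdups_adj (a @ b) = c}"
proof (rule finite_subset)
  show "{(a, b). distinct_adj a \<and> distinct_adj b \<and> remdups_adj (a @ b) = c} \<subseteq>
      (\<lambda>m. (take m c, drop m c)) ` {..length c} \<union> (\<lambda>m. (take (Suc m) c, drop m c)) ` {..<length c}"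
    unfolding remdups_adj_append_eq_iff[OF assms] by auto
qed auto

text \<open>The free monoid modulo idempotent letters; convolution over it is the product of
  \<open>MMR\<close>.\<close>

interpretation words: fin_monoid "{c :: nat list. distinct_adj c}" "\<lambda>a b. remdups_adj (a @ b)" "[]"
proof (unfold_locales, unfold mem_Collect_eq)
  show "remdups_adj (remdups_adj (a @ b) @ c) = remdups_adj (a @ remdups_adj (b @ c))" for a b c :: "nat list"
    by (simp add: remdups_adj_append_left remdups_adj_append_right)
qed (simp_all add: finite_word_factors, simp_all add: distinct_adj_altdef)

lemma word_factors_iff:
  assumes "distinct_adj c"
  shows "(a, b) \<in> words.factors c \<longleftrightarrow>
    (\<exists>m\<le>length c. a = take m c \<and> b = drop m c) \<or> (\<exists>m<length c. a = take (Suc m) c \<and> b = drop m c)"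
  using remdups_adj_append_eq_iff[OF assms, of a b] by (auto simp: words.factors_def)

section \<open>Set compositions and their inverse words\<close>

section \<open>Set compositions as labelled sets of positions\<close>

text \<open>The blocks are the classes of positions with equal label, in the order of the labels.\<close>

definition blocks :: "nat set \<Rightarrow> (nat \<Rightarrow> nat) \<Rightarrow> nat set list" where
  "blocks S l = map (\<lambda>x. {i \<in> S. l i = x}) (sorted_list_of_set (l ` S))"

definition rank :: "nat set \<Rightarrow> nat \<Rightarrow> nat" where
  "rank A x = card {y \<in> A. y < x}"

lemma rank_less_iff:
  assumes "finite A" "x \<in> A" "y \<in> A"
  shows "rank A x < rank A y \<longleftrightarrow> x < y"
proof -
  have mono: "rank A x < rank A y" if "x < y" "x \<in> A" for x y
    unfolding rank_def
  proof (rule psubset_card_mono)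
    show "{z \<in> A. z < x} \<subset> {z \<in> A. z < y}" using that by auto
  qed (use assms in simp)
  show ?thesis
    using mono[of x y] mono[of y x] assms by (cases x y rule: linorder_cases) auto
qed

lemma rank_eq_iff:
  assumes "finite A" "x \<in> A" "y \<in> A"
  shows "rank A x = rank A y \<longleftrightarrow> x = y"
  using rank_less_iff[OF assms] rank_less_iff[OF assms(1,3,2)] by (metis less_irrefl linorder_neqE_nat)

lemma rank_sorted_list:
  assumes "finite A" "j < card A"
  shows "rank A (sorted_list_of_set A ! j) = j"
proof -
  let ?xs = "sorted_list_of_set A"
  have len: "length ?xs = card A" using assms(1) by simp
  have "{y \<in> A. y < ?xs ! j} = (\<lambda>i. ?xs ! i) ` {..<j}"
  proof (intro Set.set_eqI iffI)
    fix y assume y: "y \<in> {y \<in> A. y < ?xs ! j}"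
    then obtain i where i: "i < card A" "y = ?xs ! i"
      using assms(1) len by (metis (no_types, lifting) in_set_conv_nth mem_Collect_eq set_sorted_list_of_set)
    have "i < j"
    proof (rule ccontr)
      assume "\<not> i < j"
      then have "?xs ! j \<le> ?xs ! i" using i len by (intro sorted_nth_mono) auto
      with y i show False by simp
    qed
    with i show "y \<in> (\<lambda>i. ?xs ! i) ` {..<j}" by blast
  next
    fix y assume "y \<in> (\<lambda>i. ?xs ! i) ` {..<j}"
    then obtain i where i: "i < j" "y = ?xs ! i" by blast
    have "?xs ! i < ?xs ! j"
      using strict_sorted_list_of_set[of A] i assms len
      by (simp add: sorted_wrt_iff_nth_less)
    moreover have "?xs ! i \<in> A"
      using nth_mem[of i ?xs] i assms len by simp
    ultimately show "y \<in> {y \<in> A. y < ?xs ! j}" using i by simp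
  qed
  moreover have "inj_on (\<lambda>i. ?xs ! i) {..<j}"
    using assms len by (intro inj_on_nth) auto
  ultimately show ?thesis unfolding rank_def by (simp add: card_image)
qed

lemma sorted_list_of_set_image:
  assumes "finite A" "strict_mono_on A f"
  shows "sorted_list_of_set (f ` A) = map f (sorted_list_of_set A)"
proof (rule sorted_distinct_set_unique)
  show "sorted (map f (sorted_list_of_set A))"
    unfolding sorted_map
    by (rule sorted_wrt_mono_rel[OF _ sorted_sorted_list_of_set[of A]])
      (use assms strict_mono_on_leD in \<open>auto simp: monotone_on_def order.order_iff_strict\<close>)
  show "distinct (map f (sorted_list_of_set A))"
    using assms strict_mono_on_imp_inj_on[OF assms(2)] by (simp add: distinct_map)
qed (use assms in auto)

lemma blocks_cong: "(\<And>i. i \<in> S \<Longrightarrow> l i = l' i) \<Longrightarrow> blocks S l = blocks S l'"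
proof -
  assume eq: "\<And>i. i \<in> S \<Longrightarrow> l i = l' i"
  then have "l ` S = l' ` S" by (intro image_cong) auto
  moreover have "{i \<in> S. l i = x} = {i \<in> S. l' i = x}" for x using eq by auto
  ultimately show ?thesis by (simp add: blocks_def)
qed

lemma blocks_relabel:
  assumes "finite S" "strict_mono_on (l ` S) \<theta>"
  shows "blocks S (\<lambda>i. \<theta> (l i)) = blocks S l"
proof -
  have im: "(\<lambda>i. \<theta> (l i)) ` S = \<theta> ` l ` S" by (simp add: image_image)
  have inj: "inj_on \<theta> (l ` S)" using assms(2) by (rule strict_mono_on_imp_inj_on)
  show ?thesis
    unfolding blocks_def im sorted_list_of_set_image[OF finite_imageI[OF assms(1)] assms(2)] map_map
  proof (rule map_cong[OF refl])
    fix x assume "x \<in> set (sorted_list_of_set (l ` S))"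
    then have "x \<in> l ` S" using assms(1) by simp
    then show "((\<lambda>x. {i \<in> S. \<theta> (l i) = x}) \<circ> \<theta>) x = {i \<in> S. l i = x}"
      using inj by (auto dest: inj_onD)
  qed
qed

lemma Union_blocks: "finite S \<Longrightarrow> \<Union>(set (blocks S l)) = S"
  by (auto simp: blocks_def)

lemma length_blocks: "finite S \<Longrightarrow> length (blocks S l) = card (l ` S)"
  by (simp add: blocks_def)

lemma mem_blocks_iff:
  assumes "finite S" "j < length (blocks S l)"
  shows "i \<in> blocks S l ! j \<longleftrightarrow> i \<in> S \<and> rank (l ` S) (l i) = j"
proof -
  have j: "j < card (l ` S)" using assms length_blocks by simp
  have fin: "finite (l ` S)" using assms(1) by simp
  let ?x = "sorted_list_of_set (l ` S) ! j"
  have x: "?x \<in> l ` S" using nth_mem[of j "sorted_list_of_set (l ` S)"] j fin by simp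
  have "blocks S l ! j = {i \<in> S. l i = ?x}"
    using j fin by (simp add: blocks_def)
  then show ?thesis
    using rank_eq_iff[OF fin _ x] rank_sorted_list[OF fin j] by auto
qed

lemma set_composition_blocks:
  assumes "finite S" "0 \<notin> S"
  shows "set_composition S (blocks S l)"
  unfolding set_composition_def
proof (intro conjI allI impI)
  show "{} \<notin> set (blocks S l)" using assms(1) by (auto simp: blocks_def)
  show "\<Union> (set (blocks S l)) = S" by (rule Union_blocks[OF assms(1)])
  show "blocks S l ! i \<inter> blocks S l ! j = {}"
    if "i < length (blocks S l)" "j < length (blocks S l)" "i \<noteq> j" for i j
  proof -
    have "False" if "k \<in> blocks S l ! i" "k \<in> blocks S l ! j" for k
      using that \<open>i \<noteq> j\<close> mem_blocks_iff[OF assms(1) \<open>i < length (blocks S l)\<close>, of k]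
        mem_blocks_iff[OF assms(1) \<open>j < length (blocks S l)\<close>, of k] by simp
    then show ?thesis by blast
  qed
qed (use assms in auto)

lemma word_inverse_eq:
  assumes "set_composition S w" "j < length w" "i \<in> w ! j"
  shows "word_inverse w i = j"
  unfolding word_inverse_def
  by (rule the_equality) (use assms in \<open>auto simp: set_composition_def\<close>)

lemma word_inverse_mem:
  assumes "set_composition S w" "i \<in> S"
  shows "word_inverse w i < length w" "i \<in> w ! word_inverse w i"
proof -
  obtain j where "j < length w" "i \<in> w ! j"
    using assms unfolding set_composition_def by (metis UnionE in_set_conv_nth)
  then show "word_inverse w i < length w" "i \<in> w ! word_inverse w i"
    using word_inverse_eq[OF assms(1)] by auto
qed

lemma word_inverse_blocks:
  assumes "finite S" "0 \<notin> S" "i \<in> S"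
  shows "word_inverse (blocks S l) i = rank (l ` S) (l i)"
proof -
  note sc = set_composition_blocks[OF assms(1,2), of l]
  show ?thesis
    using word_inverse_mem[OF sc assms(3)] mem_blocks_iff[OF assms(1), of "word_inverse (blocks S l) i"] by simp
qed

lemma word_inverse_image:
  assumes "set_composition S w"
  shows "word_inverse w ` S = {..<length w}"
proof (intro equalityI subsetI)
  fix j assume "j \<in> {..<length w}"
  then have j: "j < length w" by simp
  then have "w ! j \<noteq> {}" "w ! j \<subseteq> S"
    using assms unfolding set_composition_def by (metis nth_mem, metis Union_upper nth_mem)
  then obtain i where "i \<in> w ! j" "i \<in> S" by blast
  with word_inverse_eq[OF assms j] show "j \<in> word_inverse w ` S" by blast
qed (use word_inverse_mem[OF assms] in auto)

lemma blocks_word_inverse: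
  assumes "set_composition S w"
  shows "blocks S (word_inverse w) = w"
proof -
  have "{i \<in> S. word_inverse w i = j} = w ! j" if "j < length w" for j
  proof -
    have "w ! j \<subseteq> S" using assms that unfolding set_composition_def by (metis Union_upper nth_mem)
    then show ?thesis using word_inverse_eq[OF assms that] word_inverse_mem[OF assms] by blast
  qed
  then show ?thesis
    unfolding blocks_def word_inverse_image[OF assms] lessThan_atLeast0 sorted_list_of_set_range
    by (intro nth_equalityI) auto
qed

lemma restrict_blocks:
  assumes "finite S"
  shows "restrict_word (blocks S l) T = blocks (S \<inter> T) l"
proof -
  have "sorted_list_of_set (l ` (S \<inter> T)) = filter (\<lambda>x. x \<in> l ` (S \<inter> T)) (sorted_list_of_set (l ` S))"
    by (rule sorted_distinct_set_unique) (use assms in \<open>auto simp: sorted_wrt_filter\<close>)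
  moreover have "filter (\<lambda>x. {i \<in> S. l i = x} \<inter> T \<noteq> {}) xs = filter (\<lambda>x. x \<in> l ` (S \<inter> T)) xs" for xs
    by (rule filter_cong[OF refl]) auto
  moreover have "{i \<in> S. l i = x} \<inter> T = {i \<in> S \<inter> T. l i = x}" for x by auto
  ultimately show ?thesis
    by (simp add: restrict_word_def blocks_def filter_map comp_def)
qed

text \<open>The inverse of passing from a set composition to its inverse word. The letters may be
  any natural numbers and only their relative order matters; this freedom is used for the coproduct,
  where two words are put on separated alphabets.\<close>

definition word_perm :: "nat list \<Rightarrow> nat set list" where
  "word_perm c = blocks {1..length c} (\<lambda>i. c ! (i - 1))"

lemma image_nth_pred: "(\<lambda>i. c ! (i - 1)) ` {1..length c} = set c"
proof -
  have "(\<lambda>i. c ! (i - 1)) ` {1..length c} = (\<lambda>i. c ! i) ` {..<length c}"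
  proof (intro equalityI subsetI)
    fix x assume "x \<in> (\<lambda>i. c ! i) ` {..<length c}"
    then obtain i where "i < length c" "x = c ! i" by auto
    then show "x \<in> (\<lambda>i. c ! (i - 1)) ` {1..length c}" by (intro image_eqI[of _ _ "Suc i"]) auto
  qed auto
  also have "\<dots> = set c" by (auto simp: set_conv_nth)
  finally show ?thesis .
qed

lemma set_composition_word_perm: "set_composition {1..length c} (word_perm c)"
  unfolding word_perm_def by (rule set_composition_blocks) auto

lemma word_inverse_word_perm:
  "i < length c \<Longrightarrow> word_inverse (word_perm c) (Suc i) = rank (set c) (c ! i)"
  using word_inverse_blocks[of "{1..length c}" "Suc i" "\<lambda>i. c ! (i - 1)"]
  unfolding image_nth_pred word_perm_def[symmetric] by simp

lemma word_perm_relabel: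
  assumes "strict_mono_on (set c) \<theta>"
  shows "word_perm (map \<theta> c) = word_perm c"
proof -
  have "word_perm (map \<theta> c) = blocks {1..length c} (\<lambda>i. \<theta> (c ! (i - 1)))"
    unfolding word_perm_def length_map by (rule blocks_cong) auto
  also have "\<dots> = word_perm c"
    unfolding word_perm_def by (rule blocks_relabel) (use assms in \<open>simp_all only: image_nth_pred finite_atLeastAtMost\<close>)
  finally show ?thesis .
qed

lemma length_word_perm: "length (word_perm c) = card (set c)"
  unfolding word_perm_def by (simp only: length_blocks finite_atLeastAtMost image_nth_pred)

lemma word_perm_eqD:
  assumes "word_perm c = word_perm d"
  shows "length c = length d" "\<And>i. i < length c \<Longrightarrow> rank (set c) (c ! i) = rank (set d) (d ! i)"
proof -
  have "\<Union>(set (word_perm e)) = {1..length e}" for e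
    unfolding word_perm_def by (rule Union_blocks) simp
  then have "{1..length c} = {1..length d}"
    using assms by metis
  then have "card {1..length c} = card {1..length d}" by (rule arg_cong)
  then show len: "length c = length d" by simp
  show "rank (set c) (c ! i) = rank (set d) (d ! i)" if "i < length c" for i
    using word_inverse_word_perm[of i c] word_inverse_word_perm[of i d] that len assms by simp
qed

lemma word_perm_inj:
  assumes "word_perm c = word_perm d" "set c = set d"
  shows "c = d"
proof (rule nth_equalityI)
  fix i assume i: "i < length c"
  then have "rank (set d) (c ! i) = rank (set d) (d ! i)" using word_perm_eqD(2)[OF assms(1)] assms(2) by simp
  then show "c ! i = d ! i"
    using rank_eq_iff[of "set d"] i word_perm_eqD(1)[OF assms(1)] assms(2) nth_mem by (metis List.finite_set)
qed (rule word_perm_eqD(1)[OF assms(1)])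

text \<open>Equal set compositions give each position the same block number, so sending a letter of
  \<open>c\<close> to the letter of \<open>d\<close> of equal rank is well defined and
  increasing.\<close>

lemma word_perm_relabeling:
  assumes "word_perm c = word_perm d"
  obtains \<theta> where "strict_mono_on (set c) \<theta>" "d = map \<theta> c"
proof
  define \<theta> where "\<theta> x = (THE y. y \<in> set d \<and> rank (set d) y = rank (set c) x)" for x
  note len = word_perm_eqD(1)[OF assms] and rk = word_perm_eqD(2)[OF assms]
  have \<theta>: "\<theta> (c ! i) = d ! i" if "i < length c" for i
    unfolding \<theta>_def
  proof (rule the_equality)
    show "d ! i \<in> set d \<and> rank (set d) (d ! i) = rank (set c) (c ! i)" using that rk len by simp
    show "y = d ! i" if "y \<in> set d \<and> rank (set d) y = rank (set c) (c ! i)" for y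
      using that rk[OF \<open>i < length c\<close>] rank_eq_iff[of "set d" y "d ! i"] \<open>i < length c\<close> len by simp
  qed
  then show "d = map \<theta> c" using len by (intro nth_equalityI) auto
  show "strict_mono_on (set c) \<theta>"
  proof (rule strict_mono_onI)
    fix x y assume "x \<in> set c" "y \<in> set c" "x < y"
    then obtain i j where ij: "i < length c" "j < length c" "x = c ! i" "y = c ! j"
      by (metis in_set_conv_nth)
    have "rank (set d) (d ! i) < rank (set d) (d ! j)"
      using rank_less_iff[of "set c" x y] \<open>x < y\<close> ij rk by simp
    then show "\<theta> x < \<theta> y"
      using rank_less_iff[of "set d" "d ! i" "d ! j"] ij \<theta> len by simp
  qed
qed

lemma word_perm_M_perm:
  assumes "distinct_adj c"
  shows "word_perm c \<in> M_perms (length c)"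
proof -
  have "\<not> (i \<in> A \<and> Suc i \<in> A)" if A: "A \<in> set (word_perm c)" for A i
  proof
    assume i: "i \<in> A \<and> Suc i \<in> A"
    obtain x where "A = {i \<in> {1..length c}. c ! (i - 1) = x}"
      using A unfolding word_perm_def blocks_def by auto
    then have "1 \<le> i" "i < length c" "c ! (i - 1) = c ! i" using i by auto
    then show False
      using distinct_adj_nth[OF assms, of "i - 1"] by simp
  qed
  then show ?thesis
    unfolding M_perms_def using set_composition_word_perm by blast
qed

text \<open>The word is the inverse word of \<open>w\<close>: two consecutive integers in one block
  would be two equal neighbours in it.\<close>

lemma M_perm_word:
  assumes "w \<in> M_perms n"
  obtains c where "distinct_adj c" "length c = n" "set c = {..<length w}" "word_perm c = w"
proof
  have sc: "set_composition {1..n} w" using assms by (simp add: M_perms_def)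
  let ?c = "map (\<lambda>i. word_inverse w (Suc i)) [0..<n]"
  show "length ?c = n" by simp
  show "word_perm ?c = w"
  proof -
    have "word_perm ?c = blocks {1..n} (word_inverse w)"
      unfolding word_perm_def by (simp, rule blocks_cong) auto
    then show ?thesis using blocks_word_inverse[OF sc] by simp
  qed
  have "set ?c = word_inverse w ` Suc ` {0..<n}"
    unfolding image_image by auto
  also have "Suc ` {0..<n} = {1..n}"
    by (simp add: image_Suc_atLeastLessThan atLeastLessThanSuc_atLeastAtMost)
  finally have "set ?c = word_inverse w ` {1..n}" .
  then show "set ?c = {..<length w}" by (simp only: word_inverse_image[OF sc])
  show "distinct_adj ?c"
    unfolding distinct_adj_conv_nth
  proof (intro allI impI)
    fix i assume i: "Suc i < length ?c"
    show "?c ! i \<noteq> ?c ! Suc i"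
    proof
      assume eq: "?c ! i = ?c ! Suc i"
      let ?j = "word_inverse w (Suc i)"
      have "Suc i \<in> w ! ?j" "?j < length w" "Suc (Suc i) \<in> w ! ?j"
        using word_inverse_mem[OF sc, of "Suc i"] word_inverse_mem[OF sc, of "Suc (Suc i)"] i eq by auto
      then show False using assms nth_mem[of ?j w] unfolding M_perms_def by blast
    qed
  qed
qed

lemma M_perms_disjoint: "w \<in> M_perms m \<Longrightarrow> w \<in> M_perms n \<Longrightarrow> m = n"
proof -
  assume "w \<in> M_perms m" "w \<in> M_perms n"
  then have "{1..m} = {1..n}" by (auto simp: M_perms_def set_composition_def)
  then have "card {1..m} = card {1..n}" by (rule arg_cong)
  then show "m = n" by simp
qed

lemma all_M_perms_word:
  assumes "w \<in> all_M_perms"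
  obtains c where "distinct_adj c" "set c = {..<length w}" "word_perm c = w"
  using assms M_perm_word unfolding all_M_perms_def by blast

lemma word_perm_all_M_perms: "distinct_adj c \<Longrightarrow> word_perm c \<in> all_M_perms"
  using word_perm_M_perm unfolding all_M_perms_def by blast


section \<open>Standardization is contraction of the inverse word\<close>

section \<open>Standardization\<close>

text \<open>A closed form for the result of the rewriting in \<open>st\<close>: read off the block
  numbers of the letters present, in increasing order of the letters, and contract equal
  neighbours.\<close>

definition standard_form :: "nat set list \<Rightarrow> nat set list" where
  "standard_form w = word_perm (remdups_adj (map (word_inverse w) (sorted_list_of_set (\<Union>(set w)))))"

lemma word_perm_remdups_map_relabel:
  assumes "strict_mono_on (set xs) \<theta>"
  shows "word_perm (remdups_adj (map \<theta> xs)) = word_perm (remdups_adj xs)"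
  using remdups_adj_map_inj_on[OF strict_mono_on_imp_inj_on[OF assms]] word_perm_relabel[of "remdups_adj xs" \<theta>] assms
  by simp

lemma standard_form_blocks:
  assumes "finite S" "0 \<notin> S"
  shows "standard_form (blocks S l) = word_perm (remdups_adj (map l (sorted_list_of_set S)))"
proof -
  have "map (word_inverse (blocks S l)) (sorted_list_of_set S) = map (rank (l ` S)) (map l (sorted_list_of_set S))"
    using assms by (simp add: word_inverse_blocks)
  moreover have "strict_mono_on (set (map l (sorted_list_of_set S))) (rank (l ` S))"
    using assms by (auto intro!: strict_mono_onI simp: rank_less_iff)
  ultimately show ?thesis
    unfolding standard_form_def Union_blocks[OF assms(1)]
    by (simp only: word_perm_remdups_map_relabel)
qed

lemma standard_form_word_perm:
  assumes "distinct_adj c"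
  shows "standard_form (word_perm c) = word_perm c"
proof -
  have "map (\<lambda>i. c ! (i - 1)) (sorted_list_of_set {1..length c}) = c"
    unfolding sorted_list_of_set_range atLeastLessThanSuc_atLeastAtMost[symmetric] One_nat_def
    by (rule nth_equalityI) (auto simp del: upt_Suc)
  then have "standard_form (word_perm c) = word_perm (remdups_adj c)"
    unfolding word_perm_def[of c] by (subst standard_form_blocks) auto
  then show ?thesis using assms by (simp add: distinct_adj_altdef)
qed

lemma standard_form_M_perm: "w \<in> all_M_perms \<Longrightarrow> standard_form w = w"
  by (erule all_M_perms_word) (use standard_form_word_perm in blast)

lemma standard_form_in_all_M_perms: "standard_form w \<in> all_M_perms"
  unfolding standard_form_def by (rule word_perm_all_M_perms) simp

lemma sorted_list_of_set_Suc:
  assumes "finite S" "i \<in> S" "Suc i \<in> S"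
  obtains as bs where "sorted_list_of_set S = as @ i # Suc i # bs" "sorted_list_of_set (S - {Suc i}) = as @ i # bs"
proof -
  let ?xs = "sorted_list_of_set S"
  obtain as cs where xs: "?xs = as @ i # cs"
    using split_list[of i ?xs] assms by auto
  have strict: "sorted_wrt (<) (as @ i # cs)"
    using strict_sorted_list_of_set[of S] unfolding xs .
  have "Suc i \<in> set (as @ i # cs)" using assms xs[symmetric] by simp
  then have "Suc i \<in> set cs" using strict by (auto simp: sorted_wrt_append)
  then obtain c bs where cs: "cs = c # bs" by (cases cs) auto
  have "c = Suc i"
    using strict \<open>Suc i \<in> set cs\<close> unfolding cs by (auto simp: sorted_wrt_append)
  then have eq: "?xs = as @ i # Suc i # bs" using xs cs by simp
  have "Suc i \<notin> set as" using strict by (auto simp: sorted_wrt_append)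
  then have "sorted_list_of_set (S - {Suc i}) = as @ i # bs"
    using sorted_list_of_set_remove[OF assms(1), of "Suc i"] unfolding eq by (simp add: remove1_append)
  with eq show ?thesis by (rule that)
qed

text \<open>R1 removes one of two equal neighbours from the sequence of block numbers, and R2
  renames the letters increasingly, which leaves that sequence unchanged. So
  \<open>standard_form\<close> is an invariant of the rewriting.\<close>

lemma st_step_standard_form:
  assumes "st_step w w'" "set_composition S w"
  shows "(\<exists>S'. set_composition S' w') \<and> standard_form w' = standard_form w"
  using assms
proof (induction rule: st_step.induct)
  case (R1 j w i)
  let ?l = "word_inverse w" and ?S' = "S - {Suc i}"
  note sc = R1(4)
  have fin: "finite S" "0 \<notin> S" using sc by (auto simp: set_composition_def)
  have li: "?l i = j" "?l (Suc i) = j"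
    using word_inverse_eq[OF sc R1(1)] R1(2,3) by auto
  have iS: "i \<in> S" "Suc i \<in> S"
    using sc R1(1-3) unfolding set_composition_def by (metis UnionI nth_mem)+
  have "?l ` ?S' = ?l ` S"
  proof (intro equalityI subsetI)
    fix x assume "x \<in> ?l ` S"
    then obtain y where "y \<in> S" "x = ?l y" by blast
    then show "x \<in> ?l ` ?S'"
      using iS li by (cases "y = Suc i") (auto intro: rev_image_eqI[of i])
  qed auto
  then have im: "?l ` ?S' = {..<length w}" using word_inverse_image[OF sc] by simp
  have blk: "w[j := w ! j - {Suc i}] = blocks ?S' ?l"
  proof (rule nth_equalityI)
    show "length (w[j := w ! j - {Suc i}]) = length (blocks ?S' ?l)"
      using fin im by (simp add: length_blocks)
    fix k assume "k < length (w[j := w ! j - {Suc i}])"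
    then have k: "k < length w" by simp
    have "blocks ?S' ?l ! k = {x \<in> ?S'. ?l x = k}"
      unfolding blocks_def im lessThan_atLeast0 sorted_list_of_set_range using k by simp
    also have "\<dots> = w ! k - {Suc i}"
    proof -
      have "w ! k \<subseteq> S" using sc k unfolding set_composition_def by (metis Union_upper nth_mem)
      then show ?thesis using word_inverse_eq[OF sc k] word_inverse_mem[OF sc] by blast
    qed
    also have "\<dots> = w[j := w ! j - {Suc i}] ! k"
    proof (cases "k = j")
      case False
      then have "Suc i \<notin> w ! k" using word_inverse_eq[OF sc k] li by blast
      then show ?thesis using False k by simp
    qed (use k in simp)
    finally show "w[j := w ! j - {Suc i}] ! k = blocks ?S' ?l ! k" ..
  qed
  obtain as bs where ab: "sorted_list_of_set S = as @ i # Suc i # bs" "sorted_list_of_set ?S' = as @ i # bs"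
    using sorted_list_of_set_Suc[OF fin(1) iS] .
  have "standard_form (blocks ?S' ?l) = standard_form (blocks S ?l)"
    using fin by (simp add: standard_form_blocks ab li remdups_adj_double)
  then show ?case
    unfolding blk blocks_word_inverse[OF sc] using fin by (auto intro: set_composition_blocks)
next
  case (R2 i w)
  define f where "f x = (if x > i then x - 1 else x)" for x :: nat
  have f': "(\<lambda>x. if x > i then x - 1 else x) = f" by (simp add: f_def fun_eq_iff)
  let ?l = "word_inverse w"
  note sc = R2(3)
  have fin: "finite S" "0 \<notin> S" and U: "\<Union>(set w) = S" using sc by (auto simp: set_composition_def)
  have iS: "i \<notin> S" using R2(2) U by simp
  have mono: "strict_mono_on S f"
  proof (rule strict_mono_onI)
    fix r s assume "r \<in> S" "s \<in> S" "r < s"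
    then show "f r < f s" using iS R2(1) unfolding f_def by (cases "r = i"; cases "s = i") auto
  qed
  note inj = strict_mono_on_imp_inj_on[OF mono]
  have zero: "0 \<notin> f ` S"
  proof
    assume "0 \<in> f ` S"
    then obtain x where x: "x \<in> S" "0 = f x" by (rule imageE)
    then have "x \<noteq> 0" using fin(2) by metis
    with x(2) R2(1) show False by (simp add: f_def split: if_split_asm)
  qed
  define g where "g = inv_into S f"
  have gf: "g (f x) = x" if "x \<in> S" for x unfolding g_def using inv_into_f_f[OF inj that] .
  have "blocks (f ` S) (\<lambda>x. ?l (g x)) = map ((`) f) (blocks S ?l)"
  proof -
    have "(\<lambda>x. ?l (g x)) ` f ` S = ?l ` S" unfolding image_image using gf by (intro image_cong) auto
    moreover have "{y \<in> f ` S. ?l (g y) = x} = f ` {y \<in> S. ?l y = x}" for x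
    proof (intro Set.set_eqI iffI)
      fix y assume "y \<in> {y \<in> f ` S. ?l (g y) = x}"
      then obtain z where "z \<in> S" "y = f z" "?l (g y) = x" by blast
      then show "y \<in> f ` {y \<in> S. ?l y = x}" using gf[of z] by simp
    next
      fix y assume "y \<in> f ` {y \<in> S. ?l y = x}"
      then obtain z where "z \<in> S" "y = f z" "?l z = x" by blast
      then show "y \<in> {y \<in> f ` S. ?l (g y) = x}" using gf[of z] by simp
    qed
    ultimately show ?thesis by (simp add: blocks_def)
  qed
  then have blk: "map ((`) f) w = blocks (f ` S) (\<lambda>x. ?l (g x))"
    using blocks_word_inverse[OF sc] by simp
  have "map (\<lambda>x. ?l (g x)) (sorted_list_of_set (f ` S)) = map ?l (sorted_list_of_set S)"
    unfolding sorted_list_of_set_image[OF fin(1) mono] map_map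
    by (rule map_cong[OF refl]) (use fin gf in \<open>simp only: comp_def set_sorted_list_of_set\<close>)
  then have "standard_form (blocks (f ` S) (\<lambda>x. ?l (g x))) = standard_form (blocks S ?l)"
    unfolding standard_form_blocks[OF finite_imageI[OF fin(1), of f] zero] standard_form_blocks[OF fin]
    by (simp only:)
  then show ?case
    unfolding f' blk blocks_word_inverse[OF sc]
    using set_composition_blocks[OF finite_imageI[OF fin(1)] zero] by blast
qed

lemma st_steps_standard_form:
  assumes "st_step\<^sup>*\<^sup>* w u" "set_composition S w"
  shows "(\<exists>S'. set_composition S' u) \<and> standard_form u = standard_form w"
  using assms
proof (induction rule: rtranclp_induct)
  case (step y z)
  then obtain S' where "set_composition S' y" "standard_form y = standard_form w" by blast
  then show ?case using st_step_standard_form[OF step.hyps(2)] by simp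
qed auto

text \<open>Termination by the sum of all letters, with R2 used only at a gap \<open>i\<close> below
  some letter, since otherwise it changes nothing. If neither rule lowers the sum, the letters are
  1, ..., n and no block contains two consecutive ones.\<close>

lemma st_steps_exists:
  assumes "set_composition S w"
  shows "\<exists>u\<in>all_M_perms. st_step\<^sup>*\<^sup>* w u"
  using assms
proof (induction "\<Sum>S" arbitrary: S w rule: less_induct)
  case less
  note sc = less.prems
  have fin: "finite S" "0 \<notin> S" and U: "\<Union>(set w) = S" using sc by (auto simp: set_composition_def)
  have reduce: "\<exists>u\<in>all_M_perms. st_step\<^sup>*\<^sup>* w u"
    if red: "st_step w w'" "\<Sum>(\<Union>(set w')) < \<Sum>S" for w'
  proof -
    obtain S' where S': "set_composition S' w'" using st_step_standard_form[OF red(1) sc] by blast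
    then have "\<Union>(set w') = S'" by (simp add: set_composition_def)
    with less.hyps[OF _ S'] red(2) obtain u where "u \<in> all_M_perms" "st_step\<^sup>*\<^sup>* w' u" by auto
    with red(1) show ?thesis by (blast intro: converse_rtranclp_into_rtranclp)
  qed
  show ?case
  proof (cases "\<exists>A\<in>set w. \<exists>i. i \<in> A \<and> Suc i \<in> A")
    case True
    then obtain j i where ji: "j < length w" "i \<in> w ! j" "Suc i \<in> w ! j" by (metis in_set_conv_nth)
    let ?w' = "w[j := w ! j - {Suc i}]"
    have "Suc i \<in> S" using ji U by (metis UnionI nth_mem)
    have "\<Union>(set ?w') \<subseteq> S - {Suc i}"
    proof
      fix x assume "x \<in> \<Union>(set ?w')"
      then obtain k where k: "k < length w" "x \<in> ?w' ! k" by (metis UnionE in_set_conv_nth length_list_update)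
      have xk: "x \<in> w ! k" using k by (cases "k = j") auto
      then have "x \<in> S" using U k(1) by (metis UnionI nth_mem)
      moreover have "x \<noteq> Suc i"
      proof
        assume "x = Suc i"
        then have "k = j" using xk word_inverse_eq[OF sc k(1)] word_inverse_eq[OF sc ji(1) ji(3)] by simp
        then show False using k(2) \<open>x = Suc i\<close> ji(1) by simp
      qed
      ultimately show "x \<in> S - {Suc i}" by blast
    qed
    then have "\<Sum>(\<Union>(set ?w')) \<le> \<Sum>(S - {Suc i})" using fin by (intro sum_mono2) auto
    also have "\<dots> < \<Sum>S"
      using sum.remove[OF fin(1) \<open>Suc i \<in> S\<close>, of "\<lambda>x. x"] by simp
    finally show ?thesis by (rule reduce[OF st_step.R1[OF ji]])
  next
    case no_adj: False
    show ?thesis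
    proof (cases "\<exists>i x. 0 < i \<and> i \<notin> S \<and> x \<in> S \<and> i < x")
      case True
      then obtain i x where ix: "0 < i" "i \<notin> S" "x \<in> S" "i < x" by blast
      let ?f = "\<lambda>x. if x > i then x - 1 else x"
      let ?w' = "map ((`) ?f) w"
      have step: "st_step w ?w'" using st_step.R2[of i w] ix U by simp
      have un: "\<Union>(set ?w') = ?f ` S" unfolding U[symmetric] by auto
      have le: "\<Sum>(?f ` S) \<le> (\<Sum>x\<in>S. ?f x)"
        using sum_image_le[OF fin(1), of "\<lambda>x. x" ?f] by (simp add: comp_def)
      have lt: "(\<Sum>x\<in>S. ?f x) < \<Sum>S"
        by (rule sum_strict_mono_ex1[OF fin(1)]) (use ix in \<open>auto intro!: bexI[of _ x]\<close>)
      have "\<Sum>(\<Union>(set ?w')) < \<Sum>S" unfolding un by (rule le_less_trans[OF le lt])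
      then show ?thesis by (rule reduce[OF step])
    next
      case no_gap: False
      have S_eq: "S = {1..card S}"
      proof -
        have "insert 0 S = {..<card (insert 0 S)}"
        proof (rule initial_segment)
          fix r r' assume "r \<in> insert 0 S" "r' \<le> r"
          then show "r' \<in> insert 0 S"
            using no_gap le_neq_implies_less[of r' r] by (cases "r' = 0"; cases "r' = r") blast+
        qed (simp add: fin)
        then have "insert 0 S = {0..card S}" using fin by (simp add: lessThan_Suc_atMost atMost_atLeast0)
        then have "S = {0..card S} - {0}" using fin(2) by (metis Diff_insert_absorb)
        also have "\<dots> = {1..card S}" by auto
        finally show ?thesis .
      qed
      have "set_composition {1..card S} w" by (simp only: S_eq[symmetric] sc)
      then have "w \<in> M_perms (card S)" unfolding M_perms_def using no_adj by blast
      then show ?thesis unfolding all_M_perms_def by blast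
    qed
  qed
qed

text \<open>Existence comes from termination; uniqueness holds because \<open>standard_form\<close>
  is invariant and fixes M-permutations.\<close>

lemma st_eq_standard_form:
  assumes "set_composition S w"
  shows "st w = standard_form w"
proof -
  have uniq: "u = standard_form w" if "st_step\<^sup>*\<^sup>* w u" "u \<in> all_M_perms" for u
    using st_steps_standard_form[OF that(1) assms] standard_form_M_perm[OF that(2)] by simp
  obtain u where u: "u \<in> all_M_perms" "st_step\<^sup>*\<^sup>* w u" using st_steps_exists[OF assms] by blast
  show ?thesis
    unfolding st_def
    by (rule the_equality) (use uniq u in blast)+
qed

lemma st_blocks:
  assumes "finite S" "0 \<notin> S"
  shows "st (blocks S l) = word_perm (remdups_adj (map l (sorted_list_of_set S)))"
  using st_eq_standard_form[OF set_composition_blocks[OF assms]] standard_form_blocks[OF assms] by simp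

section \<open>The product of M-permutations as convolution\<close>

section \<open>The product of \<open>\<MM>MR\<close>\<close>

lemma restrict_word_perm_take:
  assumes "m \<le> length c"
  shows "restrict_word (word_perm c) {1..m} = word_perm (take m c)"
proof -
  have "{1..length c} \<inter> {1..m} = {1..m}" using assms by auto
  then have "restrict_word (word_perm c) {1..m} = blocks {1..m} (\<lambda>i. c ! (i - 1))"
    unfolding word_perm_def by (simp only: restrict_blocks finite_atLeastAtMost)
  also have "\<dots> = word_perm (take m c)"
  proof -
    have len: "length (take m c) = m" using assms by simp
    show ?thesis unfolding word_perm_def len by (rule blocks_cong) auto
  qed
  finally show ?thesis .
qed

lemma st_restrict_word_perm_drop:
  assumes "distinct_adj c" "m \<le> length c"
  shows "st (restrict_word (word_perm c) {Suc m..length c}) = word_perm (drop m c)"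
proof -
  have "{1..length c} \<inter> {Suc m..length c} = {Suc m..length c}" by auto
  then have "restrict_word (word_perm c) {Suc m..length c} = blocks {Suc m..length c} (\<lambda>i. c ! (i - 1))"
    unfolding word_perm_def by (simp only: restrict_blocks finite_atLeastAtMost)
  then have "st (restrict_word (word_perm c) {Suc m..length c}) =
      word_perm (remdups_adj (map (\<lambda>i. c ! (i - 1)) (sorted_list_of_set {Suc m..length c})))"
    by (simp add: st_blocks)
  also have "map (\<lambda>i. c ! (i - 1)) (sorted_list_of_set {Suc m..length c}) = drop m c"
    unfolding sorted_list_of_set_range atLeastLessThanSuc_atLeastAtMost[symmetric]
    by (rule nth_equalityI) (use assms in \<open>auto simp del: upt_Suc\<close>)
  also have "remdups_adj (drop m c) = drop m c"
    using assms(1) append_take_drop_id[of m c] by (metis distinct_adj_altdef distinct_adj_appendD2)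
  finally show ?thesis .
qed

lemma restrict_word_perm_all: "{1..length c} \<subseteq> T \<Longrightarrow> restrict_word (word_perm c) T = word_perm c"
  unfolding word_perm_def by (simp add: restrict_blocks Int_absorb2)

lemma restrict_word_perm_none: "{1..length c} \<inter> T = {} \<Longrightarrow> restrict_word (word_perm c) T = []"
  unfolding word_perm_def by (simp add: restrict_blocks) (simp add: blocks_def)

text \<open>Restricting to the first \<open>m\<close> letters of [n] takes a prefix of the inverse
  word, and standardizing the remaining part gives the complementary suffix, which shares one letter
  with the prefix in the second family. So the words in the product are the products in the word
  monoid.\<close>

lemma product_words_iff:
  assumes c: "distinct_adj c"
  shows "word_perm c \<in> product_words w u \<longleftrightarrow> (\<exists>(a, b)\<in>words.factors c. word_perm a = w \<and> word_perm b = u)"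
proof
  let ?N = "length c"
  note vN = word_perm_M_perm[OF c]
  assume "word_perm c \<in> product_words w u"
  then obtain m n where wu: "w \<in> M_perms m" "u \<in> M_perms n" and
    alt: "word_perm c \<in> M_perms (m + n) \<and> restrict_word (word_perm c) {1..m} = w \<and>
        st (restrict_word (word_perm c) {m+1..m+n}) = u \<or>
      (\<exists>N. Suc N = m + n \<and> word_perm c \<in> M_perms N \<and> restrict_word (word_perm c) {1..m} = w \<and>
        st (restrict_word (word_perm c) {m..N}) = u)"
    unfolding product_words_def by blast
  from alt show "\<exists>(a, b)\<in>words.factors c. word_perm a = w \<and> word_perm b = u"
  proof (elim disjE exE conjE)
    assume "word_perm c \<in> M_perms (m + n)"
      and r: "restrict_word (word_perm c) {1..m} = w" "st (restrict_word (word_perm c) {m+1..m+n}) = u"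
    then have N: "?N = m + n" using M_perms_disjoint[OF vN] by blast
    then have "w = word_perm (take m c)" "u = word_perm (drop m c)"
      using r restrict_word_perm_take[of m c] st_restrict_word_perm_drop[OF c, of m] by simp_all
    moreover have "(take m c, drop m c) \<in> words.factors c"
      using N unfolding word_factors_iff[OF c] by (intro disjI1 exI[of _ m]) simp
    ultimately show ?thesis by blast
  next
    fix N assume NN: "Suc N = m + n" "word_perm c \<in> M_perms N"
      and r: "restrict_word (word_perm c) {1..m} = w" "st (restrict_word (word_perm c) {m..N}) = u"
    then have N: "?N = N" using M_perms_disjoint[OF vN] by blast
    show ?thesis
    \<comment> \<open>In the overlapping family an empty factor is impossible: the other restriction
      would be all of \<open>c\<close>, so the other factor would have length \<open>N\<close>
      instead of \<open>Suc N\<close>.\<close>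
    proof (cases "m = 0")
      case True
      have "restrict_word (word_perm c) {0..N} = word_perm c"
        by (rule restrict_word_perm_all) (use N in auto)
      moreover have "st (word_perm c) = word_perm c"
        using st_eq_standard_form[OF set_composition_word_perm] standard_form_word_perm[OF c] by simp
      ultimately have "u = word_perm c" using r(2) True by simp
      then have "n = N" using M_perms_disjoint[OF wu(2)] NN(2) by blast
      then show ?thesis using NN(1) True by simp
    next
      case False
      show ?thesis
      proof (cases "m \<le> N")
        case True
        obtain m' where m': "m = Suc m'" using False by (cases m) auto
        have "w = word_perm (take (Suc m') c)" "u = word_perm (drop m' c)"
          using r restrict_word_perm_take[of m c] st_restrict_word_perm_drop[OF c, of m'] True N m' by simp_all
        moreover have "(take (Suc m') c, drop m' c) \<in> words.factors c"
          using N True m' unfolding word_factors_iff[OF c] by (intro disjI2 exI[of _ m']) simp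
        ultimately show ?thesis by blast
      next
        case False
        have "restrict_word (word_perm c) {1..m} = word_perm c"
          by (rule restrict_word_perm_all) (use N False in auto)
        then have "m = N" using M_perms_disjoint[OF wu(1)] NN(2) r(1) by simp
        then show ?thesis using False by simp
      qed
    qed
  qed
next
  note vN = word_perm_M_perm[OF c]
  assume "\<exists>(a, b)\<in>words.factors c. word_perm a = w \<and> word_perm b = u"
  then obtain a b where ab: "(a, b) \<in> words.factors c" "word_perm a = w" "word_perm b = u" by blast
  then have M: "w \<in> M_perms (length a)" "u \<in> M_perms (length b)"
    using word_perm_M_perm[of a] word_perm_M_perm[of b] by (auto simp: words.factors_def)
  from ab(1) show "word_perm c \<in> product_words w u"
    unfolding word_factors_iff[OF c]
  proof (elim disjE exE conjE)
    fix m assume m: "m \<le> length c" "a = take m c" "b = drop m c"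
    have "restrict_word (word_perm c) {1..m} = w" "st (restrict_word (word_perm c) {m+1..length c}) = u"
      using restrict_word_perm_take[OF m(1)] st_restrict_word_perm_drop[OF c m(1)] ab m by simp_all
    then show ?thesis
      unfolding product_words_def using M m vN
      by (intro CollectI exI[of _ m] exI[of _ "length c - m"]) simp
  next
    fix m assume m: "m < length c" "a = take (Suc m) c" "b = drop m c"
    have "restrict_word (word_perm c) {1..Suc m} = w" "st (restrict_word (word_perm c) {Suc m..length c}) = u"
      using restrict_word_perm_take[of "Suc m" c] st_restrict_word_perm_drop[OF c, of m] ab m by simp_all
    then show ?thesis
      unfolding product_words_def using M m vN
      by (intro CollectI exI[of _ "Suc m"] exI[of _ "length c - m"] conjI disjI2 exI[of _ "length c"]) simp_all
  qed
qed

definition finsupp :: "('a \<Rightarrow> int) \<Rightarrow> bool" where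
  "finsupp f \<longleftrightarrow> finite {x. f x \<noteq> 0}"

text \<open>\<open>product_words_iff\<close> turns the double sum over supports into a sum over the
  factorizations of \<open>c\<close>, provided different factorizations give different pairs of
  M-permutations.\<close>

lemma MMR_mult_word_perm:
  assumes f: "finsupp f" and g: "finsupp g" and c: "distinct_adj c"
  shows "(f \<otimes>\<^bsub>MMR\<^esub> g) (word_perm c) = words.conv (\<lambda>a. f (word_perm a)) (\<lambda>b. g (word_perm b)) c"
proof -
  let ?F = "{w. f w \<noteq> 0}" and ?G = "{u. g u \<noteq> 0}"
  let ?h = "\<lambda>(a, b). (word_perm a, word_perm b)"
  have fin: "finite ?F" "finite ?G" using f g by (simp_all add: finsupp_def)
  have finf: "finite (words.factors c)" using words.finite_factors' c by simp
  have inj: "inj_on ?h (words.factors c)"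
  proof (rule inj_onI, clarify)
    fix a b a' b' assume *: "(a, b) \<in> words.factors c" "(a', b') \<in> words.factors c"
      "word_perm a = word_perm a'" "word_perm b = word_perm b'"
    \<comment> \<open>The factors are a prefix and a suffix of \<open>c\<close>, hence determined by
      their lengths, which \<open>word_perm\<close> preserves.\<close>
    have "a = take (length a) c \<and> b = drop (length c - length b) c" if "(a, b) \<in> words.factors c" for a b
      using that unfolding word_factors_iff[OF c] by auto
    from this[OF *(1)] this[OF *(2)] word_perm_eqD(1)[OF *(3)] word_perm_eqD(1)[OF *(4)]
    show "a = a' \<and> b = b'" by metis
  qed
  have im: "?h ` words.factors c = {(w, u). word_perm c \<in> product_words w u}"
    unfolding product_words_iff[OF c] by force
  have "(f \<otimes>\<^bsub>MMR\<^esub> g) (word_perm c) =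
      (\<Sum>p\<in>?F \<times> ?G. f (fst p) * g (snd p) * (if word_perm c \<in> product_words (fst p) (snd p) then 1 else 0))"
    by (simp add: MMR_def sum.cartesian_product case_prod_beta)
  also have "\<dots> = (\<Sum>p\<in>{(w, u). word_perm c \<in> product_words w u}. f (fst p) * g (snd p))"
  proof (rule sum.mono_neutral_cong)
    show "finite {(w, u). word_perm c \<in> product_words w u}" unfolding im[symmetric] using finf by simp
  qed (use fin in auto)
  also have "\<dots> = (\<Sum>p\<in>words.factors c. f (word_perm (fst p)) * g (word_perm (snd p)))"
    unfolding im[symmetric] sum.reindex[OF inj] by (rule sum.cong) auto
  finally show ?thesis by (simp add: words.conv_def case_prod_beta)
qed

lemma MMR_mult_outside:
  assumes "v \<notin> all_M_perms"
  shows "(f \<otimes>\<^bsub>MMR\<^esub> g) v = 0"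
proof -
  have "v \<notin> product_words w u" for w u
    using assms unfolding product_words_def all_M_perms_def by blast
  then show ?thesis by (simp add: MMR_def)
qed


section \<open>The ring spanned by the \<open>R_tilde\<close>, and its generators\<close>

section \<open>The ring \<open>\<MM>NSym\<close>\<close>

text \<open>With positions counted from 1, as in a descent set, \<open>i\<close> compares the
  letters number \<open>i\<close> and \<open>i + 1\<close>; list indices are counted from 0.\<close>

definition descents :: "nat list \<Rightarrow> nat set" where
  "descents c = {i. 1 \<le> i \<and> i < length c \<and> c ! i < c ! (i - 1)}"

lemma descent_set_snoc: "descent_set (\<beta> @ [x]) = {sum_list (take i \<beta>) | i. 1 \<le> i \<and> i \<le> length \<beta>}"
proof -
  have "v = sum_list (take i (\<beta> @ [x])) \<and> 1 \<le> i \<and> i < length (\<beta> @ [x]) \<longleftrightarrow>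
      v = sum_list (take i \<beta>) \<and> 1 \<le> i \<and> i \<le> length \<beta>" for v i
    by (cases "i \<le> length \<beta>") auto
  then show ?thesis unfolding descent_set_def by simp
qed

lemma descent_set_Nil: "descent_set [] = {}"
  by (simp add: descent_set_def)

lemma descent_set_single: "descent_set [x] = {}"
  using descent_set_snoc[of "[]" x] by simp

lemma descent_set_snoc2: "descent_set (\<beta> @ [j, k]) = insert (sum_list \<beta> + j) (descent_set (\<beta> @ [j]))"
proof -
  have split_last: "{f i | i. 1 \<le> i \<and> i \<le> Suc n} = insert (f (Suc n)) {f i | i. 1 \<le> i \<and> i \<le> n}"
    for f :: "nat \<Rightarrow> nat" and n by (auto simp: le_Suc_eq)
  have "descent_set (\<beta> @ [j, k]) = {sum_list (take i (\<beta> @ [j])) | i. 1 \<le> i \<and> i \<le> Suc (length \<beta>)}"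
    using descent_set_snoc[of "\<beta> @ [j]" k] by simp
  also have "\<dots> = insert (sum_list (take (Suc (length \<beta>)) (\<beta> @ [j])))
      {sum_list (take i (\<beta> @ [j])) | i. 1 \<le> i \<and> i \<le> length \<beta>}"
    by (rule split_last[where f = "\<lambda>i. sum_list (take i (\<beta> @ [j]))"])
  also have "{sum_list (take i (\<beta> @ [j])) | i. 1 \<le> i \<and> i \<le> length \<beta>} =
      {sum_list (take i \<beta>) | i. 1 \<le> i \<and> i \<le> length \<beta>}"
  proof -
    have "v = sum_list (take i (\<beta> @ [j])) \<and> 1 \<le> i \<and> i \<le> length \<beta> \<longleftrightarrow>
        v = sum_list (take i \<beta>) \<and> 1 \<le> i \<and> i \<le> length \<beta>" for v i
      by (cases "i \<le> length \<beta>") auto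
    then show ?thesis by simp
  qed
  finally show ?thesis by (simp add: descent_set_snoc)
qed

lemma descent_set_snoc_cong: "descent_set (\<beta> @ [x]) = descent_set (\<beta> @ [y])"
  by (simp add: descent_set_snoc)

lemma is_composition_simps [simp]:
  "is_composition []" "is_composition (a # \<alpha>) \<longleftrightarrow> 0 < a \<and> is_composition \<alpha>"
  "is_composition (\<alpha> @ \<beta>) \<longleftrightarrow> is_composition \<alpha> \<and> is_composition \<beta>"
  by (auto simp: is_composition_def)

lemma descent_set_subset:
  assumes "is_composition \<alpha>"
  shows "descent_set \<alpha> \<subseteq> {1..<sum_list \<alpha>}"
  using assms
proof (induction \<alpha> rule: rev_induct)
  case (snoc k \<beta>)
  show ?case
  proof (cases \<beta> rule: rev_cases)
    case (snoc \<beta>' j)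
    have "descent_set (\<beta> @ [k]) = insert (sum_list \<beta>) (descent_set \<beta>)"
      using descent_set_snoc2[of \<beta>' j k] by (simp add: snoc)
    then show ?thesis using snoc.IH snoc.prems snoc by auto
  qed (simp add: descent_set_single)
qed (simp add: descent_set_Nil)

text \<open>The largest element of the descent set is the sum of all parts but the last, so the last
  part can be peeled off.\<close>

lemma composition_eqI:
  assumes "is_composition \<alpha>" "is_composition \<beta>" "sum_list \<alpha> = sum_list \<beta>" "descent_set \<alpha> = descent_set \<beta>"
  shows "\<alpha> = \<beta>"
  using assms
proof (induction \<alpha> arbitrary: \<beta> rule: rev_induct)
  case Nil
  then show ?case by (cases \<beta>) auto
next
  case (snoc x \<alpha>)
  obtain \<beta>' y where \<beta>: "\<beta> = \<beta>' @ [y]"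
    using snoc.prems by (cases \<beta> rule: rev_cases) auto
  have D: "descent_set (\<gamma> @ [z]) = insert (sum_list \<gamma>) (descent_set \<gamma>)" if "\<gamma> \<noteq> []" for \<gamma> z
    using that descent_set_snoc2[of _ _ z] by (cases \<gamma> rule: rev_cases) auto
  show ?case
  proof (cases "\<alpha> = []")
    case True
    then have "\<beta>' = []"
      using snoc.prems(4) D[of \<beta>' y] by (auto simp: \<beta> descent_set_single)
    then show ?thesis using True snoc.prems(3) by (simp add: \<beta>)
  next
    case False
    then have "\<beta>' \<noteq> []"
      using snoc.prems(4) D[of \<alpha> x] by (auto simp: \<beta> descent_set_single)
    note D\<alpha> = D[OF False, of x] and D\<beta> = D[OF this, of y]
    have sub: "descent_set \<alpha> \<subseteq> {1..<sum_list \<alpha>}" "descent_set \<beta>' \<subseteq> {1..<sum_list \<beta>'}"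
      by (rule descent_set_subset; use snoc.prems in \<open>simp add: \<beta>\<close>)+
    have eq: "insert (sum_list \<alpha>) (descent_set \<alpha>) = insert (sum_list \<beta>') (descent_set \<beta>')"
      using snoc.prems(4) D\<alpha> D\<beta> by (simp add: \<beta>)
    have "sum_list \<alpha> \<le> sum_list \<beta>'" "sum_list \<beta>' \<le> sum_list \<alpha>"
      using eq sub by (metis atLeastLessThan_iff insertE insertI1 less_imp_le order_refl subsetD)+
    then have s: "sum_list \<alpha> = sum_list \<beta>'" by simp
    have "descent_set \<alpha> = descent_set \<beta>'"
      using eq sub unfolding s by (metis Diff_insert_absorb atLeastLessThan_iff less_irrefl subsetD)
    then have "\<alpha> = \<beta>'" using snoc.IH[of \<beta>'] snoc.prems s by (simp add: \<beta>)
    then show ?thesis using snoc.prems(3) by (simp add: \<beta>)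
  qed
qed

lemma has_type_word_perm:
  assumes "distinct_adj c"
  shows "has_type (word_perm c) \<alpha> \<longleftrightarrow> length c = sum_list \<alpha> \<and> descents c = descent_set \<alpha>"
proof -
  have M: "word_perm c \<in> M_perms (sum_list \<alpha>) \<longleftrightarrow> length c = sum_list \<alpha>"
    using word_perm_M_perm[OF assms] M_perms_disjoint by metis
  have "word_inverse (word_perm c) i > word_inverse (word_perm c) (i + 1) \<longleftrightarrow> c ! i < c ! (i - 1)"
    if "1 \<le> i" "i < length c" for i
    using word_inverse_word_perm[of "i - 1" c] word_inverse_word_perm[of i c] that
      rank_less_iff[of "set c" "c ! i" "c ! (i - 1)"] by simp
  then have eq: "{i. 1 \<le> i \<and> i < length c \<and> word_inverse (word_perm c) i > word_inverse (word_perm c) (i + 1)} = descents c"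
    unfolding descents_def by blast
  show ?thesis
  proof (cases "length c = sum_list \<alpha>")
    case True
    show ?thesis
      unfolding has_type_def M unfolding True[symmetric] eq by (simp only: simp_thms)
  qed (simp only: has_type_def M simp_thms)
qed

lemma R_tilde_word_perm:
  assumes "distinct_adj c"
  shows "R_tilde \<alpha> (word_perm c) = (if length c = sum_list \<alpha> \<and> descents c = descent_set \<alpha> then 1 else 0)"
  by (simp add: R_tilde_def has_type_word_perm[OF assms])

text \<open>A word with prescribed descents: letters rise by 1 within a run, and at each descent the
  loss of one multiple of the length n outweighs this rise, since a descent exists only for n at
  least 2.\<close>

definition composition_word :: "nat list \<Rightarrow> nat list" where
  "composition_word \<alpha> =
     map (\<lambda>i. i + sum_list \<alpha> * card {d \<in> descent_set \<alpha>. i < d}) [0..<sum_list \<alpha>]"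

lemma composition_word:
  assumes "is_composition \<alpha>"
  shows "distinct_adj (composition_word \<alpha>)" "length (composition_word \<alpha>) = sum_list \<alpha>"
    "descents (composition_word \<alpha>) = descent_set \<alpha>"
proof -
  let ?n = "sum_list \<alpha>" and ?D = "descent_set \<alpha>" and ?c = "composition_word \<alpha>"
  note sub = descent_set_subset[OF assms]
  have fin: "finite ?D" using sub finite_subset by blast
  show len: "length ?c = ?n" by (simp add: composition_word_def)
  have card_Suc: "card {d \<in> ?D. i - 1 < d} = card {d \<in> ?D. i < d} + (if i \<in> ?D then 1 else 0)" if "1 \<le> i" for i
  proof -
    have "i - 1 < d \<longleftrightarrow> d = i \<or> i < d" for d using that by linarith
    then have "{d \<in> ?D. i - 1 < d} = {d \<in> ?D. i < d} \<union> (if i \<in> ?D then {i} else {})"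
      by auto
    then show ?thesis using fin by auto
  qed
  define K where "K i = card {d \<in> ?D. i < d}" for i
  have nth: "?c ! i = i + ?n * K i" if "i < ?n" for i
    using that by (simp add: composition_word_def K_def)
  have cmp: "?c ! i < ?c ! (i - 1) \<longleftrightarrow> i \<in> ?D" "?c ! (i - 1) \<noteq> ?c ! i" if i: "1 \<le> i" "i < ?n" for i
  proof -
    have c1: "?c ! i = i + ?n * K i" "?c ! (i - 1) = i - 1 + ?n * K (i - 1)"
      using nth[of i] nth[of "i - 1"] i by simp_all
    have "?c ! i < ?c ! (i - 1)" if "i \<in> ?D"
    proof -
      have "K (i - 1) = K i + 1" using card_Suc[OF i(1)] that unfolding K_def by simp
      then show ?thesis using i unfolding c1 by (simp add: distrib_left)
    qed
    moreover have "?c ! (i - 1) < ?c ! i" if "i \<notin> ?D"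
    proof -
      have "K (i - 1) = K i" using card_Suc[OF i(1)] that unfolding K_def by simp
      then show ?thesis using i unfolding c1 by simp
    qed
    ultimately show "?c ! i < ?c ! (i - 1) \<longleftrightarrow> i \<in> ?D" "?c ! (i - 1) \<noteq> ?c ! i"
      by (metis less_asym, metis less_irrefl)
  qed
  show "descents ?c = ?D"
    using cmp(1) sub unfolding descents_def len by auto
  show "distinct_adj ?c"
    unfolding distinct_adj_conv_nth len using cmp(2)[of "Suc _"] by simp
qed

definition representative :: "nat list \<Rightarrow> nat set list" where
  "representative \<alpha> = word_perm (composition_word \<alpha>)"

text \<open>The \<open>R_tilde\<close> are indicator functions of disjoint classes, so evaluation at
  representatives of the classes is the dual basis and reads off coefficients.\<close>

lemma R_tilde_representative:
  assumes "is_composition \<alpha>" "is_composition \<beta>"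
  shows "R_tilde \<beta> (representative \<alpha>) = (if \<alpha> = \<beta> then 1 else 0)"
  unfolding representative_def R_tilde_word_perm[OF composition_word(1)[OF assms(1)]]
    composition_word(2,3)[OF assms(1)]
  using composition_eqI[OF assms] by auto

lemma inj_representative: "inj_on representative {\<alpha>. is_composition \<alpha>}"
proof (rule inj_onI)
  fix \<alpha> \<beta> assume "\<alpha> \<in> {\<alpha>. is_composition \<alpha>}" "\<beta> \<in> {\<alpha>. is_composition \<alpha>}" "representative \<alpha> = representative \<beta>"
  then show "\<alpha> = \<beta>"
    using R_tilde_representative[of \<alpha> \<beta>] R_tilde_representative[of \<beta> \<beta>] by (simp split: if_splits)
qed

lemma finite_M_perms: "finite (M_perms n)"
proof (rule finite_subset)
  show "M_perms n \<subseteq> word_perm ` {c. set c \<subseteq> {..<n} \<and> length c = n}"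
  proof
    fix w assume "w \<in> M_perms n"
    then obtain c where c: "length c = n" "set c = {..<length w}" "word_perm c = w"
      using M_perm_word[of w n] by metis
    have "length w = card (set c)" using c(2) by simp
    also have "\<dots> \<le> n" using card_length[of c] c(1) by simp
    finally show "w \<in> word_perm ` {c. set c \<subseteq> {..<n} \<and> length c = n}"
      using c by (intro image_eqI[of _ _ c]) auto
  qed
qed (simp add: finite_lists_length_eq)

definition MMR_space :: "(nat set list \<Rightarrow> int) set" where
  "MMR_space = {f. finsupp f \<and> (\<forall>w. w \<notin> all_M_perms \<longrightarrow> f w = 0)}"

lemma MMR_spaceD: "f \<in> MMR_space \<Longrightarrow> finsupp f" "f \<in> MMR_space \<Longrightarrow> w \<notin> all_M_perms \<Longrightarrow> f w = 0"
  by (auto simp: MMR_space_def)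

lemma zmodule_MMR_space: "zmodule MMR_space"
  unfolding zmodule_def MMR_space_def finsupp_def mem_Collect_eq
proof (intro conjI ballI allI impI, unfold mem_Collect_eq)
  fix f g :: "nat set list \<Rightarrow> int"
  assume "finite {x. f x \<noteq> 0} \<and> (\<forall>w. w \<notin> all_M_perms \<longrightarrow> f w = 0)"
    "finite {x. g x \<noteq> 0} \<and> (\<forall>w. w \<notin> all_M_perms \<longrightarrow> g w = 0)"
  then have "finite ({x. f x \<noteq> 0} \<union> {x. g x \<noteq> 0})" by simp
  then show "finite {x. f x + g x \<noteq> 0}" by (rule finite_subset[rotated]) auto
next
  fix f :: "nat set list \<Rightarrow> int" and c :: int
  assume "finite {x. f x \<noteq> 0} \<and> (\<forall>w. w \<notin> all_M_perms \<longrightarrow> f w = 0)"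
  then have "finite {x. f x \<noteq> 0}" by blast
  then show "finite {x. c * f x \<noteq> 0}" by (rule finite_subset[rotated]) auto
qed auto

lemma R_tilde_MMR_space: "R_tilde \<alpha> \<in> MMR_space"
proof -
  have "{w. R_tilde \<alpha> w \<noteq> 0} \<subseteq> M_perms (sum_list \<alpha>)"
    by (auto simp: R_tilde_def has_type_def split: if_splits)
  then show ?thesis
    using finite_subset[OF _ finite_M_perms] unfolding MMR_space_def finsupp_def all_M_perms_def by blast
qed

lemma MMR_space_eqI:
  assumes "\<And>w. w \<notin> all_M_perms \<Longrightarrow> f w = 0" "\<And>w. w \<notin> all_M_perms \<Longrightarrow> g w = 0"
    and "\<And>c. distinct_adj c \<Longrightarrow> f (word_perm c) = g (word_perm c)"
  shows "f = g"
proof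
  fix w
  show "f w = g w"
  proof (cases "w \<in> all_M_perms")
    case True
    then obtain c where "distinct_adj c" "word_perm c = w" by (rule all_M_perms_word)
    with assms(3) show ?thesis by blast
  qed (simp add: assms)
qed

abbreviation W :: "(nat set list \<Rightarrow> int) set" where
  "W \<equiv> carrier MNSym"

abbreviation mmr_mult (infixl "\<star>" 70) where
  "f \<star> g \<equiv> f \<otimes>\<^bsub>MMR\<^esub> g"

lemma MNSym_simps [simp]:
  "ring.zero MNSym = (\<lambda>_. 0)" "ring.add MNSym = (\<lambda>f g v. f v + g v)" "monoid.one MNSym = basis_elem []"
  "monoid.mult MNSym = monoid.mult MMR" "comult MNSym = comult MMR" "counit MNSym f = f []"
  by (simp_all add: MNSym_def MMR_def)

lemma W_eq: "W = zspan {R_tilde \<alpha> | \<alpha>. is_composition \<alpha>}"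
  by (simp add: MNSym_def)

lemma zmodule_W: "zmodule W"
  unfolding W_eq by (rule zmodule_zspan)

lemma R_tilde_W: "is_composition \<alpha> \<Longrightarrow> R_tilde \<alpha> \<in> W"
  unfolding W_eq by (rule zspan_base) blast

lemma W_MMR_space: "x \<in> W \<Longrightarrow> x \<in> MMR_space"
  using zspan_subset[OF zmodule_MMR_space, of "{R_tilde \<alpha> | \<alpha>. is_composition \<alpha>}"] R_tilde_MMR_space
  unfolding W_eq by blast

lemma W_finsupp: "x \<in> W \<Longrightarrow> finsupp x"
  using W_MMR_space MMR_spaceD(1) by blast

lemma W_outside: "x \<in> W \<Longrightarrow> w \<notin> all_M_perms \<Longrightarrow> x w = 0"
  using W_MMR_space MMR_spaceD(2) by blast

lemma mult_eqI:
  assumes "\<And>w. w \<notin> all_M_perms \<Longrightarrow> h w = 0" "finsupp f" "finsupp g"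
    and "\<And>c. distinct_adj c \<Longrightarrow> h (word_perm c) = words.conv (\<lambda>a. f (word_perm a)) (\<lambda>b. g (word_perm b)) c"
  shows "f \<star> g = h"
  by (rule MMR_space_eqI) (use assms in \<open>simp_all add: MMR_mult_outside MMR_mult_word_perm\<close>)

text \<open>The product of \<open>MMR\<close> sums over supports and is convolution between
  functions of finite support; hence the finiteness conditions on the intermediate products.\<close>

lemma mult_assoc:
  assumes "finsupp f" "finsupp g" "finsupp h" "finsupp (f \<star> g)" "finsupp (g \<star> h)"
  shows "f \<star> g \<star> h = f \<star> (g \<star> h)"
proof (rule mult_eqI)
  fix c :: "nat list" assume c: "distinct_adj c"
  let ?f = "\<lambda>a. f (word_perm a)" and ?g = "\<lambda>a. g (word_perm a)" and ?h = "\<lambda>a. h (word_perm a)"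
  have "words.conv (\<lambda>a. (f \<star> g) (word_perm a)) ?h c = words.conv (words.conv ?f ?g) ?h c"
    by (rule words.conv_cong) (simp_all add: MMR_mult_word_perm assms)
  also have "\<dots> = words.conv ?f (words.conv ?g ?h) c"
    by (rule words.conv_assoc) (simp add: c)
  also have "\<dots> = words.conv ?f (\<lambda>a. (g \<star> h) (word_perm a)) c"
    by (rule words.conv_cong) (simp_all add: MMR_mult_word_perm assms)
  finally show "(f \<star> (g \<star> h)) (word_perm c) = words.conv (\<lambda>a. (f \<star> g) (word_perm a)) ?h c"
    using MMR_mult_word_perm[OF assms(1,5) c] by simp
qed (simp_all add: assms MMR_mult_outside)

lemma word_perm_Nil [simp]: "word_perm [] = []"
  by (simp add: word_perm_def blocks_def)

lemma word_perm_eq_Nil: "word_perm c = [] \<longleftrightarrow> c = []"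
  using length_word_perm[of c] by auto

lemma basis_elem_Nil_word_perm: "basis_elem [] (word_perm c) = (if c = [] then 1 else 0)"
  by (simp add: basis_elem_def word_perm_eq_Nil)

lemma Nil_M_perm: "[] \<in> all_M_perms"
  using word_perm_all_M_perms[of "[]"] by simp

lemma finsupp_one: "finsupp (basis_elem [])"
  by (simp add: finsupp_def basis_elem_def)

lemma R_tilde_Nil: "R_tilde [] = basis_elem []"
proof (rule MMR_space_eqI)
  fix c :: "nat list" assume "distinct_adj c"
  then show "R_tilde [] (word_perm c) = basis_elem [] (word_perm c)"
    by (simp add: R_tilde_word_perm basis_elem_Nil_word_perm descent_set_Nil descents_def)
qed (use MMR_spaceD(2)[OF R_tilde_MMR_space] Nil_M_perm in \<open>auto simp: basis_elem_def\<close>)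

lemma one_W: "basis_elem [] \<in> W"
  using R_tilde_W[of "[]"] by (simp add: R_tilde_Nil)

lemma mult_one:
  assumes "x \<in> W"
  shows "x \<star> basis_elem [] = x" "basis_elem [] \<star> x = x"
  by (rule mult_eqI; use assms W_finsupp W_outside finsupp_one in
      \<open>simp add: basis_elem_Nil_word_perm words.conv_one_right words.conv_one_left\<close>)+

lemma mult_add_left:
  assumes "x \<in> W" "y \<in> W" "z \<in> W"
  shows "(\<lambda>v. x v + y v) \<star> z = (\<lambda>v. (x \<star> z) v + (y \<star> z) v)"
  by (rule mult_eqI)
    (use assms zmodule_add[OF zmodule_W assms(1,2)] in
      \<open>simp_all add: MMR_mult_outside W_finsupp MMR_mult_word_perm words.conv_add_left\<close>)

lemma mult_add_right:
  assumes "x \<in> W" "y \<in> W" "z \<in> W"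
  shows "z \<star> (\<lambda>v. x v + y v) = (\<lambda>v. (z \<star> x) v + (z \<star> y) v)"
  by (rule mult_eqI)
    (use assms zmodule_add[OF zmodule_W assms(1,2)] in
      \<open>simp_all add: MMR_mult_outside W_finsupp MMR_mult_word_perm words.conv_add_right\<close>)

lemma mult_scale_left:
  assumes "x \<in> W" "z \<in> W"
  shows "(\<lambda>v. c * x v) \<star> z = (\<lambda>v. c * (x \<star> z) v)"
  by (rule mult_eqI)
    (use assms zmodule_scale[OF zmodule_W assms(1), of c] in
      \<open>simp_all add: MMR_mult_outside W_finsupp MMR_mult_word_perm words.conv_scale_left\<close>)

lemma mult_scale_right:
  assumes "x \<in> W" "z \<in> W"
  shows "z \<star> (\<lambda>v. c * x v) = (\<lambda>v. c * (z \<star> x) v)"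
  by (rule mult_eqI)
    (use assms zmodule_scale[OF zmodule_W assms(1), of c] in
      \<open>simp_all add: MMR_mult_outside W_finsupp MMR_mult_word_perm words.conv_scale_right\<close>)

lemma descents_take: "p \<le> length c \<Longrightarrow> descents (take p c) = descents c \<inter> {..<p}"
  by (auto simp: descents_def)

lemma descents_drop_empty_iff: "p \<le> length c \<Longrightarrow> descents (drop p c) = {} \<longleftrightarrow> descents c \<inter> {p<..} = {}"
proof
  assume "p \<le> length c" "descents (drop p c) = {}"
  then have "\<not> (1 \<le> i \<and> i < length c - p \<and> c ! (p + i) < c ! (p + (i - 1)))" for i
    unfolding descents_def by auto
  from this[of "_ - p"] show "descents c \<inter> {p<..} = {}"
    unfolding descents_def by fastforce
next
  assume p: "p \<le> length c" and e: "descents c \<inter> {p<..} = {}"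
  have "i \<notin> descents (drop p c)" for i
  proof
    assume "i \<in> descents (drop p c)"
    then have "p + i \<in> descents c \<inter> {p<..}" using p by (auto simp: descents_def)
    with e show False by blast
  qed
  then show "descents (drop p c) = {}" by blast
qed

text \<open>The factors of \<open>c\<close> are a prefix and a suffix that meet or share one letter,
  so prescribing both lengths leaves at most one factorization.\<close>

lemma sum_factors_lengths:
  assumes c: "distinct_adj c" and p: "0 < p" "0 < k"
    and z: "\<And>a b. length a \<noteq> p \<or> length b \<noteq> k \<Longrightarrow> f a b = (0 :: int)"
  shows "(\<Sum>(a, b)\<in>words.factors c. f a b) =
    (if length c = p + k then f (take p c) (drop p c)
     else if length c = p + k - 1 then f (take p c) (drop (p - 1) c) else 0)"
proof -
  have finf: "finite (words.factors c)" using words.finite_factors' c by simp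
  have shape: "(a, b) = (take p c, drop p c) \<and> length c = p + k \<or>
      (a, b) = (take p c, drop (p - 1) c) \<and> length c = p + k - 1"
    if "(a, b) \<in> words.factors c" "length a = p" "length b = k" for a b
    using that unfolding word_factors_iff[OF c]
  proof (elim disjE exE conjE)
    fix m assume "m < length c" "a = take (Suc m) c" "b = drop m c"
    then show ?thesis using that(2,3) by (intro disjI2) auto
  qed auto
  consider (sum) "length c = p + k" | (overlap) "length c = p + k - 1" "length c \<noteq> p + k"
    | (none) "length c \<noteq> p + k" "length c \<noteq> p + k - 1" by blast
  then show ?thesis
  proof cases
    case sum
    have mem: "(take p c, drop p c) \<in> words.factors c"
      unfolding word_factors_iff[OF c] using sum by (intro disjI1 exI[of _ p]) simp
    have "(\<Sum>(a, b)\<in>words.factors c. f a b) = (\<Sum>(a, b)\<in>{(take p c, drop p c)}. f a b)"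
    proof (rule sum.mono_neutral_right[OF finf])
      show "\<forall>x\<in>words.factors c - {(take p c, drop p c)}. (case x of (a, b) \<Rightarrow> f a b) = 0"
      proof (rule ballI)
        fix x assume x: "x \<in> words.factors c - {(take p c, drop p c)}"
        obtain a b where ab: "x = (a, b)" by fastforce
        have "length a \<noteq> p \<or> length b \<noteq> k"
          using shape[of a b] x sum p unfolding ab by auto
        then show "(case x of (a, b) \<Rightarrow> f a b) = 0" using z by (simp add: ab)
      qed
    qed (use mem in simp)
    then show ?thesis using sum by simp
  next
    case overlap
    have mem: "(take p c, drop (p - 1) c) \<in> words.factors c"
      unfolding word_factors_iff[OF c] using overlap p by (intro disjI2 exI[of _ "p - 1"]) simp
    have "(\<Sum>(a, b)\<in>words.factors c. f a b) = (\<Sum>(a, b)\<in>{(take p c, drop (p - 1) c)}. f a b)"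
    proof (rule sum.mono_neutral_right[OF finf])
      show "\<forall>x\<in>words.factors c - {(take p c, drop (p - 1) c)}. (case x of (a, b) \<Rightarrow> f a b) = 0"
      proof (rule ballI)
        fix x assume x: "x \<in> words.factors c - {(take p c, drop (p - 1) c)}"
        obtain a b where ab: "x = (a, b)" by fastforce
        have "length a \<noteq> p \<or> length b \<noteq> k"
          using shape[of a b] x overlap p unfolding ab by auto
        then show "(case x of (a, b) \<Rightarrow> f a b) = 0" using z by (simp add: ab)
      qed
    qed (use mem in simp)
    then show ?thesis using overlap p by simp
  next
    case none
    have "(\<Sum>(a, b)\<in>words.factors c. f a b) = 0"
    proof (rule sum.neutral, rule ballI)
      fix x assume x: "x \<in> words.factors c"
      obtain a b where ab: "x = (a, b)" by fastforce
      have "length a \<noteq> p \<or> length b \<noteq> k"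
        using shape[of a b] x none unfolding ab by auto
      then show "(case x of (a, b) \<Rightarrow> f a b) = 0" using z by (simp add: ab)
    qed
    then show ?thesis using none by simp
  qed
qed

text \<open>The product rule on the side of words. A word of length \<open>p + k\<close> with the
  right prefix and an increasing suffix may or may not have a descent at the seam \<open>p\<close>,
  giving the first two terms; when the factors overlap, no comparison is left open and only the
  third type occurs. This matches \<open>dual_g_tilde_ribbon_rec\<close>.\<close>

lemma R_tilde_mult_F_gen:
  assumes "is_composition \<alpha>" "0 < j" "0 < k"
  shows "R_tilde (\<alpha> @ [j]) \<star> F_gen k =
    (\<lambda>v. R_tilde (\<alpha> @ [j, k]) v + R_tilde (\<alpha> @ [j + k]) v + R_tilde (\<alpha> @ [j + k - 1]) v)"
proof (rule mult_eqI)
  show "finsupp (R_tilde (\<alpha> @ [j]))" "finsupp (F_gen k)"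
    unfolding F_gen_def by (rule MMR_spaceD(1)[OF R_tilde_MMR_space])+
  show "R_tilde (\<alpha> @ [j, k]) w + R_tilde (\<alpha> @ [j + k]) w + R_tilde (\<alpha> @ [j + k - 1]) w = 0"
    if "w \<notin> all_M_perms" for w
    using that by (simp add: MMR_spaceD(2)[OF R_tilde_MMR_space])
next
  fix c :: "nat list" assume c: "distinct_adj c"
  define p where "p = sum_list \<alpha> + j"
  define D where "D = descent_set (\<alpha> @ [j])"
  have D: "D \<subseteq> {1..<p}" using descent_set_subset[of "\<alpha> @ [j]"] assms by (simp add: D_def p_def)
  have p: "0 < p" using assms by (simp add: p_def)
  define g where "g a b = (if length a = p \<and> descents a = D then 1 else 0) * (if length b = k \<and> descents b = {} then 1 else (0::int))" for a b
  have "words.conv (\<lambda>a. R_tilde (\<alpha> @ [j]) (word_perm a)) (\<lambda>b. F_gen k (word_perm b)) c = (\<Sum>(a, b)\<in>words.factors c. g a b)"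
    unfolding words.conv_def
  proof (rule sum.cong[OF refl], clarify)
    fix a b assume "(a, b) \<in> words.factors c"
    then have "distinct_adj a" "distinct_adj b" by (auto simp: words.factors_def)
    then show "R_tilde (\<alpha> @ [j]) (word_perm a) * F_gen k (word_perm b) = g a b"
      by (simp add: R_tilde_word_perm F_gen_def g_def p_def D_def descent_set_single)
  qed
  also have "\<dots> = (if length c = p + k then g (take p c) (drop p c)
     else if length c = p + k - 1 then g (take p c) (drop (p - 1) c) else 0)"
    by (rule sum_factors_lengths[OF c p assms(3)]) (auto simp: g_def)
  also have "\<dots> = R_tilde (\<alpha> @ [j, k]) (word_perm c) + R_tilde (\<alpha> @ [j + k]) (word_perm c) + R_tilde (\<alpha> @ [j + k - 1]) (word_perm c)"
  proof -
    have DD: "descent_set (\<alpha> @ [j, k]) = insert p D" "descent_set (\<alpha> @ [j + k]) = D" "descent_set (\<alpha> @ [j + k - 1]) = D"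
      using descent_set_snoc2[of \<alpha> j k] descent_set_snoc_cong[of \<alpha> _ j] by (simp_all add: D_def p_def)
    have sums: "sum_list (\<alpha> @ [j, k]) = p + k" "sum_list (\<alpha> @ [j + k]) = p + k" "sum_list (\<alpha> @ [j + k - 1]) = p + k - 1"
      using assms by (simp_all add: p_def)
    have pD: "p \<notin> D" using D by auto
    consider (sum) "length c = p + k" | (overlap) "length c = p + k - 1" "length c \<noteq> p + k"
      | (none) "length c \<noteq> p + k" "length c \<noteq> p + k - 1" by blast
    then show ?thesis
    proof cases
      case sum
      have neq: "p + k \<noteq> p + k - 1" using p by linarith
      \<comment> \<open>The prefix fixes the descents below \<open>p\<close> and the suffix excludes
        those above; only position \<open>p\<close> is free.\<close>
      have "descents (take p c) = D \<and> descents (drop p c) = {} \<longleftrightarrow> descents c = D \<or> descents c = insert p D"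
      proof -
        have pc: "p \<le> length c" using sum by simp
        have split: "descents c = (descents c \<inter> {..<p}) \<union> (descents c \<inter> {p}) \<union> (descents c \<inter> {p<..})" by auto
        show ?thesis
          unfolding descents_take[OF pc] descents_drop_empty_iff[OF pc]
        proof
          assume *: "descents c \<inter> {..<p} = D \<and> descents c \<inter> {p<..} = {}"
          show "descents c = D \<or> descents c = insert p D"
            using split * by (cases "p \<in> descents c") auto
        next
          assume "descents c = D \<or> descents c = insert p D"
          then show "descents c \<inter> {..<p} = D \<and> descents c \<inter> {p<..} = {}" using D by auto
        qed
      qed
      moreover have "\<not> (descents c = D \<and> descents c = insert p D)" using pD by blast
      ultimately have "g (take p c) (drop p c) = (if descents c = insert p D then 1 else 0) + (if descents c = D then 1 else 0)"
        using sum by (auto simp: g_def)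
      then show ?thesis
        unfolding R_tilde_word_perm[OF c] sums DD using sum neq by simp
    next
      case overlap
      have pc: "p \<le> length c" "p - 1 \<le> length c" using overlap assms by simp_all
      have "descents (take p c) = D \<and> descents (drop (p - 1) c) = {} \<longleftrightarrow> descents c = D"
        unfolding descents_take[OF pc(1)] descents_drop_empty_iff[OF pc(2)]
      proof
        assume *: "descents c \<inter> {..<p} = D \<and> descents c \<inter> {p - 1<..} = {}"
        have "descents c = (descents c \<inter> {..<p}) \<union> (descents c \<inter> {p - 1<..})" using p by auto
        with * show "descents c = D" by simp
      qed (use D in auto)
      then have "g (take p c) (drop (p - 1) c) = (if descents c = D then 1 else 0)"
        using overlap p assms(3) by (auto simp: g_def)
      then show ?thesis
        unfolding R_tilde_word_perm[OF c] sums DD using overlap by simp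
    next
      case none
      then show ?thesis
        unfolding R_tilde_word_perm[OF c] sums DD by simp
    qed
  qed
  finally show "R_tilde (\<alpha> @ [j, k]) (word_perm c) + R_tilde (\<alpha> @ [j + k]) (word_perm c) + R_tilde (\<alpha> @ [j + k - 1]) (word_perm c) =
     words.conv (\<lambda>a. R_tilde (\<alpha> @ [j]) (word_perm a)) (\<lambda>b. F_gen k (word_perm b)) c" by simp
qed


lemma F_gen_W: "0 < k \<Longrightarrow> F_gen k \<in> W"
  unfolding F_gen_def by (rule R_tilde_W) simp

lemma mult_F_gen_W:
  assumes "x \<in> W" "0 < k"
  shows "x \<star> F_gen k \<in> W"
proof -
  have "x \<in> {x \<in> W. x \<star> F_gen k \<in> W}"
    using assms(1) unfolding W_eq
  proof (rule zspan_minimal, unfold W_eq[symmetric])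
    have "(\<lambda>_. 0) \<star> F_gen k = (\<lambda>v. 0 * (basis_elem [] \<star> F_gen k) v)"
      using mult_scale_left[OF one_W F_gen_W[OF assms(2)], of 0] by simp
    then show "(\<lambda>_. 0) \<in> {x \<in> W. x \<star> F_gen k \<in> W}"
      using zmodule_zero[OF zmodule_W] by simp
  next
    fix s a c assume s: "s \<in> {R_tilde \<alpha> | \<alpha>. is_composition \<alpha>}" and a: "a \<in> {x \<in> W. x \<star> F_gen k \<in> W}"
    obtain \<alpha> where \<alpha>: "s = R_tilde \<alpha>" "is_composition \<alpha>" using s by blast
    have sW: "s \<in> W" unfolding \<alpha>(1) by (rule R_tilde_W[OF \<alpha>(2)])
    have aW: "a \<in> W" "a \<star> F_gen k \<in> W" using a by auto
    have sF: "s \<star> F_gen k \<in> W"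
    proof (cases \<alpha> rule: rev_cases)
      case Nil
      then show ?thesis using mult_one(2)[OF F_gen_W[OF assms(2)]] F_gen_W[OF assms(2)] by (simp add: \<alpha> R_tilde_Nil)
    next
      case (snoc \<beta> j)
      then have pos: "is_composition \<beta>" "0 < j" using \<alpha>(2) by auto
      show ?thesis
        unfolding \<alpha>(1) snoc R_tilde_mult_F_gen[OF pos assms(2)]
        by (intro zmodule_add[OF zmodule_W] R_tilde_W) (use pos assms(2) in auto)
    qed
    have csW: "(\<lambda>x. c * s x) \<in> W" by (rule zmodule_scale[OF zmodule_W sW])
    have "(\<lambda>x. c * s x + a x) \<star> F_gen k = (\<lambda>v. c * (s \<star> F_gen k) v + (a \<star> F_gen k) v)"
      unfolding mult_add_left[OF csW aW(1) F_gen_W[OF assms(2)]] mult_scale_left[OF sW F_gen_W[OF assms(2)]] ..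
    moreover have "(\<lambda>v. c * (s \<star> F_gen k) v + (a \<star> F_gen k) v) \<in> W"
      by (rule zmodule_add[OF zmodule_W zmodule_scale[OF zmodule_W sF] aW(2)])
    moreover have "(\<lambda>x. c * s x + a x) \<in> W" by (rule zmodule_add[OF zmodule_W csW aW(1)])
    ultimately show "(\<lambda>x. c * s x + a x) \<in> {x \<in> W. x \<star> F_gen k \<in> W}" by simp
  qed
  then show ?thesis by blast
qed

text \<open>The F_k generate. Solved for its first term, the product rule expresses
  \<open>R_tilde (\<gamma> @ [j, k])\<close> by a product with F_k and by types with fewer parts, so
  induction on the number of parts reaches every \<open>R_tilde\<close>.\<close>

lemma W_induct_F [consumes 1, case_names zero add scale one mult]:
  assumes x: "x \<in> W"
    and zero: "Q (\<lambda>_. 0)"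
    and add: "\<And>x y. x \<in> W \<Longrightarrow> y \<in> W \<Longrightarrow> Q x \<Longrightarrow> Q y \<Longrightarrow> Q (\<lambda>v. x v + y v)"
    and scale: "\<And>x c. x \<in> W \<Longrightarrow> Q x \<Longrightarrow> Q (\<lambda>v. c * x v)"
    and one: "Q (basis_elem [])"
    and mult: "\<And>x k. x \<in> W \<Longrightarrow> 0 < k \<Longrightarrow> Q x \<Longrightarrow> Q (x \<star> F_gen k)"
  shows "Q x"
proof -
  have diff: "Q (\<lambda>v. x v - y v)" if "x \<in> W" "y \<in> W" "Q x" "Q y" for x y
    using add[OF that(1) zmodule_scale[OF zmodule_W that(2), of "-1"] that(3) scale[OF that(2,4), of "-1"]] by simp
  have R: "Q (R_tilde \<alpha>)" if "is_composition \<alpha>" for \<alpha>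
    using that
  proof (induction "length \<alpha>" arbitrary: \<alpha> rule: less_induct)
    case less
    show ?case
    proof (cases \<alpha> rule: rev_cases)
      case Nil
      then show ?thesis using one by (simp add: R_tilde_Nil)
    next
      case snoc1: (snoc \<beta> k)
      then have k: "0 < k" "is_composition \<beta>" using less.prems by auto
      show ?thesis
      proof (cases \<beta> rule: rev_cases)
        case Nil
        have "Q (basis_elem [] \<star> F_gen k)" by (rule mult[OF one_W k(1) one])
        then show ?thesis
          using mult_one(2)[OF F_gen_W[OF k(1)]] by (simp add: snoc1 Nil F_gen_def)
      next
        case (snoc \<gamma> j)
        have j: "is_composition \<gamma>" "0 < j" using k snoc by auto
        have c: "is_composition (\<gamma> @ [j + k])" "is_composition (\<gamma> @ [j + k - 1])" "is_composition (\<gamma> @ [j])"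
          using j k by auto
        have IH: "Q (R_tilde (\<gamma> @ [j + k]))" "Q (R_tilde (\<gamma> @ [j + k - 1]))" "Q (R_tilde (\<gamma> @ [j]))"
          by (rule less.hyps; use c in \<open>simp add: snoc1 snoc\<close>)+
        note m = mult_F_gen_W[OF R_tilde_W[OF c(3)] k(1)]
        note RW = R_tilde_W[OF c(1)] R_tilde_W[OF c(2)]
        have "Q (\<lambda>v. (R_tilde (\<gamma> @ [j]) \<star> F_gen k) v - (R_tilde (\<gamma> @ [j + k]) v + R_tilde (\<gamma> @ [j + k - 1]) v))"
          by (intro diff add m RW IH mult R_tilde_W[OF c(3)] k zmodule_add[OF zmodule_W])
        also have "(\<lambda>v. (R_tilde (\<gamma> @ [j]) \<star> F_gen k) v - (R_tilde (\<gamma> @ [j + k]) v + R_tilde (\<gamma> @ [j + k - 1]) v)) = R_tilde \<alpha>"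
          unfolding R_tilde_mult_F_gen[OF j k(1)] by (simp add: snoc1 snoc)
        finally show ?thesis .
      qed
    qed
  qed
  have "x \<in> {x \<in> W. Q x}"
    using x unfolding W_eq
  proof (rule zspan_minimal, unfold W_eq[symmetric])
    show "(\<lambda>_. 0) \<in> {x \<in> W. Q x}" using zero zmodule_zero[OF zmodule_W] by simp
    fix s a c assume s: "s \<in> {R_tilde \<alpha> | \<alpha>. is_composition \<alpha>}" and a: "a \<in> {x \<in> W. Q x}"
    then have "s \<in> W" "Q s" using R R_tilde_W by blast+
    then show "(\<lambda>x. c * s x + a x) \<in> {x \<in> W. Q x}"
      using a by (simp add: add scale zmodule_add[OF zmodule_W] zmodule_scale[OF zmodule_W])
  qed
  then show ?thesis by blast
qed

lemma W_mult_assoc_F: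
  assumes "x \<in> W" "y \<in> W" "x \<star> y \<in> W" "0 < k"
  shows "x \<star> (y \<star> F_gen k) = x \<star> y \<star> F_gen k"
  by (rule mult_assoc[symmetric]) (use assms mult_F_gen_W F_gen_W W_finsupp in blast)+

text \<open>Builds the second factor by appending one generator F_k at a time, where closure is the
  product rule \<open>mult_F_gen_W\<close>.\<close>

lemma mult_W:
  assumes "x \<in> W" "y \<in> W"
  shows "x \<star> y \<in> W"
  using assms(2)
proof (induction rule: W_induct_F)
  case zero
  have "x \<star> (\<lambda>_. 0) = (\<lambda>_. 0)"
    using mult_scale_right[OF one_W assms(1), of 0] by simp
  then show ?case using zmodule_zero[OF zmodule_W] by simp
next
  case (add y z)
  then show ?case using zmodule_add[OF zmodule_W] by (simp add: mult_add_right assms(1))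
next
  case (scale y c)
  then show ?case using zmodule_scale[OF zmodule_W] by (simp add: mult_scale_right assms(1))
next
  case one
  then show ?case using mult_one(1)[OF assms(1)] assms(1) by simp
next
  case (mult y k)
  then show ?case by (simp only: W_mult_assoc_F[OF assms(1)] mult_F_gen_W)
qed

lemma W_mult_assoc:
  assumes "x \<in> W" "y \<in> W" "z \<in> W"
  shows "x \<star> y \<star> z = x \<star> (y \<star> z)"
  by (rule mult_assoc) (use assms mult_W W_finsupp in blast)+

lemma ring_MNSym: "ring MNSym"
proof (rule ringI)
  show "abelian_group MNSym"
    by (rule pointwise_abelian_group[OF zmodule_W]) simp_all
  show "monoid MNSym"
    by (rule monoidI) (simp_all add: mult_W one_W W_mult_assoc mult_one)
qed (simp_all add: mult_add_left mult_add_right)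

text \<open>A second family of generators. Products of the h_k all have a power of x_1 as leading
  monomial, whereas the images of the E_n have leading monomial x_1 ... x_n, so their products tell
  the dominant monomials apart.\<close>

definition E_gen :: "nat \<Rightarrow> nat set list \<Rightarrow> int" where
  "E_gen n = R_tilde (replicate n 1)"

lemma E_gen_W: "E_gen n \<in> W"
  unfolding E_gen_def by (rule R_tilde_W) (simp add: is_composition_def)

text \<open>It suffices to express the F_k by the E_n. This is done for all types (1, ..., 1, k)
  together, because the product rule applied to them stays within this family.\<close>

lemma W_induct_E [consumes 1, case_names zero add scale one mult]:
  assumes x: "x \<in> W"
    and zero: "Q (\<lambda>_. 0)"
    and add: "\<And>x y. x \<in> W \<Longrightarrow> y \<in> W \<Longrightarrow> Q x \<Longrightarrow> Q y \<Longrightarrow> Q (\<lambda>v. x v + y v)"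
    and scale: "\<And>x c. x \<in> W \<Longrightarrow> Q x \<Longrightarrow> Q (\<lambda>v. c * x v)"
    and one: "Q (basis_elem [])"
    and mult: "\<And>x n. x \<in> W \<Longrightarrow> 0 < n \<Longrightarrow> Q x \<Longrightarrow> Q (x \<star> E_gen n)"
  shows "Q x"
proof -
  \<comment> \<open>Elements whose right multiplication preserves \<open>Q\<close> are closed under
    products and differences, so showing that each F_k is one of them reduces the claim to
    \<open>W_induct_F\<close>.\<close>
  define good where "good y \<longleftrightarrow> y \<in> W \<and> (\<forall>x\<in>W. Q x \<longrightarrow> Q (x \<star> y))" for y
  have goodD: "Q (x \<star> y)" if "good y" "x \<in> W" "Q x" for x y using that by (auto simp: good_def)
  have goodW: "y \<in> W" if "good y" for y using that by (simp add: good_def)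
  have good_E: "good (E_gen n)" if "0 < n" for n
    unfolding good_def using mult[OF _ that] E_gen_W by blast
  have good_mult: "good (y \<star> z)" if yz: "good y" "good z" for y z
    unfolding good_def
  proof (intro conjI ballI impI)
    show "y \<star> z \<in> W" using mult_W goodW yz by blast
    fix x assume x: "x \<in> W" "Q x"
    have "Q (x \<star> y \<star> z)" using goodD[OF yz(2) mult_W[OF x(1) goodW[OF yz(1)]] goodD[OF yz(1) x]] .
    then show "Q (x \<star> (y \<star> z))" by (simp only: W_mult_assoc[OF x(1) goodW[OF yz(1)] goodW[OF yz(2)]])
  qed
  have good_diff: "good (\<lambda>v. y v - z v)" if yz: "good y" "good z" for y z
    unfolding good_def
  proof (intro conjI ballI impI)
    note yW = goodW[OF yz(1)] and zW = goodW[OF yz(2)]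
    note nzW = zmodule_scale[OF zmodule_W zW, of "-1"]
    show "(\<lambda>v. y v - z v) \<in> W" by (rule zmodule_diff[OF zmodule_W yW zW])
    fix x assume x: "x \<in> W" "Q x"
    have "Q (\<lambda>v. (x \<star> y) v + -1 * (x \<star> z) v)"
      by (intro add scale mult_W x yW zW zmodule_scale[OF zmodule_W] goodD[OF yz(1) x] goodD[OF yz(2) x])
    also have "(\<lambda>v. (x \<star> y) v + -1 * (x \<star> z) v) = x \<star> (\<lambda>v. y v + -1 * z v)"
      unfolding mult_add_right[OF yW nzW x(1)] mult_scale_right[OF zW x(1)] ..
    finally show "Q (x \<star> (\<lambda>v. y v - z v))" by simp
  qed
  \<comment> \<open>Induction on \<open>k\<close> for all \<open>j\<close> at once: multiplying
    E_(j+1) by F_k, which is the case \<open>j = 0\<close> at level \<open>k\<close>, produces the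
    type ending in \<open>Suc k\<close> and two types ending in \<open>k\<close>.\<close>
  have R: "\<forall>j. good (R_tilde (replicate j 1 @ [k]))" if "0 < k" for k
    using that
  proof (induction k rule: nat_induct_non_zero)
    case 1
    show ?case
      using good_E[of "Suc _"] unfolding E_gen_def by (simp add: replicate_append_same)
  next
    case (Suc k)
    show ?case
    proof
      fix j
      let ?\<beta> = "replicate j (1 :: nat)"
      have rec: "R_tilde (?\<beta> @ [1]) \<star> F_gen k =
          (\<lambda>v. R_tilde (?\<beta> @ [1, k]) v + R_tilde (?\<beta> @ [1 + k]) v + R_tilde (?\<beta> @ [1 + k - 1]) v)"
        by (rule R_tilde_mult_F_gen) (use Suc.hyps in \<open>simp_all add: is_composition_def\<close>)
      have "good (R_tilde (replicate 0 1 @ [k]))" using Suc.IH by blast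
      then have gF: "good (F_gen k)" by (simp add: F_gen_def)
      have gE: "good (R_tilde (?\<beta> @ [1]))"
        using good_E[of "Suc j"] unfolding E_gen_def by (simp add: replicate_append_same)
      have eq: "?\<beta> @ [1, k] = replicate (Suc j) 1 @ [k]" by (simp add: replicate_app_Cons_same)
      have "good (\<lambda>v. ((R_tilde (?\<beta> @ [1]) \<star> F_gen k) v - R_tilde (?\<beta> @ [1, k]) v) - R_tilde (?\<beta> @ [k]) v)"
        using Suc.IH unfolding eq by (intro good_diff good_mult gE gF) blast+
      then show "good (R_tilde (?\<beta> @ [Suc k]))" unfolding rec by simp
    qed
  qed
  have gF: "good (F_gen k)" if "0 < k" for k
    using R[OF that] unfolding F_gen_def by (metis append_Nil replicate_0)
  show ?thesis
    using x
  proof (induction rule: W_induct_F)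
    case (mult x k)
    then show ?case using goodD[OF gF] by blast
  qed (use zero add scale one in blast)+
qed


section \<open>The coproduct in terms of words, and its multiplicativity\<close>

section \<open>The coproduct of \<open>\<MM>MR\<close>\<close>

text \<open>Deleting letters respects the relations xx = x, so it induces a map on contracted
  words.\<close>

lemma remdups_adj_filter: "remdups_adj (filter Q (remdups_adj xs)) = remdups_adj (filter Q xs)"
proof (induction xs rule: remdups_adj.induct)
  case (3 x y xs)
  show ?case
  proof (cases "x = y")
    case False
    have "remdups_adj (x # filter Q (remdups_adj (y # xs))) = remdups_adj ([x] @ remdups_adj (filter Q (remdups_adj (y # xs))))"
      by (simp only: remdups_adj_append_right) simp
    also have "\<dots> = remdups_adj ([x] @ filter Q (y # xs))"
      by (simp only: 3(2)[OF False] remdups_adj_append_right)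
    finally show ?thesis using False 3(2)[OF False] by (cases "Q x") simp_all
  qed (use 3(1) in simp)
qed simp_all

lemma blocks_split:
  assumes "finite S"
  shows "blocks S l = blocks {i \<in> S. l i < k} l @ blocks {i \<in> S. \<not> l i < k} l"
proof -
  let ?A = "{i \<in> S. l i < k}" and ?B = "{i \<in> S. \<not> l i < k}"
  have "sorted_list_of_set (l ` S) = sorted_list_of_set (l ` ?A) @ sorted_list_of_set (l ` ?B)"
  proof (rule sorted_distinct_set_unique)
    have fin: "finite (l ` ?A)" "finite (l ` ?B)" "finite (l ` S)" using assms by simp_all
    have parts: "l ` S = l ` ?A \<union> l ` ?B" "l ` ?A \<inter> l ` ?B = {}" by auto
    show "sorted (sorted_list_of_set (l ` ?A) @ sorted_list_of_set (l ` ?B))"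
      unfolding sorted_append using fin by auto
    show "distinct (sorted_list_of_set (l ` ?A) @ sorted_list_of_set (l ` ?B))"
      unfolding distinct_append set_sorted_list_of_set[OF fin(1)] set_sorted_list_of_set[OF fin(2)]
      by (simp only: parts(2) distinct_sorted_list_of_set simp_thms)
    show "set (sorted_list_of_set (l ` S)) = set (sorted_list_of_set (l ` ?A) @ sorted_list_of_set (l ` ?B))"
      unfolding set_append set_sorted_list_of_set[OF fin(1)] set_sorted_list_of_set[OF fin(2)]
        set_sorted_list_of_set[OF fin(3)] by (rule parts(1))
  qed simp_all
  moreover have "map (\<lambda>x. {i \<in> S. l i = x}) (sorted_list_of_set (l ` ?A)) = blocks ?A l"
    unfolding blocks_def
  proof (rule map_cong[OF refl])
    fix x assume "x \<in> set (sorted_list_of_set (l ` ?A))"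
    then have "x < k" using assms by auto
    then show "{i \<in> S. l i = x} = {i \<in> ?A. l i = x}" by blast
  qed
  moreover have "map (\<lambda>x. {i \<in> S. l i = x}) (sorted_list_of_set (l ` ?B)) = blocks ?B l"
    unfolding blocks_def
  proof (rule map_cong[OF refl])
    fix x assume "x \<in> set (sorted_list_of_set (l ` ?B))"
    then have "\<not> x < k" using assms by auto
    then show "{i \<in> S. l i = x} = {i \<in> ?B. l i = x}" by blast
  qed
  ultimately show ?thesis unfolding blocks_def[of S l] by (simp only: map_append)
qed

lemma map_nth_filter:
  "map (\<lambda>i. c ! (i - 1)) (sorted_list_of_set {i \<in> {1..length c}. Q (c ! (i - 1))}) = filter Q c"
proof -
  have "sorted_list_of_set {i \<in> {1..length c}. Q (c ! (i - 1))} =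
      filter (\<lambda>i. Q (c ! (i - 1))) [1..<Suc (length c)]"
  proof (rule sorted_distinct_set_unique)
    show "sorted (filter (\<lambda>i. Q (c ! (i - 1))) [1..<Suc (length c)])"
      by (rule sorted_wrt_filter) (simp del: upt_Suc)
  qed (auto simp del: upt_Suc)
  moreover have "map (\<lambda>i. c ! (i - 1)) [1..<Suc (length c)] = c"
    by (rule nth_equalityI) (auto simp del: upt_Suc)
  moreover have "map (\<lambda>i. c ! (i - 1)) (filter (\<lambda>i. Q (c ! (i - 1))) [1..<Suc (length c)]) =
      filter Q (map (\<lambda>i. c ! (i - 1)) [1..<Suc (length c)])"
    by (simp add: filter_map comp_def del: upt_Suc)
  ultimately show ?thesis by simp
qed

text \<open>Cutting a set composition separates the small letters of its word from the large ones;
  the first part has one block for each distinct letter below \<open>k\<close>.\<close>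

lemma word_perm_split:
  assumes "j = card (set c \<inter> {..<k})"
  shows "st (take j (word_perm c)) = word_perm (remdups_adj (filter (\<lambda>x. x < k) c))"
    and "st (drop j (word_perm c)) = word_perm (remdups_adj (filter (\<lambda>x. \<not> x < k) c))"
proof -
  let ?l = "\<lambda>i. c ! (i - 1)"
  let ?A = "{i \<in> {1..length c}. ?l i < k}" and ?B = "{i \<in> {1..length c}. \<not> ?l i < k}"
  have split: "word_perm c = blocks ?A ?l @ blocks ?B ?l"
    unfolding word_perm_def by (rule blocks_split) simp
  have "?l ` ?A = ?l ` {1..length c} \<inter> {..<k}" by auto
  then have "length (blocks ?A ?l) = j"
    unfolding assms image_nth_pred by (subst length_blocks) simp_all
  then have td: "take j (word_perm c) = blocks ?A ?l" "drop j (word_perm c) = blocks ?B ?l"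
    unfolding split by simp_all
  have "st (blocks ?A ?l) = word_perm (remdups_adj (map ?l (sorted_list_of_set ?A)))"
    "st (blocks ?B ?l) = word_perm (remdups_adj (map ?l (sorted_list_of_set ?B)))"
    by (rule st_blocks; simp)+
  then show "st (take j (word_perm c)) = word_perm (remdups_adj (filter (\<lambda>x. x < k) c))"
    "st (drop j (word_perm c)) = word_perm (remdups_adj (filter (\<lambda>x. \<not> x < k) c))"
    unfolding td map_nth_filter[of c "\<lambda>x. x < k"] map_nth_filter[of c "\<lambda>x. \<not> x < k"] by blast+
qed

text \<open>The words that restrict to \<open>u\<close> on the letters below \<open>k\<close> and to \<open>v\<close> on the others.\<close>

definition shuffles_below :: "nat \<Rightarrow> nat list \<Rightarrow> nat list \<Rightarrow> nat list set" where
  "shuffles_below k u v = {c. distinct_adj c \<and> remdups_adj (filter (\<lambda>x. x < k) c) = u \<and>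
     remdups_adj (filter (\<lambda>x. \<not> x < k) c) = v}"

lemma shuffles_below_set: "c \<in> shuffles_below k u v \<Longrightarrow> set c = set u \<union> set v"
  unfolding shuffles_below_def by (auto simp flip: remdups_adj_set[of "filter _ c"])

lemma inj_word_perm_shuffles: "inj_on word_perm (shuffles_below k u v)"
  by (rule inj_onI) (metis word_perm_inj shuffles_below_set)

text \<open>\<open>shuffles_below\<close> can be infinite: for \<open>k = 1\<close>,
  \<open>u = [0]\<close> and \<open>v = [1]\<close> it contains every alternating word using both
  letters. Sums over it are therefore restricted to a support, whose finiteness carries over by
  injectivity of \<open>word_perm\<close>.\<close>

lemma finite_shuffles_supp:
  assumes "finsupp f"
  shows "finite {c \<in> shuffles_below k u v. f (word_perm c) \<noteq> 0}"
proof (rule finite_imageD)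
  show "finite (word_perm ` {c \<in> shuffles_below k u v. f (word_perm c) \<noteq> 0})"
    by (rule finite_subset[OF _ assms[unfolded finsupp_def]]) auto
  show "inj_on word_perm {c \<in> shuffles_below k u v. f (word_perm c) \<noteq> 0}"
    by (rule inj_on_subset[OF inj_word_perm_shuffles[of k u v]]) auto
qed

text \<open>Once \<open>u\<close> and \<open>v\<close> use alphabets separated by \<open>k\<close>,
  each cut of a set composition into two parts with the prescribed standardizations has exactly one
  word \<open>c\<close> whose small letters contract to \<open>u\<close> and whose large letters
  contract to \<open>v\<close>.\<close>

lemma comult_word_perm:
  assumes f: "f \<in> MMR_space" and u: "distinct_adj u" "set u \<subseteq> {..<k}" and v: "distinct_adj v" "set v \<subseteq> {k..}"
  shows "comult MMR f (word_perm u, word_perm v) =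
    (\<Sum>c\<in>{c \<in> shuffles_below k u v. f (word_perm c) \<noteq> 0}. f (word_perm c))"
proof -
  let ?F = "{w. f w \<noteq> 0}"
  let ?S = "\<lambda>w. {(x, y). x @ y = w \<and> st x = word_perm u \<and> st y = word_perm v}"
  let ?C = "{c \<in> shuffles_below k u v. f (word_perm c) \<noteq> 0}"
  define j where "j = card (set u)"
  have finF: "finite ?F" using MMR_spaceD(1)[OF f] by (simp add: finsupp_def)
  have finS: "finite (?S w)" for w
  proof (rule finite_subset)
    show "?S w \<subseteq> (\<lambda>j. (take j w, drop j w)) ` {..length w}"
    proof
      fix p assume "p \<in> ?S w"
      then obtain x y where "p = (x, y)" "x @ y = w" by blast
      then show "p \<in> (\<lambda>j. (take j w, drop j w)) ` {..length w}"
        by (intro image_eqI[of _ _ "length x"]) auto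
    qed
  qed simp
  have "comult MMR f (word_perm u, word_perm v) = (\<Sum>w\<in>?F. \<Sum>p\<in>?S w. f w)"
    by (simp add: MMR_def mult.commute)
  also have "\<dots> = (\<Sum>(w, p)\<in>Sigma ?F ?S. f w)"
    by (rule sum.Sigma) (use finF finS in blast)+
  also have "\<dots> = (\<Sum>c\<in>?C. f (word_perm c))"
  proof (rule sum.reindex_cong[of "\<lambda>c. (word_perm c, (take j (word_perm c), drop j (word_perm c)))"])
    show "inj_on (\<lambda>c. (word_perm c, (take j (word_perm c), drop j (word_perm c)))) ?C"
      using inj_word_perm_shuffles[of k u v] by (auto simp: inj_on_def)
    show "Sigma ?F ?S = (\<lambda>c. (word_perm c, (take j (word_perm c), drop j (word_perm c)))) ` ?C"
    proof (intro equalityI subsetI)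
      fix z assume "z \<in> (\<lambda>c. (word_perm c, (take j (word_perm c), drop j (word_perm c)))) ` ?C"
      then obtain c where c: "c \<in> ?C" "z = (word_perm c, (take j (word_perm c), drop j (word_perm c)))" by blast
      have "set c \<inter> {..<k} = set u"
        using shuffles_below_set[of c k u v] c(1) u(2) v(2) by auto
      then have j: "j = card (set c \<inter> {..<k})" by (simp add: j_def)
      have "st (take j (word_perm c)) = word_perm u" "st (drop j (word_perm c)) = word_perm v"
        using word_perm_split[OF j] c(1) by (simp_all add: shuffles_below_def)
      then show "z \<in> Sigma ?F ?S" using c by simp
    next
      fix z assume "z \<in> Sigma ?F ?S"
      then obtain w x y where z: "z = (w, (x, y))" "f w \<noteq> 0" "x @ y = w" "st x = word_perm u" "st y = word_perm v"
        by blast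
      have "w \<in> all_M_perms" using MMR_spaceD(2)[OF f, of w] z(2) by blast
      then obtain d where d: "distinct_adj d" "set d = {..<length w}" "word_perm d = w" by (rule all_M_perms_word)
      let ?i = "length x"
      have xy: "x = take ?i w" "y = drop ?i w" using z(3) by auto
      have "set d \<inter> {..<?i} = {..<?i}" unfolding d(2) z(3)[symmetric] by auto
      then have i: "?i = card (set d \<inter> {..<?i})" by simp
      let ?d1 = "remdups_adj (filter (\<lambda>x. x < ?i) d)" and ?d2 = "remdups_adj (filter (\<lambda>x. \<not> x < ?i) d)"
      have "word_perm ?d1 = word_perm u" "word_perm ?d2 = word_perm v"
        using word_perm_split[OF i] z(4,5) xy d(3) by metis+
      obtain \<theta>1 where t1: "strict_mono_on (set ?d1) \<theta>1" "u = map \<theta>1 ?d1"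
        using word_perm_relabeling[OF \<open>word_perm ?d1 = word_perm u\<close>] by blast
      obtain \<theta>2 where t2: "strict_mono_on (set ?d2) \<theta>2" "v = map \<theta>2 ?d2"
        using word_perm_relabeling[OF \<open>word_perm ?d2 = word_perm v\<close>] by blast
      \<comment> \<open>The two relabellings fit together to an increasing one, because the letters
        of \<open>u\<close> lie below \<open>k\<close> and those of \<open>v\<close> do not.\<close>
      define \<theta> where "\<theta> a = (if a < ?i then \<theta>1 a else \<theta>2 a)" for a
      have lo: "\<theta> a < k" if "a \<in> set d" "a < ?i" for a
      proof -
        have "\<theta>1 a \<in> set u" unfolding t1(2) using that by simp
        with u(2) that show ?thesis by (auto simp: \<theta>_def)
      qed
      have hi: "k \<le> \<theta> a" if "a \<in> set d" "\<not> a < ?i" for a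
      proof -
        have "\<theta>2 a \<in> set v" unfolding t2(2) using that by simp
        with v(2) that show ?thesis by (auto simp: \<theta>_def)
      qed
      have mono: "strict_mono_on (set d) \<theta>"
      proof (rule strict_mono_onI)
        fix a b assume ab: "a \<in> set d" "b \<in> set d" "a < b"
        consider "b < ?i" | "a < ?i" "\<not> b < ?i" | "\<not> a < ?i" "\<not> b < ?i" using ab(3) by linarith
        then show "\<theta> a < \<theta> b"
        proof cases
          case 1
          then show ?thesis using strict_mono_onD[OF t1(1), of a b] ab by (simp add: \<theta>_def)
        next
          case 2
          then show ?thesis using lo[OF ab(1)] hi[OF ab(2)] by simp
        next
          case 3
          then show ?thesis using strict_mono_onD[OF t2(1), of a b] ab by (simp add: \<theta>_def)
        qed
      qed
      define c where "c = map \<theta> d"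
      have inj: "inj_on \<theta> (set d)" using mono by (rule strict_mono_on_imp_inj_on)
      have wc: "word_perm c = w" unfolding c_def word_perm_relabel[OF mono] d(3) ..
      have dc: "distinct_adj c" unfolding c_def using d(1) inj by (rule distinct_adj_mapI)
      have "filter (\<lambda>x. x < k) c = map \<theta> (filter (\<lambda>x. x < ?i) d)"
        unfolding c_def filter_map comp_def
        by (rule arg_cong[where f = "map \<theta>"], rule filter_cong[OF refl]) (use lo hi not_le in blast)
      moreover have "remdups_adj (map \<theta> (filter (\<lambda>x. x < ?i) d)) = map \<theta> ?d1"
        by (rule remdups_adj_map_inj_on[OF inj_on_subset[OF inj]]) auto
      moreover have "map \<theta> ?d1 = u" unfolding t1(2) by (rule map_cong[OF refl]) (simp add: \<theta>_def)
      ultimately have cu: "remdups_adj (filter (\<lambda>x. x < k) c) = u" by simp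
      have "filter (\<lambda>x. \<not> x < k) c = map \<theta> (filter (\<lambda>x. \<not> x < ?i) d)"
        unfolding c_def filter_map comp_def
        by (rule arg_cong[where f = "map \<theta>"], rule filter_cong[OF refl]) (use lo hi not_le in blast)
      moreover have "remdups_adj (map \<theta> (filter (\<lambda>x. \<not> x < ?i) d)) = map \<theta> ?d2"
        by (rule remdups_adj_map_inj_on[OF inj_on_subset[OF inj]]) auto
      moreover have "map \<theta> ?d2 = v" unfolding t2(2) by (rule map_cong[OF refl]) (simp add: \<theta>_def)
      ultimately have cv: "remdups_adj (filter (\<lambda>x. \<not> x < k) c) = v" by simp
      have cC: "c \<in> ?C" using dc cu cv wc z(2) by (simp add: shuffles_below_def)
      have "length w = ?i + length y" using z(3) by auto
      then have "set ?d1 = {..<?i}"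
        by (simp only: remdups_adj_set set_filter d(2)) auto
      moreover have "set u = \<theta>1 ` set ?d1" using t1(2) by simp
      moreover have "inj_on \<theta>1 (set ?d1)" using t1(1) by (rule strict_mono_on_imp_inj_on)
      ultimately have "j = ?i" unfolding j_def using card_image[of \<theta>1 "{..<?i}"] by simp
      then have "z = (word_perm c, (take j (word_perm c), drop j (word_perm c)))"
        using z(1) wc xy by simp
      with cC show "z \<in> (\<lambda>c. (word_perm c, (take j (word_perm c), drop j (word_perm c)))) ` ?C" by blast
    qed
  qed simp
  finally show ?thesis .
qed

lemma word_factors_sets:
  "(a, b) \<in> words.factors c \<Longrightarrow> distinct_adj a \<and> distinct_adj b \<and> set a \<subseteq> set c \<and> set b \<subseteq> set c"
  unfolding words.factors_def by (auto simp flip: remdups_adj_set[of "a @ b"])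

text \<open>
  Multiplicativity of the coproduct: deleting letters is a homomorphism for the multiplication
  of words, and both sides are sums over the pairs of words whose product restricts to \<open>u\<close> and
  \<open>v\<close>.
\<close>

lemma comult_mult_word_perm:
  assumes f: "f \<in> MMR_space" and g: "g \<in> MMR_space" and fg: "f \<star> g \<in> MMR_space"
    and u: "distinct_adj u" "set u \<subseteq> {..<k}" and v: "distinct_adj v" "set v \<subseteq> {k..}"
  shows "comult MMR (f \<star> g) (word_perm u, word_perm v) =
    (\<Sum>(u1, u2)\<in>words.factors u. \<Sum>(v1, v2)\<in>words.factors v.
       comult MMR f (word_perm u1, word_perm v1) * comult MMR g (word_perm u2, word_perm v2))"
proof -
  let ?lo = "\<lambda>a. remdups_adj (filter (\<lambda>x. x < k) a)" and ?hi = "\<lambda>a. remdups_adj (filter (\<lambda>x. \<not> x < k) a)"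
  let ?A = "\<lambda>u v. {c \<in> shuffles_below k u v. f (word_perm c) \<noteq> 0}"
  let ?B = "\<lambda>u v. {c \<in> shuffles_below k u v. g (word_perm c) \<noteq> 0}"
  define T where "T = {(a, b). distinct_adj a \<and> distinct_adj b \<and> f (word_perm a) \<noteq> 0 \<and> g (word_perm b) \<noteq> 0 \<and>
      ?lo (a @ b) = u \<and> ?hi (a @ b) = v}"
  define h where "h = (\<lambda>(a, b). f (word_perm a) * g (word_perm b))"
  \<comment> \<open>Restricts both factors to the small and to the large letters; the fibres are
    products of the index sets of \<open>comult_word_perm\<close>, which gives the right-hand
    side.\<close>
  define \<pi> where "\<pi> = (\<lambda>(a, b). ((?lo a, ?lo b), (?hi a, ?hi b)))"
  note supp = MMR_spaceD(1)
  have finuv: "finite (words.factors u)" "finite (words.factors v)"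
    using words.finite_factors' u v by simp_all
  have fiber: "{z \<in> T. \<pi> z = ((u1, u2), (v1, v2))} = ?A u1 v1 \<times> ?B u2 v2"
    if "(u1, u2) \<in> words.factors u" "(v1, v2) \<in> words.factors v" for u1 u2 v1 v2
  proof -
    have "remdups_adj (u1 @ u2) = u" "remdups_adj (v1 @ v2) = v"
      using that by (simp_all add: words.factors_def)
    moreover have "?lo (a @ b) = remdups_adj (?lo a @ ?lo b)" "?hi (a @ b) = remdups_adj (?hi a @ ?hi b)" for a b
      by (simp_all add: remdups_adj_append_left remdups_adj_append_right)
    ultimately show ?thesis
      unfolding T_def \<pi>_def shuffles_below_def by auto
  qed
  have im: "\<pi> ` T \<subseteq> words.factors u \<times> words.factors v"
  proof (rule image_subsetI)
    fix z assume "z \<in> T"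
    then obtain a b where z: "z = (a, b)" "?lo (a @ b) = u" "?hi (a @ b) = v" unfolding T_def by blast
    have "remdups_adj (?lo a @ ?lo b) = u" "remdups_adj (?hi a @ ?hi b) = v"
      unfolding z(2)[symmetric] z(3)[symmetric] by (simp_all add: remdups_adj_append_left remdups_adj_append_right)
    then show "\<pi> z \<in> words.factors u \<times> words.factors v"
      unfolding z(1) \<pi>_def words.factors_def by simp
  qed
  have finT: "finite T"
  proof (rule finite_subset)
    show "T \<subseteq> (\<Union>(p, q)\<in>words.factors u \<times> words.factors v. ?A (fst p) (fst q) \<times> ?B (snd p) (snd q))"
    proof
      fix z assume z: "z \<in> T"
      then have "\<pi> z \<in> words.factors u \<times> words.factors v" using im by blast
      then obtain u1 u2 v1 v2 where p: "\<pi> z = ((u1, u2), (v1, v2))"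
        "(u1, u2) \<in> words.factors u" "(v1, v2) \<in> words.factors v" by (metis mem_Times_iff prod.collapse)
      then have "z \<in> ?A u1 v1 \<times> ?B u2 v2" using fiber[OF p(2,3)] z by blast
      then show "z \<in> (\<Union>(p, q)\<in>words.factors u \<times> words.factors v. ?A (fst p) (fst q) \<times> ?B (snd p) (snd q))"
        using p(2,3) by (intro UN_I[of "((u1, u2), (v1, v2))"]) auto
    qed
    show "finite (\<Union>(p, q)\<in>words.factors u \<times> words.factors v. ?A (fst p) (fst q) \<times> ?B (snd p) (snd q))"
      using finuv finite_shuffles_supp[OF supp[OF f]] finite_shuffles_supp[OF supp[OF g]]
      by (intro finite_UN_I finite_cartesian_product) (auto split: prod.splits)
  qed
  have rhs: "(\<Sum>z\<in>T. h z) = (\<Sum>(u1, u2)\<in>words.factors u. \<Sum>(v1, v2)\<in>words.factors v.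
       comult MMR f (word_perm u1, word_perm v1) * comult MMR g (word_perm u2, word_perm v2))"
  proof -
    have "(\<Sum>z\<in>T. h z) = (\<Sum>p\<in>words.factors u \<times> words.factors v. \<Sum>z\<in>{z \<in> T. \<pi> z = p}. h z)"
      by (rule sum.group[OF finT _ im, symmetric]) (simp add: finuv)
    also have "\<dots> = (\<Sum>p\<in>words.factors u \<times> words.factors v.
        comult MMR f (word_perm (fst (fst p)), word_perm (fst (snd p))) *
        comult MMR g (word_perm (snd (fst p)), word_perm (snd (snd p))))"
    proof (rule sum.cong[OF refl])
      fix p assume "p \<in> words.factors u \<times> words.factors v"
      then obtain u1 u2 v1 v2 where p: "p = ((u1, u2), (v1, v2))"
        "(u1, u2) \<in> words.factors u" "(v1, v2) \<in> words.factors v" by (metis mem_Times_iff prod.collapse)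
      have uv: "distinct_adj u1" "distinct_adj u2" "distinct_adj v1" "distinct_adj v2"
        "set u1 \<subseteq> {..<k}" "set u2 \<subseteq> {..<k}" "set v1 \<subseteq> {k..}" "set v2 \<subseteq> {k..}"
        using word_factors_sets[OF p(2)] word_factors_sets[OF p(3)] u v by auto
      have "(\<Sum>z\<in>{z \<in> T. \<pi> z = p}. h z) = (\<Sum>a\<in>?A u1 v1. \<Sum>b\<in>?B u2 v2. f (word_perm a) * g (word_perm b))"
        unfolding p(1) fiber[OF p(2,3)] h_def sum.cartesian_product ..
      also have "\<dots> = (\<Sum>a\<in>?A u1 v1. f (word_perm a)) * (\<Sum>b\<in>?B u2 v2. g (word_perm b))"
        by (simp add: sum_product)
      also have "\<dots> = comult MMR f (word_perm u1, word_perm v1) * comult MMR g (word_perm u2, word_perm v2)"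
        using comult_word_perm[OF f uv(1,5,3,7)] comult_word_perm[OF g uv(2,6,4,8)] by simp
      finally show "(\<Sum>z\<in>{z \<in> T. \<pi> z = p}. h z) =
        comult MMR f (word_perm (fst (fst p)), word_perm (fst (snd p))) *
        comult MMR g (word_perm (snd (fst p)), word_perm (snd (snd p)))"
        by (simp add: p(1))
    qed
    finally show ?thesis by (simp add: sum.cartesian_product case_prod_beta)
  qed
  \<comment> \<open>The second fibration of \<open>T\<close>: over the product word \<open>c\<close>
    the fibre sums to the coefficient of \<open>c\<close> in \<open>f \<star> g\<close>.\<close>
  define \<mu> where "\<mu> = (\<lambda>(a, b). remdups_adj (a @ b :: nat list))"
  have fiber2: "(\<Sum>z\<in>{z \<in> T. \<mu> z = c}. h z) = (f \<star> g) (word_perm c)" if c: "c \<in> shuffles_below k u v" for c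
  proof -
    have dc: "distinct_adj c" using c by (simp add: shuffles_below_def)
    have lohi: "?lo (a @ b) = u" "?hi (a @ b) = v" if "remdups_adj (a @ b) = c" for a b
      using remdups_adj_filter[of "\<lambda>x. x < k" "a @ b"] remdups_adj_filter[of "\<lambda>x. \<not> x < k" "a @ b"] c that
      by (simp_all add: shuffles_below_def)
    have "(f \<star> g) (word_perm c) = (\<Sum>z\<in>words.factors c. h z)"
      using MMR_mult_word_perm[OF supp[OF f] supp[OF g] dc] by (simp add: words.conv_def h_def)
    also have "\<dots> = (\<Sum>z\<in>{z \<in> T. \<mu> z = c}. h z)"
    proof (rule sum.mono_neutral_right)
      show "finite (words.factors c)" using words.finite_factors' dc by simp
      show "{z \<in> T. \<mu> z = c} \<subseteq> words.factors c"
        unfolding T_def \<mu>_def words.factors_def by auto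
      show "\<forall>z\<in>words.factors c - {z \<in> T. \<mu> z = c}. h z = 0"
      proof (rule ballI, rule ccontr)
        fix z assume z: "z \<in> words.factors c - {z \<in> T. \<mu> z = c}" "h z \<noteq> 0"
        obtain a b where ab: "z = (a, b)" by fastforce
        have "distinct_adj a" "distinct_adj b" and m: "remdups_adj (a @ b) = c"
          using z(1) unfolding ab words.factors_def by auto
        then have "z \<in> T" using lohi[OF m] z(2) unfolding ab T_def h_def by simp
        then show False using z(1) m by (simp add: \<mu>_def ab)
      qed
    qed
    finally show ?thesis ..
  qed
  have mu_mem: "\<mu> z \<in> shuffles_below k u v" if "z \<in> T" for z
    using that remdups_adj_filter[of "\<lambda>x. x < k"] remdups_adj_filter[of "\<lambda>x. \<not> x < k"]
    unfolding T_def \<mu>_def shuffles_below_def by auto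
  let ?C = "{c \<in> shuffles_below k u v. (f \<star> g) (word_perm c) \<noteq> 0}"
  have finC: "finite (?C \<union> \<mu> ` T)" using finite_shuffles_supp[OF supp[OF fg]] finT by simp
  have "(\<Sum>z\<in>T. h z) = (\<Sum>c\<in>?C \<union> \<mu> ` T. \<Sum>z\<in>{z \<in> T. \<mu> z = c}. h z)"
    by (rule sum.group[OF finT finC, symmetric]) auto
  also have "\<dots> = (\<Sum>c\<in>?C \<union> \<mu> ` T. (f \<star> g) (word_perm c))"
    by (rule sum.cong[OF refl], rule fiber2) (use mu_mem in auto)
  also have "\<dots> = (\<Sum>c\<in>?C. (f \<star> g) (word_perm c))"
    by (rule sum.mono_neutral_right[OF finC]) (use mu_mem in auto)
  also have "\<dots> = comult MMR (f \<star> g) (word_perm u, word_perm v)"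
    by (rule comult_word_perm[OF fg u v, symmetric])
  finally show ?thesis unfolding rhs ..
qed

lemma comult_outside:
  assumes f: "f \<in> MMR_space" and "p \<notin> all_M_perms \<or> q \<notin> all_M_perms"
  shows "comult MMR f (p, q) = 0"
proof -
  have none: "{(u, v). u @ v = w \<and> st u = p \<and> st v = q} = {}" if w: "f w \<noteq> 0" for w
  proof -
    have "w \<in> all_M_perms" using MMR_spaceD(2)[OF f, of w] w by blast
    then obtain n where "set_composition {1..n} w" unfolding all_M_perms_def M_perms_def by blast
    then have dis: "\<And>i j. i < length w \<Longrightarrow> j < length w \<Longrightarrow> i \<noteq> j \<Longrightarrow> w ! i \<inter> w ! j = {}"
      and ne: "{} \<notin> set w" and U: "\<Union>(set w) = {1..n}" by (auto simp: set_composition_def)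
    have "st u \<in> all_M_perms \<and> st v \<in> all_M_perms" if uv: "u @ v = w" for u v
    proof -
      have "set_composition (\<Union>(set u)) u"
        unfolding set_composition_def
      proof (intro conjI allI impI)
        have sub: "\<Union>(set u) \<subseteq> {1..n}" unfolding U[symmetric] uv[symmetric] by auto
        show "finite (\<Union>(set u))" by (rule finite_subset[OF sub]) simp
        show "0 \<notin> \<Union>(set u)" using sub by auto
        show "{} \<notin> set u" using ne uv by auto
        show "u ! i \<inter> u ! j = {}" if "i < length u" "j < length u" "i \<noteq> j" for i j
          using dis[of i j] that unfolding uv[symmetric] by (simp add: nth_append)
      qed simp
      moreover have "set_composition (\<Union>(set v)) v"
        unfolding set_composition_def
      proof (intro conjI allI impI)
        have sub: "\<Union>(set v) \<subseteq> {1..n}" unfolding U[symmetric] uv[symmetric] by auto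
        show "finite (\<Union>(set v))" by (rule finite_subset[OF sub]) simp
        show "0 \<notin> \<Union>(set v)" using sub by auto
        show "{} \<notin> set v" using ne uv by auto
        show "v ! i \<inter> v ! j = {}" if "i < length v" "j < length v" "i \<noteq> j" for i j
          using dis[of "length u + i" "length u + j"] that unfolding uv[symmetric] by simp
      qed simp
      ultimately show ?thesis by (simp add: st_eq_standard_form standard_form_in_all_M_perms)
    qed
    with assms(2) show ?thesis by blast
  qed
  have "comult MMR f (p, q) = (\<Sum>w | f w \<noteq> 0. f w * int (card {(u, v). u @ v = w \<and> st u = p \<and> st v = q}))"
    by (simp add: MMR_def)
  also have "\<dots> = 0"
  proof (rule sum.neutral, rule ballI)
    fix w assume "w \<in> {w. f w \<noteq> 0}"
    then have "f w \<noteq> 0" by simp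
    from none[OF this] show "f w * int (card {(u, v). u @ v = w \<and> st u = p \<and> st v = q}) = 0"
      by (simp only: card.empty of_nat_0 mult_zero_right)
  qed
  finally show ?thesis .
qed

lemma descents_empty_iff: "descents c = {} \<longleftrightarrow> sorted c"
proof
  assume e: "descents c = {}"
  show "sorted c"
    unfolding sorted_iff_nth_Suc
  proof (intro allI impI)
    fix i assume "Suc i < length c"
    then have "Suc i \<notin> descents c \<Longrightarrow> c ! i \<le> c ! Suc i" by (auto simp: descents_def)
    with e show "c ! i \<le> c ! Suc i" by blast
  qed
next
  assume "sorted c"
  show "descents c = {}"
  proof (rule equals0I)
    fix i assume "i \<in> descents c"
    then have i: "i < length c" "c ! i < c ! (i - 1)" by (simp_all add: descents_def)
    have "c ! (i - 1) \<le> c ! i" by (rule sorted_nth_mono[OF \<open>sorted c\<close> _ i(1)]) simp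
    with i(2) show False by simp
  qed
qed

lemma F_gen_word_perm:
  "distinct_adj c \<Longrightarrow> F_gen k (word_perm c) = (if length c = k \<and> sorted c then 1 else 0)"
  by (simp add: F_gen_def R_tilde_word_perm descent_set_single descents_empty_iff)

lemma F_gen_MMR_space: "F_gen k \<in> MMR_space"
  unfolding F_gen_def by (rule R_tilde_MMR_space)

text \<open>The coproduct of F_k is the sum of F_i \<otimes> F_(k-i): in an increasing word the
  small letters precede the large ones, so \<open>u @ v\<close> is the only candidate, and it
  qualifies exactly if \<open>u\<close> and \<open>v\<close> are increasing of total length
  \<open>k\<close>.\<close>

lemma comult_F_gen_word_perm:
  assumes u: "distinct_adj u" "set u \<subseteq> {..<K}" and v: "distinct_adj v" "set v \<subseteq> {K..}"
  shows "comult MMR (F_gen k) (word_perm u, word_perm v) =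
    (\<Sum>i\<le>k. F_gen i (word_perm u) * F_gen (k - i) (word_perm v))"
proof -
  have "last u \<noteq> hd v" if "u \<noteq> []" "v \<noteq> []"
  proof -
    have "last u \<in> {..<K}" "hd v \<in> {K..}"
      using u(2) v(2) last_in_set[OF that(1)] hd_in_set[OF that(2)] by blast+
    then show ?thesis by auto
  qed
  then have uv: "distinct_adj (u @ v)"
    using u v unfolding distinct_adj_append_iff by blast
  have flt: "filter (\<lambda>x. x < K) (u @ v) = u" "filter (\<lambda>x. \<not> x < K) (u @ v) = v"
  proof -
    have "filter (\<lambda>x. x < K) u = u" "filter (\<lambda>x. \<not> x < K) u = []"
      "filter (\<lambda>x. x < K) v = []" "filter (\<lambda>x. \<not> x < K) v = v"
      using u(2) v(2) unfolding filter_id_conv filter_empty_conv by auto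
    then show "filter (\<lambda>x. x < K) (u @ v) = u" "filter (\<lambda>x. \<not> x < K) (u @ v) = v"
      unfolding filter_append by (simp_all only: append_Nil append_Nil2)
  qed
  have uvS: "u @ v \<in> shuffles_below K u v"
    unfolding shuffles_below_def mem_Collect_eq flt using uv u v by (simp add: distinct_adj_altdef)
  have only: "c = u @ v" if c: "c \<in> shuffles_below K u v" "sorted c" for c
  proof -
    have "c = filter (\<lambda>x. x < K) c @ filter (\<lambda>x. \<not> x < K) c"
      using c(2)
    proof (induction c)
      case (Cons a c)
      show ?case
      proof (cases "a < K")
        case True
        with Cons show ?thesis by simp
      next
        case False
        then have "filter (\<lambda>x. x < K) c = []" "filter (\<lambda>x. \<not> x < K) c = c"
          using Cons.prems unfolding filter_empty_conv filter_id_conv by force+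
        with False show ?thesis by simp
      qed
    qed simp
    then obtain c1 c2 where cc: "c = c1 @ c2" "c1 = filter (\<lambda>x. x < K) c" "c2 = filter (\<lambda>x. \<not> x < K) c" by blast
    have "distinct_adj c1" "distinct_adj c2"
      using c(1) cc(1) by (auto simp: shuffles_below_def distinct_adj_append_iff)
    then have "c1 = u" "c2 = v"
      using c(1) unfolding cc(2,3) shuffles_below_def by (simp_all add: distinct_adj_altdef)
    with cc(1) show ?thesis by simp
  qed
  have supp: "{c \<in> shuffles_below K u v. F_gen k (word_perm c) \<noteq> 0} =
      (if length (u @ v) = k \<and> sorted (u @ v) then {u @ v} else {})"
  proof -
    have nz: "F_gen k (word_perm c) \<noteq> 0 \<longleftrightarrow> length c = k \<and> sorted c" if "c \<in> shuffles_below K u v" for c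
      using that by (simp add: shuffles_below_def F_gen_word_perm)
    show ?thesis
    proof (cases "length (u @ v) = k \<and> sorted (u @ v)")
      case True
      have "{c \<in> shuffles_below K u v. F_gen k (word_perm c) \<noteq> 0} = {u @ v}"
        using nz only nz[OF uvS] uvS True by blast
      then show ?thesis unfolding if_P[OF True] .
    next
      case False
      have "{c \<in> shuffles_below K u v. F_gen k (word_perm c) \<noteq> 0} = {}"
        using nz only False by blast
      then show ?thesis unfolding if_not_P[OF False] .
    qed
  qed
  have "comult MMR (F_gen k) (word_perm u, word_perm v) = (if length (u @ v) = k \<and> sorted (u @ v) then 1 else 0)"
    unfolding comult_word_perm[OF F_gen_MMR_space u v] supp using F_gen_word_perm[OF uv, of k] by auto
  also have "sorted (u @ v) \<longleftrightarrow> sorted u \<and> sorted v"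
    using u(2) v(2) by (fastforce simp: sorted_append)
  also have "(if length (u @ v) = k \<and> sorted u \<and> sorted v then 1 else 0) =
      (\<Sum>i\<le>k. F_gen i (word_perm u) * F_gen (k - i) (word_perm v))"
  proof -
    have "(\<Sum>i\<le>k. F_gen i (word_perm u) * F_gen (k - i) (word_perm v)) =
        (\<Sum>i\<le>k. if i = length u then (if length (u @ v) = k \<and> sorted u \<and> sorted v then 1 else 0) else 0)"
      unfolding F_gen_word_perm[OF u(1)] F_gen_word_perm[OF v(1)] by (rule sum.cong[OF refl]) auto
    also have "\<dots> = (if length (u @ v) = k \<and> sorted u \<and> sorted v then 1 else 0)"
      by (simp add: sum.delta)
    finally show ?thesis ..
  qed
  finally show ?thesis .
qed


section \<open>The ring homomorphism to symmetric functions\<close>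

section \<open>The morphism to symmetric functions\<close>

definition comp_supp :: "(nat set list \<Rightarrow> int) \<Rightarrow> nat list set" where
  "comp_supp x = {\<alpha>. is_composition \<alpha> \<and> x (representative \<alpha>) \<noteq> 0}"

text \<open>The coefficient of \<open>R_tilde \<alpha>\<close> in an element of \<open>\<MM>NSym\<close> is its value at \<open>representative \<alpha>\<close>.\<close>

definition ribbon_map :: "(nat set list \<Rightarrow> int) \<Rightarrow> series" where
  "ribbon_map x = (\<lambda>m. \<Sum>\<alpha>\<in>comp_supp x. x (representative \<alpha>) * dual_g_tilde (ribbon \<alpha>) m)"

lemma finite_comp_supp:
  assumes "x \<in> W"
  shows "finite (comp_supp x)"
proof (rule finite_imageD)
  show "finite (representative ` comp_supp x)"
    by (rule finite_subset[OF _ W_finsupp[OF assms, unfolded finsupp_def]]) (auto simp: comp_supp_def)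
  show "inj_on representative (comp_supp x)"
    by (rule inj_on_subset[OF inj_representative]) (auto simp: comp_supp_def)
qed

lemma ribbon_map_superset:
  assumes "finite A" "comp_supp x \<subseteq> A" "\<And>\<alpha>. \<alpha> \<in> A \<Longrightarrow> is_composition \<alpha>"
  shows "ribbon_map x m = (\<Sum>\<alpha>\<in>A. x (representative \<alpha>) * dual_g_tilde (ribbon \<alpha>) m)"
  unfolding ribbon_map_def
  by (rule sum.mono_neutral_left[OF assms(1,2)]) (use assms(3) in \<open>auto simp: comp_supp_def\<close>)

lemma ribbon_map_add:
  assumes "x \<in> W" "y \<in> W"
  shows "ribbon_map (\<lambda>v. x v + y v) = (\<lambda>m. ribbon_map x m + ribbon_map y m)"
proof
  fix m
  let ?A = "comp_supp x \<union> comp_supp y"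
  have A: "finite ?A" "\<And>\<alpha>. \<alpha> \<in> ?A \<Longrightarrow> is_composition \<alpha>"
    using finite_comp_supp assms by (auto simp: comp_supp_def)
  have "comp_supp (\<lambda>v. x v + y v) \<subseteq> ?A" by (auto simp: comp_supp_def)
  then show "ribbon_map (\<lambda>v. x v + y v) m = ribbon_map x m + ribbon_map y m"
    using ribbon_map_superset[OF A(1) _ A(2), of "\<lambda>v. x v + y v" m]
      ribbon_map_superset[OF A(1) _ A(2), of x m] ribbon_map_superset[OF A(1) _ A(2), of y m]
    by (simp add: distrib_right sum.distrib)
qed

lemma ribbon_map_scale:
  assumes "x \<in> W"
  shows "ribbon_map (\<lambda>v. c * x v) = (\<lambda>m. c * ribbon_map x m)"
proof
  fix m
  have A: "finite (comp_supp x)" "\<And>\<alpha>. \<alpha> \<in> comp_supp x \<Longrightarrow> is_composition \<alpha>"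
    using finite_comp_supp assms by (auto simp: comp_supp_def)
  have "comp_supp (\<lambda>v. c * x v) \<subseteq> comp_supp x" by (auto simp: comp_supp_def)
  then show "ribbon_map (\<lambda>v. c * x v) m = c * ribbon_map x m"
    using ribbon_map_superset[OF A(1) _ A(2), of "\<lambda>v. c * x v" m]
    by (simp add: ribbon_map_def sum_distrib_left mult.assoc)
qed

lemma ribbon_map_zero: "ribbon_map (\<lambda>_. 0) = (\<lambda>_. 0)"
  by (simp add: ribbon_map_def comp_supp_def)

lemma ribbon_map_R_tilde:
  assumes "is_composition \<alpha>"
  shows "ribbon_map (R_tilde \<alpha>) = dual_g_tilde (ribbon \<alpha>)"
proof -
  have "comp_supp (R_tilde \<alpha>) = {\<alpha>}"
    using assms by (auto simp: comp_supp_def R_tilde_representative split: if_splits)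
  then show ?thesis by (simp add: ribbon_map_def R_tilde_representative[OF assms assms] fun_eq_iff)
qed

lemma dual_g_tilde_empty: "dual_g_tilde (ribbon []) = basis_elem 0"
proof -
  have "fillings [] = {[]}" by simp
  then have "{R \<in> fillings []. filling_weight R = m} = (if m = 0 then {[]} else {})" for m by auto
  then have "filling_count [] m = (if m = 0 then 1 else 0)" for m unfolding filling_count_def by simp
  then show ?thesis
    using dual_g_tilde_ribbon[of "[]"] by (auto simp: basis_elem_def fun_eq_iff)
qed

lemma ribbon_map_one: "ribbon_map (basis_elem []) = basis_elem 0"
  using ribbon_map_R_tilde[of "[]"] by (simp add: R_tilde_Nil dual_g_tilde_empty)

lemma ribbon_map_F_gen: "0 < k \<Longrightarrow> ribbon_map (F_gen k) = dual_g (diagram [k])"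
  unfolding F_gen_def using ribbon_map_R_tilde[of "[k]"] dual_g_tilde_row[of k] by (simp add: diagram_eq_ribbon)

text \<open>The product rules \<open>R_tilde_mult_F_gen\<close> and
  \<open>dual_g_tilde_ribbon_rec\<close> agree term by term; linearity extends this from the
  \<open>R_tilde\<close> to their span.\<close>

lemma ribbon_map_mult_F_gen:
  assumes "x \<in> W" "0 < k"
  shows "ribbon_map (x \<star> F_gen k) = monomials.conv (ribbon_map x) (dual_g (diagram [k]))"
proof -
  note FW = F_gen_W[OF assms(2)]
  have "x \<in> {x \<in> W. ribbon_map (x \<star> F_gen k) = monomials.conv (ribbon_map x) (dual_g (diagram [k]))}"
    using assms(1) unfolding W_eq
  proof (rule zspan_minimal, unfold W_eq[symmetric])
    have "(\<lambda>_. 0) \<star> F_gen k = (\<lambda>_. 0)"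
      using mult_scale_left[OF one_W FW, of 0] by simp
    then show "(\<lambda>_. 0) \<in> {x \<in> W. ribbon_map (x \<star> F_gen k) = monomials.conv (ribbon_map x) (dual_g (diagram [k]))}"
      using zmodule_zero[OF zmodule_W] by (simp add: ribbon_map_zero)
  next
    fix s a c assume s: "s \<in> {R_tilde \<alpha> | \<alpha>. is_composition \<alpha>}"
      and a: "a \<in> {x \<in> W. ribbon_map (x \<star> F_gen k) = monomials.conv (ribbon_map x) (dual_g (diagram [k]))}"
    obtain \<alpha> where \<alpha>: "s = R_tilde \<alpha>" "is_composition \<alpha>" using s by blast
    have sW: "s \<in> W" unfolding \<alpha>(1) by (rule R_tilde_W[OF \<alpha>(2)])
    have aW: "a \<in> W" "ribbon_map (a \<star> F_gen k) = monomials.conv (ribbon_map a) (dual_g (diagram [k]))"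
      using a by auto
    have sF: "ribbon_map (s \<star> F_gen k) = monomials.conv (ribbon_map s) (dual_g (diagram [k]))"
    proof (cases \<alpha> rule: rev_cases)
      case Nil
      then show ?thesis
        using mult_one(2)[OF FW] by (simp add: \<alpha> R_tilde_Nil ribbon_map_one conv_one_monomials ribbon_map_F_gen assms)
    next
      case (snoc \<beta> j)
      then have pos: "is_composition \<beta>" "0 < j" using \<alpha>(2) by auto
      have c: "is_composition (\<beta> @ [j, k])" "is_composition (\<beta> @ [j + k])" "is_composition (\<beta> @ [j + k - 1])"
        using pos assms(2) by auto
      note R = R_tilde_W[OF c(1)] R_tilde_W[OF c(2)] R_tilde_W[OF c(3)]
      have "ribbon_map (s \<star> F_gen k) = (\<lambda>m. dual_g_tilde (ribbon (\<beta> @ [j, k])) m +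
          dual_g_tilde (ribbon (\<beta> @ [j + k])) m + dual_g_tilde (ribbon (\<beta> @ [j + k - 1])) m)"
        unfolding \<alpha>(1) snoc R_tilde_mult_F_gen[OF pos assms(2)]
          ribbon_map_add[OF zmodule_add[OF zmodule_W R(1,2)] R(3)] ribbon_map_add[OF R(1,2)]
          ribbon_map_R_tilde[OF c(1)] ribbon_map_R_tilde[OF c(2)] ribbon_map_R_tilde[OF c(3)] ..
      also have "\<dots> = monomials.conv (dual_g_tilde (ribbon \<alpha>)) (dual_g (diagram [k]))"
        unfolding snoc dual_g_tilde_ribbon_rec[OF c(1)] ..
      finally show ?thesis unfolding \<alpha>(1) ribbon_map_R_tilde[OF \<alpha>(2)] .
    qed
    have csW: "(\<lambda>x. c * s x) \<in> W" by (rule zmodule_scale[OF zmodule_W sW])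
    have sFW: "s \<star> F_gen k \<in> W" "a \<star> F_gen k \<in> W" using mult_W sW aW(1) FW by blast+
    have "ribbon_map ((\<lambda>x. c * s x + a x) \<star> F_gen k) =
        (\<lambda>m. c * ribbon_map (s \<star> F_gen k) m + ribbon_map (a \<star> F_gen k) m)"
      unfolding mult_add_left[OF csW aW(1) FW] mult_scale_left[OF sW FW]
        ribbon_map_add[OF zmodule_scale[OF zmodule_W sFW(1)] sFW(2)] ribbon_map_scale[OF sFW(1)] ..
    also have "\<dots> = monomials.conv (ribbon_map (\<lambda>x. c * s x + a x)) (dual_g (diagram [k]))"
      unfolding sF aW(2) ribbon_map_add[OF csW aW(1)] ribbon_map_scale[OF sW]
      by (intro ext) (simp add: monomials.conv_add_left monomials.conv_scale_left)
    finally show "(\<lambda>x. c * s x + a x) \<in>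
        {x \<in> W. ribbon_map (x \<star> F_gen k) = monomials.conv (ribbon_map x) (dual_g (diagram [k]))}"
      using zmodule_add[OF zmodule_W csW aW(1)] by simp
  qed
  then show ?thesis by blast
qed

lemma monomials_conv_assoc: "monomials.conv (monomials.conv f g) h = monomials.conv f (monomials.conv g h)"
  by (intro ext monomials.conv_assoc) simp

text \<open>Multiplicativity for one factor F_k spreads to all products because the F_k generate and
  both products are associative.\<close>

lemma ribbon_map_mult:
  assumes "x \<in> W" "y \<in> W"
  shows "ribbon_map (x \<star> y) = monomials.conv (ribbon_map x) (ribbon_map y)"
  using assms(2)
proof (induction rule: W_induct_F)
  case zero
  have "x \<star> (\<lambda>_. 0) = (\<lambda>_. 0)"
    using mult_scale_right[OF one_W assms(1), of 0] by simp
  then show ?case by (simp add: ribbon_map_zero)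
next
  case (add y z)
  show ?case
    unfolding mult_add_right[OF add.hyps(1,2) assms(1)] ribbon_map_add[OF mult_W[OF assms(1) add.hyps(1)] mult_W[OF assms(1) add.hyps(2)]]
      ribbon_map_add[OF add.hyps] add.IH
    by (intro ext) (simp add: monomials.conv_add_right)
next
  case (scale y c)
  show ?case
    unfolding mult_scale_right[OF scale.hyps assms(1)] ribbon_map_scale[OF mult_W[OF assms(1) scale.hyps]]
      ribbon_map_scale[OF scale.hyps] scale.IH
    by (intro ext) (simp add: monomials.conv_scale_right)
next
  case one
  then show ?case by (simp add: mult_one(1)[OF assms(1)] ribbon_map_one conv_one_monomials)
next
  case (mult y k)
  show ?case
    unfolding W_mult_assoc_F[OF assms(1) mult.hyps(1) mult_W[OF assms(1) mult.hyps(1)] mult.hyps(2)]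
      ribbon_map_mult_F_gen[OF mult_W[OF assms(1) mult.hyps(1)] mult.hyps(2)]
      ribbon_map_mult_F_gen[OF mult.hyps(1,2)] mult.IH
    by (rule monomials_conv_assoc)
qed

lemma ribbon_map_symmetric:
  assumes "x \<in> W"
  shows "ribbon_map x \<in> symmetric_functions"
  using assms
proof (induction rule: W_induct_F)
  case zero
  then show ?case using zmodule_zero[OF zmodule_symmetric_functions] by (simp add: ribbon_map_zero)
next
  case (add x y)
  then show ?case by (simp only: ribbon_map_add zmodule_add[OF zmodule_symmetric_functions])
next
  case (scale x c)
  then show ?case by (simp only: ribbon_map_scale zmodule_scale[OF zmodule_symmetric_functions])
next
  case one
  then show ?case by (simp add: ribbon_map_one symmetric_functions_one)
next
  case (mult x k)
  have "dual_g (diagram [k]) \<in> symmetric_functions"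
    by (rule dual_g_diagram_symmetric) (use mult.hyps in \<open>simp add: is_partition_def\<close>)
  with mult show ?case by (simp only: ribbon_map_mult_F_gen symmetric_functions_conv)
qed

lemma ring_hom_ribbon_map: "ring_hom_ring MNSym MSym ribbon_map"
proof (rule ring_hom_ringI)
  show "ring MNSym" by (rule ring_MNSym)
  show "ring MSym" by (rule cring.axioms(1)[OF cring_MSym])
qed (simp_all add: carrier_MSym ribbon_map_symmetric mult_MSym ribbon_map_mult ribbon_map_add ribbon_map_one)

section \<open>Surjectivity through products of the column generators\<close>

lemma ribbon_replicate: "ribbon (replicate n 1) = diagram (replicate n 1)"
proof (induction n)
  case (Suc n)
  have off: "ribbon_offset (replicate n 1) = 0" by (simp add: ribbon_offset_def)
  have rev: "rev (1 # replicate n 1) = replicate (Suc n) (1 :: nat)" "rev (replicate n 1) = replicate n (1 :: nat)"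
    by (simp_all add: replicate_append_same)
  show ?case
    using ribbon_Cons[of 1 "replicate n 1"] diagram_Cons[of 1 "replicate n 1"]
    unfolding off rev Suc by simp
qed (simp add: ribbon_Nil diagram_def)

text \<open>The ribbon of (1, ..., 1) is a single column, so \<open>leading_dual_g\<close> applies;
  at the leading monomial, of degree \<open>n\<close>, the sign is positive.\<close>

lemma leading_E_gen: "leading (ribbon_map (E_gen n)) (elementary_monomial n)"
proof -
  let ?l = "replicate n (1 :: nat)"
  have part: "is_partition ?l" by (auto simp: is_partition_def sorted_wrt_iff_nth_less)
  have comp: "is_composition ?l" by (simp add: is_composition_def)
  have "partition_monomial ?l = elementary_monomial n"
    by (rule poly_mapping_eqI) (simp add: expo_partition_monomial expo_elementary_monomial)
  then have lead: "leading (dual_g (diagram ?l)) (elementary_monomial n)" using leading_dual_g[OF part] by simp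
  have "ribbon_map (E_gen n) m = (-1) ^ (n + monomial_degree m) * dual_g (diagram ?l) m" for m
    using dual_g_tilde_ribbon[OF comp, of m] dual_g_ribbon[of ?l]
    unfolding E_gen_def ribbon_map_R_tilde[OF comp] by (simp add: ribbon_replicate[simplified] sum_list_replicate)
  with lead show ?thesis
    unfolding leading_def by (simp flip: mult_2)
qed

fun E_word :: "nat list \<Rightarrow> nat set list \<Rightarrow> int" where
  "E_word [] = basis_elem []"
| "E_word (n # l) = E_gen n \<star> E_word l"

definition word_monomial :: "nat list \<Rightarrow> monomial" where
  "word_monomial l = (\<Sum>n\<leftarrow>l. elementary_monomial n)"

lemma E_word_W: "E_word l \<in> W"
  by (induction l) (simp_all add: one_W mult_W E_gen_W)

lemma leading_E_word: "leading (ribbon_map (E_word l)) (word_monomial l)"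
proof (induction l)
  case Nil
  then show ?case by (simp add: ribbon_map_one leading_one word_monomial_def)
next
  case (Cons n l)
  then show ?case
    using leading_conv[OF leading_E_gen Cons] by (simp add: ribbon_map_mult E_gen_W E_word_W word_monomial_def)
qed

lemma expo_word_monomial: "expo (word_monomial l) i = length (filter (\<lambda>n. i < n) l)"
  by (induction l) (simp_all add: word_monomial_def lookup_add expo_elementary_monomial)

text \<open>The exponents are the parts of the conjugate partition: exponent number \<open>i\<close>
  counts the letters above \<open>i\<close>, and consecutive differences recover the
  multiplicities.\<close>

lemma word_monomial_inj:
  assumes "word_monomial l = word_monomial l'" "sorted l" "sorted l'" "0 \<notin> set l" "0 \<notin> set l'"
  shows "l = l'"
proof -
  have cnt: "expo (word_monomial l) (n - 1) = count_list l n + expo (word_monomial l) n" if "0 < n" for l n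
    unfolding expo_word_monomial using that by (induction l) auto
  have "count_list l n = count_list l' n" for n
  proof (cases "n = 0")
    case False
    then show ?thesis using assms(1) cnt[of n l] cnt[of n l'] by simp
  qed (use assms(4,5) in \<open>simp add: count_list_0_iff\<close>)
  then have "mset l = mset l'" by (intro multiset_eqI) (simp add: count_mset)
  then show ?thesis using assms(2,3) by (metis properties_for_sort sorted_sort_id)
qed

lemma dominant_support:
  assumes "dominant m"
  shows "\<exists>n. \<forall>i. expo m i \<noteq> 0 \<longleftrightarrow> i < n"
proof -
  have "mkeys m = {..<card (mkeys m)}"
  proof (rule initial_segment)
    fix r r' assume "r \<in> mkeys m" "r' \<le> r"
    then show "r' \<in> mkeys m" using dominant_mono[OF assms, of r' r] by (auto simp: in_keys_iff)
  qed simp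
  then obtain n where n: "mkeys m = {..<n}" by blast
  have "expo m i \<noteq> 0 \<longleftrightarrow> i < n" for i
    using in_keys_iff[of i m] unfolding n by simp
  then show ?thesis by blast
qed

text \<open>Conjugation of partitions: with n the number of variables occurring, dividing by x_1 ...
  x_n leaves a dominant monomial of smaller degree.\<close>

lemma dominant_word:
  assumes "dominant m"
  shows "\<exists>l. m = word_monomial l"
  using assms
proof (induction "monomial_degree m" arbitrary: m rule: less_induct)
  case less
  show ?case
  proof (cases "m = 0")
    case True
    then show ?thesis by (intro exI[of _ "[]"]) (simp add: word_monomial_def)
  next
    case False
    obtain n where nz: "\<And>i. expo m i \<noteq> 0 \<longleftrightarrow> i < n"
      using dominant_support[OF less.prems] by blast
    have "n \<noteq> 0"
    proof
      assume "n = 0"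
      then have "m = 0" using nz by (intro poly_mapping_eqI) simp
      with False show False ..
    qed
    define m' where "m' = m - elementary_monomial n"
    have e': "expo m' i = expo m i - (if i < n then 1 else 0)" for i
      by (simp add: m'_def lookup_minus expo_elementary_monomial)
    have m: "m = elementary_monomial n + m'"
    proof (rule poly_mapping_eqI)
      fix i show "expo m i = expo (elementary_monomial n + m') i"
        using nz[of i] by (simp add: lookup_add e' expo_elementary_monomial)
    qed
    have "dominant m'"
      unfolding dominant_def
    proof
      fix i
      have "expo m (Suc i) \<le> expo m i" using less.prems by (simp add: dominant_def)
      then show "expo m' (Suc i) \<le> expo m' i"
        using nz[of i] nz[of "Suc i"] by (auto simp: e')
    qed
    moreover have "monomial_degree m' < monomial_degree m"
      using \<open>n \<noteq> 0\<close> by (simp add: m)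
    ultimately obtain l where "m' = word_monomial l" using less.hyps by blast
    then show ?thesis using m by (intro exI[of _ "n # l"]) (simp add: word_monomial_def)
  qed
qed

text \<open>The elimination used for \<open>carrier_MSym\<close>, now with the images of the
  \<open>E_word\<close> products as elements of given leading monomial.\<close>

lemma ribbon_map_surj: "ribbon_map ` W = carrier MSym"
proof
  show "ribbon_map ` W \<subseteq> carrier MSym"
    unfolding carrier_MSym using ribbon_map_symmetric by blast
  have "zmodule (ribbon_map ` W)"
    unfolding zmodule_def
  proof (intro conjI ballI allI)
    show "(\<lambda>_. 0) \<in> ribbon_map ` W"
      using ribbon_map_zero zmodule_zero[OF zmodule_W] by (metis image_eqI)
  next
    fix f g assume "f \<in> ribbon_map ` W" "g \<in> ribbon_map ` W"
    then obtain x y where xy: "x \<in> W" "y \<in> W" "f = ribbon_map x" "g = ribbon_map y" by blast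
    show "(\<lambda>m. f m + g m) \<in> ribbon_map ` W"
      unfolding xy(3,4) ribbon_map_add[OF xy(1,2), symmetric]
      by (rule imageI[OF zmodule_add[OF zmodule_W xy(1,2)]])
  next
    fix f c assume "f \<in> ribbon_map ` W"
    then obtain x where x: "x \<in> W" "f = ribbon_map x" by blast
    show "(\<lambda>m. c * f m) \<in> ribbon_map ` W"
      unfolding x(2) ribbon_map_scale[OF x(1), symmetric]
      by (rule imageI[OF zmodule_scale[OF zmodule_W x(1)]])
  qed
  then show "carrier MSym \<subseteq> ribbon_map ` W"
    unfolding carrier_MSym
  proof (rule symmetric_functions_subset)
    show "ribbon_map ` W \<subseteq> symmetric_functions" using ribbon_map_symmetric by blast
    fix m assume "dominant m"
    then obtain l where "m = word_monomial l" using dominant_word by blast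
    then show "\<exists>b\<in>ribbon_map ` W. leading b m"
      using leading_E_word[of l] E_word_W by blast
  qed
qed


section \<open>Compatibility with coproduct and counit\<close>

section \<open>Compatibility with the coproducts\<close>

abbreviation WW :: "(nat set list \<times> nat set list \<Rightarrow> int) set" where
  "WW \<equiv> tensor_square W"

text \<open>The tensor square of \<open>ribbon_map\<close>, as a formula on functions of two
  arguments: apply the map in the second argument, then in the first.\<close>

definition ribbon_map2 :: "(nat set list \<times> nat set list \<Rightarrow> int) \<Rightarrow> monomial \<times> monomial \<Rightarrow> int" where
  "ribbon_map2 t = (\<lambda>(a, b). ribbon_map (\<lambda>w1. ribbon_map (\<lambda>w2. t (w1, w2)) b) a)"

lemma tens_apply: "tens f g (a, b) = f a * g b"
  by (simp add: tens_def)

lemma zmodule_WW: "zmodule WW"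
  unfolding tensor_square_def by (rule zmodule_zspan)

lemma tens_WW: "p \<in> W \<Longrightarrow> q \<in> W \<Longrightarrow> tens p q \<in> WW"
  unfolding tensor_square_def by (rule zspan_base) blast

lemma WW_induct [consumes 1, case_names zero step]:
  assumes "t \<in> WW" "Q (\<lambda>_. 0)"
    and "\<And>p q c a. p \<in> W \<Longrightarrow> q \<in> W \<Longrightarrow> a \<in> WW \<Longrightarrow> Q a \<Longrightarrow> Q (\<lambda>x. c * tens p q x + a x)"
  shows "Q t"
proof -
  have "t \<in> {t \<in> WW. Q t}"
    using assms(1) unfolding tensor_square_def
  proof (rule zspan_minimal, unfold tensor_square_def[symmetric])
    show "(\<lambda>_. 0) \<in> {t \<in> WW. Q t}" using zmodule_zero[OF zmodule_WW] assms(2) by simp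
    fix s a c assume "s \<in> {tens p q | p q. p \<in> W \<and> q \<in> W}" and a: "a \<in> {t \<in> WW. Q t}"
    then obtain p q where s: "s = tens p q" "p \<in> W" "q \<in> W" by blast
    have "(\<lambda>x. c * s x + a x) \<in> WW"
      unfolding s(1) by (intro zmodule_add[OF zmodule_WW] zmodule_scale[OF zmodule_WW] tens_WW s) (use a in simp)
    moreover have "Q (\<lambda>x. c * s x + a x)" unfolding s(1) by (rule assms(3)[OF s(2,3)]) (use a in simp_all)
    ultimately show "(\<lambda>x. c * s x + a x) \<in> {t \<in> WW. Q t}" by simp
  qed
  then show ?thesis by blast
qed

text \<open>\<open>ribbon_map\<close> is known to be linear on \<open>W\<close> only; these
  memberships let linearity be used in each argument separately.\<close>

lemma WW_slices:
  assumes "t \<in> WW"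
  shows "(\<lambda>w2. t (w1, w2)) \<in> W" "(\<lambda>w1. ribbon_map (\<lambda>w2. t (w1, w2)) b) \<in> W"
proof -
  have "(\<forall>w1. (\<lambda>w2. t (w1, w2)) \<in> W) \<and> (\<forall>b. (\<lambda>w1. ribbon_map (\<lambda>w2. t (w1, w2)) b) \<in> W)"
    using assms
  proof (induction rule: WW_induct)
    case zero
    then show ?case using zmodule_zero[OF zmodule_W] by (simp add: ribbon_map_zero)
  next
    case (step p q c a)
    have s1: "(\<lambda>w2. c * tens p q (w1, w2) + a (w1, w2)) = (\<lambda>w2. (c * p w1) * q w2 + a (w1, w2))" for w1
      by (simp add: tens_def mult.assoc)
    have aW: "(\<lambda>w2. a (w1, w2)) \<in> W" for w1 using step.IH by blast
    have cq: "(\<lambda>w2. (c * p w1) * q w2) \<in> W" for w1 by (rule zmodule_scale[OF zmodule_W step.hyps(2)])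
    have s2: "ribbon_map (\<lambda>w2. c * tens p q (w1, w2) + a (w1, w2)) b =
        (c * ribbon_map q b) * p w1 + ribbon_map (\<lambda>w2. a (w1, w2)) b" for w1 b
      unfolding s1 ribbon_map_add[OF cq aW] ribbon_map_scale[OF step.hyps(2)] by simp
    show ?case
    proof (intro conjI allI)
      show "(\<lambda>w2. c * tens p q (w1, w2) + a (w1, w2)) \<in> W" for w1
        unfolding s1 by (rule zmodule_add[OF zmodule_W cq aW])
      have "(\<lambda>w1. ribbon_map (\<lambda>w2. a (w1, w2)) b) \<in> W" for b using step.IH by blast
      then show "(\<lambda>w1. ribbon_map (\<lambda>w2. c * tens p q (w1, w2) + a (w1, w2)) b) \<in> W" for b
        unfolding s2 by (rule zmodule_add[OF zmodule_W zmodule_scale[OF zmodule_W step.hyps(1)]])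
    qed
  qed
  then show "(\<lambda>w2. t (w1, w2)) \<in> W" "(\<lambda>w1. ribbon_map (\<lambda>w2. t (w1, w2)) b) \<in> W" by blast+
qed

lemma ribbon_map2_add:
  assumes "s \<in> WW" "t \<in> WW"
  shows "ribbon_map2 (\<lambda>x. s x + t x) = (\<lambda>x. ribbon_map2 s x + ribbon_map2 t x)"
proof
  fix x :: "monomial \<times> monomial"
  obtain a b where x: "x = (a, b)" by fastforce
  have "ribbon_map (\<lambda>w2. s (w1, w2) + t (w1, w2)) b =
      ribbon_map (\<lambda>w2. s (w1, w2)) b + ribbon_map (\<lambda>w2. t (w1, w2)) b" for w1
    unfolding ribbon_map_add[OF WW_slices(1)[OF assms(1)] WW_slices(1)[OF assms(2)]] ..
  then show "ribbon_map2 (\<lambda>x. s x + t x) x = ribbon_map2 s x + ribbon_map2 t x"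
    unfolding x ribbon_map2_def prod.case
    by (simp add: ribbon_map_add[OF WW_slices(2)[OF assms(1)] WW_slices(2)[OF assms(2)]])
qed

lemma ribbon_map2_scale:
  assumes "t \<in> WW"
  shows "ribbon_map2 (\<lambda>x. c * t x) = (\<lambda>x. c * ribbon_map2 t x)"
proof
  fix x :: "monomial \<times> monomial"
  obtain a b where x: "x = (a, b)" by fastforce
  have "ribbon_map (\<lambda>w2. c * t (w1, w2)) b = c * ribbon_map (\<lambda>w2. t (w1, w2)) b" for w1
    unfolding ribbon_map_scale[OF WW_slices(1)[OF assms]] ..
  then show "ribbon_map2 (\<lambda>x. c * t x) x = c * ribbon_map2 t x"
    unfolding x ribbon_map2_def prod.case by (simp add: ribbon_map_scale[OF WW_slices(2)[OF assms]])
qed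

lemma ribbon_map2_zero: "ribbon_map2 (\<lambda>_. 0) = (\<lambda>_. 0)"
  by (simp add: ribbon_map2_def ribbon_map_zero fun_eq_iff)

lemma ribbon_map2_tens:
  assumes "p \<in> W" "q \<in> W"
  shows "ribbon_map2 (tens p q) = tens (ribbon_map p) (ribbon_map q)"
proof
  fix x :: "monomial \<times> monomial"
  obtain a b where x: "x = (a, b)" by fastforce
  have eq: "ribbon_map (\<lambda>w2. tens p q (w1, w2)) b = ribbon_map q b * p w1" for w1
    unfolding tens_apply ribbon_map_scale[OF assms(2)] by (rule mult.commute)
  show "ribbon_map2 (tens p q) x = tens (ribbon_map p) (ribbon_map q) x"
    unfolding x ribbon_map2_def prod.case eq ribbon_map_scale[OF assms(1)]
    by (simp add: tens_def)
qed

lemma ribbon_map2_sum: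
  assumes "finite I" "\<And>i. i \<in> I \<Longrightarrow> t i \<in> WW"
  shows "ribbon_map2 (\<lambda>x. \<Sum>i\<in>I. t i x) = (\<lambda>x. \<Sum>i\<in>I. ribbon_map2 (t i) x)"
  using assms
proof (induction I)
  case (insert i I)
  have "(\<lambda>x. \<Sum>i\<in>I. t i x) \<in> WW" using insert by (intro zmodule_sum[OF zmodule_WW]) auto
  then show ?case
    using insert ribbon_map2_add[of "t i" "\<lambda>x. \<Sum>i\<in>I. t i x"] by simp
qed (simp add: ribbon_map2_zero)

text \<open>The multiplication of the tensor square of the series ring.\<close>

definition conv2 :: "(monomial \<times> monomial \<Rightarrow> int) \<Rightarrow> (monomial \<times> monomial \<Rightarrow> int) \<Rightarrow> monomial \<times> monomial \<Rightarrow> int" where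
  "conv2 s t = (\<lambda>(a, b). \<Sum>(a1, a2)\<in>monomials.factors a. \<Sum>(b1, b2)\<in>monomials.factors b. s (a1, b1) * t (a2, b2))"

lemma conv2_add_left: "conv2 (\<lambda>x. s x + s' x) t = (\<lambda>x. conv2 s t x + conv2 s' t x)"
  by (auto simp: conv2_def fun_eq_iff case_prod_beta distrib_right sum.distrib)

lemma conv2_scale_left: "conv2 (\<lambda>x. c * s x) t = (\<lambda>x. c * conv2 s t x)"
  by (auto simp: conv2_def fun_eq_iff case_prod_beta sum_distrib_left mult.assoc)

lemma conv2_zero_left: "conv2 (\<lambda>_. 0) t = (\<lambda>_. 0)"
  by (auto simp: conv2_def fun_eq_iff)

lemma conv2_sum_right: "conv2 s (\<lambda>x. \<Sum>i\<in>I. t i x) = (\<lambda>x. \<Sum>i\<in>I. conv2 s (t i) x)"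
proof
  fix x :: "monomial \<times> monomial"
  obtain a b where x: "x = (a, b)" by fastforce
  show "conv2 s (\<lambda>x. \<Sum>i\<in>I. t i x) x = (\<Sum>i\<in>I. conv2 s (t i) x)"
    unfolding x conv2_def prod.case case_prod_beta sum_distrib_left
    by (simp only: sum.swap[of _ I])
qed

lemma conv2_tens: "conv2 (tens p q) (tens f g) = tens (monomials.conv p f) (monomials.conv q g)"
proof
  fix x :: "monomial \<times> monomial"
  obtain a b where x: "x = (a, b)" by fastforce
  show "conv2 (tens p q) (tens f g) x = tens (monomials.conv p f) (monomials.conv q g) x"
    unfolding x conv2_def tens_def prod.case monomials.conv_def sum_product case_prod_beta
    by (intro sum.cong refl) (simp add: ac_simps)
qed

text \<open>Factoring a monomial in the interleaved variables means factoring its x part and its y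
  part independently.\<close>

lemma comult_MSym_conv: "comult MSym (monomials.conv f g) = conv2 (comult MSym f) (comult MSym g)"
proof
  fix x :: "monomial \<times> monomial"
  obtain a b where x: "x = (a, b)" by fastforce
  have "monomials.conv f g (interleave a b) =
      (\<Sum>(p, q)\<in>monomials.factors a \<times> monomials.factors b.
        f (interleave (fst p) (fst q)) * g (interleave (snd p) (snd q)))"
    unfolding monomials.conv_def
  proof (rule sum.reindex_bij_witness[where
        i = "\<lambda>(p, q). (interleave (fst p) (fst q), interleave (snd p) (snd q))" and
        j = "\<lambda>(m, n). ((deinterleave 0 m, deinterleave 0 n), (deinterleave 1 m, deinterleave 1 n))"])
    fix z assume "z \<in> monomials.factors (interleave a b)"
    then obtain m n where z: "z = (m, n)" "m + n = interleave a b" by (auto simp: monomials.factors_def)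
    have "interleave (deinterleave 0 m + deinterleave 0 n) (deinterleave 1 m + deinterleave 1 n) = interleave a b"
      unfolding interleave_add interleave_deinterleave by (rule z(2))
    then show "(case z of (m, n) \<Rightarrow> ((deinterleave 0 m, deinterleave 0 n), (deinterleave 1 m, deinterleave 1 n))) \<in>
        monomials.factors a \<times> monomials.factors b"
      by (simp add: z(1) interleave_inj monomials.factors_def)
    show "(case (case z of (m, n) \<Rightarrow> ((deinterleave 0 m, deinterleave 0 n), (deinterleave 1 m, deinterleave 1 n))) of
        (p, q) \<Rightarrow> (interleave (fst p) (fst q), interleave (snd p) (snd q))) = z"
      by (simp add: z(1) interleave_deinterleave[simplified])
    show "(case (case z of (m, n) \<Rightarrow> ((deinterleave 0 m, deinterleave 0 n), (deinterleave 1 m, deinterleave 1 n))) of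
        (p, q) \<Rightarrow> f (interleave (fst p) (fst q)) * g (interleave (snd p) (snd q))) = (case z of (a, b) \<Rightarrow> f a * g b)"
      by (simp add: z(1) interleave_deinterleave[simplified])
  next
    have de: "deinterleave 0 (interleave c d) = c" "deinterleave 1 (interleave c d) = d" for c d
      using interleave_deinterleave[of "interleave c d"] unfolding interleave_inj by blast+
    fix z assume "z \<in> monomials.factors a \<times> monomials.factors b"
    then obtain a1 a2 b1 b2 where z: "z = ((a1, a2), (b1, b2))" "a1 + a2 = a" "b1 + b2 = b"
      by (auto simp: monomials.factors_def)
    show "(case (case z of (p, q) \<Rightarrow> (interleave (fst p) (fst q), interleave (snd p) (snd q))) of
        (m, n) \<Rightarrow> ((deinterleave 0 m, deinterleave 0 n), (deinterleave 1 m, deinterleave 1 n))) = z"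
      unfolding z(1) prod.case fst_conv snd_conv de ..
    show "(case z of (p, q) \<Rightarrow> (interleave (fst p) (fst q), interleave (snd p) (snd q))) \<in> monomials.factors (interleave a b)"
      by (simp add: z monomials.factors_def flip: interleave_add)
  qed
  then show "comult MSym (monomials.conv f g) x = conv2 (comult MSym f) (comult MSym g) x"
    by (simp add: x conv2_def sum.cartesian_product case_prod_beta)
qed

text \<open>The element \<open>t'\<close> is the product of \<open>t\<close> with f \<otimes> g in
  the tensor square of \<open>W\<close>, described by its values on pairs of words. It lies in
  \<open>WW\<close>, and \<open>ribbon_map2\<close> carries the product to the product of
  images.\<close>

lemma tensor_mult_exists:
  assumes f: "f \<in> W" and g: "g \<in> W" and t: "t \<in> WW"
  shows "\<exists>t'\<in>WW. (\<forall>u v. distinct_adj u \<longrightarrow> distinct_adj v \<longrightarrow> t' (word_perm u, word_perm v) =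
      (\<Sum>(u1, u2)\<in>words.factors u. \<Sum>(v1, v2)\<in>words.factors v.
        t (word_perm u1, word_perm v1) * (f (word_perm u2) * g (word_perm v2)))) \<and>
    ribbon_map2 t' = conv2 (ribbon_map2 t) (tens (ribbon_map f) (ribbon_map g))"
  using t
proof (induction rule: WW_induct)
  case zero
  show ?case
    by (rule bexI[OF _ zmodule_zero[OF zmodule_WW]])
      (simp add: case_prod_beta ribbon_map2_zero conv2_zero_left)
next
  case (step p q c a)
  then obtain a' where a': "a' \<in> WW"
    "\<And>u v. distinct_adj u \<Longrightarrow> distinct_adj v \<Longrightarrow> a' (word_perm u, word_perm v) =
      (\<Sum>(u1, u2)\<in>words.factors u. \<Sum>(v1, v2)\<in>words.factors v.
        a (word_perm u1, word_perm v1) * (f (word_perm u2) * g (word_perm v2)))"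
    "ribbon_map2 a' = conv2 (ribbon_map2 a) (tens (ribbon_map f) (ribbon_map g))" by blast
  note pf = mult_W[OF step.hyps(1) f] and qg = mult_W[OF step.hyps(2) g]
  note T = tens_WW[OF pf qg] and T' = tens_WW[OF step.hyps(1,2)]
  let ?t = "\<lambda>x. c * tens (p \<star> f) (q \<star> g) x + a' x"
  show ?case
  proof (intro bexI[of _ ?t] conjI allI impI)
    show "?t \<in> WW" by (intro zmodule_add[OF zmodule_WW] zmodule_scale[OF zmodule_WW] T a'(1))
    fix u v :: "nat list" assume uv: "distinct_adj u" "distinct_adj v"
    have "tens (p \<star> f) (q \<star> g) (word_perm u, word_perm v) =
      (\<Sum>(u1, u2)\<in>words.factors u. \<Sum>(v1, v2)\<in>words.factors v.
        tens p q (word_perm u1, word_perm v1) * (f (word_perm u2) * g (word_perm v2)))"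
      unfolding tens_apply
        MMR_mult_word_perm[OF W_finsupp[OF step.hyps(1)] W_finsupp[OF f] uv(1)]
        MMR_mult_word_perm[OF W_finsupp[OF step.hyps(2)] W_finsupp[OF g] uv(2)]
        words.conv_def sum_product case_prod_beta
      by (intro sum.cong refl) (simp add: ac_simps)
    then show "?t (word_perm u, word_perm v) =
      (\<Sum>(u1, u2)\<in>words.factors u. \<Sum>(v1, v2)\<in>words.factors v.
        (c * tens p q (word_perm u1, word_perm v1) + a (word_perm u1, word_perm v1)) *
        (f (word_perm u2) * g (word_perm v2)))"
      by (simp add: a'(2)[OF uv] case_prod_beta distrib_right sum.distrib sum_distrib_left mult.assoc)
  next
    show "ribbon_map2 ?t = conv2 (ribbon_map2 (\<lambda>x. c * tens p q x + a x)) (tens (ribbon_map f) (ribbon_map g))"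
      unfolding ribbon_map2_add[OF zmodule_scale[OF zmodule_WW T] a'(1)] ribbon_map2_scale[OF T]
        ribbon_map2_tens[OF pf qg] a'(3)
        ribbon_map2_add[OF zmodule_scale[OF zmodule_WW T'] step.hyps(3)] ribbon_map2_scale[OF T']
        ribbon_map2_tens[OF step.hyps(1,2)] conv2_add_left conv2_scale_left conv2_tens
        ribbon_map_mult[OF step.hyps(1) f] ribbon_map_mult[OF step.hyps(2) g] ..
  qed
qed

lemma WW_outside:
  assumes "t \<in> WW" "p \<notin> all_M_perms \<or> q \<notin> all_M_perms"
  shows "t (p, q) = 0"
  using assms(1)
proof (induction rule: WW_induct)
  case (step x y c a)
  then show ?case using assms(2) W_outside[of x p] W_outside[of y q] by (auto simp: tens_def)
qed simp

lemma comult_MMR_superset: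
  assumes "finite A" "{w. f w \<noteq> 0} \<subseteq> A"
  shows "comult MMR f (a, b) = (\<Sum>w\<in>A. f w * int (card {(u, v). u @ v = w \<and> st u = a \<and> st v = b}))"
proof -
  have "comult MMR f (a, b) = (\<Sum>w | f w \<noteq> 0. f w * int (card {(u, v). u @ v = w \<and> st u = a \<and> st v = b}))"
    by (simp add: MMR_def)
  also have "\<dots> = (\<Sum>w\<in>A. f w * int (card {(u, v). u @ v = w \<and> st u = a \<and> st v = b}))"
    by (rule sum.mono_neutral_left[OF assms]) auto
  finally show ?thesis .
qed

lemma comult_add:
  assumes "finsupp f" "finsupp g"
  shows "comult MMR (\<lambda>v. f v + g v) = (\<lambda>x. comult MMR f x + comult MMR g x)"
proof
  fix x :: "nat set list \<times> nat set list"
  obtain a b where x: "x = (a, b)" by fastforce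
  let ?A = "{w. f w \<noteq> 0} \<union> {w. g w \<noteq> 0}"
  have fin: "finite ?A" using assms by (simp add: finsupp_def)
  show "comult MMR (\<lambda>v. f v + g v) x = comult MMR f x + comult MMR g x"
    unfolding x
    by (subst (1 2 3) comult_MMR_superset[OF fin]) (auto simp: distrib_right sum.distrib)
qed

lemma comult_scale:
  assumes "finsupp f"
  shows "comult MMR (\<lambda>v. c * f v) = (\<lambda>x. c * comult MMR f x)"
proof
  fix x :: "nat set list \<times> nat set list"
  obtain a b where x: "x = (a, b)" by fastforce
  let ?A = "{w. f w \<noteq> 0}"
  have fin: "finite ?A" using assms by (simp add: finsupp_def)
  show "comult MMR (\<lambda>v. c * f v) x = c * comult MMR f x"
    unfolding x
    by (subst (1 2) comult_MMR_superset[OF fin]) (auto simp: sum_distrib_left mult.assoc)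
qed

lemma F_gen_0: "F_gen 0 = basis_elem []"
proof (rule MMR_space_eqI)
  fix c :: "nat list" assume "distinct_adj c"
  then show "F_gen 0 (word_perm c) = basis_elem [] (word_perm c)"
    by (auto simp: F_gen_word_perm basis_elem_Nil_word_perm)
qed (use MMR_spaceD(2)[OF F_gen_MMR_space] W_outside[OF one_W] in auto)

lemma F_gen_W': "F_gen k \<in> W"
  using F_gen_W[of k] F_gen_0 one_W by (cases "k = 0") auto

lemma ribbon_map_F_gen_eq: "ribbon_map (F_gen k) m = (if monomial_degree m = k then 1 else 0)"
proof (cases "k = 0")
  case True
  then show ?thesis unfolding True F_gen_0 ribbon_map_one by (simp add: basis_elem_def)
next
  case False
  then show ?thesis by (simp add: ribbon_map_F_gen dual_g_row)
qed

text \<open>Coefficients of h_k depend only on the degree, and degrees add up under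
  interleaving.\<close>

lemma comult_MSym_F_gen:
  "comult MSym (ribbon_map (F_gen k)) = (\<lambda>x. \<Sum>i\<le>k. tens (ribbon_map (F_gen i)) (ribbon_map (F_gen (k - i))) x)"
proof
  fix x :: "monomial \<times> monomial"
  obtain a b where x: "x = (a, b)" by fastforce
  have "(\<Sum>i\<le>k. tens (ribbon_map (F_gen i)) (ribbon_map (F_gen (k - i))) x) =
      (\<Sum>i\<le>k. if i = monomial_degree a then (if monomial_degree a + monomial_degree b = k then 1 else 0) else 0)"
    unfolding x tens_def prod.case ribbon_map_F_gen_eq by (rule sum.cong[OF refl]) auto
  then show "comult MSym (ribbon_map (F_gen k)) x = (\<Sum>i\<le>k. tens (ribbon_map (F_gen i)) (ribbon_map (F_gen (k - i))) x)"
    by (simp add: x ribbon_map_F_gen_eq monomial_degree_interleave)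
qed

text \<open>Shifting the letters of the second word by the number of blocks of the first puts the
  two words on the separated alphabets required by \<open>comult_word_perm\<close>.\<close>

lemma M_perm_pair_words:
  assumes "p \<in> all_M_perms" "q \<in> all_M_perms"
  obtains u v k where "distinct_adj u" "set u \<subseteq> {..<k}" "distinct_adj v" "set v \<subseteq> {k..}"
    "word_perm u = p" "word_perm v = q"
proof -
  obtain u where u: "distinct_adj u" "set u = {..<length p}" "word_perm u = p"
    using all_M_perms_word[OF assms(1)] by blast
  obtain v where v: "distinct_adj v" "word_perm v = q"
    using all_M_perms_word[OF assms(2)] by blast
  let ?v = "map (\<lambda>i. i + length p) v"
  have "word_perm ?v = q" using word_perm_relabel[of v "\<lambda>i. i + length p"] v(2) by (simp add: strict_mono_on_def)
  moreover have "distinct_adj ?v" by (rule distinct_adj_mapI[OF v(1)]) (simp add: inj_on_def)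
  moreover have "set ?v \<subseteq> {length p..}" by auto
  ultimately show ?thesis using that[of u "length p" ?v] u by simp
qed

text \<open>Both coproducts are multiplicative and match on F_k, so the claim propagates along
  products of the F_k. The membership in \<open>WW\<close> is carried through the same induction,
  because linearity of \<open>ribbon_map2\<close> depends on it.\<close>

lemma comult_compatible:
  assumes "x \<in> W"
  shows "comult MMR x \<in> WW \<and> comult MSym (ribbon_map x) = ribbon_map2 (comult MMR x)"
  using assms
proof (induction rule: W_induct_F)
  case zero
  have c0: "comult MMR (\<lambda>_. 0) = (\<lambda>_. 0)" by (simp add: MMR_def fun_eq_iff)
  have "comult MSym (\<lambda>_. 0) = (\<lambda>_. 0)" by (simp add: MSym_def fun_eq_iff)
  then show ?case
    unfolding c0 ribbon_map_zero ribbon_map2_zero using zmodule_zero[OF zmodule_WW] by blast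
next
  case (add x y)
  have "comult MSym (\<lambda>m. f m + g m) = (\<lambda>z. comult MSym f z + comult MSym g z)" for f g
    by (auto simp: MSym_def fun_eq_iff)
  then show ?case
    unfolding comult_add[OF W_finsupp[OF add.hyps(1)] W_finsupp[OF add.hyps(2)]] ribbon_map_add[OF add.hyps]
    using add.IH by (simp add: ribbon_map2_add zmodule_add[OF zmodule_WW])
next
  case (scale x c)
  have "comult MSym (\<lambda>m. c * f m) = (\<lambda>z. c * comult MSym f z)" for f
    by (auto simp: MSym_def fun_eq_iff)
  then show ?case
    unfolding comult_scale[OF W_finsupp[OF scale.hyps]] ribbon_map_scale[OF scale.hyps]
    using scale.IH by (simp add: ribbon_map2_scale zmodule_scale[OF zmodule_WW])
next
  case one
  \<comment> \<open>The unit is treated as F_0, so that the formula for the coproduct of F_k covers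
    it.\<close>
  have T: "tens (F_gen 0) (F_gen 0) \<in> WW" by (rule tens_WW[OF F_gen_W' F_gen_W'])
  have "comult MMR (F_gen 0) = tens (F_gen 0) (F_gen 0)"
  proof
    fix z :: "nat set list \<times> nat set list"
    obtain p q where z: "z = (p, q)" by fastforce
    show "comult MMR (F_gen 0) z = tens (F_gen 0) (F_gen 0) z"
    proof (cases "p \<in> all_M_perms \<and> q \<in> all_M_perms")
      case True
      obtain u v k where uv: "distinct_adj u" "set u \<subseteq> {..<k}" "distinct_adj v" "set v \<subseteq> {k..}"
        "word_perm u = p" "word_perm v = q"
        by (rule M_perm_pair_words[OF True[THEN conjunct1] True[THEN conjunct2]])
      show ?thesis
        using comult_F_gen_word_perm[OF uv(1-4), of 0] uv(5,6) by (simp add: z tens_def)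
    next
      case False
      then show ?thesis
        unfolding z using comult_outside[OF F_gen_MMR_space, of p q 0] WW_outside[OF T, of p q] by auto
    qed
  qed
  moreover have "comult MSym (ribbon_map (F_gen 0)) = tens (ribbon_map (F_gen 0)) (ribbon_map (F_gen 0))"
    unfolding comult_MSym_F_gen by simp
  ultimately show ?case
    using T ribbon_map2_tens[OF F_gen_W' F_gen_W', of 0 0] by (simp add: F_gen_0)
next
  case (mult x k)
  let ?t = "comult MMR x"
  note xW = mult.hyps(1)
  have "\<forall>i. \<exists>t'. t' \<in> WW \<and> (\<forall>u v. distinct_adj u \<longrightarrow> distinct_adj v \<longrightarrow> t' (word_perm u, word_perm v) =
      (\<Sum>(u1, u2)\<in>words.factors u. \<Sum>(v1, v2)\<in>words.factors v.
        ?t (word_perm u1, word_perm v1) * (F_gen i (word_perm u2) * F_gen (k - i) (word_perm v2)))) \<and>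
    ribbon_map2 t' = conv2 (ribbon_map2 ?t) (tens (ribbon_map (F_gen i)) (ribbon_map (F_gen (k - i))))"
    using tensor_mult_exists[OF F_gen_W' F_gen_W', of ?t] mult.IH by blast
  then obtain T where T: "\<And>i. T i \<in> WW"
    "\<And>i u v. distinct_adj u \<Longrightarrow> distinct_adj v \<Longrightarrow> T i (word_perm u, word_perm v) =
      (\<Sum>(u1, u2)\<in>words.factors u. \<Sum>(v1, v2)\<in>words.factors v.
        ?t (word_perm u1, word_perm v1) * (F_gen i (word_perm u2) * F_gen (k - i) (word_perm v2)))"
    "\<And>i. ribbon_map2 (T i) = conv2 (ribbon_map2 ?t) (tens (ribbon_map (F_gen i)) (ribbon_map (F_gen (k - i))))"
    by metis
  have TW: "(\<lambda>z. \<Sum>i\<le>k. T i z) \<in> WW" by (rule zmodule_sum[OF zmodule_WW]) (simp_all add: T(1))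
  have prodW: "x \<star> F_gen k \<in> W" by (rule mult_W[OF xW F_gen_W'])
  have eq: "comult MMR (x \<star> F_gen k) = (\<lambda>z. \<Sum>i\<le>k. T i z)"
  proof
    fix z :: "nat set list \<times> nat set list"
    obtain p q where z: "z = (p, q)" by fastforce
    show "comult MMR (x \<star> F_gen k) z = (\<Sum>i\<le>k. T i z)"
    proof (cases "p \<in> all_M_perms \<and> q \<in> all_M_perms")
      case True
      obtain u v K where uv: "distinct_adj u" "set u \<subseteq> {..<K}" "distinct_adj v" "set v \<subseteq> {K..}"
        "word_perm u = p" "word_perm v = q"
        by (rule M_perm_pair_words[OF True[THEN conjunct1] True[THEN conjunct2]])
      have "comult MMR (x \<star> F_gen k) (word_perm u, word_perm v) =
         (\<Sum>(u1, u2)\<in>words.factors u. \<Sum>(v1, v2)\<in>words.factors v.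
           ?t (word_perm u1, word_perm v1) * comult MMR (F_gen k) (word_perm u2, word_perm v2))"
        by (rule comult_mult_word_perm[OF W_MMR_space[OF xW] F_gen_MMR_space W_MMR_space[OF prodW] uv(1-4)])
      also have "\<dots> = (\<Sum>(u1, u2)\<in>words.factors u. \<Sum>(v1, v2)\<in>words.factors v. \<Sum>i\<le>k.
           ?t (word_perm u1, word_perm v1) * (F_gen i (word_perm u2) * F_gen (k - i) (word_perm v2)))"
      proof (intro sum.cong refl, clarify, intro sum.cong refl, clarify)
        fix u1 u2 v1 v2 assume "(u1, u2) \<in> words.factors u" "(v1, v2) \<in> words.factors v"
        then have "distinct_adj u2" "distinct_adj v2" "set u2 \<subseteq> {..<K}" "set v2 \<subseteq> {K..}"
          using word_factors_sets uv(2,4) by blast+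
        then show "?t (word_perm u1, word_perm v1) * comult MMR (F_gen k) (word_perm u2, word_perm v2) =
           (\<Sum>i\<le>k. ?t (word_perm u1, word_perm v1) * (F_gen i (word_perm u2) * F_gen (k - i) (word_perm v2)))"
          by (simp only: comult_F_gen_word_perm sum_distrib_left)
      qed
      also have "\<dots> = (\<Sum>i\<le>k. T i (word_perm u, word_perm v))"
        unfolding T(2)[OF uv(1,3)] case_prod_beta by (simp only: sum.swap[of _ "{..k}"])
      finally show ?thesis by (simp add: z uv)
    next
      case False
      then show ?thesis
        unfolding z using comult_outside[OF W_MMR_space[OF prodW], of p q] WW_outside[OF TW, of p q] by auto
    qed
  qed
  have "comult MSym (ribbon_map (x \<star> F_gen k)) =
      conv2 (comult MSym (ribbon_map x)) (comult MSym (ribbon_map (F_gen k)))"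
    unfolding ribbon_map_mult[OF xW F_gen_W'] by (rule comult_MSym_conv)
  also have "\<dots> = (\<lambda>z. \<Sum>i\<le>k. ribbon_map2 (T i) z)"
    unfolding comult_MSym_F_gen conv2_sum_right T(3) using mult.IH by simp
  also have "\<dots> = ribbon_map2 (\<lambda>z. \<Sum>i\<le>k. T i z)"
    by (rule ribbon_map2_sum[symmetric]) (simp_all add: T(1))
  finally show ?case unfolding eq using TW by simp
qed

text \<open>For k > 0, multiples of F_k have no coefficient at the empty word, and multiples of h_k
  have no constant term.\<close>

lemma counit_ribbon_map:
  assumes "x \<in> W"
  shows "ribbon_map x 0 = x []"
  using assms
proof (induction rule: W_induct_F)
  case (mult x k)
  have "(x \<star> F_gen k) (word_perm []) = 0"
  proof -
    have d: "distinct_adj ([] :: nat list)" by simp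
    have f: "z = ([], [])" if "z \<in> words.factors []" for z
      using that word_factors_iff[OF d, of "fst z" "snd z"] by (cases z) simp
    have "F_gen k (word_perm []) = 0" using F_gen_word_perm[OF d, of k] mult.hyps(2) by simp
    then show ?thesis
      unfolding MMR_mult_word_perm[OF W_finsupp[OF mult.hyps(1)] W_finsupp[OF F_gen_W'] d] words.conv_def
      by (intro sum.neutral ballI) (drule f, simp)
  qed
  moreover have "monomials.conv (ribbon_map x) (dual_g (diagram [k])) 0 = 0"
  proof (rule ccontr)
    assume "monomials.conv (ribbon_map x) (dual_g (diagram [k])) 0 \<noteq> 0"
    then obtain a b where "a + b = 0" "dual_g (diagram [k]) b \<noteq> 0" by (rule conv_nonzero)
    moreover have "monomial_degree b \<le> monomial_degree (a + b)" by simp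
    ultimately show False using mult.hyps(2) by (simp add: dual_g_row split: if_splits)
  qed
  ultimately show ?case using mult.hyps by (simp add: ribbon_map_mult_F_gen)
next
  case (add x y)
  then show ?case by (simp add: ribbon_map_add)
next
  case (scale x c)
  then show ?case by (simp add: ribbon_map_scale)
next
  case one
  show ?case unfolding ribbon_map_one by (simp add: basis_elem_def)
qed (simp add: ribbon_map_zero)

lemma coalgebra_hom_ribbon_map: "coalgebra_hom MNSym MSym ribbon_map"
  unfolding coalgebra_hom_def
proof (intro conjI exI[of _ ribbon_map2] ballI)
  show "is_tensor_map W ribbon_map ribbon_map2"
    unfolding is_tensor_map_def by (simp add: ribbon_map2_add ribbon_map2_tens)
qed (simp_all add: comult_compatible counit_ribbon_map)

section \<open>The kernel is the commutator ideal; conclusion\<close>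

section \<open>The kernel\<close>

lemma commutators_subset:
  "{x \<otimes>\<^bsub>MNSym\<^esub> y \<ominus>\<^bsub>MNSym\<^esub> y \<otimes>\<^bsub>MNSym\<^esub> x | x y. x \<in> carrier MNSym \<and> y \<in> carrier MNSym} \<subseteq> carrier MNSym"
proof -
  interpret ring MNSym by (rule ring_MNSym)
  show ?thesis by (blast intro: minus_closed m_closed)
qed

lemma commutator_ideal_ideal: "ideal (commutator_ideal MNSym) MNSym"
proof -
  interpret ring MNSym by (rule ring_MNSym)
  show ?thesis unfolding commutator_ideal_def by (rule genideal_ideal[OF commutators_subset])
qed

lemma commutator_ideal_subset: "commutator_ideal MNSym \<subseteq> W"
  using ideal.Icarr[OF commutator_ideal_ideal] by blast

lemma commutator_mem:
  assumes "x \<in> W" "y \<in> W"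
  shows "(\<lambda>v. (x \<star> y) v - (y \<star> x) v) \<in> commutator_ideal MNSym"
proof -
  interpret ring MNSym by (rule ring_MNSym)
  let ?S = "{x \<otimes>\<^bsub>MNSym\<^esub> y \<ominus>\<^bsub>MNSym\<^esub> y \<otimes>\<^bsub>MNSym\<^esub> x | x y. x \<in> W \<and> y \<in> W}"
  have "x \<otimes>\<^bsub>MNSym\<^esub> y \<ominus>\<^bsub>MNSym\<^esub> y \<otimes>\<^bsub>MNSym\<^esub> x \<in> ?S" using assms by blast
  moreover have "?S \<subseteq> commutator_ideal MNSym"
    unfolding commutator_ideal_def by (rule genideal_self[OF commutators_subset])
  moreover have "x \<otimes>\<^bsub>MNSym\<^esub> y \<ominus>\<^bsub>MNSym\<^esub> y \<otimes>\<^bsub>MNSym\<^esub> x = (\<lambda>v. (x \<star> y) v - (y \<star> x) v)"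
    using pointwise_minus[OF zmodule_W, of "x \<star> y" "y \<star> x"] mult_W[OF assms] mult_W[OF assms(2,1)] by simp
  ultimately show ?thesis by auto
qed

lemma commutator_ideal_mult:
  assumes "x \<in> commutator_ideal MNSym" "y \<in> W"
  shows "y \<star> x \<in> commutator_ideal MNSym" "x \<star> y \<in> commutator_ideal MNSym"
  using ideal.I_l_closed[OF commutator_ideal_ideal assms] ideal.I_r_closed[OF commutator_ideal_ideal assms] by simp_all

lemma zmodule_commutator_ideal: "zmodule (commutator_ideal MNSym)"
  unfolding zmodule_def
proof (intro conjI ballI allI)
  interpret ideal "commutator_ideal MNSym" MNSym by (rule commutator_ideal_ideal)
  show "(\<lambda>_. 0) \<in> commutator_ideal MNSym"
    using additive_subgroup.zero_closed[OF is_additive_subgroup] by simp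
  show "(\<lambda>v. f v + g v) \<in> commutator_ideal MNSym"
    if "f \<in> commutator_ideal MNSym" "g \<in> commutator_ideal MNSym" for f g
    using additive_subgroup.a_closed[OF is_additive_subgroup that] by simp
  show "(\<lambda>v. c * f v) \<in> commutator_ideal MNSym" if f: "f \<in> commutator_ideal MNSym" for f c
  proof -
    have fW: "f \<in> W" using f commutator_ideal_subset by blast
    \<comment> \<open>Multiplication by the integer \<open>c\<close> is multiplication by
      \<open>c\<close> times the unit, which the ideal absorbs.\<close>
    have "(\<lambda>v. c * basis_elem [] v) \<star> f \<in> commutator_ideal MNSym"
      by (rule commutator_ideal_mult(1)[OF f zmodule_scale[OF zmodule_W one_W]])
    then show ?thesis by (simp add: mult_scale_left[OF one_W fW] mult_one(2)[OF fW])
  qed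
qed

lemma mult_diff_right:
  assumes "x \<in> W" "y \<in> W" "z \<in> W"
  shows "z \<star> (\<lambda>v. x v - y v) = (\<lambda>v. (z \<star> x) v - (z \<star> y) v)"
  using mult_add_right[OF assms(1) zmodule_scale[OF zmodule_W assms(2), of "-1"] assms(3)]
    mult_scale_right[OF assms(2,3), of "-1"] by simp

lemma mult_diff_left:
  assumes "x \<in> W" "y \<in> W" "z \<in> W"
  shows "(\<lambda>v. x v - y v) \<star> z = (\<lambda>v. (x \<star> z) v - (y \<star> z) v)"
  using mult_add_left[OF assms(1) zmodule_scale[OF zmodule_W assms(2), of "-1"] assms(3)]
    mult_scale_left[OF assms(2,3), of "-1"] by simp

text \<open>Modulo commutators a factor E_n moves from the right end to its sorted place: it jumps
  in one commutator over the letters that are at least \<open>n\<close>, and the smaller letters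
  before them are left factors, absorbed by the ideal.\<close>

lemma E_word_insort:
  "(\<lambda>v. E_word (insort n l) v - (E_word l \<star> E_gen n) v) \<in> commutator_ideal MNSym"
proof (induction l)
  case Nil
  then show ?case
    using zmodule_zero[OF zmodule_commutator_ideal] by (simp add: mult_one E_gen_W)
next
  case (Cons a l)
  show ?case
  proof (cases "n \<le> a")
    case True
    then show ?thesis using commutator_mem[OF E_gen_W E_word_W, of n "a # l"] by simp
  next
    case False
    have "E_gen a \<star> (\<lambda>v. E_word (insort n l) v - (E_word l \<star> E_gen n) v) \<in> commutator_ideal MNSym"
      by (rule commutator_ideal_mult(1)[OF Cons E_gen_W])
    then show ?thesis
      using False by (simp add: mult_diff_right E_word_W E_gen_W mult_W W_mult_assoc)
  qed
qed

abbreviation sorted_E_words :: "(nat set list \<Rightarrow> int) set" where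
  "sorted_E_words \<equiv> {E_word l | l. sorted l \<and> 0 \<notin> set l}"

lemma zspan_sorted_E_words: "f \<in> zspan sorted_E_words \<Longrightarrow> f \<in> W"
  using zspan_subset[OF zmodule_W, of sorted_E_words] E_word_W by blast

lemma sorted_E_words_mult:
  assumes "f \<in> zspan sorted_E_words" "0 < n"
  shows "\<exists>f'\<in>zspan sorted_E_words. (\<lambda>v. (f \<star> E_gen n) v - f' v) \<in> commutator_ideal MNSym"
proof -
  let ?I = "commutator_ideal MNSym" and ?Z = "zspan sorted_E_words"
  have "f \<in> {f \<in> ?Z. \<exists>f'\<in>?Z. (\<lambda>v. (f \<star> E_gen n) v - f' v) \<in> ?I}"
    using assms(1)
  proof (rule zspan_minimal)
    have "(\<lambda>_. 0) \<star> E_gen n = (\<lambda>_. 0)" using mult_scale_left[OF one_W E_gen_W, of 0 n] by simp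
    then show "(\<lambda>_. 0) \<in> {f \<in> ?Z. \<exists>f'\<in>?Z. (\<lambda>v. (f \<star> E_gen n) v - f' v) \<in> ?I}"
      using zmodule_zero[OF zmodule_commutator_ideal] zspan_zero[of sorted_E_words]
      by (auto intro!: bexI[of _ "\<lambda>_. 0"])
  next
    fix s a c assume "s \<in> sorted_E_words" and a: "a \<in> {f \<in> ?Z. \<exists>f'\<in>?Z. (\<lambda>v. (f \<star> E_gen n) v - f' v) \<in> ?I}"
    then obtain l where l: "s = E_word l" "sorted l" "0 \<notin> set l" by blast
    have sZ: "s \<in> ?Z" by (rule zspan_base) (use l in blast)
    obtain a' where a': "a \<in> ?Z" "a' \<in> ?Z" "(\<lambda>v. (a \<star> E_gen n) v - a' v) \<in> ?I" using a by blast
    have i: "E_word (insort n l) \<in> ?Z"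
      by (rule zspan_base) (use l assms(2) in \<open>auto simp: sorted_insort set_insort_key\<close>)
    note sW = zspan_sorted_E_words[OF sZ] and aW = zspan_sorted_E_words[OF a'(1)]
    have "(\<lambda>v. (-c) * (E_word (insort n l) v - (E_word l \<star> E_gen n) v) + ((a \<star> E_gen n) v - a' v)) \<in> ?I"
      by (intro zmodule_add[OF zmodule_commutator_ideal] zmodule_scale[OF zmodule_commutator_ideal] E_word_insort a'(3))
    moreover have "(\<lambda>x. c * s x + a x) \<star> E_gen n = (\<lambda>v. c * (E_word l \<star> E_gen n) v + (a \<star> E_gen n) v)"
      unfolding mult_add_left[OF zmodule_scale[OF zmodule_W sW] aW E_gen_W] mult_scale_left[OF sW E_gen_W]
      unfolding l(1) by (rule refl)
    ultimately have "(\<lambda>v. ((\<lambda>x. c * s x + a x) \<star> E_gen n) v - (c * E_word (insort n l) v + a' v)) \<in> ?I"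
      by (simp add: algebra_simps)
    moreover have "(\<lambda>v. c * E_word (insort n l) v + a' v) \<in> ?Z" "(\<lambda>x. c * s x + a x) \<in> ?Z"
      by (intro zmodule_add[OF zmodule_zspan] zmodule_scale[OF zmodule_zspan] i a' sZ)+
    ultimately show "(\<lambda>x. c * s x + a x) \<in> {f \<in> ?Z. \<exists>f'\<in>?Z. (\<lambda>v. (f \<star> E_gen n) v - f' v) \<in> ?I}"
      by (intro CollectI conjI bexI[of _ "\<lambda>v. c * E_word (insort n l) v + a' v"])
  qed
  then show ?thesis by blast
qed

text \<open>The E_n generate, and every product of them can be sorted modulo commutators.\<close>

lemma sorted_E_words_generate:
  assumes "x \<in> W"
  shows "\<exists>f\<in>zspan sorted_E_words. (\<lambda>v. x v - f v) \<in> commutator_ideal MNSym"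
  using assms
proof (induction rule: W_induct_E)
  case zero
  show ?case
    by (rule bexI[OF _ zspan_zero]) (simp add: zmodule_zero[OF zmodule_commutator_ideal])
next
  case (add x y)
  then obtain f g where fg: "f \<in> zspan sorted_E_words" "(\<lambda>v. x v - f v) \<in> commutator_ideal MNSym"
    "g \<in> zspan sorted_E_words" "(\<lambda>v. y v - g v) \<in> commutator_ideal MNSym" by blast
  have "(\<lambda>v. (x v - f v) + (y v - g v)) \<in> commutator_ideal MNSym"
    by (rule zmodule_add[OF zmodule_commutator_ideal fg(2,4)])
  then show ?case
    by (intro bexI[OF _ zspan_add[OF fg(1,3)]]) (simp add: algebra_simps)
next
  case (scale x c)
  then obtain f where f: "f \<in> zspan sorted_E_words" "(\<lambda>v. x v - f v) \<in> commutator_ideal MNSym" by blast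
  have "(\<lambda>v. c * (x v - f v)) \<in> commutator_ideal MNSym"
    by (rule zmodule_scale[OF zmodule_commutator_ideal f(2)])
  then show ?case
    by (intro bexI[OF _ zspan_mult[OF f(1), of c]]) (simp add: algebra_simps)
next
  case one
  have "E_word [] \<in> zspan sorted_E_words" by (rule zspan_base) (auto intro!: exI[of _ "[]"])
  then show ?case
    by (intro bexI[of _ "E_word []"]) (simp_all add: zmodule_zero[OF zmodule_commutator_ideal])
next
  case (mult x n)
  then obtain f where f: "f \<in> zspan sorted_E_words" "(\<lambda>v. x v - f v) \<in> commutator_ideal MNSym" by blast
  obtain f' where f': "f' \<in> zspan sorted_E_words" "(\<lambda>v. (f \<star> E_gen n) v - f' v) \<in> commutator_ideal MNSym"
    using sorted_E_words_mult[OF f(1) mult.hyps(2)] by blast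
  have "(\<lambda>v. (x \<star> E_gen n) v - (f \<star> E_gen n) v) \<in> commutator_ideal MNSym"
    using commutator_ideal_mult(2)[OF f(2) E_gen_W, of n]
    by (simp add: mult_diff_left[OF mult.hyps(1) zspan_sorted_E_words[OF f(1)] E_gen_W])
  from zmodule_add[OF zmodule_commutator_ideal this f'(2)] show ?case
    by (intro bexI[OF _ f'(1)]) simp
qed

lemma kernel_iff: "x \<in> a_kernel MNSym MSym ribbon_map \<longleftrightarrow> x \<in> W \<and> ribbon_map x = (\<lambda>_. 0)"
  unfolding a_kernel_def' by simp

text \<open>The target is commutative, so commutators map to zero, and the kernel is an
  ideal.\<close>

lemma commutator_ideal_le_kernel: "commutator_ideal MNSym \<subseteq> a_kernel MNSym MSym ribbon_map"
proof -
  interpret hom: ring_hom_ring MNSym MSym ribbon_map by (rule ring_hom_ribbon_map)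
  interpret K: cring MSym by (rule cring_MSym)
  show ?thesis
    unfolding commutator_ideal_def
  proof (rule hom.R.genideal_minimal[OF hom.kernel_is_ideal], rule subsetI)
    fix z assume "z \<in> {x \<otimes>\<^bsub>MNSym\<^esub> y \<ominus>\<^bsub>MNSym\<^esub> y \<otimes>\<^bsub>MNSym\<^esub> x | x y. x \<in> W \<and> y \<in> W}"
    then obtain x y where z: "z = x \<otimes>\<^bsub>MNSym\<^esub> y \<ominus>\<^bsub>MNSym\<^esub> y \<otimes>\<^bsub>MNSym\<^esub> x" "x \<in> W" "y \<in> W" by blast
    have xy: "x \<star> y \<in> W" "y \<star> x \<in> W" using mult_W z by blast+
    have "z = (\<lambda>v. (x \<star> y) v - (y \<star> x) v)"
      using pointwise_minus[OF zmodule_W, of "x \<star> y" "y \<star> x"] xy by (simp add: z(1))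
    then have "z = (\<lambda>v. (x \<star> y) v + (-1) * (y \<star> x) v)" by simp
    then have "ribbon_map z = (\<lambda>m. ribbon_map (x \<star> y) m + (-1) * ribbon_map (y \<star> x) m)"
      by (simp only: ribbon_map_add[OF xy(1) zmodule_scale[OF zmodule_W xy(2)]] ribbon_map_scale[OF xy(2)])
    also have "\<dots> = (\<lambda>_. 0)"
      unfolding ribbon_map_mult[OF z(2,3)] ribbon_map_mult[OF z(3,2)]
        conv_monomials_commute[of "ribbon_map y"] by simp
    finally have "ribbon_map z = (\<lambda>_. 0)" .
    moreover have "z \<in> W" using z hom.R.m_closed hom.R.minus_closed by blast
    ultimately show "z \<in> a_kernel MNSym MSym ribbon_map" unfolding kernel_iff by blast
  qed
qed

lemma ribbon_map_sum:
  assumes "finite I" "\<And>i. i \<in> I \<Longrightarrow> x i \<in> W"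
  shows "ribbon_map (\<lambda>v. \<Sum>i\<in>I. c i * x i v) = (\<lambda>m. \<Sum>i\<in>I. c i * ribbon_map (x i) m)"
  using assms
proof (induction I)
  case (insert i I)
  have "(\<lambda>v. \<Sum>i\<in>I. c i * x i v) \<in> W"
    using insert by (intro zmodule_sum[OF zmodule_W] zmodule_scale[OF zmodule_W]) auto
  moreover have "(\<lambda>v. c i * x i v) \<in> W" using insert by (intro zmodule_scale[OF zmodule_W]) auto
  ultimately show ?case
    using insert ribbon_map_add[of "\<lambda>v. c i * x i v" "\<lambda>v. \<Sum>i\<in>I. c i * x i v"]
    by (simp add: ribbon_map_scale)
qed (simp add: ribbon_map_zero)

text \<open>An element of the kernel is congruent modulo the commutator ideal to a combination
  \<open>f\<close> of sorted \<open>E_word\<close> products, which then also lies in the kernel. The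
  images of these products have distinct leading monomials (\<open>word_monomial_inj\<close>), so
  all coefficients vanish and \<open>f\<close> is zero.\<close>

lemma kernel_ribbon_map: "a_kernel MNSym MSym ribbon_map = commutator_ideal MNSym"
proof
  show "commutator_ideal MNSym \<subseteq> a_kernel MNSym MSym ribbon_map" by (rule commutator_ideal_le_kernel)
  show "a_kernel MNSym MSym ribbon_map \<subseteq> commutator_ideal MNSym"
  proof
    fix x assume "x \<in> a_kernel MNSym MSym ribbon_map"
    then have x: "x \<in> W" "ribbon_map x = (\<lambda>_. 0)" unfolding kernel_iff by blast+
    obtain f where f: "f \<in> zspan sorted_E_words" "(\<lambda>v. x v - f v) \<in> commutator_ideal MNSym"
      using sorted_E_words_generate[OF x(1)] by blast
    note fW = zspan_sorted_E_words[OF f(1)]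
    have "ribbon_map (\<lambda>v. x v - f v) = (\<lambda>_. 0)"
      using f(2) commutator_ideal_le_kernel kernel_iff by blast
    moreover have "ribbon_map (\<lambda>v. x v + (-1) * f v) = (\<lambda>m. ribbon_map x m + (-1) * ribbon_map f m)"
      by (simp only: ribbon_map_add[OF x(1) zmodule_scale[OF zmodule_W fW]] ribbon_map_scale[OF fW])
    ultimately have f0: "ribbon_map f = (\<lambda>_. 0)" by (simp add: x(2) fun_eq_iff)
    obtain F c where F: "f = (\<lambda>v. \<Sum>s\<in>F. c s * s v)" "finite F" "F \<subseteq> sorted_E_words"
      using f(1) unfolding zspan_def by blast
    have "\<forall>s\<in>F. \<exists>l. s = E_word l \<and> sorted l \<and> 0 \<notin> set l" using F(3) by blast
    then obtain L where L: "\<And>s. s \<in> F \<Longrightarrow> s = E_word (L s) \<and> sorted (L s) \<and> 0 \<notin> set (L s)" by metis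
    let ?J = "{s \<in> F. c s \<noteq> 0}"
    have "?J = {}"
    proof (rule ccontr)
      assume ne: "?J \<noteq> {}"
      have "\<exists>m. (\<Sum>s\<in>?J. c s * ribbon_map s m) \<noteq> 0"
      proof (rule leading_sum_nonzero[where L = "\<lambda>s. word_monomial (L s)"])
        show "inj_on (\<lambda>s. word_monomial (L s)) ?J"
        proof (rule inj_onI)
          fix s t assume st: "s \<in> ?J" "t \<in> ?J" "word_monomial (L s) = word_monomial (L t)"
          then have "L s = L t" using L by (intro word_monomial_inj) auto
          then show "s = t" using L[of s] L[of t] st by simp
        qed
        show "leading (ribbon_map s) (word_monomial (L s))" if "s \<in> ?J" for s
          using leading_E_word[of "L s"] L[of s] that by simp
      qed (use F(2) ne in auto)
      then obtain m where "(\<Sum>s\<in>?J. c s * ribbon_map s m) \<noteq> 0" by blast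
      moreover have "(\<Sum>s\<in>?J. c s * ribbon_map s m) = (\<Sum>s\<in>F. c s * ribbon_map s m)"
        by (rule sum.mono_neutral_left[OF F(2)]) auto
      moreover have "ribbon_map f m = (\<Sum>s\<in>F. c s * ribbon_map s m)"
      proof -
        have "ribbon_map f = (\<lambda>m. \<Sum>s\<in>F. c s * ribbon_map s m)"
          unfolding F(1) by (rule ribbon_map_sum[OF F(2)]) (use L E_word_W in metis)
        then show ?thesis by (rule fun_cong)
      qed
      ultimately show False using f0 by simp
    qed
    then have "f = (\<lambda>_. 0)" unfolding F(1) by (auto simp: fun_eq_iff intro!: sum.neutral)
    with f(2) show "x \<in> commutator_ideal MNSym" by simp
  qed
qed

text \<open>Ring homomorphisms are additive by definition; compatibility with integer multiples
  follows by induction from zero in both directions, as uniqueness in the theorem requires.\<close>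

lemma additive_scale:
  fixes \<psi> :: "('x \<Rightarrow> int) \<Rightarrow> ('y \<Rightarrow> int)" and c :: int
  assumes A: "zmodule A" and add: "\<And>x y. x \<in> A \<Longrightarrow> y \<in> A \<Longrightarrow> \<psi> (\<lambda>v. x v + y v) = (\<lambda>m. \<psi> x m + \<psi> y m)"
    and x: "x \<in> A"
  shows "\<psi> (\<lambda>v. c * x v) = (\<lambda>m. c * \<psi> x m)"
proof -
  note cx = zmodule_scale[OF A x]
  have step: "\<psi> (\<lambda>v. (i + 1) * x v) = (\<lambda>m. \<psi> (\<lambda>v. i * x v) m + \<psi> x m)" for i :: int
    using add[OF cx[of i] x] by (simp add: distrib_right)
  have zero: "\<psi> (\<lambda>v. 0 * x v) = (\<lambda>m. 0 * \<psi> x m)"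
    using step[of 0] by (auto simp: fun_eq_iff)
  show ?thesis
  proof (induction c rule: int_induct[of _ 0])
    case base
    show ?case by (rule zero)
  next
    case (step1 i)
    then show ?case using step[of i] by (simp add: distrib_right)
  next
    case (step2 i)
    then show ?case using step[of "i - 1"] by (auto simp: fun_eq_iff left_diff_distrib)
  qed
qed

theorem theorem9p13:
  shows "(\<forall>k\<ge>1. dual_g (diagram [k]) = dual_g_tilde (diagram [k])) \<and>
    (\<exists>\<phi>. hopf_hom MNSym MSym \<phi> \<and>
         (\<forall>k\<ge>1. \<phi> (F_gen k) = dual_g (diagram [k])) \<and>
         (\<forall>\<psi>. ring_hom_ring MNSym MSym \<psi> \<and> (\<forall>k\<ge>1. \<psi> (F_gen k) = dual_g (diagram [k])) \<longrightarrow>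
              (\<forall>x\<in>carrier MNSym. \<psi> x = \<phi> x)) \<and>
         \<phi> ` carrier MNSym = carrier MSym \<and>
         (\<forall>\<alpha>. is_composition \<alpha> \<longrightarrow> \<phi> (R_tilde \<alpha>) = dual_g_tilde (ribbon \<alpha>)) \<and>
         a_kernel MNSym MSym \<phi> = commutator_ideal MNSym)"
proof (intro conjI exI[of _ ribbon_map] allI impI ballI)
  show "dual_g (diagram [k]) = dual_g_tilde (diagram [k])" if "1 \<le> k" for k
    using that dual_g_tilde_row by simp
  show "hopf_hom MNSym MSym ribbon_map"
    unfolding hopf_hom_def using ring_hom_ribbon_map coalgebra_hom_ribbon_map by blast
  show "ribbon_map (F_gen k) = dual_g (diagram [k])" if "1 \<le> k" for k
    using that ribbon_map_F_gen by simp
  show "\<psi> x = ribbon_map x"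
    if \<psi>: "ring_hom_ring MNSym MSym \<psi> \<and> (\<forall>k\<ge>1. \<psi> (F_gen k) = dual_g (diagram [k]))" and x: "x \<in> W" for \<psi> x
  proof -
    interpret hom: ring_hom_ring MNSym MSym \<psi> using \<psi> by blast
    have hom_plus: "\<psi> (\<lambda>v. x v + y v) = (\<lambda>m. \<psi> x m + \<psi> y m)" if "x \<in> W" "y \<in> W" for x y
      using hom.hom_add[OF that] by simp
    \<comment> \<open>Uniqueness: two homomorphisms that agree on the F_k agree on all of
      \<open>W\<close>, since the F_k generate it.\<close>
    show ?thesis
      using x
    proof (induction rule: W_induct_F)
      case zero
      then show ?case using hom.hom_zero by (simp add: ribbon_map_zero)
    next
      case (add x y)
      then show ?case by (simp add: hom_plus ribbon_map_add)
    next
      case (scale x c)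
      have "\<psi> (\<lambda>v. c * x v) = (\<lambda>m. c * \<psi> x m)"
        by (rule additive_scale[where A = W and \<psi> = \<psi>, OF zmodule_W _ scale.hyps]) (rule hom_plus)
      then show ?case using scale by (simp add: ribbon_map_scale)
    next
      case one
      then show ?case using hom.hom_one by (simp add: ribbon_map_one)
    next
      case (mult x k)
      then show ?case
        using hom.hom_mult[OF mult.hyps(1) F_gen_W[OF mult.hyps(2)]] \<psi>
        by (simp add: mult_MSym ribbon_map_mult_F_gen)
    qed
  qed
  show "ribbon_map ` W = carrier MSym" by (rule ribbon_map_surj)
  show "ribbon_map (R_tilde \<alpha>) = dual_g_tilde (ribbon \<alpha>)" if "is_composition \<alpha>" for \<alpha>
    by (rule ribbon_map_R_tilde[OF that])
  show "a_kernel MNSym MSym ribbon_map = commutator_ideal MNSym" by (rule kernel_ribbon_map)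
qed

end
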